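(* Let $n\in\mathbb Z$. Let $\mathrm{GC}_{2n+1}$ be the graph complex of connected at least trivalent graphs, let $\mathrm{GC}^{\mathrm{nm}}_{2n+1}\subset \mathrm{GC}_{2n+1}$ be the subcomplex spanned by graphs without multiple edges, and let $\Theta\in \mathrm{GC}_{2n+1}$ be the graph with two vertices joined by three edges (all as defined in the context). Then the inclusion $\mathbb K\Theta\oplus \mathrm{GC}^{\mathrm{nm}}_{2n+1}\to \mathrm{GC}_{2n+1}$ is a quasi-isomorphism of complexes.
   Context: Work over a field $\mathbb K$ of characteristic $0$. Graph spaces. For $v\ge 1,e\ge 0$ consider all maps $g=(g_1,g_2)\colon E\to V\times V$, where $V=\{1,\dots,v\}$ (vertices) and $E=\{1,\dots,e\}$ (edges; edge $a$ is directed from $g_1(a)$ to $g_2(a)$). The valence of a vertex $x$ is the number of pairs $(a,j)\in E\times\{1,2\}$ with $g_j(a)=x$. Let $V_{v,e}$ be the vector space spanned by all such graphs that have all valences $\ge 3$. Let $V^{odd}_{v,e}$ be the quotient of $V_{v,e}$ obtained by identifying: a graph with minus the graph obtained by reversing the direction of one edge; a graph with the graph obtained by any permutation of the edge labels; and a graph with $\operatorname{sgn}(\sigma)$ times the graph obtained by applying a permutation $\sigma\in S_v$ to the vertex labels. (Hence graphs with a tadpole, i.e. an edge with both ends at the same vertex, are zero.) Let $\tilde V^{odd}_{v,e}\subset V^{odd}_{v,e}$ be the subspace spanned by connected graphs, and $\tilde V^{odd*}_{v,e}\subset\tilde V^{odd}_{v,e}$ the subspace spanned by connected graphs without multiple edges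 (no two distinct edges connect the same pair of vertices). Complexes. For an odd integer $m$, $$\mathrm{GC}_m=\prod_{v\ge1}\prod_{e\ge0}\tilde V^{odd}_{v,e}[(m-1)e-m(v-1)],\qquad \mathrm{GC}_m^{\mathrm{nm}}=\prod_{v\ge1}\prod_{e\ge0}\tilde V^{odd*}_{v,e}[(m-1)e-m(v-1)],$$ i.e. a graph with $v$ vertices and $e$ edges has cohomological degree $m(v-1)-(m-1)e$ (product taken in each degree). The differential is $$d\Gamma=\sum_{x\in V(\Gamma)}\Big(\tfrac12(\text{splitting of }x)-(\text{adding an edge at }x)\Big).$$ Here "splitting of $x$" means: add a new vertex labelled $v+1$ and a new edge directed from $x$ to $v+1$, and sum over all ways of reattaching the half-edges formerly attached to $x$ to either $x$ or $v+1$. "Adding an edge at $x$" means: add a new vertex $v+1$ and a new edge directed from $x$ to $v+1$, leaving all other edges unchanged. All terms with vertices of valence $1$ or $2$ cancel, so that $d$ is well defined on these spaces, $d^2=0$, and $d$ preserves the subspace $\mathrm{GC}_m^{\mathrm{nm}}$. The element $\Theta$ is a cocycle. *)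

theory Defs
  imports
    "HOL-Library.Poly_Mapping"
    "HOL-Library.Function_Algebras"
    "HOL-Combinatorics.Permutations"
    "HOL-Analysis.Product_Vector"
begin

section \<open>Cochain complexes of vector spaces and quasi-isomorphisms\<close>

definition cocycles :: "(int \<Rightarrow> 'a set) \<Rightarrow> ('a \<Rightarrow> 'a::ab_group_add) \<Rightarrow> int \<Rightarrow> 'a set" where
  "cocycles C d k = {x \<in> C k. d x = 0}"

definition coboundaries :: "(int \<Rightarrow> 'a set) \<Rightarrow> ('a \<Rightarrow> 'a::ab_group_add) \<Rightarrow> int \<Rightarrow> 'a set" where
  "coboundaries C d k = d ` C (k - 1)"

definition cohomologous :: "(int \<Rightarrow> 'a set) \<Rightarrow> ('a \<Rightarrow> 'a::ab_group_add) \<Rightarrow> int \<Rightarrow> ('a \<times> 'a) set" where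
  "cohomologous C d k =
     {(x, y). x \<in> cocycles C d k \<and> y \<in> cocycles C d k \<and> x - y \<in> coboundaries C d k}"

definition cohomology :: "(int \<Rightarrow> 'a set) \<Rightarrow> ('a \<Rightarrow> 'a::ab_group_add) \<Rightarrow> int \<Rightarrow> 'a set set" where
  "cohomology C d k = cocycles C d k // cohomologous C d k"

text \<open>The map induced by \<open>f\<close> from the degree \<open>k\<close> cohomology of any complex to that of
  \<^term>\<open>(D, dD)\<close>: a class \<open>c\<close> is sent to the class of \<open>f x\<close> for \<open>x \<in> c\<close>.\<close>

definition cohomology_map ::
  "(int \<Rightarrow> 'b set) \<Rightarrow> ('b \<Rightarrow> 'b::ab_group_add) \<Rightarrow> ('a \<Rightarrow> 'b) \<Rightarrow> int \<Rightarrow> 'a set \<Rightarrow> 'b set" where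
  "cohomology_map D dD f k c = cohomologous D dD k `` (f ` c)"

locale cochain_complex = vector_space scale
  for scale :: "'k::field \<Rightarrow> 'a::ab_group_add \<Rightarrow> 'a" +
  fixes C :: "int \<Rightarrow> 'a set" and d :: "'a \<Rightarrow> 'a"
  assumes subspace_C: "subspace (C k)"
    and linear_d: "Vector_Spaces.linear scale scale d"
    and d_in: "x \<in> C k \<Longrightarrow> d x \<in> C (k + 1)"
    and d_d: "x \<in> C k \<Longrightarrow> d (d x) = 0"

text \<open>The induced maps on cohomology are linear, so bijectivity makes them isomorphisms.\<close>

locale quasi_isomorphism =
  source: cochain_complex sC C dC + target: cochain_complex sD D dD +
  Vector_Spaces.linear sC sD f
  for sC :: "'k::field \<Rightarrow> 'a::ab_group_add \<Rightarrow> 'a" and C dC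
    and sD :: "'k \<Rightarrow> 'b::ab_group_add \<Rightarrow> 'b" and D dD
    and f :: "'a \<Rightarrow> 'b" +
  assumes map_in: "x \<in> C k \<Longrightarrow> f x \<in> D k"
    and map_d: "x \<in> C k \<Longrightarrow> f (dC x) = dD (f x)"
    and bij_cohomology:
      "bij_betw (cohomology_map D dD f k) (cohomology C dC k) (cohomology D dD k)"


section \<open>Labelled graphs\<close>

text \<open>\<open>Graph v e g\<close> has vertices \<open>1, \<dots>, v\<close> and edges \<open>1, \<dots>, e\<close>, and edge \<open>a\<close> is directed from
  \<open>fst (g a)\<close> to \<open>snd (g a)\<close>.  For graphs in \<open>labelled_graphs\<close> the function \<open>g\<close> is extensional,
  so that it is the same thing as a map on the edge set.\<close>

datatype graph = Graph (nverts: nat) (nedges: nat) (ends: "nat \<Rightarrow> nat \<times> nat")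

abbreviation verts :: "graph \<Rightarrow> nat set" where "verts \<Gamma> \<equiv> {1..nverts \<Gamma>}"
abbreviation edges :: "graph \<Rightarrow> nat set" where "edges \<Gamma> \<equiv> {1..nedges \<Gamma>}"

definition labelled_graphs :: "graph set" where
  "labelled_graphs =
     {\<Gamma>. nverts \<Gamma> \<ge> 1 \<and> ends \<Gamma> \<in> edges \<Gamma> \<rightarrow>\<^sub>E verts \<Gamma> \<times> verts \<Gamma>}"

text \<open>The half-edge \<open>(a, j)\<close>, \<open>j \<in> {1, 2}\<close>, is the \<open>j\<close>-th end of the edge \<open>a\<close>.\<close>

definition half_edge_vertex :: "graph \<Rightarrow> nat \<times> nat \<Rightarrow> nat" where
  "half_edge_vertex \<Gamma> h = (if snd h = 1 then fst (ends \<Gamma> (fst h)) else snd (ends \<Gamma> (fst h)))"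

definition half_edges_at :: "graph \<Rightarrow> nat \<Rightarrow> (nat \<times> nat) set" where
  "half_edges_at \<Gamma> x = {h \<in> edges \<Gamma> \<times> {1, 2}. half_edge_vertex \<Gamma> h = x}"

definition valence :: "graph \<Rightarrow> nat \<Rightarrow> nat" where
  "valence \<Gamma> x = card (half_edges_at \<Gamma> x)"

definition adjacency :: "graph \<Rightarrow> (nat \<times> nat) set" where
  "adjacency \<Gamma> = ends \<Gamma> ` edges \<Gamma> \<union> (ends \<Gamma> ` edges \<Gamma>)\<inverse>"

definition connected_graph :: "graph \<Rightarrow> bool" where
  "connected_graph \<Gamma> \<longleftrightarrow> (\<forall>x\<in>verts \<Gamma>. \<forall>y\<in>verts \<Gamma>. (x, y) \<in> (adjacency \<Gamma>)\<^sup>*)"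

definition no_multiple_edges :: "graph \<Rightarrow> bool" where
  "no_multiple_edges \<Gamma> \<longleftrightarrow> (\<forall>a\<in>edges \<Gamma>. \<forall>b\<in>edges \<Gamma>. a \<noteq> b \<longrightarrow>
     {fst (ends \<Gamma> a), snd (ends \<Gamma> a)} \<noteq> {fst (ends \<Gamma> b), snd (ends \<Gamma> b)})"

definition trivalent_graphs :: "nat \<Rightarrow> nat \<Rightarrow> graph set" where
  "trivalent_graphs v e = {\<Gamma> \<in> labelled_graphs.
     nverts \<Gamma> = v \<and> nedges \<Gamma> = e \<and> (\<forall>x\<in>verts \<Gamma>. valence \<Gamma> x \<ge> 3)}"

definition reverse_edge :: "nat \<Rightarrow> graph \<Rightarrow> graph" where
  "reverse_edge a \<Gamma> =
     Graph (nverts \<Gamma>) (nedges \<Gamma>) ((ends \<Gamma>)(a := prod.swap (ends \<Gamma> a)))"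

definition relabel_edges :: "(nat \<Rightarrow> nat) \<Rightarrow> graph \<Rightarrow> graph" where
  "relabel_edges \<pi> \<Gamma> = Graph (nverts \<Gamma>) (nedges \<Gamma>) (ends \<Gamma> \<circ> \<pi>)"

definition relabel_verts :: "(nat \<Rightarrow> nat) \<Rightarrow> graph \<Rightarrow> graph" where
  "relabel_verts \<sigma> \<Gamma> =
     Graph (nverts \<Gamma>) (nedges \<Gamma>) (restrict (map_prod \<sigma> \<sigma> \<circ> ends \<Gamma>) (edges \<Gamma>))"

definition add_edge_at :: "graph \<Rightarrow> nat \<Rightarrow> graph" where
  "add_edge_at \<Gamma> x = Graph (nverts \<Gamma> + 1) (nedges \<Gamma> + 1)
     ((ends \<Gamma>)(nedges \<Gamma> + 1 := (x, nverts \<Gamma> + 1)))"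

definition reattach :: "graph \<Rightarrow> (nat \<times> nat) set \<Rightarrow> nat \<Rightarrow> graph" where
  "reattach \<Gamma> S y = Graph (nverts \<Gamma>) (nedges \<Gamma>)
     (\<lambda>a. (if (a, 1) \<in> S then y else fst (ends \<Gamma> a),
           if (a, 2) \<in> S then y else snd (ends \<Gamma> a)))"

text \<open>The term of the splitting of \<open>x\<close> in which precisely the half-edges in \<open>S\<close> move from \<open>x\<close>
  to the new vertex.\<close>

definition split_vertex :: "graph \<Rightarrow> nat \<Rightarrow> (nat \<times> nat) set \<Rightarrow> graph" where
  "split_vertex \<Gamma> x S = add_edge_at (reattach \<Gamma> S (nverts \<Gamma> + 1)) x"


section \<open>Formal linear combinations of graphs\<close>

definition fscale :: "'k::field \<Rightarrow> ('b \<Rightarrow>\<^sub>0 'k) \<Rightarrow> 'b \<Rightarrow>\<^sub>0 'k" where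
  "fscale c p = Poly_Mapping.map ((*) c) p"

lemma lookup_fscale [simp]:
  "Poly_Mapping.lookup (fscale c p) x = c * Poly_Mapping.lookup p x"
  by (simp add: fscale_def Poly_Mapping.map.rep_eq when_def)

interpretation free: vector_space fscale
  by standard (auto intro!: poly_mapping_eqI simp: Poly_Mapping.lookup_add algebra_simps)

abbreviation gen :: "'b \<Rightarrow> 'b \<Rightarrow>\<^sub>0 'k::field" where
  "gen b \<equiv> Poly_Mapping.single b 1"

definition graph_differential :: "graph \<Rightarrow> graph \<Rightarrow>\<^sub>0 'k::field" where
  "graph_differential \<Gamma> =
     (\<Sum>x\<in>verts \<Gamma>.
        fscale (1 / 2) (\<Sum>S\<in>Pow (half_edges_at \<Gamma> x). gen (split_vertex \<Gamma> x S))
        - gen (add_edge_at \<Gamma> x))"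

definition linear_differential :: "(graph \<Rightarrow>\<^sub>0 'k::field) \<Rightarrow> graph \<Rightarrow>\<^sub>0 'k" where
  "linear_differential p =
     (\<Sum>\<Gamma>\<in>Poly_Mapping.keys p. fscale (Poly_Mapping.lookup p \<Gamma>) (graph_differential \<Gamma>))"

definition odd_relations :: "(graph \<Rightarrow>\<^sub>0 'k::field) set" where
  "odd_relations =
     {gen \<Gamma> + gen (reverse_edge a \<Gamma>) | \<Gamma> a. \<Gamma> \<in> labelled_graphs \<and> a \<in> edges \<Gamma>} \<union>
     {gen \<Gamma> - gen (relabel_edges \<pi> \<Gamma>) | \<Gamma> \<pi>.
        \<Gamma> \<in> labelled_graphs \<and> \<pi> permutes edges \<Gamma>} \<union>
     {gen \<Gamma> - fscale (of_int (sign \<sigma>)) (gen (relabel_verts \<sigma> \<Gamma>)) | \<Gamma> \<sigma>.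
        \<Gamma> \<in> labelled_graphs \<and> \<sigma> permutes verts \<Gamma>}"


subsection \<open>The differential respects the relations\<close>

lemma linear_differential_eq_sum:
  assumes "finite A" "Poly_Mapping.keys p \<subseteq> A"
  shows "linear_differential p =
    (\<Sum>\<Gamma>\<in>A. fscale (Poly_Mapping.lookup p \<Gamma>) (graph_differential \<Gamma>))"
  unfolding linear_differential_def using assms
  by (intro sum.mono_neutral_left) (auto simp: in_keys_iff)

lemma linear_linear_differential:
  "Vector_Spaces.linear fscale fscale (linear_differential :: (graph \<Rightarrow>\<^sub>0 'k::field) \<Rightarrow> _)"
  unfolding module_hom_iff_linear[symmetric]
proof (intro module_hom.intro module_hom_axioms.intro free.module_axioms)
  fix p q :: "graph \<Rightarrow>\<^sub>0 'k"
  let ?A = "Poly_Mapping.keys p \<union> Poly_Mapping.keys q"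
  have "linear_differential (p + q) =
      (\<Sum>\<Gamma>\<in>?A. fscale (Poly_Mapping.lookup (p + q) \<Gamma>) (graph_differential \<Gamma>))"
    by (rule linear_differential_eq_sum) (use Poly_Mapping.keys_add[of p q] in auto)
  moreover have "linear_differential p =
      (\<Sum>\<Gamma>\<in>?A. fscale (Poly_Mapping.lookup p \<Gamma>) (graph_differential \<Gamma>))"
    by (rule linear_differential_eq_sum) auto
  moreover have "linear_differential q =
      (\<Sum>\<Gamma>\<in>?A. fscale (Poly_Mapping.lookup q \<Gamma>) (graph_differential \<Gamma>))"
    by (rule linear_differential_eq_sum) auto
  ultimately show "linear_differential (p + q) = linear_differential p + linear_differential q"
    by (simp add: lookup_add free.scale_left_distrib sum.distrib)
next
  fix c and p :: "graph \<Rightarrow>\<^sub>0 'k"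
  have "linear_differential (fscale c p) =
      (\<Sum>\<Gamma>\<in>Poly_Mapping.keys p. fscale (Poly_Mapping.lookup (fscale c p) \<Gamma>)
        (graph_differential \<Gamma>))"
    by (rule linear_differential_eq_sum) (auto simp: in_keys_iff)
  then show "linear_differential (fscale c p) = fscale c (linear_differential p)"
    by (simp add: linear_differential_def free.scale_sum_right)
qed

interpretation lindiff: Vector_Spaces.linear fscale fscale linear_differential
  by (rule linear_linear_differential)

lemma linear_differential_single [simp]:
  "linear_differential (gen \<Gamma>) = graph_differential \<Gamma>"
  by (simp add: linear_differential_def)

lemma graph_differential_related:
  fixes c :: "'k::field"
  assumes \<rho>: "bij_betw \<rho> (verts \<Gamma>) (verts \<Gamma>')"
    and \<phi>: "inj \<phi>"
    and half: "\<And>x. x \<in> verts \<Gamma> \<Longrightarrow> half_edges_at \<Gamma>' (\<rho> x) = \<phi> ` half_edges_at \<Gamma> x"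
    and split: "\<And>x S. x \<in> verts \<Gamma> \<Longrightarrow> S \<subseteq> half_edges_at \<Gamma> x \<Longrightarrow>
      gen (split_vertex \<Gamma> x S)
        - fscale c (gen (split_vertex \<Gamma>' (\<rho> x) (\<phi> ` S))) \<in> free.span R"
    and add: "\<And>x. add_edge_at \<Gamma> x = split_vertex \<Gamma> x {}"
      "\<And>x. add_edge_at \<Gamma>' x = split_vertex \<Gamma>' x {}"
  shows "graph_differential \<Gamma> - fscale c (graph_differential \<Gamma>') \<in> free.span R"
proof -
  let ?s = "\<lambda>\<Gamma> x S. gen (split_vertex \<Gamma> x S) :: graph \<Rightarrow>\<^sub>0 'k"
  have inner: "(\<Sum>S\<in>Pow (half_edges_at \<Gamma>' (\<rho> x)). ?s \<Gamma>' (\<rho> x) S) =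
      (\<Sum>S\<in>Pow (half_edges_at \<Gamma> x). ?s \<Gamma>' (\<rho> x) (\<phi> ` S))" if "x \<in> verts \<Gamma>" for x
  proof -
    have "bij_betw ((`) \<phi>) (Pow (half_edges_at \<Gamma> x)) (Pow (half_edges_at \<Gamma>' (\<rho> x)))"
      by (intro bij_betw_Pow) (simp add: bij_betw_def half[OF that] inj_on_subset[OF \<phi>])
    then show ?thesis
      by (rule sum.reindex_bij_betw[symmetric])
  qed
  have "graph_differential \<Gamma>' =
      (\<Sum>x\<in>verts \<Gamma>. fscale (1/2) (\<Sum>S\<in>Pow (half_edges_at \<Gamma>' (\<rho> x)). ?s \<Gamma>' (\<rho> x) S)
        - ?s \<Gamma>' (\<rho> x) {})"
    unfolding graph_differential_def add by (rule sum.reindex_bij_betw[OF \<rho>, symmetric])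
  also have "\<dots> = (\<Sum>x\<in>verts \<Gamma>.
      fscale (1/2) (\<Sum>S\<in>Pow (half_edges_at \<Gamma> x). ?s \<Gamma>' (\<rho> x) (\<phi> ` S)) - ?s \<Gamma>' (\<rho> x) {})"
    by (intro sum.cong refl) (simp add: inner)
  finally have \<Gamma>': "graph_differential \<Gamma>' = (\<Sum>x\<in>verts \<Gamma>.
      fscale (1/2) (\<Sum>S\<in>Pow (half_edges_at \<Gamma> x). ?s \<Gamma>' (\<rho> x) (\<phi> ` S)) - ?s \<Gamma>' (\<rho> x) {})" .
  let ?t = "\<lambda>x S. ?s \<Gamma> x S - fscale c (?s \<Gamma>' (\<rho> x) (\<phi> ` S))"
  have "fscale (1/2) (\<Sum>S\<in>Pow (half_edges_at \<Gamma> x). ?s \<Gamma> x S) - ?s \<Gamma> x {}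
      - fscale c (fscale (1/2) (\<Sum>S\<in>Pow (half_edges_at \<Gamma> x). ?s \<Gamma>' (\<rho> x) (\<phi> ` S)) - ?s \<Gamma>' (\<rho> x) {})
      = fscale (1/2) (\<Sum>S\<in>Pow (half_edges_at \<Gamma> x). ?t x S) - ?t x {}" for x
    unfolding sum_subtractf free.scale_right_diff_distrib free.scale_sum_right[of c, symmetric]
      free.scale_left_commute[of c "1/2"] image_empty
    by (simp only: algebra_simps)
  then have "graph_differential \<Gamma> - fscale c (graph_differential \<Gamma>') =
      (\<Sum>x\<in>verts \<Gamma>. fscale (1/2) (\<Sum>S\<in>Pow (half_edges_at \<Gamma> x). ?t x S) - ?t x {})"
    unfolding \<Gamma>' unfolding graph_differential_def add free.scale_sum_right[of c]
      sum_subtractf[symmetric] by (intro sum.cong refl)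
  moreover have "fscale (1/2) (\<Sum>S\<in>Pow (half_edges_at \<Gamma> x). ?t x S) - ?t x {} \<in> free.span R"
    if x: "x \<in> verts \<Gamma>" for x
  proof (rule free.span_diff)
    show "fscale (1/2) (\<Sum>S\<in>Pow (half_edges_at \<Gamma> x). ?t x S) \<in> free.span R"
      using split[OF x] by (intro free.span_scale free.span_sum) simp
    show "?t x {} \<in> free.span R"
      using split[OF x, of "{}"] by simp
  qed
  ultimately show ?thesis
    by (simp only: free.span_sum)
qed

lemma add_edge_at_eq_split: "add_edge_at \<Gamma> x = split_vertex \<Gamma> x {}"
  by (simp add: split_vertex_def add_edge_at_def reattach_def)

lemma split_vertex_labelled:
  assumes "\<Gamma> \<in> labelled_graphs" "x \<in> verts \<Gamma>" "S \<subseteq> half_edges_at \<Gamma> x"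
  shows "split_vertex \<Gamma> x S \<in> labelled_graphs"
proof -
  have g: "ends \<Gamma> a \<in> verts \<Gamma> \<times> verts \<Gamma>" if "a \<in> edges \<Gamma>" for a
    using assms(1) that unfolding labelled_graphs_def by (blast intro: PiE_mem)
  have out: "ends \<Gamma> a = undefined" if "a \<notin> edges \<Gamma>" for a
    using assms(1) that unfolding labelled_graphs_def by (blast intro: PiE_arb)
  have S: "(a, j) \<notin> S" if "a \<notin> edges \<Gamma>" for a j
    using assms(3) that by (auto simp: half_edges_at_def)
  let ?\<Gamma>' = "split_vertex \<Gamma> x S"
  have "ends ?\<Gamma>' a \<in> verts ?\<Gamma>' \<times> verts ?\<Gamma>'" if "a \<in> edges ?\<Gamma>'" for a
  proof (cases "a \<in> edges \<Gamma>")
    case True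
    then show ?thesis
      using g[OF True]
      by (cases "ends \<Gamma> a") (auto simp: split_vertex_def add_edge_at_def reattach_def)
  next
    case False
    then have "a = nedges \<Gamma> + 1"
      using that by (auto simp: split_vertex_def add_edge_at_def reattach_def)
    then show ?thesis
      using assms(2) by (auto simp: split_vertex_def add_edge_at_def reattach_def)
  qed
  moreover have "ends ?\<Gamma>' a = undefined" if "a \<notin> edges ?\<Gamma>'" for a
  proof -
    have "a \<notin> edges \<Gamma>" "a \<noteq> nedges \<Gamma> + 1"
      using that by (auto simp: split_vertex_def add_edge_at_def reattach_def)
    then show ?thesis
      using S[of a] out[of a] by (simp add: split_vertex_def add_edge_at_def reattach_def)
  qed
  ultimately show ?thesis
    unfolding labelled_graphs_def
    by (intro CollectI conjI PiE_I) (simp_all add: split_vertex_def add_edge_at_def)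
qed

lemmas split_simps = split_vertex_def add_edge_at_def reattach_def

definition flip_half_edge :: "nat \<Rightarrow> nat \<times> nat \<Rightarrow> nat \<times> nat" where
  "flip_half_edge a = (\<lambda>(b, j). (b, if b = a then transpose 1 2 j else j))"

lemma flip_half_edge_flip [simp]: "flip_half_edge a (flip_half_edge a h) = h"
  by (auto simp: flip_half_edge_def split: prod.splits)

lemma inj_flip_half_edge: "inj (flip_half_edge a)"
  by (metis flip_half_edge_flip injI)

lemma in_flip_half_edge_image: "h \<in> flip_half_edge a ` S \<longleftrightarrow> flip_half_edge a h \<in> S"
  by (metis flip_half_edge_flip image_eqI imageE)

lemma flip_half_edge_simps [simp]:
  "flip_half_edge a (a, 1) = (a, 2)" "flip_half_edge a (a, Suc 0) = (a, 2)"
  "flip_half_edge a (a, 2) = (a, 1)" "b \<noteq> a \<Longrightarrow> flip_half_edge a (b, j) = (b, j)"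
  by (simp_all add: flip_half_edge_def)

lemma transpose_1_2_eq: "transpose 1 2 j = 1 \<longleftrightarrow> j = 2" "transpose 1 2 j = 2 \<longleftrightarrow> j = 1"
  for j :: nat
  by (auto simp: transpose_def)

lemma half_edges_at_reverse_edge:
  assumes "a \<in> edges \<Gamma>"
  shows "half_edges_at (reverse_edge a \<Gamma>) x = flip_half_edge a ` half_edges_at \<Gamma> x"
proof -
  have "(b, j) \<in> half_edges_at (reverse_edge a \<Gamma>) x
      \<longleftrightarrow> flip_half_edge a (b, j) \<in> half_edges_at \<Gamma> x" for b j
  proof (cases "b = a \<and> (j = 1 \<or> j = 2)")
    case True
    then show ?thesis
      by (elim conjE disjE) (simp_all add: half_edges_at_def half_edge_vertex_def
          reverse_edge_def flip_half_edge_def)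
  next
    case False
    then show ?thesis
      using transpose_1_2_eq[of j]
      by (cases "b = a") (simp_all add: half_edges_at_def half_edge_vertex_def
          reverse_edge_def flip_half_edge_def)
  qed
  then show ?thesis
    by (simp add: set_eq_iff in_flip_half_edge_image)
qed

lemma in_relabel_half_edges_image:
  assumes "\<pi> permutes A"
  shows "(b, j) \<in> map_prod (inv \<pi>) id ` S \<longleftrightarrow> (\<pi> b, j) \<in> S"
proof
  assume "(b, j) \<in> map_prod (inv \<pi>) id ` S"
  then show "(\<pi> b, j) \<in> S"
    using permutes_inverses(1)[OF assms] by auto
next
  assume "(\<pi> b, j) \<in> S"
  then have "map_prod (inv \<pi>) id (\<pi> b, j) \<in> map_prod (inv \<pi>) id ` S"
    by (rule imageI)
  then show "(b, j) \<in> map_prod (inv \<pi>) id ` S"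
    using permutes_inverses(2)[OF assms] by simp
qed

lemma half_edges_at_relabel_edges:
  assumes "\<pi> permutes edges \<Gamma>"
  shows "half_edges_at (relabel_edges \<pi> \<Gamma>) x = map_prod (inv \<pi>) id ` half_edges_at \<Gamma> x"
proof (rule set_eqI)
  fix h :: "nat \<times> nat"
  show "h \<in> half_edges_at (relabel_edges \<pi> \<Gamma>) x
      \<longleftrightarrow> h \<in> map_prod (inv \<pi>) id ` half_edges_at \<Gamma> x"
    using permutes_in_image[OF assms, of "fst h"]
    by (cases h) (auto simp: in_relabel_half_edges_image[OF assms] half_edges_at_def
        half_edge_vertex_def relabel_edges_def)
qed

lemma half_edges_at_relabel_verts:
  assumes "\<sigma> permutes verts \<Gamma>"
  shows "half_edges_at (relabel_verts \<sigma> \<Gamma>) (\<sigma> x) = half_edges_at \<Gamma> x"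
proof -
  have "half_edge_vertex (relabel_verts \<sigma> \<Gamma>) h = \<sigma> x \<longleftrightarrow> half_edge_vertex \<Gamma> h = x"
    if "h \<in> edges \<Gamma> \<times> {1, 2}" for h
  proof -
    have "half_edge_vertex (relabel_verts \<sigma> \<Gamma>) h = \<sigma> (half_edge_vertex \<Gamma> h)"
      using that by (cases h) (simp add: half_edge_vertex_def relabel_verts_def)
    then show ?thesis
      by (simp only: inj_eq[OF permutes_inj[OF assms]])
  qed
  moreover have "nedges (relabel_verts \<sigma> \<Gamma>) = nedges \<Gamma>"
    by (simp add: relabel_verts_def)
  ultimately show ?thesis
    unfolding half_edges_at_def by (intro Collect_cong) metis
qed

lemma differential_reverse_edge:
  assumes \<Gamma>: "\<Gamma> \<in> labelled_graphs" and a: "a \<in> edges \<Gamma>"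
  shows "graph_differential \<Gamma> + graph_differential (reverse_edge a \<Gamma>)
    \<in> free.span (odd_relations :: (graph \<Rightarrow>\<^sub>0 'k::field) set)"
proof -
  let ?\<phi> = "flip_half_edge a"
  have eq: "split_vertex (reverse_edge a \<Gamma>) x (?\<phi> ` S) = reverse_edge a (split_vertex \<Gamma> x S)"
    for x S
  proof (rule graph.expand, intro conjI ext)
    fix b
    have "a \<noteq> nedges \<Gamma> + 1"
      using a by simp
    then show "ends (split_vertex (reverse_edge a \<Gamma>) x (?\<phi> ` S)) b
        = ends (reverse_edge a (split_vertex \<Gamma> x S)) b"
      by (cases "b = a") (simp_all add: split_simps reverse_edge_def in_flip_half_edge_image)
  qed (simp_all add: split_simps reverse_edge_def)
  have "graph_differential \<Gamma> - fscale (- 1) (graph_differential (reverse_edge a \<Gamma>))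
    \<in> free.span (odd_relations :: (graph \<Rightarrow>\<^sub>0 'k) set)"
  proof (rule graph_differential_related[where \<Gamma> = \<Gamma> and \<Gamma>' = "reverse_edge a \<Gamma>"
        and \<rho> = "\<lambda>x. x" and \<phi> = ?\<phi> and R = "odd_relations :: (graph \<Rightarrow>\<^sub>0 'k) set"])
    show "bij_betw (\<lambda>x. x) (verts \<Gamma>) (verts (reverse_edge a \<Gamma>))"
      by (simp add: reverse_edge_def bij_betw_def)
    fix x S assume x: "x \<in> verts \<Gamma>" "S \<subseteq> half_edges_at \<Gamma> x"
    have "a \<in> edges (split_vertex \<Gamma> x S)"
      using a by (auto simp: split_simps)
    then have "gen (split_vertex \<Gamma> x S) + gen (reverse_edge a (split_vertex \<Gamma> x S))
        \<in> (odd_relations :: (graph \<Rightarrow>\<^sub>0 'k) set)"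
      unfolding odd_relations_def using split_vertex_labelled[OF \<Gamma> x] by blast
    then show "gen (split_vertex \<Gamma> x S)
        - fscale (- 1) (gen (split_vertex (reverse_edge a \<Gamma>) x (?\<phi> ` S)))
        \<in> free.span (odd_relations :: (graph \<Rightarrow>\<^sub>0 'k) set)"
      unfolding eq by (simp add: free.span_base)
  qed (rule inj_flip_half_edge half_edges_at_reverse_edge[OF a] add_edge_at_eq_split)+
  then show ?thesis
    by simp
qed

lemma differential_relabel_edges:
  assumes \<Gamma>: "\<Gamma> \<in> labelled_graphs" and \<pi>: "\<pi> permutes edges \<Gamma>"
  shows "graph_differential \<Gamma> - graph_differential (relabel_edges \<pi> \<Gamma>)
    \<in> free.span (odd_relations :: (graph \<Rightarrow>\<^sub>0 'k::field) set)"
proof -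
  let ?\<phi> = "map_prod (inv \<pi>) (id :: nat \<Rightarrow> nat)"
  have inj: "inj ?\<phi>"
    using permutes_inj[OF permutes_inv[OF \<pi>]] by (intro prod.inj_map) auto
  have new: "\<pi> b = nedges \<Gamma> + 1 \<longleftrightarrow> b = nedges \<Gamma> + 1" for b
  proof -
    have "\<pi> (nedges \<Gamma> + 1) = nedges \<Gamma> + 1"
      using \<pi> by (intro permutes_not_in) auto
    then show ?thesis
      using permutes_inj[OF \<pi>] by (metis injD)
  qed
  have eq: "split_vertex (relabel_edges \<pi> \<Gamma>) x (?\<phi> ` S) = relabel_edges \<pi> (split_vertex \<Gamma> x S)"
    for x S
    using new by (auto simp: split_simps relabel_edges_def fun_eq_iff
        in_relabel_half_edges_image[OF \<pi>])
  have "graph_differential \<Gamma> - fscale 1 (graph_differential (relabel_edges \<pi> \<Gamma>))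
    \<in> free.span (odd_relations :: (graph \<Rightarrow>\<^sub>0 'k) set)"
  proof (rule graph_differential_related[where \<Gamma> = \<Gamma> and \<Gamma>' = "relabel_edges \<pi> \<Gamma>"
        and \<rho> = "\<lambda>x. x" and \<phi> = ?\<phi> and R = "odd_relations :: (graph \<Rightarrow>\<^sub>0 'k) set"])
    show "bij_betw (\<lambda>x. x) (verts \<Gamma>) (verts (relabel_edges \<pi> \<Gamma>))"
      by (simp add: relabel_edges_def bij_betw_def)
    fix x S assume x: "x \<in> verts \<Gamma>" "S \<subseteq> half_edges_at \<Gamma> x"
    have "\<pi> permutes edges (split_vertex \<Gamma> x S)"
      by (rule permutes_subset[OF \<pi>]) (auto simp: split_simps)
    then have "gen (split_vertex \<Gamma> x S) - gen (relabel_edges \<pi> (split_vertex \<Gamma> x S))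
        \<in> (odd_relations :: (graph \<Rightarrow>\<^sub>0 'k) set)"
      unfolding odd_relations_def using split_vertex_labelled[OF \<Gamma> x] by blast
    then show "gen (split_vertex \<Gamma> x S)
        - fscale 1 (gen (split_vertex (relabel_edges \<pi> \<Gamma>) x (?\<phi> ` S)))
        \<in> free.span (odd_relations :: (graph \<Rightarrow>\<^sub>0 'k) set)"
      unfolding eq by (simp add: free.span_base)
  qed (rule inj half_edges_at_relabel_edges[OF \<pi>] add_edge_at_eq_split)+
  then show ?thesis
    by simp
qed

lemma differential_relabel_verts:
  assumes \<Gamma>: "\<Gamma> \<in> labelled_graphs" and \<sigma>: "\<sigma> permutes verts \<Gamma>"
  shows "graph_differential \<Gamma>
      - fscale (of_int (sign \<sigma>)) (graph_differential (relabel_verts \<sigma> \<Gamma>))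
    \<in> free.span (odd_relations :: (graph \<Rightarrow>\<^sub>0 'k::field) set)"
proof (rule graph_differential_related[where \<Gamma> = \<Gamma> and \<Gamma>' = "relabel_verts \<sigma> \<Gamma>"
      and \<rho> = \<sigma> and \<phi> = "\<lambda>h. h" and R = "odd_relations :: (graph \<Rightarrow>\<^sub>0 'k) set"])
  show "bij_betw \<sigma> (verts \<Gamma>) (verts (relabel_verts \<sigma> \<Gamma>))"
    using permutes_imp_bij[OF \<sigma>] by (simp add: relabel_verts_def)
  show "half_edges_at (relabel_verts \<sigma> \<Gamma>) (\<sigma> x) = (\<lambda>h. h) ` half_edges_at \<Gamma> x" for x
    by (simp add: half_edges_at_relabel_verts[OF \<sigma>])
  fix x S assume x: "x \<in> verts \<Gamma>" and S: "S \<subseteq> half_edges_at \<Gamma> x"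
  have out: "(b, j) \<notin> S" if "b \<notin> edges \<Gamma>" for b j
    using S that by (auto simp: half_edges_at_def)
  have new: "\<sigma> (nverts \<Gamma> + 1) = nverts \<Gamma> + 1"
    using \<sigma> by (intro permutes_not_in) auto
  have "ends (split_vertex (relabel_verts \<sigma> \<Gamma>) (\<sigma> x) S) b
      = ends (relabel_verts \<sigma> (split_vertex \<Gamma> x S)) b" for b
  proof -
    consider "b \<in> edges \<Gamma>" | "b = nedges \<Gamma> + 1" | "b \<notin> edges \<Gamma>" "b \<noteq> nedges \<Gamma> + 1"
      by blast
    then show ?thesis
      using new out[of b] by cases (auto simp: split_simps relabel_verts_def)
  qed
  then have eq: "split_vertex (relabel_verts \<sigma> \<Gamma>) (\<sigma> x) S = relabel_verts \<sigma> (split_vertex \<Gamma> x S)"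
    by (intro graph.expand) (auto simp: split_simps relabel_verts_def)
  have "\<sigma> permutes verts (split_vertex \<Gamma> x S)"
    by (rule permutes_subset[OF \<sigma>]) (auto simp: split_simps)
  then have "gen (split_vertex \<Gamma> x S)
      - fscale (of_int (sign \<sigma>)) (gen (relabel_verts \<sigma> (split_vertex \<Gamma> x S)))
      \<in> (odd_relations :: (graph \<Rightarrow>\<^sub>0 'k) set)"
    unfolding odd_relations_def using split_vertex_labelled[OF \<Gamma> x S] by blast
  then show "gen (split_vertex \<Gamma> x S) - fscale (of_int (sign \<sigma>))
        (gen (split_vertex (relabel_verts \<sigma> \<Gamma>) (\<sigma> x) ((\<lambda>h. h) ` S)))
      \<in> free.span (odd_relations :: (graph \<Rightarrow>\<^sub>0 'k) set)"
    unfolding image_ident eq by (rule free.span_base)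
qed (simp_all add: add_edge_at_eq_split)

lemma linear_differential_relations:
  assumes "p \<in> free.span (odd_relations :: (graph \<Rightarrow>\<^sub>0 'k::field) set)"
  shows "linear_differential p \<in> free.span odd_relations"
  using assms
proof (induction rule: free.span_induct_alt)
  case base
  show ?case
    by (simp add: free.span_zero lindiff.zero)
next
  case (step c r p)
  have "linear_differential r \<in> free.span odd_relations"
    using step.hyps differential_reverse_edge differential_relabel_edges
      differential_relabel_verts
    unfolding odd_relations_def
    by (elim UnE CollectE exE conjE)
      (simp_all add: lindiff.add lindiff.diff lindiff.scale flip: odd_relations_def)
  then show ?case
    using step.IH by (simp add: lindiff.add lindiff.scale free.span_add free.span_scale)
qed


subsection \<open>The relations between at least trivalent graphs\<close>

lemma trivalent_graphs_related:
  assumes "\<Gamma> \<in> labelled_graphs" "\<Gamma>' \<in> labelled_graphs" "nedges \<Gamma>' = nedges \<Gamma>"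
    and nv: "nverts \<Gamma>' = nverts \<Gamma>" and \<rho>: "\<rho> permutes verts \<Gamma>"
    and val: "\<And>x. valence \<Gamma>' (\<rho> x) = valence \<Gamma> x"
  shows "\<Gamma>' \<in> trivalent_graphs v e \<longleftrightarrow> \<Gamma> \<in> trivalent_graphs v e"
proof -
  have "(\<forall>x\<in>verts \<Gamma>'. valence \<Gamma>' x \<ge> 3) \<longleftrightarrow> (\<forall>x\<in>\<rho> ` verts \<Gamma>. valence \<Gamma>' x \<ge> 3)"
    by (simp only: nv permutes_image[OF \<rho>])
  then show ?thesis
    using assms(1-4) by (simp add: trivalent_graphs_def val)
qed

lemma trivalent_reverse_edge:
  assumes \<Gamma>: "\<Gamma> \<in> labelled_graphs" and a: "a \<in> edges \<Gamma>"
  shows "reverse_edge a \<Gamma> \<in> trivalent_graphs v e \<longleftrightarrow> \<Gamma> \<in> trivalent_graphs v e"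
proof (rule trivalent_graphs_related[OF \<Gamma>, where \<rho> = id])
  have g: "ends \<Gamma> \<in> edges \<Gamma> \<rightarrow>\<^sub>E verts \<Gamma> \<times> verts \<Gamma>"
    using \<Gamma> by (simp add: labelled_graphs_def)
  have "prod.swap (ends \<Gamma> a) \<in> verts \<Gamma> \<times> verts \<Gamma>"
    using PiE_mem[OF g a] by (cases "ends \<Gamma> a") auto
  then have "(ends \<Gamma>)(a := prod.swap (ends \<Gamma> a)) \<in> edges \<Gamma> \<rightarrow>\<^sub>E verts \<Gamma> \<times> verts \<Gamma>"
    using PiE_fun_upd[OF _ g, of _ a] a by (simp add: insert_absorb)
  then show "reverse_edge a \<Gamma> \<in> labelled_graphs"
    using \<Gamma> by (simp add: labelled_graphs_def reverse_edge_def)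
  show "valence (reverse_edge a \<Gamma>) (id x) = valence \<Gamma> x" for x
    unfolding valence_def id_apply half_edges_at_reverse_edge[OF a]
    by (rule card_image[OF inj_on_subset[OF inj_flip_half_edge]]) simp
qed (simp_all add: reverse_edge_def permutes_id)

lemma trivalent_relabel_edges:
  assumes \<Gamma>: "\<Gamma> \<in> labelled_graphs" and \<pi>: "\<pi> permutes edges \<Gamma>"
  shows "relabel_edges \<pi> \<Gamma> \<in> trivalent_graphs v e \<longleftrightarrow> \<Gamma> \<in> trivalent_graphs v e"
proof (rule trivalent_graphs_related[OF \<Gamma>, where \<rho> = id])
  have g: "ends \<Gamma> \<in> edges \<Gamma> \<rightarrow>\<^sub>E verts \<Gamma> \<times> verts \<Gamma>"
    using \<Gamma> by (simp add: labelled_graphs_def)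
  have "ends \<Gamma> \<circ> \<pi> \<in> edges \<Gamma> \<rightarrow>\<^sub>E verts \<Gamma> \<times> verts \<Gamma>"
  proof (rule PiE_I)
    show "(ends \<Gamma> \<circ> \<pi>) b \<in> verts \<Gamma> \<times> verts \<Gamma>" if "b \<in> edges \<Gamma>" for b
      unfolding comp_apply by (rule PiE_mem[OF g]) (use that permutes_in_image[OF \<pi>] in blast)
    show "(ends \<Gamma> \<circ> \<pi>) b = undefined" if "b \<notin> edges \<Gamma>" for b
      unfolding comp_apply by (rule PiE_arb[OF g]) (use that permutes_in_image[OF \<pi>] in blast)
  qed
  then show "relabel_edges \<pi> \<Gamma> \<in> labelled_graphs"
    using \<Gamma> by (simp add: labelled_graphs_def relabel_edges_def)
  have inj: "inj (map_prod (inv \<pi>) (id :: nat \<Rightarrow> nat))"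
    using permutes_inj[OF permutes_inv[OF \<pi>]] by (intro prod.inj_map) auto
  have "valence (relabel_edges \<pi> \<Gamma>) x = valence \<Gamma> x" for x
    unfolding valence_def half_edges_at_relabel_edges[OF \<pi>]
    by (rule card_image[OF inj_on_subset[OF inj]]) simp
  then show "valence (relabel_edges \<pi> \<Gamma>) (id x) = valence \<Gamma> x" for x
    by simp
qed (simp_all add: relabel_edges_def permutes_id)

lemma trivalent_relabel_verts:
  assumes \<Gamma>: "\<Gamma> \<in> labelled_graphs" and \<sigma>: "\<sigma> permutes verts \<Gamma>"
  shows "relabel_verts \<sigma> \<Gamma> \<in> trivalent_graphs v e \<longleftrightarrow> \<Gamma> \<in> trivalent_graphs v e"
proof (rule trivalent_graphs_related[OF \<Gamma>, where \<rho> = \<sigma>])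
  have g: "ends \<Gamma> \<in> edges \<Gamma> \<rightarrow>\<^sub>E verts \<Gamma> \<times> verts \<Gamma>"
    using \<Gamma> by (simp add: labelled_graphs_def)
  have "map_prod \<sigma> \<sigma> (ends \<Gamma> b) \<in> verts \<Gamma> \<times> verts \<Gamma>" if "b \<in> edges \<Gamma>" for b
    using PiE_mem[OF g that]
    by (cases "ends \<Gamma> b") (simp add: permutes_in_image[OF \<sigma>] del: atLeastAtMost_iff One_nat_def)
  then show "relabel_verts \<sigma> \<Gamma> \<in> labelled_graphs"
    using \<Gamma> by (simp add: labelled_graphs_def relabel_verts_def PiE_iff del: atLeastAtMost_iff)
  show "valence (relabel_verts \<sigma> \<Gamma>) (\<sigma> x) = valence \<Gamma> x" for x
    by (simp add: valence_def half_edges_at_relabel_verts[OF \<sigma>])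
qed (use \<sigma> in \<open>simp_all add: relabel_verts_def\<close>)

lemma span_odd_relations_Int:
  fixes v e :: nat
  defines "V \<equiv> {p :: graph \<Rightarrow>\<^sub>0 'k::field. Poly_Mapping.keys p \<subseteq> trivalent_graphs v e}"
  shows "free.span odd_relations \<inter> V = free.span (odd_relations \<inter> V)"
proof
  let ?T = "trivalent_graphs v e"
  define P :: "(graph \<Rightarrow>\<^sub>0 'k) \<Rightarrow> graph \<Rightarrow>\<^sub>0 'k" where
    "P = Poly_Mapping.mapp (\<lambda>\<Gamma> c. if \<Gamma> \<in> ?T then c else 0)"
  have lookup_P: "Poly_Mapping.lookup (P p) \<Gamma> = (if \<Gamma> \<in> ?T then Poly_Mapping.lookup p \<Gamma> else 0)"
    for p \<Gamma>
    by (auto simp: P_def lookup_mapp when_def in_keys_iff)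
  have P_comb: "P (fscale c p + q) = fscale c (P p) + P q" for c p q
    by (rule poly_mapping_eqI) (simp add: lookup_P Poly_Mapping.lookup_add)
  have P_V: "P p = p" if "p \<in> V" for p
    using that by (intro poly_mapping_eqI) (auto simp: V_def lookup_P in_keys_iff)
  have rel: "P (gen \<Gamma> + fscale c (gen \<Gamma>')) \<in> free.span (odd_relations \<inter> V)"
    if r: "gen \<Gamma> + fscale c (gen \<Gamma>') \<in> odd_relations" and iff: "\<Gamma>' \<in> ?T \<longleftrightarrow> \<Gamma> \<in> ?T" for \<Gamma> c \<Gamma>'
  proof (cases "\<Gamma> \<in> ?T")
    case True
    then have "gen \<Gamma> + fscale c (gen \<Gamma>') \<in> V"
      using iff by (auto simp: V_def in_keys_iff Poly_Mapping.lookup_add lookup_single when_def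
          split: if_splits)
    then show ?thesis
      using r by (simp add: P_V free.span_base)
  next
    case False
    then have "P (gen \<Gamma> + fscale c (gen \<Gamma>')) = 0"
      using iff by (intro poly_mapping_eqI)
        (auto simp: lookup_P Poly_Mapping.lookup_add lookup_single when_def)
    then show ?thesis
      by (simp add: free.span_zero)
  qed
  have P_rel: "P r \<in> free.span (odd_relations \<inter> V)" if r: "r \<in> odd_relations" for r
  proof -
    consider (reverse) \<Gamma> a where "r = gen \<Gamma> + fscale 1 (gen (reverse_edge a \<Gamma>))"
        "\<Gamma> \<in> labelled_graphs" "a \<in> edges \<Gamma>"
      | (edges) \<Gamma> \<pi> where "r = gen \<Gamma> + fscale (- 1) (gen (relabel_edges \<pi> \<Gamma>))"
        "\<Gamma> \<in> labelled_graphs" "\<pi> permutes edges \<Gamma>"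
      | (verts) \<Gamma> \<sigma> where
        "r = gen \<Gamma> + fscale (- of_int (sign \<sigma>)) (gen (relabel_verts \<sigma> \<Gamma>))"
        "\<Gamma> \<in> labelled_graphs" "\<sigma> permutes verts \<Gamma>"
      using r unfolding odd_relations_def by (auto simp del: atLeastAtMost_iff)
    then show ?thesis
      using r by cases (auto intro!: rel simp: trivalent_reverse_edge trivalent_relabel_edges
          trivalent_relabel_verts simp del: atLeastAtMost_iff free.scale_minus_left free.scale_one)
  qed
  have "P p \<in> free.span (odd_relations \<inter> V)" if "p \<in> free.span odd_relations" for p
    using that
  proof (induction rule: free.span_induct_alt)
    case base
    have "P 0 = 0"
      by (rule poly_mapping_eqI) (simp add: lookup_P)
    then show ?case
      by (simp add: free.span_zero)
  next
    case (step c r p)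
    have "P r \<in> free.span (odd_relations \<inter> V)"
      by (rule P_rel[OF step.hyps(1)])
    then show ?case
      unfolding P_comb using step.IH by (simp add: free.span_add free.span_scale)
  qed
  then show "free.span odd_relations \<inter> V \<subseteq> free.span (odd_relations \<inter> V)"
    using P_V by force
  have "free.subspace V"
    unfolding free.subspace_def V_def
    by (auto simp: in_keys_iff Poly_Mapping.lookup_add subset_iff) (metis add.right_neutral)
  then show "free.span (odd_relations \<inter> V) \<subseteq> free.span odd_relations \<inter> V"
    using free.span_mono[of "odd_relations \<inter> V" odd_relations] free.span_minimal[of _ V] by blast
qed


section \<open>The space of odd graphs\<close>

text \<open>This is the direct sum over all \<open>v\<close> and \<open>e\<close> of the quotients of the spaces of graphs
  \<^emph>\<open>without\<close> valence condition.  The terms of the differential with vertices of valence one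
  or two live here, and it is here that they cancel.  Since the relations preserve \<open>v\<close>, \<open>e\<close> and
  all valences up to order, the span of the classes of at least trivalent graphs is the quotient
  of the span of these graphs by the relations between them; see \<open>span_odd_relations_Int\<close>.\<close>

quotient_type (overloaded) 'k odd_graphs = "graph \<Rightarrow>\<^sub>0 'k::field" /
  "\<lambda>p q. p - q \<in> free.span odd_relations"
proof (rule equivpI)
  let ?R = "\<lambda>p q :: graph \<Rightarrow>\<^sub>0 'k. p - q \<in> free.span odd_relations"
  show "reflp ?R"
    by (simp add: reflp_def free.span_zero)
  show "symp ?R"
  proof (rule sympI)
    fix p q assume "?R p q"
    then show "?R q p"
      using free.span_neg[of "p - q"] by simp
  qed
  show "transp ?R"
  proof (rule transpI)
    fix p q r assume "?R p q" "?R q r"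
    then show "?R p r"
      using free.span_add[of "p - q" _ "q - r"] by simp
  qed
qed

instantiation odd_graphs :: (field) ab_group_add
begin

lift_definition zero_odd_graphs :: "'a odd_graphs" is 0 .

lift_definition plus_odd_graphs :: "'a odd_graphs \<Rightarrow> 'a odd_graphs \<Rightarrow> 'a odd_graphs" is "(+)"
  by (simp only: add_diff_add free.span_add)

lift_definition uminus_odd_graphs :: "'a odd_graphs \<Rightarrow> 'a odd_graphs" is uminus
  by (simp only: minus_diff_minus free.span_neg)

lift_definition minus_odd_graphs :: "'a odd_graphs \<Rightarrow> 'a odd_graphs \<Rightarrow> 'a odd_graphs" is "(-)"
proof -
  fix p p' q q' :: "graph \<Rightarrow>\<^sub>0 'a"
  assume "p - p' \<in> free.span odd_relations" "q - q' \<in> free.span odd_relations"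
  then have "(p - p') - (q - q') \<in> free.span odd_relations"
    by (rule free.span_diff)
  moreover have "(p - p') - (q - q') = (p - q) - (p' - q')"
    by simp
  ultimately show "(p - q) - (p' - q') \<in> free.span odd_relations"
    by (simp only:)
qed

instance
  by standard (transfer; simp add: algebra_simps free.span_zero)+

end

lift_definition oscale :: "'k::field \<Rightarrow> 'k odd_graphs \<Rightarrow> 'k odd_graphs" is fscale
  by (simp only: free.span_scale flip: free.scale_right_diff_distrib)

interpretation odd: vector_space oscale
  by standard (transfer; simp add: free.scale_left_distrib free.scale_right_distrib free.span_zero)+

lift_definition graph_class :: "graph \<Rightarrow> 'k::field odd_graphs" is gen .

lift_definition odd_differential :: "'k::field odd_graphs \<Rightarrow> 'k odd_graphs"
  is linear_differential
  by (simp only: linear_differential_relations flip: lindiff.diff)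

section \<open>The graph complexes\<close>

definition odd_connected :: "nat \<Rightarrow> nat \<Rightarrow> 'k::field odd_graphs set" where
  "odd_connected v e =
     odd.span (graph_class ` {\<Gamma> \<in> trivalent_graphs v e. connected_graph \<Gamma>})"

definition odd_connected_nm :: "nat \<Rightarrow> nat \<Rightarrow> 'k::field odd_graphs set" where
  "odd_connected_nm v e =
     odd.span (graph_class ` {\<Gamma> \<in> trivalent_graphs v e. connected_graph \<Gamma> \<and> no_multiple_edges \<Gamma>})"

definition graph_degree :: "int \<Rightarrow> nat \<Rightarrow> nat \<Rightarrow> int" where
  "graph_degree m v e = m * (int v - 1) - (m - 1) * int e"

text \<open>An element of a product over all \<open>v\<close> and \<open>e\<close> is the family of its components.\<close>

type_synonym 'k graph_series = "nat \<times> nat \<Rightarrow> 'k odd_graphs"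

definition graded_product ::
  "int \<Rightarrow> (nat \<Rightarrow> nat \<Rightarrow> 'k::field odd_graphs set) \<Rightarrow> int \<Rightarrow> 'k graph_series set" where
  "graded_product m W k =
     {X. \<forall>v e. X (v, e) \<in> (if v \<ge> 1 \<and> graph_degree m v e = k then W v e else {0})}"

definition GC :: "int \<Rightarrow> int \<Rightarrow> 'k::field graph_series set" where
  "GC m = graded_product m odd_connected"

definition GC_nm :: "int \<Rightarrow> int \<Rightarrow> 'k::field graph_series set" where
  "GC_nm m = graded_product m odd_connected_nm"

definition gc_scale :: "'k::field \<Rightarrow> 'k graph_series \<Rightarrow> 'k graph_series" where
  "gc_scale c X = (\<lambda>i. oscale c (X i))"

definition gc_differential :: "'k::field graph_series \<Rightarrow> 'k graph_series" where
  "gc_differential X =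
     (\<lambda>(v, e). if v \<ge> 1 \<and> e \<ge> 1 then odd_differential (X (v - 1, e - 1)) else 0)"

interpretation gc: vector_space gc_scale
  by standard (simp_all add: gc_scale_def fun_eq_iff odd.scale_left_distrib
      odd.scale_right_distrib)

definition \<Theta>_graph :: graph where
  "\<Theta>_graph = Graph 2 3 (\<lambda>a\<in>{1..3}. (1, 2))"

definition \<Theta> :: "'k::field graph_series" where
  "\<Theta> = (\<lambda>i. if i = (2, 3) then graph_class \<Theta>_graph else 0)"

definition \<Theta>_line :: "int \<Rightarrow> int \<Rightarrow> 'k::field graph_series set" where
  "\<Theta>_line m k = (if k = graph_degree m 2 3 then gc.span {\<Theta>} else {0})"

end

(* A linear functional on odd graphs is a function f on words in odd letters (vertices) and even
letters (edges) that is graded symmetric and invariant under renaming, and on at least trivalent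
graphs the transpose of the differential is, up to a factor, the operator split_op that sums f over
all splittings of a vertex.  Introduce odd double edges and the operator mark_op that evaluates a
function after replacing two parallel edges by a double edge.  Both operators square to zero and
they anticommute.  Opening a double edge contracts mark_op up to the number of pairs of parallel
edges.  On functions of graphs with r > 0 double edges split_op is contractible as well: contract
the edge at a vertex that meets only this edge and one double edge; on graphs without loops this is
a homotopy to 4 r, and the two-vertex graph that comes from Theta is the only obstruction.  A diagram
chase in this double complex shows that f = split_op g with g = 0 on graphs without multiple edges,
provided that split_op f = 0 and f vanishes on Theta and on graphs without multiple edges.

Functionals separate points from subspaces, so dually every z whose differential has no multiple
edges is a boundary plus a multiple of Theta plus a combination of graphs without multiple edges.
This statement contains surjectivity and injectivity on cohomology. *)

theory Submission
  imports Defs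
begin

section \<open>Graphs as words in graded symbols\<close>

text \<open>A bundle of parallel edges behaves like a power of one even variable, and an odd letter
  for the double edge turns it into a complex of Koszul type. The contraction homotopy meets two
  obstacles. First, contracting an edge parallel to the double edge produces a double edge with
  equal ends, a loop. Loops carry no pairs of parallel edges, so marking is controlled only on
  loop-free words, whereas the contraction homotopy needs a function that is closed on all words.
  Since a splitting never creates a loop, a function closed on loop-free words can be corrected for
  one number of loops after the other, by a second homotopy that slides a loop along an edge. This
  fails only for a single vertex with one loop, whose splitting is the theta graph. Second,
  contraction does not respect the bound three on valences. Hence there are two degree conditions:
  weight 2 for double edges and bound 3 in the chase, weight 1 and bound 2 for contractions. The
  resulting functional may see bivalent graphs, which is harmless because the differential is
  defined before valences are restricted.\<close>

datatype cell = Vx nat | Ed nat nat | Md nat nat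

text \<open>For odd m a vertex has odd degree m and an edge even degree 1 - m. A double edge is
  declared odd, so that two double edges between the same vertices cancel and marking squares to
  zero.\<close>

fun odd_cell :: "cell \<Rightarrow> bool" where
  "odd_cell (Ed a b) = False"
| "odd_cell c = True"

fun cell_ends :: "cell \<Rightarrow> nat list" where
  "cell_ends (Vx x) = []"
| "cell_ends (Ed a b) = [a, b]"
| "cell_ends (Md a b) = [a, b]"

fun reverse_cell :: "cell \<Rightarrow> cell" where
  "reverse_cell (Vx x) = Vx x"
| "reverse_cell (Ed a b) = Ed b a"
| "reverse_cell (Md a b) = Md b a"

text \<open>Reversing both edges of a parallel pair costs two signs, so the double edge that
  replaces the pair is unoriented.\<close>

fun reverse_sign :: "cell \<Rightarrow> 'k::comm_ring_1" where
  "reverse_sign (Ed a b) = -1"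
| "reverse_sign c = 1"

fun rename :: "(nat \<Rightarrow> nat) \<Rightarrow> cell \<Rightarrow> cell" where
  "rename \<rho> (Vx x) = Vx (\<rho> x)"
| "rename \<rho> (Ed a b) = Ed (\<rho> a) (\<rho> b)"
| "rename \<rho> (Md a b) = Md (\<rho> a) (\<rho> b)"

definition koszul :: "cell \<Rightarrow> cell \<Rightarrow> 'k::comm_ring_1" where
  "koszul a b = (if odd_cell a \<and> odd_cell b then -1 else 1)"

lemma koszul_simps [simp]:
  "koszul (Ed a b) c = 1" "koszul c (Ed a b) = 1"
  "koszul (Vx x) (Vx y) = -1" "koszul (Vx x) (Md a b) = -1"
  "koszul (Md a b) (Vx x) = -1" "koszul (Md a b) (Md p q) = -1"
  by (simp_all add: koszul_def)

lemma koszul_commute: "koszul a b = koszul b a"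
  by (simp add: koszul_def conj_commute)

lemma koszul_square [simp]: "koszul a b * koszul a b = 1" "koszul a b * (koszul a b * z) = z"
  by (simp_all add: koszul_def)

lemma koszul_rename [simp]: "koszul (rename \<rho> a) (rename \<rho> b) = koszul a b"
  by (cases a; cases b) simp_all

lemma koszul_reverse [simp]: "koszul (reverse_cell a) b = koszul a b"
  by (cases a) (simp_all add: koszul_def)

text \<open>\<open>pick cs K\<close> moves each letter of \<open>cs\<close> in turn to the front, with the Koszul sign, and
  sums the values of \<open>K\<close>.\<close>

primrec pick :: "cell list \<Rightarrow> (cell \<Rightarrow> cell list \<Rightarrow> 'k::comm_ring_1) \<Rightarrow> 'k" where
  "pick [] K = 0"
| "pick (a # cs) K = K a cs + pick cs (\<lambda>b r. koszul a b * K b (a # r))"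

lemma pick_cong:
  "(\<And>a r. mset (a # r) = mset cs \<Longrightarrow> K a r = K' a r) \<Longrightarrow> pick cs K = pick cs K'"
proof (induction cs arbitrary: K K')
  case (Cons a cs)
  have "pick cs (\<lambda>b r. koszul a b * K b (a # r)) = pick cs (\<lambda>b r. koszul a b * K' b (a # r))"
    by (rule Cons.IH) (simp add: Cons.prems)
  then show ?case
    by (simp add: Cons.prems)
qed simp

lemma pick_zero: "(\<And>a r. mset (a # r) = mset cs \<Longrightarrow> K a r = 0) \<Longrightarrow> pick cs K = 0"
proof -
  have "pick cs (\<lambda>a r. 0) = 0" by (induction cs) simp_all
  then show "pick cs K = 0"
    if "\<And>a r. mset (a # r) = mset cs \<Longrightarrow> K a r = 0"
    using pick_cong[of cs K "\<lambda>a r. 0"] that by simp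
qed

lemma pick_add: "pick cs (\<lambda>a r. K a r + K' a r) = pick cs K + pick cs K'"
  by (induction cs arbitrary: K K') (simp_all add: algebra_simps)

lemma pick_mult: "pick cs (\<lambda>a r. c * K a r) = c * pick cs K"
proof (induction cs arbitrary: K)
  case (Cons a cs)
  have "pick cs (\<lambda>b r. koszul a b * (c * K b (a # r)))
      = pick cs (\<lambda>b r. c * (koszul a b * K b (a # r)))"
    by (simp add: mult.left_commute)
  then show ?case
    by (simp add: Cons.IH distrib_left)
qed simp

lemma pick_uminus: "pick cs (\<lambda>a r. - K a r) = - pick cs K"
  using pick_mult[of cs "-1" K] by simp

lemma pick_sum_list: "pick cs (\<lambda>a r. \<Sum>x\<leftarrow>xs. K x a r) = (\<Sum>x\<leftarrow>xs. pick cs (K x))"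
  by (induction xs) (simp_all add: pick_add pick_zero)

text \<open>Two letters can be extracted in either order, and the results differ by the sign of
  exchanging them at the front. All later exchanges of nested sums reduce to this.\<close>

lemma pick_swap:
  "pick cs (\<lambda>a r. pick r (K a)) = pick cs (\<lambda>b r. pick r (\<lambda>a r'. koszul a b * K a b r'))"
proof (induction cs arbitrary: K)
  case (Cons x cs)
  have "pick cs (\<lambda>a r. koszul x a * pick r (\<lambda>b r'. koszul x b * K a b (x # r')))
      = pick cs (\<lambda>a r. pick r (\<lambda>b r'. koszul x a * (koszul x b * K a b (x # r'))))"
    by (simp add: pick_mult)
  also have "\<dots> = pick cs (\<lambda>b r. pick r (\<lambda>a r'. koszul a b
      * (koszul x a * (koszul x b * K a b (x # r')))))"
    by (rule Cons.IH)
  also have "\<dots> = pick cs (\<lambda>b r. koszul x b * pick r (\<lambda>a r'. koszul x a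
      * (koszul a b * K a b (x # r'))))"
    by (simp add: pick_mult[symmetric] ac_simps)
  finally show ?case
    by (simp add: pick_add distrib_left add_ac koszul_commute[of _ x] pick_mult)
qed simp

lemma pick_rename:
  "pick (map (rename \<rho>) cs) K = pick cs (\<lambda>a r. K (rename \<rho> a) (map (rename \<rho>) r))"
  by (induction cs arbitrary: K) simp_all

section \<open>Graded symmetric functions of words\<close>

definition graded_symmetric :: "(cell list \<Rightarrow> 'k::comm_ring_1) \<Rightarrow> bool" where
  "graded_symmetric F \<longleftrightarrow> (\<forall>xs a b ys. F (xs @ a # b # ys) = koszul a b * F (xs @ b # a # ys))"

lemma graded_symmetricD:
  "graded_symmetric F \<Longrightarrow> F (xs @ a # b # ys) = koszul a b * F (xs @ b # a # ys)"
  unfolding graded_symmetric_def by blast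

lemma graded_symmetric_swap:
  "graded_symmetric F \<Longrightarrow> F (a # b # ys) = koszul a b * F (b # a # ys)"
  using graded_symmetricD[of F "[]"] unfolding append_Nil .

lemma graded_symmetric_append: "graded_symmetric F \<Longrightarrow> graded_symmetric (\<lambda>r. F (xs @ r))"
  unfolding graded_symmetric_def by (metis append_assoc)

lemma graded_symmetric_Cons: "graded_symmetric F \<Longrightarrow> graded_symmetric (\<lambda>r. F (x # r))"
  using graded_symmetric_append[of F "[x]"] by simp

lemma graded_symmetric_mult:
  "graded_symmetric F \<Longrightarrow> graded_symmetric (\<lambda>r. c * F r)"
  unfolding graded_symmetric_def by (metis mult.left_commute)

lemma graded_symmetric_zero [simp]: "graded_symmetric (\<lambda>r. 0)"
  by (simp add: graded_symmetric_def)

text \<open>If one of the two adjacent letters is extracted, their exchange is visible only in the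
  extraction sign; if neither is, the symmetry of the summand applies.\<close>

lemma graded_symmetric_pick:
  assumes "\<And>a. graded_symmetric (K a)"
  shows "graded_symmetric (\<lambda>cs. pick cs K)"
  unfolding graded_symmetric_def
proof (intro allI)
  fix xs a b ys
  show "pick (xs @ a # b # ys) K = koszul a b * pick (xs @ b # a # ys) K"
    using assms
  proof (induction xs arbitrary: K)
    case Nil
    have "pick ys (\<lambda>c r. koszul b c * (koszul a c * K c (a # b # r)))
        = koszul a b * pick ys (\<lambda>c r. koszul a c * (koszul b c * K c (b # a # r)))"
      unfolding pick_mult[symmetric]
      by (rule pick_cong) (simp add: graded_symmetric_swap[OF Nil, of _ a b] ac_simps)
    then show ?case
      by (simp add: distrib_left koszul_commute[of b a])
  next
    case (Cons x xs)
    have "graded_symmetric (\<lambda>r. koszul x c * K c (x # r))" for c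
      by (intro graded_symmetric_mult graded_symmetric_Cons Cons.prems)
    from Cons.IH[OF this] show ?case
      using graded_symmetricD[OF Cons.prems[of x], of xs a b ys] by (simp add: distrib_left)
  qed
qed

text \<open>Vanishing is independent of the order of the letters, so the sign of the permutation
  never has to be computed.\<close>

lemma graded_symmetric_mset:
  assumes "graded_symmetric F" "mset cs = mset cs'" "F cs = 0"
  shows "F cs' = 0"
proof -
  have move: "F (xs @ a # ys) = 0" if F: "graded_symmetric F" and 0: "F (a # xs @ ys) = 0"
    for F :: "cell list \<Rightarrow> 'a" and a xs ys
    using that
  proof (induction xs arbitrary: F)
    case (Cons x xs)
    have "F (x # a # xs @ ys) = 0"
      using graded_symmetric_swap[OF Cons.prems(1), of x a] Cons.prems(2) by simp
    from Cons.IH[OF graded_symmetric_Cons[OF Cons.prems(1)] this] show ?case by simp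
  qed simp
  show ?thesis
    using assms
  proof (induction cs arbitrary: cs' F)
    case (Cons a cs)
    have "a \<in> set cs'"
      using Cons.prems(2) by (metis list.set_intros(1) set_mset_mset)
    then obtain xs ys where cs': "cs' = xs @ a # ys"
      by (meson split_list)
    have "F (a # xs @ ys) = 0"
      by (rule Cons.IH[OF graded_symmetric_Cons[OF Cons.prems(1), of a], of "xs @ ys"])
        (use Cons.prems cs' in simp_all)
    then show ?case
      unfolding cs' by (rule move[OF Cons.prems(1)])
  qed simp
qed

text \<open>Moving a letter to the front and back costs the same sign twice, so every summand is a
  multiple of the value at the original word.\<close>

lemma pick_restore:
  assumes "graded_symmetric F"
  shows "pick cs (\<lambda>a r. g a * F (a # r)) = (\<Sum>a\<leftarrow>cs. g a) * F cs"
  using assms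
proof (induction cs arbitrary: F)
  case (Cons x cs)
  have "pick cs (\<lambda>b r. koszul x b * (g b * F (b # x # r))) = pick cs (\<lambda>b r. g b * F (x # b # r))"
    by (rule pick_cong) (simp add: graded_symmetric_swap[OF Cons.prems, of x] ac_simps)
  then show ?case
    using Cons.IH[OF graded_symmetric_Cons[OF Cons.prems, of x]] by (simp add: distrib_right)
qed simp

lemma sum_list_map_mset: "mset xs = mset ys \<Longrightarrow> (\<Sum>x\<leftarrow>xs. f x) = (\<Sum>x\<leftarrow>ys. f x :: 'k::comm_monoid_add)"
  by (metis mset_map sum_mset_sum_list)

text \<open>The second letter is drawn from what the first one leaves behind, so no position is
  paired with itself; this is the subtracted diagonal.\<close>

lemma pick_pick_restore:
  assumes F: "graded_symmetric F"
  shows "pick cs (\<lambda>a r. pick r (\<lambda>b q. g a b * F (a # b # q)))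
    = ((\<Sum>a\<leftarrow>cs. \<Sum>b\<leftarrow>cs. g a b) - (\<Sum>a\<leftarrow>cs. g a a)) * F cs"
proof -
  have "pick cs (\<lambda>a r. pick r (\<lambda>b q. g a b * F (a # b # q)))
      = pick cs (\<lambda>a r. ((\<Sum>b\<leftarrow>cs. g a b) - g a a) * F (a # r))"
  proof (rule pick_cong)
    fix a r assume "mset (a # r) = mset cs"
    from sum_list_map_mset[OF this, of "g a"] have "(\<Sum>b\<leftarrow>r. g a b) = (\<Sum>b\<leftarrow>cs. g a b) - g a a"
      by (simp add: algebra_simps)
    then show "pick r (\<lambda>b q. g a b * F (a # b # q)) = ((\<Sum>b\<leftarrow>cs. g a b) - g a a) * F (a # r)"
      using pick_restore[OF graded_symmetric_Cons[OF F, of a]] by simp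
  qed
  also have "\<dots> = ((\<Sum>a\<leftarrow>cs. \<Sum>b\<leftarrow>cs. g a b) - (\<Sum>a\<leftarrow>cs. g a a)) * F cs"
    unfolding pick_restore[OF F] by (simp add: sum_list_subtractf)
  finally show ?thesis .
qed


section \<open>Sums over reattachments of half-edges\<close>

primrec cell_choices :: "(nat \<Rightarrow> nat list) \<Rightarrow> cell \<Rightarrow> cell list" where
  "cell_choices f (Vx x) = [Vx x]"
| "cell_choices f (Ed a b) = concat (map (\<lambda>p. map (Ed p) (f b)) (f a))"
| "cell_choices f (Md a b) = concat (map (\<lambda>p. map (Md p) (f b)) (f a))"

text \<open>\<open>reattach_sum f cs K\<close> sums \<open>K\<close> over all ways of moving each half-edge at \<open>i\<close> to one of
  the vertices in \<open>f i\<close>.\<close>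

primrec reattach_sum :: "(nat \<Rightarrow> nat list) \<Rightarrow> cell list \<Rightarrow> (cell list \<Rightarrow> 'k::comm_ring_1) \<Rightarrow> 'k" where
  "reattach_sum f [] K = K []"
| "reattach_sum f (c # cs) K = (\<Sum>c'\<leftarrow>cell_choices f c. reattach_sum f cs (\<lambda>r. K (c' # r)))"

lemma reattach_sum_cong:
  "(\<And>r. list_all2 (\<lambda>c c'. c' \<in> set (cell_choices f c)) cs r \<Longrightarrow> K r = K' r)
    \<Longrightarrow> reattach_sum f cs K = reattach_sum f cs K'"
proof (induction cs arbitrary: K K')
  case (Cons c cs)
  have "reattach_sum f cs (\<lambda>r. K (c' # r)) = reattach_sum f cs (\<lambda>r. K' (c' # r))"
    if "c' \<in> set (cell_choices f c)" for c'
    by (rule Cons.IH) (use Cons.prems that in simp)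
  then show ?case
    by (simp cong: map_cong)
qed simp

lemma sum_list_map_add: "(\<Sum>x\<leftarrow>xs. f x + g x) = (\<Sum>x\<leftarrow>xs. f x) + (\<Sum>x\<leftarrow>xs. g x :: 'k::comm_monoid_add)"
  by (induction xs) (simp_all add: ac_simps)

lemma sum_list_map_swap:
  "(\<Sum>x\<leftarrow>xs. \<Sum>y\<leftarrow>ys. f x y) = (\<Sum>y\<leftarrow>ys. \<Sum>x\<leftarrow>xs. f x y :: 'k::comm_monoid_add)"
  by (induction xs) (simp_all add: sum_list_map_add)

lemma reattach_sum_add:
  "reattach_sum f cs (\<lambda>r. K r + K' r) = reattach_sum f cs K + reattach_sum f cs K'"
  by (induction cs arbitrary: K K') (simp_all add: sum_list_map_add)

lemma reattach_sum_mult: "reattach_sum f cs (\<lambda>r. c * K r) = c * reattach_sum f cs K"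
  by (induction cs arbitrary: K) (simp_all add: sum_list_const_mult)

lemma reattach_sum_uminus: "reattach_sum f cs (\<lambda>r. - K r) = - reattach_sum f cs K"
  using reattach_sum_mult[of f cs "-1" K] by simp

lemma reattach_sum_zero:
  assumes "\<And>r. list_all2 (\<lambda>c c'. c' \<in> set (cell_choices f c)) cs r \<Longrightarrow> K r = 0"
  shows "reattach_sum f cs K = 0"
proof -
  have "reattach_sum f cs K = reattach_sum f cs (\<lambda>r. 0 * K r)"
    by (rule reattach_sum_cong) (simp add: assms)
  then show ?thesis
    unfolding reattach_sum_mult by simp
qed

lemma reattach_sum_sum_list:
  "reattach_sum f cs (\<lambda>r. \<Sum>x\<leftarrow>xs. K x r) = (\<Sum>x\<leftarrow>xs. reattach_sum f cs (K x))"
  by (induction xs) (simp_all add: reattach_sum_add reattach_sum_zero)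

lemma koszul_choices:
  "a' \<in> set (cell_choices f a) \<Longrightarrow> koszul a' b = koszul a b"
  "a' \<in> set (cell_choices f a) \<Longrightarrow> koszul b a' = koszul b a"
  by (cases a; auto simp: koszul_def)+

lemma graded_symmetric_reattach_sum:
  assumes "graded_symmetric K"
  shows "graded_symmetric (\<lambda>cs. reattach_sum f cs K)"
  unfolding graded_symmetric_def
proof (intro allI)
  fix xs a b ys
  show "reattach_sum f (xs @ a # b # ys) K = koszul a b * reattach_sum f (xs @ b # a # ys) K"
    using assms
  proof (induction xs arbitrary: K)
    case Nil
    have sw: "reattach_sum f ys (\<lambda>r. K (a' # b' # r)) = koszul a' b' * reattach_sum f ys (\<lambda>r. K (b' # a' # r))"
      for a' b'
      unfolding reattach_sum_mult[symmetric] by (simp only: graded_symmetric_swap[OF Nil, of a' b'])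
    have "(\<Sum>a'\<leftarrow>cell_choices f a. \<Sum>b'\<leftarrow>cell_choices f b. reattach_sum f ys (\<lambda>r. K (a' # b' # r)))
        = (\<Sum>a'\<leftarrow>cell_choices f a. \<Sum>b'\<leftarrow>cell_choices f b. koszul a b * reattach_sum f ys (\<lambda>r. K (b' # a' # r)))"
      by (intro arg_cong[where f = sum_list] map_cong refl)
        (subst sw, simp add: koszul_choices)
    then show ?case
      by (simp add: sum_list_map_swap[of _ "cell_choices f a"] sum_list_const_mult)
  next
    case (Cons x xs)
    then show ?case
      by (simp add: graded_symmetric_Cons sum_list_const_mult)
  qed
qed

text \<open>Reattachment changes neither the order nor the parity of letters, so it commutes with
  extraction and its signs.\<close>

lemma reattach_sum_pick:
  "reattach_sum f cs (\<lambda>r. pick r K)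
    = pick cs (\<lambda>a r. \<Sum>a'\<leftarrow>cell_choices f a. reattach_sum f r (K a'))"
proof (induction cs arbitrary: K)
  case (Cons x cs)
  have "(\<Sum>x'\<leftarrow>cell_choices f x. reattach_sum f cs (\<lambda>r. pick r (\<lambda>b q. koszul x' b * K b (x' # q))))
      = (\<Sum>x'\<leftarrow>cell_choices f x. pick cs (\<lambda>a r. \<Sum>a'\<leftarrow>cell_choices f a.
          koszul x a * reattach_sum f r (\<lambda>q. K a' (x' # q))))"
    unfolding Cons.IH
    by (intro arg_cong[where f = sum_list] map_cong refl pick_cong)
      (simp add: reattach_sum_mult koszul_choices)
  also have "\<dots> = pick cs (\<lambda>a r. \<Sum>x'\<leftarrow>cell_choices f x. \<Sum>a'\<leftarrow>cell_choices f a.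
          koszul x a * reattach_sum f r (\<lambda>q. K a' (x' # q)))"
    by (simp add: pick_sum_list)
  finally show ?case
    by (simp add: reattach_sum_add sum_list_map_add sum_list_const_mult
        sum_list_map_swap[of _ "cell_choices f x"])
qed simp

lemma sum_list_concat_map: "(\<Sum>y\<leftarrow>concat (map g xs). h y) = (\<Sum>x\<leftarrow>xs. \<Sum>y\<leftarrow>g x. h y :: 'k::comm_monoid_add)"
  by (induction xs) simp_all

lemma sum_list_cell_choices_Ed:
  "(\<Sum>c\<leftarrow>cell_choices f (Ed a b). h c) = (\<Sum>p\<leftarrow>f a. \<Sum>q\<leftarrow>f b. h (Ed p q) :: 'k::comm_monoid_add)"
  and sum_list_cell_choices_Md:
  "(\<Sum>c\<leftarrow>cell_choices f (Md a b). h c) = (\<Sum>p\<leftarrow>f a. \<Sum>q\<leftarrow>f b. h (Md p q) :: 'k::comm_monoid_add)"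
  by (simp_all only: cell_choices.simps sum_list_concat_map map_map comp_def)

lemma sum_list_cell_choices_cong:
  assumes "\<And>i h. i \<in> set (cell_ends c) \<Longrightarrow> (\<Sum>j\<leftarrow>f i. h j) = (\<Sum>j\<leftarrow>g i. h j :: 'k::comm_monoid_add)"
  shows "(\<Sum>c'\<leftarrow>cell_choices f c. h c') = (\<Sum>c'\<leftarrow>cell_choices g c. h c' :: 'k)"
  using assms
  by (cases c) (simp_all only: sum_list_cell_choices_Ed sum_list_cell_choices_Md cell_choices.simps(1),
      simp_all)

lemma reattach_sum_fun_cong:
  assumes "\<And>c i. c \<in> set cs \<Longrightarrow> i \<in> set (cell_ends c) \<Longrightarrow> mset (f i) = mset (g i)"
  shows "reattach_sum f cs K = reattach_sum g cs K"
  using assms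
proof (induction cs arbitrary: K)
  case (Cons c cs)
  have "(\<Sum>c'\<leftarrow>cell_choices f c. reattach_sum g cs (\<lambda>r. K (c' # r)))
      = (\<Sum>c'\<leftarrow>cell_choices g c. reattach_sum g cs (\<lambda>r. K (c' # r)))"
    by (intro sum_list_cell_choices_cong sum_list_map_mset) (rule Cons.prems[of c], simp_all)
  moreover have "reattach_sum f cs K = reattach_sum g cs K" for K :: "cell list \<Rightarrow> 'a"
    by (rule Cons.IH, rule Cons.prems) simp_all
  ultimately show ?case by simp
qed simp

lemma reattach_sum_reattach_sum:
  "reattach_sum f cs (\<lambda>r. reattach_sum g r K) = reattach_sum (\<lambda>i. concat (map g (f i))) cs K"
proof (induction cs arbitrary: K)
  case (Cons c cs)
  have "(\<Sum>c'\<leftarrow>cell_choices f c. \<Sum>d\<leftarrow>cell_choices g c'. h d)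
      = (\<Sum>d\<leftarrow>cell_choices (\<lambda>i. concat (map g (f i))) c. h d)" for h :: "cell \<Rightarrow> 'a"
    by (cases c) (simp_all only: sum_list_cell_choices_Ed sum_list_cell_choices_Md
        sum_list_concat_map, simp_all add: sum_list_map_swap[of _ "f _" "g _"])
  then show ?case
    by (simp add: reattach_sum_sum_list Cons.IH)
qed simp

lemma reattach_sum_rename:
  assumes "\<And>c i. c \<in> set cs \<Longrightarrow> i \<in> set (cell_ends c) \<Longrightarrow> g (\<rho> i) = map \<rho> (f i)"
  shows "reattach_sum g (map (rename \<rho>) cs) K = reattach_sum f cs (\<lambda>r. K (map (rename \<rho>) r))"
  using assms
proof (induction cs arbitrary: K)
  case (Cons c cs)
  have "cell_choices g (rename \<rho> c) = map (rename \<rho>) (cell_choices f c)"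
    using Cons.prems[of c] by (cases c) (simp_all add: map_concat comp_def)
  moreover have "reattach_sum g (map (rename \<rho>) cs) K
      = reattach_sum f cs (\<lambda>r. K (map (rename \<rho>) r))" for K :: "cell list \<Rightarrow> 'a"
    by (rule Cons.IH, rule Cons.prems) simp_all
  ultimately show ?case by (simp add: comp_def)
qed simp

text \<open>A renaming also acts on vertex letters, which reattachment leaves alone; therefore it
  must fix those that occur before it can be absorbed into the targets.\<close>

lemma reattach_sum_rename_result:
  assumes "\<And>x. Vx x \<in> set cs \<Longrightarrow> \<rho> x = x"
  shows "reattach_sum f cs (\<lambda>r. K (map (rename \<rho>) r)) = reattach_sum (\<lambda>i. map \<rho> (f i)) cs K"
  using assms
proof (induction cs arbitrary: K)
  case (Cons c cs)
  have 1: "map (rename \<rho>) (cell_choices f c) = cell_choices (\<lambda>i. map \<rho> (f i)) c"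
    using Cons.prems by (cases c) (simp_all add: map_concat comp_def)
  have 2: "reattach_sum f cs (\<lambda>r. K (map (rename \<rho>) r))
      = reattach_sum (\<lambda>i. map \<rho> (f i)) cs K" for K :: "cell list \<Rightarrow> 'a"
    by (rule Cons.IH, rule Cons.prems) simp_all
  show ?case
    unfolding reattach_sum.simps 1[symmetric] map_map comp_def 2[symmetric] list.map ..
qed simp

section \<open>Equivariant functions\<close>

text \<open>Only the front letter is mentioned; together with graded symmetry this covers every
  position.\<close>

definition reversal_symmetric :: "(cell list \<Rightarrow> 'k::comm_ring_1) \<Rightarrow> bool" where
  "reversal_symmetric F \<longleftrightarrow> (\<forall>c r. F (c # r) = reverse_sign c * F (reverse_cell c # r))"

definition cell_symmetric :: "(cell list \<Rightarrow> 'k::comm_ring_1) \<Rightarrow> bool" where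
  "cell_symmetric F \<longleftrightarrow> graded_symmetric F \<and> reversal_symmetric F"

lemma cell_symmetric_graded: "cell_symmetric F \<Longrightarrow> graded_symmetric F"
  by (simp add: cell_symmetric_def)

lemma cell_symmetric_reverse:
  "cell_symmetric F \<Longrightarrow> F (c # r) = reverse_sign c * F (reverse_cell c # r)"
  unfolding cell_symmetric_def reversal_symmetric_def by blast

lemma cell_symmetricI:
  "graded_symmetric F \<Longrightarrow> (\<And>c r. F (c # r) = reverse_sign c * F (reverse_cell c # r))
    \<Longrightarrow> cell_symmetric F"
  unfolding cell_symmetric_def reversal_symmetric_def by blast

lemma cell_symmetric_Cons:
  assumes "cell_symmetric F"
  shows "cell_symmetric (\<lambda>r. F (x # r))"
proof -
  have "F (x # c # r) = reverse_sign c * F (x # reverse_cell c # r)" for c r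
    using graded_symmetric_swap[OF cell_symmetric_graded[OF assms], of x c r]
      graded_symmetric_swap[OF cell_symmetric_graded[OF assms], of "reverse_cell c" x r]
      cell_symmetric_reverse[OF assms, of c "x # r"]
    by (simp add: koszul_commute[of x] mult.left_commute)
  then show ?thesis
    by (rule cell_symmetricI[OF graded_symmetric_Cons[OF cell_symmetric_graded[OF assms]]])
qed

lemma cell_symmetric_mult:
  assumes F: "cell_symmetric F"
  shows "cell_symmetric (\<lambda>r. k * F r)"
proof (rule cell_symmetricI[OF graded_symmetric_mult[OF cell_symmetric_graded[OF F]]])
  show "k * F (c # r) = reverse_sign c * (k * F (reverse_cell c # r))" for c r
    using cell_symmetric_reverse[OF F, of c r] by (simp add: mult.left_commute)
qed

lemma cell_symmetric_zero [simp]: "cell_symmetric (\<lambda>r. 0)"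
  by (simp add: cell_symmetric_def reversal_symmetric_def)

lemma cell_symmetric_pick:
  assumes K: "\<And>a. cell_symmetric (K a)"
    and rev: "\<And>a r. K a r = reverse_sign a * K (reverse_cell a) r"
  shows "cell_symmetric (\<lambda>cs. pick cs K)"
proof -
  have "pick (c # cs) K = reverse_sign c * pick (reverse_cell c # cs) K" for c cs
  proof -
    have "pick cs (\<lambda>b r. koszul c b * K b (c # r))
        = pick cs (\<lambda>b r. reverse_sign c * (koszul (reverse_cell c) b * K b (reverse_cell c # r)))"
    proof (rule pick_cong)
      fix b r
      show "koszul c b * K b (c # r) = reverse_sign c * (koszul (reverse_cell c) b * K b (reverse_cell c # r))"
        using cell_symmetric_reverse[OF K, of b c r] by (simp add: mult.left_commute)
    qed
    then show ?thesis
      using rev[of c cs] by (simp add: pick_mult distrib_left)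
  qed
  then show ?thesis
    by (rule cell_symmetricI[OF graded_symmetric_pick[OF cell_symmetric_graded[OF K]]])
qed

lemma cell_symmetric_reattach_sum:
  assumes K: "cell_symmetric K"
  shows "cell_symmetric (\<lambda>cs. reattach_sum f cs K)"
proof -
  have "reattach_sum f (c # cs) K = reverse_sign c * reattach_sum f (reverse_cell c # cs) K" for c cs
  proof -
    have "reattach_sum f (reverse_cell c # cs) K
        = (\<Sum>c'\<leftarrow>cell_choices f c. reattach_sum f cs (\<lambda>r. K (reverse_cell c' # r)))"
    proof (cases c)
      case (Ed a b)
      show ?thesis
        unfolding Ed reverse_cell.simps reattach_sum.simps sum_list_cell_choices_Ed
        by (rule sum_list_map_swap)
    next
      case (Md a b)
      show ?thesis
        unfolding Md reverse_cell.simps reattach_sum.simps sum_list_cell_choices_Md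
        by (rule sum_list_map_swap)
    qed simp
    also have "\<dots> = (\<Sum>c'\<leftarrow>cell_choices f c. reverse_sign c * reattach_sum f cs (\<lambda>r. K (c' # r)))"
    proof (intro arg_cong[where f = sum_list] map_cong refl)
      fix c' assume "c' \<in> set (cell_choices f c)"
      then have c': "reverse_sign c' = (reverse_sign c :: 'a)" by (cases c) auto
      have "K (reverse_cell c' # r) = reverse_sign c * K (c' # r)" for r
        using cell_symmetric_reverse[OF K, of c' r] c' by (cases c) simp_all
      then show "reattach_sum f cs (\<lambda>r. K (reverse_cell c' # r))
          = reverse_sign c * reattach_sum f cs (\<lambda>r. K (c' # r))"
        by (simp add: reattach_sum_mult)
    qed
    finally have "reattach_sum f (reverse_cell c # cs) K = reverse_sign c * reattach_sum f (c # cs) K"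
      by (simp only: sum_list_const_mult reattach_sum.simps)
    moreover have "reverse_sign c * (reverse_sign c * z) = z" for z :: 'a
      by (cases c) simp_all
    ultimately show ?thesis
      by (simp only:)
  qed
  then show ?thesis
    by (rule cell_symmetricI[OF graded_symmetric_reattach_sum[OF cell_symmetric_graded[OF K]]])
qed

section \<open>Graph invariants and well-formed words\<close>

definition graph_invariant :: "(cell list \<Rightarrow> 'b) \<Rightarrow> bool" where
  "graph_invariant h \<longleftrightarrow> (\<forall>cs cs'. mset cs = mset cs' \<longrightarrow> h cs = h cs')
    \<and> (\<forall>c r. h (c # r) = h (reverse_cell c # r))
    \<and> (\<forall>\<rho> cs. inj \<rho> \<longrightarrow> h (map (rename \<rho>) cs) = h cs)"

lemma graph_invariant_mset: "graph_invariant h \<Longrightarrow> mset cs = mset cs' \<Longrightarrow> h cs = h cs'"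
  unfolding graph_invariant_def by blast

lemma graph_invariant_reverse: "graph_invariant h \<Longrightarrow> h (c # r) = h (reverse_cell c # r)"
  unfolding graph_invariant_def by blast

lemma graph_invariant_rename: "graph_invariant h \<Longrightarrow> inj \<rho> \<Longrightarrow> h (map (rename \<rho>) cs) = h cs"
  unfolding graph_invariant_def by blast

lemma graph_invariantI:
  assumes "\<And>cs cs'. mset cs = mset cs' \<Longrightarrow> h cs = h cs'" "\<And>c r. h (c # r) = h (reverse_cell c # r)"
    "\<And>\<rho> cs. inj \<rho> \<Longrightarrow> h (map (rename \<rho>) cs) = h cs"
  shows "graph_invariant h"
  unfolding graph_invariant_def using assms by blast

lemma graph_invariant_comp: "graph_invariant h \<Longrightarrow> graph_invariant (\<lambda>cs. g (h cs))"
  unfolding graph_invariant_def by metis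

lemma graph_invariant_comp2:
  "graph_invariant h \<Longrightarrow> graph_invariant h' \<Longrightarrow> graph_invariant (\<lambda>cs. g (h cs) (h' cs))"
  unfolding graph_invariant_def by metis

definition vertices :: "cell list \<Rightarrow> nat set" where
  "vertices cs = {x. Vx x \<in> set cs}"

text \<open>Ill-formed words act as a zero: every equivariant function vanishes on a word that still
  mentions a deleted vertex. In this way \<open>contract_op\<close> enforces that the contracted
  vertex meets nothing else.\<close>

definition wf_graph :: "cell list \<Rightarrow> bool" where
  "wf_graph cs \<longleftrightarrow> (\<forall>x. count (mset cs) (Vx x) \<le> 1) \<and> (\<forall>c\<in>set cs. set (cell_ends c) \<subseteq> vertices cs)"

definition supported :: "(cell list \<Rightarrow> bool) \<Rightarrow> (cell list \<Rightarrow> 'k::zero) \<Rightarrow> bool" where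
  "supported P F \<longleftrightarrow> (\<forall>cs. \<not> P cs \<longrightarrow> F cs = 0)"

lemma supportedD: "supported P F \<Longrightarrow> \<not> P cs \<Longrightarrow> F cs = 0"
  by (simp add: supported_def)

definition equivariant :: "(cell list \<Rightarrow> 'k::comm_ring_1) \<Rightarrow> bool" where
  "equivariant F \<longleftrightarrow> cell_symmetric F \<and> (\<forall>\<rho> cs. inj \<rho> \<longrightarrow> F (map (rename \<rho>) cs) = F cs)
    \<and> supported wf_graph F"

lemma equivariantD:
  assumes "equivariant F"
  shows "cell_symmetric F" "graded_symmetric F" "inj \<rho> \<Longrightarrow> F (map (rename \<rho>) cs) = F cs"
    "supported wf_graph F" "\<not> wf_graph cs \<Longrightarrow> F cs = 0"
    "F (c # r) = reverse_sign c * F (reverse_cell c # r)"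
proof -
  show F: "cell_symmetric F" "supported wf_graph F"
    using assms by (simp_all add: equivariant_def)
  show "graded_symmetric F" "F (c # r) = reverse_sign c * F (reverse_cell c # r)"
    by (rule cell_symmetric_graded[OF F(1)], rule cell_symmetric_reverse[OF F(1)])
  show "inj \<rho> \<Longrightarrow> F (map (rename \<rho>) cs) = F cs" "\<not> wf_graph cs \<Longrightarrow> F cs = 0"
    using assms by (simp_all add: equivariant_def supported_def)
qed

lemma equivariantI:
  assumes "cell_symmetric F" "\<And>\<rho> cs. inj \<rho> \<Longrightarrow> F (map (rename \<rho>) cs) = F cs" "supported wf_graph F"
  shows "equivariant F"
  using assms by (simp add: equivariant_def)

lemma equivariant_mult:
  assumes h: "graph_invariant h" and F: "equivariant F"
  shows "equivariant (\<lambda>cs. h cs * F cs)"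
proof (rule equivariantI[OF cell_symmetricI])
  show "graded_symmetric (\<lambda>cs. h cs * F cs)"
    unfolding graded_symmetric_def
  proof (intro allI)
    fix xs a b ys
    have "h (xs @ a # b # ys) = h (xs @ b # a # ys)"
      by (rule graph_invariant_mset[OF h]) simp
    then show "h (xs @ a # b # ys) * F (xs @ a # b # ys) = koszul a b * (h (xs @ b # a # ys) * F (xs @ b # a # ys))"
      using graded_symmetricD[OF equivariantD(2)[OF F], of xs a b ys] by (simp add: mult.left_commute)
  qed
  show "h (c # r) * F (c # r) = reverse_sign c * (h (reverse_cell c # r) * F (reverse_cell c # r))" for c r
    using graph_invariant_reverse[OF h, of c r] equivariantD(6)[OF F, of c r]
    by (simp add: mult.left_commute)
  show "h (map (rename \<rho>) cs) * F (map (rename \<rho>) cs) = h cs * F cs" if "inj \<rho>" for \<rho> cs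
    by (simp only: that graph_invariant_rename[OF h] equivariantD(3)[OF F])
  show "supported wf_graph (\<lambda>cs. h cs * F cs)"
    using equivariantD(5)[OF F] by (simp add: supported_def)
qed

lemma graph_invariant_const: "graph_invariant (\<lambda>cs. c)"
  by (simp add: graph_invariant_def)

lemma equivariant_add:
  assumes F: "equivariant F" and G: "equivariant G"
  shows "equivariant (\<lambda>cs. F cs + G cs)"
proof (rule equivariantI[OF cell_symmetricI])
  show "graded_symmetric (\<lambda>cs. F cs + G cs)"
    unfolding graded_symmetric_def
  proof (intro allI)
    fix xs a b ys
    show "F (xs @ a # b # ys) + G (xs @ a # b # ys)
        = koszul a b * (F (xs @ b # a # ys) + G (xs @ b # a # ys))"
      using graded_symmetricD[OF equivariantD(2)[OF F], of xs a b ys]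
        graded_symmetricD[OF equivariantD(2)[OF G], of xs a b ys] by (simp add: distrib_left)
  qed
  show "F (c # r) + G (c # r) = reverse_sign c * (F (reverse_cell c # r) + G (reverse_cell c # r))" for c r
    using equivariantD(6)[OF F, of c r] equivariantD(6)[OF G, of c r] by (simp add: distrib_left)
qed (use F G in \<open>simp_all add: supported_def equivariantD(3,5)\<close>)

lemma equivariant_scale: "equivariant F \<Longrightarrow> equivariant (\<lambda>cs. c * F cs)"
  by (rule equivariant_mult[OF graph_invariant_const])

lemma equivariant_diff: "equivariant F \<Longrightarrow> equivariant G \<Longrightarrow> equivariant (\<lambda>cs. F cs - G cs)"
  using equivariant_add[OF _ equivariant_scale[of G "-1"], of F] by simp

lemma equivariant_restrict:
  assumes "graph_invariant P" "equivariant F"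
  shows "equivariant (\<lambda>cs. if P cs then F cs else 0)"
proof -
  have "(\<lambda>cs. if P cs then F cs else 0) = (\<lambda>cs. of_bool (P cs) * F cs)"
    by auto
  then show ?thesis
    using equivariant_mult[OF graph_invariant_comp[OF assms(1)] assms(2), of of_bool] by (simp only:)
qed

lemma graph_invariant_sum_list:
  assumes "\<And>c. f (reverse_cell c) = f c" "\<And>c \<rho>. inj \<rho> \<Longrightarrow> f (rename \<rho> c) = f c"
  shows "graph_invariant (\<lambda>cs. \<Sum>c\<leftarrow>cs. f c :: 'b::comm_monoid_add)"
proof (rule graph_invariantI)
  show "(\<Sum>c\<leftarrow>cs. f c) = (\<Sum>c\<leftarrow>cs'. f c)" if "mset cs = mset cs'" for cs cs'
    by (rule sum_list_map_mset[OF that])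
  show "(\<Sum>d\<leftarrow>c # r. f d) = (\<Sum>d\<leftarrow>reverse_cell c # r. f d)" for c r
    by (simp add: assms(1))
  show "(\<Sum>c\<leftarrow>map (rename \<rho>) cs. f c) = (\<Sum>c\<leftarrow>cs. f c)" if "inj \<rho>" for \<rho> cs
    by (simp add: assms(2)[OF that] comp_def)
qed

lemma reverse_cell_eq_Vx [simp]: "Vx x = reverse_cell c \<longleftrightarrow> c = Vx x"
  by (cases c) auto

lemma rename_eq_Vx: "inj \<rho> \<Longrightarrow> rename \<rho> c = Vx (\<rho> x) \<longleftrightarrow> c = Vx x"
  by (cases c) (auto dest: injD)

lemma set_cell_ends_reverse [simp]: "set (cell_ends (reverse_cell c)) = set (cell_ends c)"
  by (cases c) auto

lemma cell_ends_rename [simp]: "cell_ends (rename \<rho> c) = map \<rho> (cell_ends c)"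
  by (cases c) simp_all

lemma vertices_simps [simp]:
  "vertices [] = {}" "vertices (Vx x # cs) = insert x (vertices cs)"
  "vertices (Ed a b # cs) = vertices cs" "vertices (Md a b # cs) = vertices cs"
  "vertices (xs @ ys) = vertices xs \<union> vertices ys"
  by (auto simp: vertices_def)

lemma vertices_reverse [simp]: "vertices (reverse_cell c # cs) = vertices (c # cs)"
  by (cases c) simp_all

lemma vertices_rename [simp]: "vertices (map (rename \<rho>) cs) = \<rho> ` vertices cs"
proof -
  have "vertices (map (rename \<rho>) (c # cs)) = \<rho> ` vertices (c # cs)"
    if "vertices (map (rename \<rho>) cs) = \<rho> ` vertices cs" for c cs
    using that by (cases c) simp_all
  then show ?thesis
    by (induction cs) simp_all
qed

lemma vertices_mset: "mset cs = mset cs' \<Longrightarrow> vertices cs = vertices cs'"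
  by (simp add: vertices_def) (metis set_mset_mset)

lemma finite_vertices [simp]: "finite (vertices cs)"
proof (induction cs)
  case (Cons c cs)
  then show ?case by (cases c) simp_all
qed simp

lemma wf_graph_Cons:
  "wf_graph (Vx x # cs) \<longleftrightarrow> x \<notin> vertices cs \<and> (\<forall>y. count (mset cs) (Vx y) \<le> 1)
    \<and> (\<forall>c\<in>set cs. set (cell_ends c) \<subseteq> insert x (vertices cs))"
  "\<not> odd_cell c \<or> c = Md a b \<Longrightarrow> wf_graph (c # cs) \<longleftrightarrow> set (cell_ends c) \<subseteq> vertices cs \<and> wf_graph cs"
proof -
  have "count (mset cs) (Vx x) = 0 \<longleftrightarrow> x \<notin> vertices cs"
    by (simp add: vertices_def)
  then show "wf_graph (Vx x # cs) \<longleftrightarrow> x \<notin> vertices cs \<and> (\<forall>y. count (mset cs) (Vx y) \<le> 1)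
    \<and> (\<forall>c\<in>set cs. set (cell_ends c) \<subseteq> insert x (vertices cs))"
    by (auto simp: wf_graph_def) (metis count_mset_0_iff zero_le)
  show "\<not> odd_cell c \<or> c = Md a b \<Longrightarrow> wf_graph (c # cs) \<longleftrightarrow> set (cell_ends c) \<subseteq> vertices cs \<and> wf_graph cs"
    by (cases c) (auto simp: wf_graph_def)
qed

lemma wf_graph_mset: "mset cs = mset cs' \<Longrightarrow> wf_graph cs = wf_graph cs'"
  using vertices_mset[of cs cs'] by (simp add: wf_graph_def) (metis set_mset_mset)

lemma graph_invariant_wf: "graph_invariant wf_graph"
proof -
  have "wf_graph (c # r) = wf_graph (reverse_cell c # r)" for c r
    by (cases c) (auto simp: wf_graph_Cons(2))
  moreover have "wf_graph (map (rename \<rho>) cs) = wf_graph cs" if \<rho>: "inj \<rho>" for \<rho> cs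
  proof -
    have c: "count (mset (map (rename \<rho>) cs)) (Vx (\<rho> x)) = count (mset cs) (Vx x)" for x
      by (induction cs) (auto simp: rename_eq_Vx[OF \<rho>])
    have "(\<forall>x. count (mset (map (rename \<rho>) cs)) (Vx x) \<le> 1) \<longleftrightarrow> (\<forall>x. count (mset cs) (Vx x) \<le> 1)"
    proof
      assume "\<forall>x. count (mset (map (rename \<rho>) cs)) (Vx x) \<le> 1"
      then show "\<forall>x. count (mset cs) (Vx x) \<le> 1" using c by metis
    next
      assume *: "\<forall>x. count (mset cs) (Vx x) \<le> 1"
      show "\<forall>x. count (mset (map (rename \<rho>) cs)) (Vx x) \<le> 1"
      proof
        fix x
        show "count (mset (map (rename \<rho>) cs)) (Vx x) \<le> 1"
        proof (cases "Vx x \<in> set (map (rename \<rho>) cs)")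
          case True
          then have "x \<in> \<rho> ` vertices cs"
            using vertices_rename[of \<rho> cs] by (auto simp: vertices_def)
          then show ?thesis using c * by (metis imageE)
        next
          case False
          then show ?thesis by (metis count_mset_0_iff zero_le)
        qed
      qed
    qed
    moreover have "(\<forall>c\<in>set (map (rename \<rho>) cs). set (cell_ends c) \<subseteq> \<rho> ` vertices cs)
        \<longleftrightarrow> (\<forall>c\<in>set cs. set (cell_ends c) \<subseteq> vertices cs)"
      by (simp add: inj_image_subset_iff[OF \<rho>])
    ultimately show ?thesis by (simp add: wf_graph_def)
  qed
  ultimately show ?thesis
    using graph_invariantI[of wf_graph] wf_graph_mset by blast
qed

text \<open>Ends without a vertex letter are included, so that a fresh name is fresh for ill-formed
  words too.\<close>

definition names :: "cell list \<Rightarrow> nat set" where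
  "names cs = vertices cs \<union> (\<Union>c\<in>set cs. set (cell_ends c))"

lemma names_simps [simp]:
  "names [] = {}" "names (Vx x # cs) = insert x (names cs)"
  "names (Ed a b # cs) = {a, b} \<union> names cs" "names (Md a b # cs) = {a, b} \<union> names cs"
  "names (xs @ ys) = names xs \<union> names ys"
  by (auto simp: names_def)

lemma names_mset: "mset cs = mset cs' \<Longrightarrow> names cs = names cs'"
  using vertices_mset[of cs cs'] unfolding names_def by (metis set_mset_mset)

lemma names_reverse [simp]: "names (reverse_cell c # cs) = names (c # cs)"
  by (cases c) auto

lemma finite_names [simp]: "finite (names cs)"
  by (simp add: names_def)

lemma names_rename [simp]: "names (map (rename \<rho>) cs) = \<rho> ` names cs"
  by (auto simp: names_def)

lemma names_wf: "wf_graph cs \<Longrightarrow> names cs = vertices cs"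
  by (auto simp: names_def wf_graph_def)

lemma rename_cong_names: "(\<And>i. i \<in> names cs \<Longrightarrow> \<rho> i = i) \<Longrightarrow> map (rename \<rho>) cs = cs"
proof (induction cs)
  case (Cons c cs)
  then show ?case by (cases c) auto
qed simp

definition fresh_vertex :: "cell list \<Rightarrow> nat" where
  "fresh_vertex cs = Suc (Max (insert 0 (names cs)))"

lemma fresh_vertex: "fresh_vertex cs \<notin> names cs"
  using Max_ge[of "insert 0 (names cs)" "fresh_vertex cs"] unfolding fresh_vertex_def by fastforce

lemma supported_pick:
  assumes P: "graph_invariant P" and "\<And>a r. \<not> P (a # r) \<Longrightarrow> K a r = 0"
  shows "supported P (\<lambda>cs. pick cs K)"
  unfolding supported_def
proof (intro allI impI)
  fix cs assume "\<not> P cs"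
  then show "pick cs K = 0"
    using assms(2) graph_invariant_mset[OF P] by (intro pick_zero) metis
qed

lemma supported_pick_pick:
  assumes P: "graph_invariant P" and "\<And>a b r. \<not> P (a # b # r) \<Longrightarrow> K a b r = 0"
  shows "supported P (\<lambda>cs. pick cs (\<lambda>a r. pick r (K a)))"
proof (intro supported_pick[OF P] pick_zero)
  fix a r b q assume "\<not> P (a # r)" "mset (b # q) = mset r"
  then show "K a b q = 0"
    using assms(2)[of a b q] graph_invariant_mset[OF P, of "a # r" "a # b # q"] by simp
qed

lemma supported_pick_pick_pick:
  assumes P: "graph_invariant P" and "\<And>a b c r. \<not> P (a # b # c # r) \<Longrightarrow> K a b c r = 0"
  shows "supported P (\<lambda>cs. pick cs (\<lambda>a r. pick r (\<lambda>b r. pick r (K a b))))"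
proof (intro supported_pick_pick[OF P] pick_zero)
  fix a b r c q assume "\<not> P (a # b # r)" "mset (c # q) = mset r"
  then show "K a b c q = 0"
    using assms(2)[of a b c q] graph_invariant_mset[OF P, of "a # b # r" "a # b # c # q"] by simp
qed

section \<open>The operators\<close>

lemma cell_symmetric_append: "cell_symmetric F \<Longrightarrow> cell_symmetric (\<lambda>r. F (xs @ r))"
proof (induction xs arbitrary: F)
  case (Cons x xs)
  from Cons.IH[OF cell_symmetric_Cons[OF Cons.prems, of x]] show ?case by simp
qed simp

definition branch :: "nat \<Rightarrow> nat \<Rightarrow> nat \<Rightarrow> nat list" where
  "branch x w i = (if i = x then [x, w] else [i])"

text \<open>The new vertex stands in front of the old one, while in a split labelled graph it is the
  last vertex. The difference is the sign in \<open>cells_of_split_vertex\<close>.\<close>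

fun split_vertex_cell :: "nat \<Rightarrow> (cell list \<Rightarrow> 'k::comm_ring_1) \<Rightarrow> cell \<Rightarrow> cell list \<Rightarrow> 'k" where
  "split_vertex_cell w F (Vx x) r = reattach_sum (branch x w) r (\<lambda>r'. F (Vx w # Vx x # Ed x w # r'))"
| "split_vertex_cell w F (Ed a b) r = 0"
| "split_vertex_cell w F (Md a b) r = 0"

definition split_with :: "nat \<Rightarrow> (cell list \<Rightarrow> 'k::comm_ring_1) \<Rightarrow> cell list \<Rightarrow> 'k" where
  "split_with w F cs = pick cs (split_vertex_cell w F)"

text \<open>The dual of the differential that splits vertices in all possible ways.\<close>

definition split_op :: "(cell list \<Rightarrow> 'k::comm_ring_1) \<Rightarrow> cell list \<Rightarrow> 'k" where
  "split_op F cs = split_with (fresh_vertex cs) F cs"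

text \<open>The relative direction of two parallel edges. Being odd under reversal of either edge,
  it compensates the signs of \<open>reverse_sign\<close> and makes marking independent of
  directions.\<close>

fun parallel_sign :: "cell \<Rightarrow> cell \<Rightarrow> 'k::comm_ring_1" where
  "parallel_sign (Ed a b) (Ed c d)
    = (if a = b then 0 else of_bool (c = a \<and> d = b) - of_bool (c = b \<and> d = a))"
| "parallel_sign (Vx x) c = 0"
| "parallel_sign (Md a b) c = 0"
| "parallel_sign c (Vx x) = 0"
| "parallel_sign c (Md a b) = 0"

fun mark :: "cell \<Rightarrow> cell" where
  "mark (Vx x) = Vx x"
| "mark (Ed a b) = Md a b"
| "mark (Md a b) = Md a b"

text \<open>A letter \<open>Md a b\<close> stands for an odd double edge.  \<open>mark_op\<close> evaluates a function after
  replacing a pair of parallel edges by such a double edge, and \<open>unmark_op\<close> goes back.\<close>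

definition mark_op :: "(cell list \<Rightarrow> 'k::comm_ring_1) \<Rightarrow> cell list \<Rightarrow> 'k" where
  "mark_op F cs = pick cs (\<lambda>a r. pick r (\<lambda>b q. parallel_sign a b * F (mark a # q)))"

fun unmark_cell :: "(cell list \<Rightarrow> 'k::comm_ring_1) \<Rightarrow> cell \<Rightarrow> cell list \<Rightarrow> 'k" where
  "unmark_cell F (Md a b) r = F (Ed a b # Ed a b # r)"
| "unmark_cell F (Vx x) r = 0"
| "unmark_cell F (Ed a b) r = 0"

definition unmark_op :: "(cell list \<Rightarrow> 'k::comm_ring_1) \<Rightarrow> cell list \<Rightarrow> 'k" where
  "unmark_op F cs = pick cs (unmark_cell F)"

fun contract_coeff :: "bool \<Rightarrow> cell \<Rightarrow> cell \<Rightarrow> cell \<Rightarrow> 'k::comm_ring_1" where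
  "contract_coeff l (Vx z) (Ed p q) (Md s t) = (of_bool (q = z) - of_bool (p = z))
    * of_bool (if l then s = z \<and> t = z else (s = z) \<noteq> (t = z))"
| "contract_coeff l a b c = 0"

fun contract_cell :: "cell \<Rightarrow> cell \<Rightarrow> cell \<Rightarrow> cell" where
  "contract_cell (Vx z) (Ed p q) (Md s t) = (let x = (if p = z then q else p)
    in Md x (if s = z then (if t = z then x else t) else s))"
| "contract_cell a b c = c"

text \<open>The contracting homotopies: a vertex \<open>z\<close> that meets exactly one edge, joining it to \<open>x\<close>, and
  one double edge, joining it to \<open>y\<close>, is removed and the double edge now joins \<open>x\<close> to \<open>y\<close>.  For
  \<open>l = True\<close> the double edge is a loop at \<open>z\<close> and becomes a loop at \<open>x\<close>.\<close>

definition contract_op :: "bool \<Rightarrow> (cell list \<Rightarrow> 'k::comm_ring_1) \<Rightarrow> cell list \<Rightarrow> 'k" where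
  "contract_op l F cs = of_bool (wf_graph cs) * pick cs (\<lambda>a r. pick r (\<lambda>b r. pick r (\<lambda>c r.
    contract_coeff l a b c * F (contract_cell a b c # r))))"

section \<open>The operators preserve equivariance and pull back supports\<close>

lemma split_with_rename:
  assumes \<rho>: "inj \<rho>" and F: "equivariant F"
  shows "split_with (\<rho> w) F (map (rename \<rho>) cs) = split_with w F cs"
  unfolding split_with_def pick_rename
proof (rule pick_cong)
  fix a r
  show "split_vertex_cell (\<rho> w) F (rename \<rho> a) (map (rename \<rho>) r) = split_vertex_cell w F a r"
  proof (cases a)
    case (Vx x)
    have "reattach_sum (branch (\<rho> x) (\<rho> w)) (map (rename \<rho>) r) K
        = reattach_sum (branch x w) r (\<lambda>r'. K (map (rename \<rho>) r'))" for K :: "cell list \<Rightarrow> 'a"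
      by (rule reattach_sum_rename) (simp add: branch_def inj_eq[OF \<rho>])
    moreover have "F (Vx (\<rho> w) # Vx (\<rho> x) # Ed (\<rho> x) (\<rho> w) # map (rename \<rho>) r')
        = F (Vx w # Vx x # Ed x w # r')" for r'
      using equivariantD(3)[OF F \<rho>, of "Vx w # Vx x # Ed x w # r'"] by simp
    ultimately show ?thesis
      unfolding Vx by simp
  qed simp_all
qed

text \<open>Transposing two fresh names fixes the word, hence also the value.\<close>

lemma split_with_indep:
  assumes F: "equivariant F" and w: "w \<notin> names cs" "w' \<notin> names cs"
  shows "split_with w F cs = split_with w' F cs"
proof -
  have "map (rename (transpose w w')) cs = cs"
    by (rule rename_cong_names) (use w in \<open>auto simp: transpose_def\<close>)
  then show ?thesis
    using split_with_rename[OF _ F, of "transpose w w'" w cs] by simp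
qed

lemma split_op_eq:
  "equivariant F \<Longrightarrow> w \<notin> names cs \<Longrightarrow> split_op F cs = split_with w F cs"
  unfolding split_op_def by (rule split_with_indep[OF _ fresh_vertex])

lemma cell_symmetric_split_with:
  assumes F: "cell_symmetric F"
  shows "cell_symmetric (split_with w F)"
proof -
  have zero: "split_vertex_cell w F (Ed p q) = (\<lambda>r. 0)" "split_vertex_cell w F (Md p q) = (\<lambda>r. 0)" for p q
    by (simp_all add: fun_eq_iff)
  have "cell_symmetric (split_vertex_cell w F a)" for a
  proof (cases a)
    case (Vx x)
    have "split_vertex_cell w F a
        = (\<lambda>r. reattach_sum (branch x w) r (\<lambda>r'. F (Vx w # Vx x # Ed x w # r')))"
      by (simp add: Vx fun_eq_iff)
    then show ?thesis
      using cell_symmetric_append[OF F, of "[Vx w, Vx x, Ed x w]"]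
      by (simp add: cell_symmetric_reattach_sum)
  qed (simp_all add: zero)
  moreover have "split_vertex_cell w F a r = reverse_sign a * split_vertex_cell w F (reverse_cell a) r"
    for a r by (cases a) simp_all
  ultimately show ?thesis
    unfolding split_with_def by (rule cell_symmetric_pick)
qed

lemma fresh_vertex_cong: "names cs = names cs' \<Longrightarrow> fresh_vertex cs = fresh_vertex cs'"
  by (simp add: fresh_vertex_def)

lemma choices_count_Vx:
  "list_all2 (\<lambda>c c'. c' \<in> set (cell_choices f c)) r r' \<Longrightarrow> count (mset r') (Vx y) = count (mset r) (Vx y)"
proof (induction rule: list_all2_induct)
  case (Cons c r c' r')
  then show ?case by (cases c) auto
qed simp

lemma choices_vertices:
  assumes "list_all2 (\<lambda>c c'. c' \<in> set (cell_choices f c)) r r'"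
  shows "vertices r' = vertices r"
proof -
  have v: "y \<in> vertices cs \<longleftrightarrow> count (mset cs) (Vx y) \<noteq> 0" for y cs
    by (simp add: vertices_def)
  show ?thesis
    by (rule set_eqI) (simp only: v choices_count_Vx[OF assms])
qed

lemma choices_ends:
  assumes "list_all2 (\<lambda>c c'. c' \<in> set (cell_choices f c)) r r'" "c \<in> set r" "i \<in> set (cell_ends c)"
  obtains c' j where "c' \<in> set r'" "j \<in> set (f i)" "j \<in> set (cell_ends c')"
proof -
  obtain c' where c': "c' \<in> set r'" "c' \<in> set (cell_choices f c)"
    using assms(1,2) by (induction rule: list_all2_induct) auto
  moreover have "\<exists>j\<in>set (f i). j \<in> set (cell_ends c')"
    using c'(2) assms(3) by (cases c) auto
  ultimately show thesis
    using that by blast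
qed

text \<open>A term of the sum is nonzero only if the split word satisfies \<open>P'\<close>; so
  every support statement reduces to pulling the condition back along one splitting.\<close>

lemma supported_split_op:
  assumes P: "graph_invariant P" and F: "supported P' F"
    and step: "\<And>x w r r'. w \<notin> names (Vx x # r) \<Longrightarrow>
      list_all2 (\<lambda>c c'. c' \<in> set (cell_choices (branch x w) c)) r r' \<Longrightarrow>
      P' (Vx w # Vx x # Ed x w # r') \<Longrightarrow> P (Vx x # r)"
  shows "supported P (split_op F)"
  unfolding supported_def
proof (intro allI impI)
  fix cs assume cs: "\<not> P cs"
  show "split_op F cs = 0"
    unfolding split_op_def split_with_def
  proof (rule pick_zero)
    fix a r assume ar: "mset (a # r) = mset cs"
    show "split_vertex_cell (fresh_vertex cs) F a r = 0"
    proof (cases a)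
      case (Vx x)
      have "\<not> P (Vx x # r)" "fresh_vertex cs \<notin> names (Vx x # r)"
        using cs graph_invariant_mset[OF P ar] fresh_vertex[of cs] names_mset[OF ar] Vx by simp_all
      then show ?thesis
        unfolding Vx split_vertex_cell.simps
        by (intro reattach_sum_zero supportedD[OF F]) (use step in blast)
    qed simp_all
  qed
qed

lemma equivariant_split_op:
  assumes F: "equivariant F"
  shows "equivariant (split_op F)"
proof (rule equivariantI[OF cell_symmetricI])
  have sym: "cell_symmetric (split_with w F)" for w
    by (rule cell_symmetric_split_with[OF equivariantD(1)[OF F]])
  show "graded_symmetric (split_op F)"
    unfolding graded_symmetric_def
  proof (intro allI)
    fix xs a b ys
    have "fresh_vertex (xs @ a # b # ys) = fresh_vertex (xs @ b # a # ys)"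
      by (intro fresh_vertex_cong names_mset) simp
    then show "split_op F (xs @ a # b # ys) = koszul a b * split_op F (xs @ b # a # ys)"
      unfolding split_op_def using graded_symmetricD[OF cell_symmetric_graded[OF sym]] by metis
  qed
  show "split_op F (c # r) = reverse_sign c * split_op F (reverse_cell c # r)" for c r
    unfolding split_op_def fresh_vertex_cong[OF names_reverse]
    by (rule cell_symmetric_reverse[OF sym])
  show "split_op F (map (rename \<rho>) cs) = split_op F cs" if \<rho>: "inj \<rho>" for \<rho> cs
  proof -
    have "\<rho> (fresh_vertex cs) \<notin> names (map (rename \<rho>) cs)"
      using fresh_vertex[of cs] inj_image_mem_iff[OF \<rho>] by simp
    from split_op_eq[OF F this] show ?thesis
      unfolding split_with_rename[OF \<rho> F] split_op_def .
  qed
  show "supported wf_graph (split_op F)"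
  proof (rule supported_split_op[OF graph_invariant_wf equivariantD(4)[OF F]])
    fix x w r r'
    assume w: "w \<notin> names (Vx x # r)"
      and r: "list_all2 (\<lambda>c c'. c' \<in> set (cell_choices (branch x w) c)) r r'"
      and wf: "wf_graph (Vx w # Vx x # Ed x w # r')"
    have v: "vertices r' = vertices r"
      by (rule choices_vertices[OF r])
    have c: "count (mset (Vx w # Vx x # Ed x w # r')) (Vx y) \<le> 1" for y
      using wf unfolding wf_graph_def by blast
    have "count (mset r) (Vx x) = 0"
      using c[of x] by (simp add: choices_count_Vx[OF r] split: if_splits)
    then have "x \<notin> vertices r"
      by (simp add: vertices_def)
    moreover have "\<forall>y. count (mset r) (Vx y) \<le> 1"
    proof
      fix y
      have "count (mset r') (Vx y) \<le> count (mset (Vx w # Vx x # Ed x w # r')) (Vx y)"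
        by simp
      with c[of y] show "count (mset r) (Vx y) \<le> 1"
        unfolding choices_count_Vx[OF r] by linarith
    qed
    moreover have "i \<in> insert x (vertices r)" if c: "c \<in> set r" and i: "i \<in> set (cell_ends c)" for c i
    proof (cases "i = x")
      case False
      obtain c' j where c': "c' \<in> set r'" "j \<in> set (branch x w i)" "j \<in> set (cell_ends c')"
        using choices_ends[OF r c i] by metis
      then have "i \<in> set (cell_ends c')"
        using False by (simp add: branch_def)
      then have "i \<in> insert w (insert x (vertices r))"
        using wf c'(1) unfolding wf_graph_Cons by (auto simp: v)
      moreover have "i \<noteq> w"
        using w c i by (auto simp: names_def)
      ultimately show ?thesis by simp
    qed simp
    ultimately show "wf_graph (Vx x # r)"
      unfolding wf_graph_Cons by blast
  qed
qed

lemma parallel_sign_reverse: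
  "parallel_sign (reverse_cell a) b = reverse_sign a * parallel_sign a b"
  "parallel_sign a (reverse_cell b) = reverse_sign b * parallel_sign a b"
  by (cases a; cases b; auto)+

lemma parallel_sign_rename: "inj \<rho> \<Longrightarrow> parallel_sign (rename \<rho> a) (rename \<rho> b) = parallel_sign a b"
  by (cases a; cases b; auto simp: inj_eq)

lemma mark_rename: "mark (rename \<rho> a) = rename \<rho> (mark a)"
  by (cases a) simp_all

lemma reverse_sign_square [simp]: "reverse_sign a * (reverse_sign a * z) = (z :: 'k::comm_ring_1)"
  by (cases a) simp_all

lemma graph_invariant_reverse_at:
  assumes P: "graph_invariant P"
  shows "P (xs @ c # ys) = P (xs @ reverse_cell c # ys)"
proof -
  have "P (xs @ c # ys) = P (c # xs @ ys)" for c
    by (rule graph_invariant_mset[OF P]) simp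
  then show ?thesis
    using graph_invariant_reverse[OF P, of c "xs @ ys"] by simp
qed

lemma parallel_sign_nonzero:
  assumes "parallel_sign a b \<noteq> (0 :: 'k::comm_ring_1)"
  obtains p q where "p \<noteq> q" "a = Ed p q" "b = a \<or> b = reverse_cell a"
  using assms by (cases a; cases b) (auto simp: of_bool_def split: if_splits)

lemma supported_mark_op:
  assumes P: "graph_invariant P" and F: "supported P' F"
    and step: "\<And>p q r. p \<noteq> q \<Longrightarrow> P' (Md p q # r) \<Longrightarrow> P (Ed p q # Ed p q # r)"
  shows "supported P (mark_op F)"
  unfolding mark_op_def
proof (rule supported_pick_pick[OF P])
  fix a b r assume n: "\<not> P (a # b # r)"
  show "parallel_sign a b * F (mark a # r) = 0"
  proof (cases "parallel_sign a b = (0 :: 'a)")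
    case False
    then obtain p q where pq: "p \<noteq> q" "a = Ed p q" "b = a \<or> b = reverse_cell a"
      by (rule parallel_sign_nonzero)
    then have "\<not> P (Ed p q # Ed p q # r)"
      using n graph_invariant_reverse_at[OF P, of "[Ed p q]" "Ed p q" r] by auto
    then have "F (Md p q # r) = 0"
      using step[OF pq(1)] supportedD[OF F] by blast
    then show ?thesis
      by (simp add: pq(2))
  qed simp
qed

lemma equivariant_mark_op:
  assumes F: "equivariant F"
  shows "equivariant (mark_op F)"
proof (rule equivariantI)
  have sym: "cell_symmetric (\<lambda>q. parallel_sign a b * F (mark a # q))" for a b
    by (rule cell_symmetric_mult[OF cell_symmetric_Cons[OF equivariantD(1)[OF F]]])
  have m: "parallel_sign a b * F (mark (reverse_cell a) # q) = parallel_sign a b * F (mark a # q)" for a b q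
    using equivariantD(6)[OF F, of "mark a" q] by (cases a) simp_all
  show "cell_symmetric (mark_op F)"
    unfolding mark_op_def
    by (intro cell_symmetric_pick[OF cell_symmetric_pick[OF sym]])
      (simp_all add: parallel_sign_reverse pick_mult[symmetric] mult.assoc m)
  show "mark_op F (map (rename \<rho>) cs) = mark_op F cs" if \<rho>: "inj \<rho>" for \<rho> cs
    unfolding mark_op_def pick_rename parallel_sign_rename[OF \<rho>] mark_rename
    using equivariantD(3)[OF F \<rho>, of "mark _ # _"] by simp
  show "supported wf_graph (mark_op F)"
    by (rule supported_mark_op[OF graph_invariant_wf equivariantD(4)[OF F]])
      (simp add: wf_graph_Cons(2))
qed

lemma supported_unmark_op:
  assumes P: "graph_invariant P" and F: "supported P' F"
    and step: "\<And>p q r. P' (Ed p q # Ed p q # r) \<Longrightarrow> P (Md p q # r)"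
  shows "supported P (unmark_op F)"
  unfolding unmark_op_def
proof (rule supported_pick[OF P])
  fix a r assume "\<not> P (a # r)"
  then show "unmark_cell F a r = 0"
    using step supportedD[OF F] by (cases a) auto
qed

lemma equivariant_unmark_op:
  assumes F: "equivariant F"
  shows "equivariant (unmark_op F)"
proof (rule equivariantI)
  have "unmark_cell F (Vx p) = (\<lambda>r. 0)" "unmark_cell F (Ed p q) = (\<lambda>r. 0)"
    "unmark_cell F (Md p q) = (\<lambda>r. F ([Ed p q, Ed p q] @ r))" for p q
    by (simp_all add: fun_eq_iff)
  then have "cell_symmetric (unmark_cell F a)" for a
    by (cases a) (simp_all only: cell_symmetric_append[OF equivariantD(1)[OF F]] cell_symmetric_zero)
  moreover have "unmark_cell F a r = reverse_sign a * unmark_cell F (reverse_cell a) r" for a r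
  proof (cases a)
    case (Md p q)
    have "F (Ed p q # Ed p q # r) = F (Ed q p # Ed q p # r)"
      using equivariantD(6)[OF F, of "Ed p q" "Ed p q # r"]
        cell_symmetric_reverse[OF cell_symmetric_Cons[OF equivariantD(1)[OF F], of "Ed q p"], of "Ed p q" r]
      by simp
    then show ?thesis
      using Md by simp
  qed simp_all
  ultimately show "cell_symmetric (unmark_op F)"
    unfolding unmark_op_def by (rule cell_symmetric_pick)
  show "unmark_op F (map (rename \<rho>) cs) = unmark_op F cs" if \<rho>: "inj \<rho>" for \<rho> cs
    unfolding unmark_op_def pick_rename
  proof (rule pick_cong)
    fix a r
    show "unmark_cell F (rename \<rho> a) (map (rename \<rho>) r) = unmark_cell F a r"
    proof (cases a)
      case (Md p q)
      then show ?thesis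
        using equivariantD(3)[OF F \<rho>, of "Ed p q # Ed p q # r"] by simp
    qed simp_all
  qed
  show "supported wf_graph (unmark_op F)"
    by (rule supported_unmark_op[OF graph_invariant_wf equivariantD(4)[OF F]])
      (simp add: wf_graph_Cons(2))
qed

text \<open>Up to reversal of letters there is only one contractible configuration, which spares
  later arguments the distinction of directions.\<close>

lemma contract_coeff_nonzero:
  assumes "contract_coeff l a b c \<noteq> (0 :: 'k::comm_ring_1)"
  obtains z x y where "a = Vx z" "x \<noteq> z" "l \<longleftrightarrow> y = z"
    "b = Ed x z \<or> b = reverse_cell (Ed x z)" "c = Md y z \<or> c = reverse_cell (Md y z)"
    "contract_cell a b c = Md x (if l then x else y)"
proof -
  obtain z p q s t where abc: "a = Vx z" "b = Ed p q" "c = Md s t"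
    using assms by (cases a; cases b; cases c) auto
  have 1: "(p = z) \<noteq> (q = z)" "if l then s = z \<and> t = z else (s = z) \<noteq> (t = z)"
    using assms unfolding abc by (auto simp: of_bool_def split: if_splits)
  show thesis
    by (rule that[of z "if p = z then q else p" "if s = z then t else s"])
      (use abc 1 in \<open>auto split: if_splits\<close>)
qed

lemma contract_coeff_reverse:
  "contract_coeff l a (reverse_cell b) c = reverse_sign b * contract_coeff l a b c"
  "contract_coeff l a b (reverse_cell c) = contract_coeff l a b c"
  by (cases a; cases b; cases c; auto)+

lemma contract_cell_reverse:
  assumes "contract_coeff l a b c \<noteq> (0 :: 'k::comm_ring_1)"
  shows "contract_cell a (reverse_cell b) c = contract_cell a b c"
    "contract_cell a b (reverse_cell c) = contract_cell a b c"
  by (rule contract_coeff_nonzero[OF assms], auto)+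

lemma supported_contract_op:
  assumes P: "graph_invariant P" and F: "supported P' F"
    and step: "\<And>z x y r. x \<noteq> z \<Longrightarrow> (l \<longleftrightarrow> y = z) \<Longrightarrow> wf_graph (Vx z # Ed x z # Md y z # r) \<Longrightarrow>
      P' (Md x (if l then x else y) # r) \<Longrightarrow> P (Vx z # Ed x z # Md y z # r)"
  shows "supported P (contract_op l F)"
proof -
  \<comment> \<open>The factor \<open>of_bool (wf_graph cs)\<close> in \<open>contract_op\<close>
    supplies well-formedness as an additional hypothesis; the implication is again a graph
    invariant.\<close>
  let ?Q = "\<lambda>cs. wf_graph cs \<longrightarrow> P cs"
  have Q: "graph_invariant ?Q"
    by (rule graph_invariant_comp2[OF graph_invariant_wf P])
  have "supported ?Q (\<lambda>cs. pick cs (\<lambda>a r. pick r (\<lambda>b r. pick r (\<lambda>c r.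
    contract_coeff l a b c * F (contract_cell a b c # r)))))"
  proof (rule supported_pick_pick_pick[OF Q])
    fix a b c r assume n: "\<not> ?Q (a # b # c # r)"
    show "contract_coeff l a b c * F (contract_cell a b c # r) = 0"
    proof (cases "contract_coeff l a b c = (0 :: 'a)")
      case False
      then obtain z x y where z: "a = Vx z" "x \<noteq> z" "l \<longleftrightarrow> y = z"
        "b = Ed x z \<or> b = reverse_cell (Ed x z)" "c = Md y z \<or> c = reverse_cell (Md y z)"
        "contract_cell a b c = Md x (if l then x else y)"
        by (rule contract_coeff_nonzero)
      have "?Q (a # b # c # r) = ?Q (a # Ed x z # c # r)"
        using z(4) graph_invariant_reverse_at[OF Q, of "[a]" "Ed x z" "c # r"] by auto
      also have "\<dots> = ?Q (a # Ed x z # Md y z # r)"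
        using z(5) graph_invariant_reverse_at[OF Q, of "[a, Ed x z]" "Md y z" r] by auto
      finally have "\<not> P' (Md x (if l then x else y) # r)"
        using n step[OF z(2,3)] z(1) by auto
      then show ?thesis
        using supportedD[OF F] z(6) by simp
    qed simp
  qed
  then show ?thesis
    by (auto simp: supported_def contract_op_def)
qed

lemma equivariant_contract_op:
  assumes F: "equivariant F"
  shows "equivariant (contract_op l F)"
proof -
  let ?H = "\<lambda>cs. pick cs (\<lambda>a r. pick r (\<lambda>b r. pick r (\<lambda>c r.
    contract_coeff l a b c * F (contract_cell a b c # r))))"
  have wf: "graph_invariant (\<lambda>cs. of_bool (wf_graph cs) :: 'a)"
    by (rule graph_invariant_comp[OF graph_invariant_wf])
  have sym: "cell_symmetric (\<lambda>q. contract_coeff l a b c * F (contract_cell a b c # q))" for a b c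
    by (rule cell_symmetric_mult[OF cell_symmetric_Cons[OF equivariantD(1)[OF F]]])
  have 1: "contract_coeff l a b c * F (contract_cell a b (reverse_cell c) # q)
      = contract_coeff l a b c * F (contract_cell a b c # q)"
    "contract_coeff l a b c * F (contract_cell a (reverse_cell b) c # q)
      = contract_coeff l a b c * F (contract_cell a b c # q)" for a b c q
    by (cases "contract_coeff l a b c = (0 :: 'a)"; simp add: contract_cell_reverse)+
  have 2: "reverse_sign c * z = z" if "\<not> (\<exists>a b. c = Ed a b)" for c and z :: 'a
    using that by (cases c) auto
  have H: "cell_symmetric ?H"
  proof (intro cell_symmetric_pick)
    show "contract_coeff l a b c * F (contract_cell a b c # r) = reverse_sign c *
      (contract_coeff l a b (reverse_cell c) * F (contract_cell a b (reverse_cell c) # r))" for a b c r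
      by (cases a; cases b; cases c) (use 1(1)[of a b c r] contract_coeff_reverse(2)[of l a b c] in simp_all)
    show "pick r (\<lambda>c r. contract_coeff l a b c * F (contract_cell a b c # r)) = reverse_sign b *
      pick r (\<lambda>c r. contract_coeff l a (reverse_cell b) c * F (contract_cell a (reverse_cell b) c # r))" for a b r
      by (simp add: contract_coeff_reverse pick_mult[symmetric] mult.assoc 1)
    show "pick r (\<lambda>b r. pick r (\<lambda>c r. contract_coeff l a b c * F (contract_cell a b c # r))) = reverse_sign a *
      pick r (\<lambda>b r. pick r (\<lambda>c r. contract_coeff l (reverse_cell a) b c * F (contract_cell (reverse_cell a) b c # r)))" for a r
      by (cases a) (simp_all add: pick_zero)
  qed (rule sym)
  have ren: "?H (map (rename \<rho>) cs) = ?H cs" if \<rho>: "inj \<rho>" for \<rho> cs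
  proof -
    have "contract_coeff l (rename \<rho> a) (rename \<rho> b) (rename \<rho> c) = (contract_coeff l a b c :: 'a)" for a b c
      by (cases a; cases b; cases c) (simp_all add: inj_eq[OF \<rho>])
    moreover have "contract_cell (rename \<rho> a) (rename \<rho> b) (rename \<rho> c) = rename \<rho> (contract_cell a b c)" for a b c
      by (cases a; cases b; cases c) (auto simp add: inj_eq[OF \<rho>] Let_def)
    ultimately show ?thesis
      unfolding pick_rename using equivariantD(3)[OF F \<rho>, of "contract_cell _ _ _ # _"] by simp
  qed
  show ?thesis
  proof (rule equivariantI[OF cell_symmetricI])
    show "graded_symmetric (contract_op l F)"
      unfolding graded_symmetric_def contract_op_def
    proof (intro allI)
      fix xs a b ys
      have "wf_graph (xs @ a # b # ys) = wf_graph (xs @ b # a # ys)"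
        by (rule wf_graph_mset) simp
      with graded_symmetricD[OF cell_symmetric_graded[OF H], of xs a b ys]
      show "of_bool (wf_graph (xs @ a # b # ys)) * ?H (xs @ a # b # ys)
        = koszul a b * (of_bool (wf_graph (xs @ b # a # ys)) * ?H (xs @ b # a # ys))"
        by (simp only: mult.left_commute)
    qed
    show "contract_op l F (c # r) = reverse_sign c * contract_op l F (reverse_cell c # r)" for c r
      unfolding contract_op_def cell_symmetric_reverse[OF H, of c r]
        graph_invariant_reverse[OF graph_invariant_wf, of c r] by (simp only: mult.left_commute)
    show "contract_op l F (map (rename \<rho>) cs) = contract_op l F cs" if \<rho>: "inj \<rho>" for \<rho> cs
      unfolding contract_op_def ren[OF \<rho>] graph_invariant_rename[OF graph_invariant_wf \<rho>] ..
    show "supported wf_graph (contract_op l F)"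
      by (simp add: supported_def contract_op_def)
  qed
qed

section \<open>Relations between the operators\<close>

lemma graded_symmetric_front:
  assumes "graded_symmetric F"
  shows "F (xs @ a # ys) = (\<Prod>x\<leftarrow>xs. koszul x a) * F (a # xs @ ys)"
  using assms
proof (induction xs arbitrary: F)
  case (Cons x xs)
  from Cons.IH[OF graded_symmetric_Cons[OF Cons.prems, of x]]
  have "F (x # xs @ a # ys) = (\<Prod>x\<leftarrow>xs. koszul x a) * F (x # a # xs @ ys)" .
  also have "F (x # a # xs @ ys) = koszul x a * F (a # x # xs @ ys)"
    by (rule graded_symmetric_swap[OF Cons.prems])
  finally show ?case by (simp add: ac_simps)
qed simp

lemma eq_uminus_imp_zero: "a = - a \<Longrightarrow> a = (0 :: 'k::field_char_0)"
  by (simp add: eq_neg_iff_add_eq_0 flip: mult_2)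

lemma wf_graph_pick:
  assumes "wf_graph cs" "mset (a # r) = mset cs"
  shows "wf_graph (a # r)"
  using assms wf_graph_mset by blast

lemma choices_branch_names:
  assumes "list_all2 (\<lambda>c c'. c' \<in> set (cell_choices (branch x w) c)) r r'"
  shows "names r' \<subseteq> insert w (names r)"
  using assms
proof (induction rule: list_all2_induct)
  case (Cons c r c' r')
  then show ?case
    by (cases c) (auto simp: branch_def split: if_splits)
qed simp

text \<open>For contractions that remove the new vertex: since it may meet nothing besides the new
  edge and the double edge, all other half-edges must have stayed at the old vertex.\<close>

lemma reattach_sum_branch_const:
  assumes "w \<notin> names q"
    and "\<And>r'. list_all2 (\<lambda>c c'. c' \<in> set (cell_choices (branch x w) c)) q r' \<Longrightarrow> w \<in> names r' \<Longrightarrow> K r' = 0"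
  shows "reattach_sum (branch x w) q K = K q"
  using assms
proof (induction q arbitrary: K)
  case (Cons c q)
  have wq: "w \<notin> names q" "w \<notin> set (cell_ends c)"
    using Cons.prems(1) by (cases c; auto)+
  have "reattach_sum (branch x w) q (\<lambda>r. K (c' # r)) = (if w \<in> set (cell_ends c') then 0 else K (c' # q))"
    if c': "c' \<in> set (cell_choices (branch x w) c)" for c'
  proof (cases "w \<in> set (cell_ends c')")
    case True
    then have "reattach_sum (branch x w) q (\<lambda>r. K (c' # r)) = 0"
      by (intro reattach_sum_zero Cons.prems(2)) (use c' in \<open>auto simp: names_def\<close>)
    then show ?thesis using True by simp
  next
    case False
    have "reattach_sum (branch x w) q (\<lambda>r. K (c' # r)) = K (c' # q)"
    proof (rule Cons.IH[OF wq(1)])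
      fix r' assume r': "list_all2 (\<lambda>c c'. c' \<in> set (cell_choices (branch x w) c)) q r'" "w \<in> names r'"
      have "w \<in> names (c' # r')"
        using r'(2) by (cases c') simp_all
      with r'(1) c' show "K (c' # r') = 0"
        by (intro Cons.prems(2)) simp_all
    qed
    then show ?thesis using False by simp
  qed
  then have "reattach_sum (branch x w) (c # q) K
      = (\<Sum>c'\<leftarrow>cell_choices (branch x w) c. if w \<in> set (cell_ends c') then 0 else K (c' # q))"
    by (simp cong: map_cong)
  also have "\<dots> = K (c # q)"
  proof (cases c)
    case (Ed a b)
    then show ?thesis
      using wq(2) unfolding Ed sum_list_cell_choices_Ed by (auto simp: branch_def)
  next
    case (Md a b)
    then show ?thesis
      using wq(2) unfolding Md sum_list_cell_choices_Md by (auto simp: branch_def)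
  qed simp
  finally show ?case .
qed simp

text \<open>Equivariance turns the exchange of two vertex names into a symmetry of the whole sum,
  once the targets are exchanged accordingly.\<close>

lemma reattach_sum_transpose:
  assumes "\<And>y. y \<in> vertices r \<Longrightarrow> y \<noteq> p \<and> y \<noteq> q"
    and "\<And>i. i \<in> names r \<Longrightarrow> mset (map (transpose p q) (f i)) = mset (g i)"
    and F: "equivariant F"
  shows "reattach_sum f r (\<lambda>s. F (xs @ s))
    = reattach_sum g r (\<lambda>s. F (map (rename (transpose p q)) xs @ s))"
proof -
  have "reattach_sum f r (\<lambda>s. F (xs @ s))
      = reattach_sum f r (\<lambda>s. F (map (rename (transpose p q)) xs @ map (rename (transpose p q)) s))"
    using equivariantD(3)[OF F, of "transpose p q" "xs @ _"] by simp
  also have "\<dots> = reattach_sum (\<lambda>i. map (transpose p q) (f i)) r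
      (\<lambda>s. F (map (rename (transpose p q)) xs @ s))"
    by (rule reattach_sum_rename_result) (use assms(1) in \<open>auto simp: vertices_def transpose_def\<close>)
  also have "\<dots> = reattach_sum g r (\<lambda>s. F (map (rename (transpose p q)) xs @ s))"
    by (rule reattach_sum_fun_cong, rule assms(2)) (auto simp: names_def)
  finally show ?thesis .
qed

text \<open>Either one vertex is split into three, or two different vertices are split. In the first
  case transposing two of the three odd vertices reverses signs, so the terms vanish or cancel; in
  the second case the two orders of splitting cancel.\<close>

theorem split_op_split_op:
  fixes F :: "cell list \<Rightarrow> 'k::field_char_0"
  assumes F: "equivariant F"
  shows "split_op (split_op F) cs = 0"
proof (cases "wf_graph cs")
  case False
  then show ?thesis
    by (rule equivariantD(5)[OF equivariant_split_op[OF equivariant_split_op[OF F]]])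
next
  case True
  note G = equivariantD(2)[OF F]
  define w where "w = fresh_vertex cs"
  define u where "u = fresh_vertex (Vx w # cs)"
  have w: "w \<notin> names cs" and u: "u \<notin> names cs" "u \<noteq> w"
    using fresh_vertex[of cs] fresh_vertex[of "Vx w # cs"] by (simp_all add: w_def u_def)
  have inner: "split_vertex_cell w (split_op F) a r = (case a of Vx x \<Rightarrow>
      reattach_sum (branch x w) r (\<lambda>r'.
        pick r' (\<lambda>b q. split_vertex_cell u F b (Vx w # Vx x # Ed x w # q))) | _ \<Rightarrow> 0)"
    if ar: "mset (a # r) = mset cs" for a r
  proof (cases a)
    case (Vx x)
    have wf: "wf_graph (Vx x # r)"
      using wf_graph_pick[OF True ar] Vx by simp
    then have x: "x \<notin> vertices r"
      by (simp add: wf_graph_Cons)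
    have n: "names (Vx x # r) = names cs"
      using names_mset[OF ar] Vx by simp
    have xw: "x \<noteq> w" "x \<noteq> u" "w \<notin> names r" "u \<notin> names r"
      using w u n by auto
    \<comment> \<open>Every term in which x is split twice has this form: the half-edges of x are
      distributed over x, w, u, and the edges A and B form a tree on these three vertices.\<close>
    define R where "R A B = reattach_sum (\<lambda>i. if i = x then [x, w, u] else [i]) r
      (\<lambda>s. F ([Vx u, Vx w, Vx x, A, B] @ s))" for A B
    have sym: "R A B = - R (rename (transpose p q) A) (rename (transpose p q) B)"
      if pq: "(p, q) \<in> {(u, w), (x, w)}" for A B p q
    proof -
      have 1: "reattach_sum (\<lambda>i. if i = x then [x, w, u] else [i]) r (\<lambda>s. F ([Vx u, Vx w, Vx x, A, B] @ s))
        = reattach_sum (\<lambda>i. if i = x then [x, w, u] else [i]) r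
          (\<lambda>s. F (map (rename (transpose p q)) [Vx u, Vx w, Vx x, A, B] @ s))"
      proof (rule reattach_sum_transpose[OF _ _ F])
        show "y \<noteq> p \<and> y \<noteq> q" if "y \<in> vertices r" for y
          using that pq xw x by (auto simp: names_def)
        show "mset (map (transpose p q) (if i = x then [x, w, u] else [i]))
          = mset (if i = x then [x, w, u] else [i])" if "i \<in> names r" for i
        proof -
          have "i \<noteq> w" "i \<noteq> u" using that xw by auto
          then show ?thesis
            using pq xw u(2) by (auto simp: transpose_def add_mset_commute)
        qed
      qed
      have "F (map (rename (transpose p q)) [Vx u, Vx w, Vx x, A, B] @ s)
        = - F ([Vx u, Vx w, Vx x, rename (transpose p q) A, rename (transpose p q) B] @ s)" for s
        using pq graded_symmetric_swap[OF G, of "Vx w" "Vx u"]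
          graded_symmetricD[OF G, of "[Vx u]" "Vx x" "Vx w"] xw u(2) by auto
      with 1 show ?thesis
        unfolding R_def by (simp only: reattach_sum_uminus)
    qed
    have E: "R A B = R B A" if "\<not> odd_cell A" for A B
      unfolding R_def using graded_symmetricD[OF G, of "[Vx u, Vx w, Vx x]" A B] that
      by (simp add: koszul_def)
    have flip: "R (Ed b a) B = - R (Ed a b) B" for a b B
      unfolding R_def using cell_symmetric_reverse[OF cell_symmetric_append[OF equivariantD(1)[OF F]],
          of "[Vx u, Vx w, Vx x]" "Ed b a"] by (simp add: reattach_sum_uminus)
    \<comment> \<open>Exchanging u and w preserves the tree centred at x, and exchanging x and w
      preserves the tree centred at u. In \<open>X14\<close> the exchange of u and w relates the two
      remaining terms.\<close>
    have X3: "R (Ed x u) (Ed x w) = 0"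
      using sym[of u w "Ed x u" "Ed x w"] E[of "Ed x w" "Ed x u"] xw u(2)
      by (intro eq_uminus_imp_zero) (simp add: transpose_def)
    have X2: "R (Ed w u) (Ed x u) = 0"
      using sym[of x w "Ed w u" "Ed x u"] E[of "Ed w u" "Ed x u"] xw u(2)
      by (intro eq_uminus_imp_zero) (simp add: transpose_def)
    have X14: "R (Ed w u) (Ed x w) = - R (Ed x u) (Ed u w)"
      using sym[of u w "Ed w u" "Ed x w"] E[of "Ed u w" "Ed x u"] xw u(2)
      by (simp add: transpose_def)
    have comp1: "reattach_sum (branch x w) r (\<lambda>r'. reattach_sum (branch w u) r' K)
        = reattach_sum (\<lambda>i. if i = x then [x, w, u] else [i]) r K" for K :: "cell list \<Rightarrow> 'k"
      unfolding reattach_sum_reattach_sum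
      by (rule reattach_sum_fun_cong) (use xw in \<open>auto simp: branch_def names_def\<close>)
    have comp2: "reattach_sum (branch x w) r (\<lambda>r'. reattach_sum (branch x u) r' K)
        = reattach_sum (\<lambda>i. if i = x then [x, w, u] else [i]) r K" for K :: "cell list \<Rightarrow> 'k"
      unfolding reattach_sum_reattach_sum
      by (rule reattach_sum_fun_cong) (use xw in \<open>auto simp: branch_def names_def add_mset_commute\<close>)
    have f1: "F (Vx u # Vx w # Ed w u # Vx x # C # s) = F ([Vx u, Vx w, Vx x, Ed w u, C] @ s)" for C s
      using graded_symmetricD[OF G, of "[Vx u, Vx w]" "Ed w u" "Vx x" "C # s"] by simp
    have f2: "F (Vx u # Vx x # Ed x u # Vx w # C # s) = - F ([Vx u, Vx w, Vx x, Ed x u, C] @ s)" for C s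
      using graded_symmetricD[OF G, of "[Vx u, Vx x]" "Ed x u" "Vx w" "C # s"]
        graded_symmetricD[OF G, of "[Vx u]" "Vx x" "Vx w" "Ed x u # C # s"] by simp
    have T1: "reattach_sum (branch x w) r (\<lambda>r'. split_vertex_cell u F (Vx w) (Vx x # Ed x w # r'))
        = R (Ed w u) (Ed x w) + R (Ed w u) (Ed x u)"
      unfolding R_def f1[symmetric] comp1[symmetric] using xw
      by (simp add: branch_def reattach_sum_add)
    have T2: "reattach_sum (branch x w) r (\<lambda>r'. split_vertex_cell u F (Vx x) (Vx w # Ed x w # r'))
        = - R (Ed x u) (Ed x w) - R (Ed x u) (Ed u w)"
    proof -
      have "reattach_sum (branch x w) r (\<lambda>r'. split_vertex_cell u F (Vx x) (Vx w # Ed x w # r'))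
        = reattach_sum (branch x w) r (\<lambda>r'. reattach_sum (branch x u) r' (\<lambda>s. F (Vx u # Vx x # Ed x u # Vx w # Ed x w # s)))
        + reattach_sum (branch x w) r (\<lambda>r'. reattach_sum (branch x u) r' (\<lambda>s. F (Vx u # Vx x # Ed x u # Vx w # Ed u w # s)))"
        using xw by (simp add: branch_def reattach_sum_add)
      then show ?thesis
        unfolding comp2 f2 reattach_sum_uminus R_def by simp
    qed
    have "split_vertex_cell w (split_op F) a r
        = reattach_sum (branch x w) r (\<lambda>r'. split_with u F (Vx w # Vx x # Ed x w # r'))"
      unfolding Vx split_vertex_cell.simps
    proof (rule reattach_sum_cong)
      fix r' assume "list_all2 (\<lambda>c c'. c' \<in> set (cell_choices (branch x w) c)) r r'"
      from choices_branch_names[OF this] have "u \<notin> names (Vx w # Vx x # Ed x w # r')"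
        using xw u by auto
      then show "split_op F (Vx w # Vx x # Ed x w # r') = split_with u F (Vx w # Vx x # Ed x w # r')"
        by (rule split_op_eq[OF F])
    qed
    also have "\<dots> = reattach_sum (branch x w) r (\<lambda>r'. split_vertex_cell u F (Vx w) (Vx x # Ed x w # r')
        + (- split_vertex_cell u F (Vx x) (Vx w # Ed x w # r')
        + pick r' (\<lambda>b q. split_vertex_cell u F b (Vx w # Vx x # Ed x w # q))))"
    proof -
      have k: "koszul (Vx x) b * (koszul (Vx w) b * z) = z" for b and z :: 'k
        by (simp add: koszul_def)
      show ?thesis
        by (simp add: split_with_def k)
    qed
    also have "\<dots> = reattach_sum (branch x w) r (\<lambda>r'. pick r' (\<lambda>b q. split_vertex_cell u F b (Vx w # Vx x # Ed x w # q)))"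
      unfolding reattach_sum_add reattach_sum_uminus T1 T2 X2 X3 X14 by simp
    finally show ?thesis
      by (simp add: Vx)
  qed simp_all
  \<comment> \<open>Now two different vertices x and y are split, with new vertices w and u
    respectively.\<close>
  define M where "M a b q = (case (a, b) of (Vx x, Vx y) \<Rightarrow>
      reattach_sum (\<lambda>i. if i = x then [x, w] else if i = y then [y, u] else [i]) q
        (\<lambda>s. F ([Vx u, Vx y, Ed y u, Vx w, Vx x, Ed x w] @ s)) | _ \<Rightarrow> 0)" for a b q
  have "split_op (split_op F) cs = pick cs (\<lambda>a r. pick r (M a))"
    unfolding split_op_eq[OF equivariant_split_op[OF F] w] split_with_def
  proof (rule pick_cong)
    fix a r assume ar: "mset (a # r) = mset cs"
    show "split_vertex_cell w (split_op F) a r = pick r (M a)"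
    proof (cases a)
      case (Vx x)
      have "reattach_sum (branch x w) r (\<lambda>r'. pick r' (\<lambda>b q. split_vertex_cell u F b (Vx w # Vx x # Ed x w # q)))
        = pick r (M a)"
        unfolding reattach_sum_pick
      proof (rule pick_cong)
        fix b q assume bq: "mset (b # q) = mset r"
        have m: "mset (a # b # q) = mset cs"
          using ar bq by simp
        note wf = wf_graph_pick[OF True m]
        show "(\<Sum>b'\<leftarrow>cell_choices (branch x w) b. reattach_sum (branch x w) q
            (\<lambda>q. split_vertex_cell u F b' (Vx w # Vx x # Ed x w # q))) = M a b q"
        proof (cases b)
          case b: (Vx y)
          have xy: "x \<noteq> y" "y \<noteq> w" "x \<noteq> w" "w \<notin> names q"
            using wf w names_mset[OF m] unfolding Vx b wf_graph_Cons by auto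
          have "reattach_sum (branch x w) q (\<lambda>q. reattach_sum (branch y u) q K)
            = reattach_sum (\<lambda>i. if i = x then [x, w] else if i = y then [y, u] else [i]) q K"
            for K :: "cell list \<Rightarrow> 'k"
            unfolding reattach_sum_reattach_sum
            by (rule reattach_sum_fun_cong) (use xy in \<open>auto simp: branch_def names_def\<close>)
          moreover have "branch y u x = [x]" "branch y u w = [w]"
            using xy by (simp_all add: branch_def)
          ultimately show ?thesis
            unfolding Vx b M_def by simp
        qed (simp_all add: M_def reattach_sum_zero Vx sum_list_cell_choices_Ed sum_list_cell_choices_Md
            del: cell_choices.simps)
      qed
      then show ?thesis
        using inner[OF ar] by (simp add: Vx)
    qed (simp_all add: M_def pick_zero)
  qed
  also have "\<dots> = pick cs (\<lambda>b r. pick r (\<lambda>a q. koszul a b * M a b q))"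
    by (rule pick_swap)
  \<comment> \<open>Exchanging the names u and w identifies \<open>M b a\<close> with
    \<open>M a b\<close>, because whole blocks with two odd letters are permuted. The Koszul sign of
    x and y then makes the sum its own negative.\<close>
  also have "\<dots> = pick cs (\<lambda>a r. pick r (\<lambda>b q. - M a b q))"
  proof (intro pick_cong)
    fix a r b q assume ar: "mset (a # r) = mset cs" and bq: "mset (b # q) = mset r"
    have m: "mset (a # b # q) = mset cs"
      using ar bq by simp
    note wf = wf_graph_pick[OF True m]
    show "koszul b a * M b a q = - M a b q"
    proof (cases "\<exists>x y. a = Vx x \<and> b = Vx y")
      case True
      then obtain x y where ab: "a = Vx x" "b = Vx y" by blast
      have xy: "x \<noteq> y" "w \<notin> {x, y} \<union> names q" "u \<notin> {x, y} \<union> names q"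
        using wf w u names_mset[OF m] unfolding ab wf_graph_Cons by auto
      have "M b a q = reattach_sum (\<lambda>i. if i = x then [x, w] else if i = y then [y, u] else [i]) q
          (\<lambda>s. F (map (rename (transpose u w)) [Vx u, Vx x, Ed x u, Vx w, Vx y, Ed y w] @ s))"
        unfolding M_def ab prod.case cell.case
        by (rule reattach_sum_transpose[OF _ _ F])
          (use xy u(2) in \<open>auto simp: names_def transpose_def\<close>)
      moreover have "F (map (rename (transpose u w)) [Vx u, Vx x, Ed x u, Vx w, Vx y, Ed y w] @ s)
        = F ([Vx u, Vx y, Ed y u, Vx w, Vx x, Ed x w] @ s)" for s
        using graded_symmetric_front[OF G, of "[Vx w, Vx x, Ed x w, Vx u, Vx y]" "Ed y u" s]
          graded_symmetric_front[OF G, of "[Ed y u, Vx w, Vx x, Ed x w, Vx u]" "Vx y" s]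
          graded_symmetric_front[OF G, of "[Vx y, Ed y u, Vx w, Vx x, Ed x w]" "Vx u" s] xy u(2)
        by (simp add: transpose_def)
      ultimately show ?thesis
        unfolding M_def ab by simp
    qed (auto simp: M_def split: cell.splits)
  qed
  also have "\<dots> = - pick cs (\<lambda>a r. pick r (M a))"
    by (simp add: pick_uminus)
  finally have "split_op (split_op F) cs = - pick cs (\<lambda>a r. pick r (M a))" .
  moreover have "split_op (split_op F) cs = pick cs (\<lambda>a r. pick r (M a))"
    by fact
  ultimately show ?thesis
    by (metis eq_uminus_imp_zero)
qed

section \<open>Marking squares to zero and anticommutes with splitting\<close>

lemma pick_swap_even:
  assumes "\<And>a b r. odd_cell a \<Longrightarrow> odd_cell b \<Longrightarrow> K a b r = 0"
  shows "pick cs (\<lambda>a r. pick r (K a)) = pick cs (\<lambda>b r. pick r (\<lambda>a. K a b))"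
proof -
  have "koszul a b * K a b r = K a b r" for a b r
    using assms[of a b r] by (simp add: koszul_def)
  then show ?thesis
    using pick_swap[of cs K] by simp
qed

lemma pick_swap_odd:
  assumes "\<And>a b r. \<not> (odd_cell a \<and> odd_cell b) \<Longrightarrow> K a b r = 0"
  shows "pick cs (\<lambda>a r. pick r (K a)) = - pick cs (\<lambda>b r. pick r (\<lambda>a. K a b))"
proof -
  have "koszul a b * K a b r = - K a b r" for a b r
    using assms[of a b r] by (simp add: koszul_def)
  then show ?thesis
    using pick_swap[of cs K] by (simp add: pick_uminus)
qed

lemma koszul_parallel_sign [simp]:
  "koszul c a * (parallel_sign a b * z) = parallel_sign a b * z"
  "koszul c b * (parallel_sign a b * z) = parallel_sign a b * z"
  by (cases a; cases b; simp)+

lemma parallel_sign_odd: "odd_cell a \<or> odd_cell b \<Longrightarrow> parallel_sign a b = 0"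
  by (cases a; cases b; simp)

lemma parallel_sign_commute: "parallel_sign a b = parallel_sign b a"
  by (cases a; cases b) (auto simp: of_bool_def)

lemma parallel_sign_mark:
  assumes "cell_symmetric F"
  shows "parallel_sign a b * F (mark a # q) = parallel_sign a b * (F (mark b # q) :: 'k::comm_ring_1)"
proof (cases "parallel_sign a b = (0 :: 'k)")
  case False
  then obtain s t where "a = Ed s t" "b = a \<or> b = reverse_cell a"
    by (rule parallel_sign_nonzero)
  then have "F (mark a # q) = F (mark b # q)"
    using cell_symmetric_reverse[OF assms, of "mark a" q] by auto
  then show ?thesis by simp
qed simp

lemma mark_op_odd:
  assumes "odd_cell c"
  shows "mark_op F (c # r) = pick r (\<lambda>a s. pick s (\<lambda>b t. parallel_sign a b * F (mark a # c # t)))"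
proof -
  have "koszul c a * pick s (\<lambda>b t. koszul c b * (parallel_sign a b * F (mark a # c # t)))
      = pick s (\<lambda>b t. parallel_sign a b * F (mark a # c # t))" for a s
    by (simp add: pick_mult[symmetric])
  then show ?thesis
    using assms by (simp add: mark_op_def parallel_sign_odd pick_zero)
qed

text \<open>A double edge cannot be marked again, so two disjoint pairs are marked; the two orders
  produce the two odd letters in opposite order and cancel.\<close>

theorem mark_op_mark_op:
  fixes F :: "cell list \<Rightarrow> 'k::field_char_0"
  assumes F: "equivariant F"
  shows "mark_op (mark_op F) cs = 0"
proof -
  define K where "K a b c d t = parallel_sign a b * (parallel_sign c d * F (mark c # mark a # t))"
    for a b c d t
  have odd: "K a b c d t = 0" if "odd_cell a \<or> odd_cell b \<or> odd_cell c \<or> odd_cell d" for a b c d t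
    using that by (auto simp: K_def parallel_sign_odd)
  have anti: "K c d a b t = - K a b c d t" for a b c d t
  proof (cases "parallel_sign a b = (0 :: 'k) \<or> parallel_sign c d = (0 :: 'k)")
    case False
    then have "odd_cell (mark a)" "odd_cell (mark c)"
      by (cases a; cases b; cases c; cases d; simp)+
    then have "F (mark a # mark c # t) = - F (mark c # mark a # t)"
      using graded_symmetric_swap[OF equivariantD(2)[OF F], of "mark a" "mark c" t]
      by (simp add: koszul_def)
    then show ?thesis
      by (simp add: K_def mult.left_commute)
  qed (auto simp: K_def)
  have "parallel_sign a b * mark_op F (mark a # q) = pick q (\<lambda>c s. pick s (K a b c))" for a b q
  proof (cases "parallel_sign a b = (0 :: 'k)")
    case False
    then have "odd_cell (mark a)"
      by (cases a; cases b; simp)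
    then show ?thesis
      by (simp add: mark_op_odd K_def[abs_def] pick_mult)
  qed (simp add: K_def pick_zero)
  then have "mark_op (mark_op F) cs = pick cs (\<lambda>a r. pick r (\<lambda>b q. pick q (\<lambda>c s. pick s (K a b c))))"
    by (simp add: mark_op_def[of "mark_op F"])
  moreover have "\<dots> = - \<dots>"
  proof -
    have "pick cs (\<lambda>a r. pick r (\<lambda>b q. pick q (\<lambda>c s. pick s (K a b c))))
      = pick cs (\<lambda>a r. pick r (\<lambda>c q. pick q (\<lambda>b s. pick s (\<lambda>d. K a b c d))))"
      by (rule pick_cong, rule pick_swap_even) (simp add: odd pick_zero)
    also have "\<dots> = pick cs (\<lambda>c r. pick r (\<lambda>a q. pick q (\<lambda>b s. pick s (\<lambda>d. K a b c d))))"
      by (rule pick_swap_even) (simp add: odd pick_zero)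
    also have "\<dots> = pick cs (\<lambda>c r. pick r (\<lambda>a q. pick q (\<lambda>d s. pick s (\<lambda>b. K a b c d))))"
      by (rule pick_cong, rule pick_cong, rule pick_swap_even) (simp add: odd)
    also have "\<dots> = pick cs (\<lambda>c r. pick r (\<lambda>d q. pick q (\<lambda>a s. pick s (\<lambda>b. K a b c d))))"
      by (rule pick_cong, rule pick_swap_even) (simp add: odd pick_zero)
    also have "\<dots> = pick cs (\<lambda>c r. pick r (\<lambda>d q. pick q (\<lambda>a s. pick s (\<lambda>b t. - K c d a b t))))"
      by (simp only: anti[symmetric])
    finally show ?thesis
      by (simp add: pick_uminus)
  qed
  ultimately show ?thesis
    by (metis eq_uminus_imp_zero)
qed

text \<open>Only a loop at x can become parallel to the new edge, and it does so in both directions,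
  with opposite signs.\<close>

lemma parallel_sign_choices:
  assumes "w \<notin> set (cell_ends b)" "w \<noteq> x"
  shows "(\<Sum>b'\<leftarrow>cell_choices (branch x w) b. parallel_sign (Ed x w) b') = (0 :: 'k::comm_ring_1)"
    "(\<Sum>b'\<leftarrow>cell_choices (branch x w) b. parallel_sign b' (Ed x w)) = (0 :: 'k)"
proof -
  show "(\<Sum>b'\<leftarrow>cell_choices (branch x w) b. parallel_sign (Ed x w) b') = (0 :: 'k)"
    using assms by (cases b) (auto simp: branch_def)
  then show "(\<Sum>b'\<leftarrow>cell_choices (branch x w) b. parallel_sign b' (Ed x w)) = (0 :: 'k)"
    by (simp only: parallel_sign_commute)
qed

text \<open>The members of a parallel pair remain parallel exactly when they move together, which
  amounts to reattaching the double edge. A pair of loops also yields parallel edges, but in both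
  relative directions, and these terms cancel.\<close>

lemma mark_choices:
  fixes \<Phi> :: "cell \<Rightarrow> 'k::comm_ring_1"
  assumes w: "w \<notin> set (cell_ends a)" "w \<notin> set (cell_ends b)" "w \<noteq> x"
    and \<Phi>: "\<And>p q. \<Phi> (Md p q) = \<Phi> (Md q p)"
  shows "(\<Sum>a'\<leftarrow>cell_choices (branch x w) a. \<Sum>b'\<leftarrow>cell_choices (branch x w) b.
      parallel_sign a' b' * \<Phi> (mark a'))
    = parallel_sign a b * (\<Sum>m\<leftarrow>cell_choices (branch x w) (mark a). \<Phi> m)"
proof (cases "\<exists>p q s t. a = Ed p q \<and> b = Ed s t")
  case True
  then obtain p q s t where ab: "a = Ed p q" "b = Ed s t" by blast
  consider "p = x" "q = x" | "p = x" "q \<noteq> x" | "p \<noteq> x" "q = x" | "p \<noteq> x" "q \<noteq> x" by blast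
  then show ?thesis
    using w \<Phi>[of x w] unfolding ab
    by cases (cases "s = x"; cases "t = x"; simp add: branch_def; auto simp: algebra_simps)+
next
  case False
  then show ?thesis
    by (cases a; cases b) (simp_all add: sum_list_cell_choices_Ed sum_list_cell_choices_Md
        del: cell_choices.simps(2,3))
qed

text \<open>Pairs containing the new edge cancel by \<open>parallel_sign_choices\<close>; pairs of
  old edges may be marked before or after the splitting by \<open>mark_choices\<close>. The minus
  sign arises when the vertex letter to be split passes the odd double edge.\<close>

theorem split_op_mark_op:
  fixes F :: "cell list \<Rightarrow> 'k::field_char_0"
  assumes F: "equivariant F"
  shows "split_op (mark_op F) cs = - mark_op (split_op F) cs"
proof (cases "wf_graph cs")
  case False
  then show ?thesis
    by (simp add: equivariantD(5) equivariant_split_op equivariant_mark_op F)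
next
  case True
  note G = equivariantD(2)[OF F] and S = equivariantD(1)[OF F]
  define w where "w = fresh_vertex cs"
  have w: "w \<notin> names cs"
    by (simp add: w_def fresh_vertex)
  define N where "N d m s = (case d of Vx x \<Rightarrow> reattach_sum (branch x w) s
      (\<lambda>s'. F (m # Vx w # Vx x # Ed x w # s')) | _ \<Rightarrow> 0)" for d m s
  define Q where "Q d a b s = (case d of Vx x \<Rightarrow> parallel_sign a b *
      (\<Sum>m\<leftarrow>cell_choices (branch x w) (mark a). N d m s) | _ \<Rightarrow> 0)" for d a b s
  have "split_op (mark_op F) cs = pick cs (\<lambda>d r. pick r (\<lambda>a q. pick q (Q d a)))"
    unfolding split_op_eq[OF equivariant_mark_op[OF F] w] split_with_def
  proof (rule pick_cong)
    fix d r assume dr: "mset (d # r) = mset cs"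
    show "split_vertex_cell w (mark_op F) d r = pick r (\<lambda>a q. pick q (Q d a))"
    proof (cases d)
      case (Vx x)
      have xw: "x \<noteq> w" "w \<notin> names r"
        using w names_mset[OF dr] Vx by auto
      let ?U = "\<lambda>m q. F (m # Vx w # Vx x # q)"
      have "mark_op F (Vx w # Vx x # Ed x w # r')
        = pick r' (\<lambda>b q. parallel_sign (Ed x w) b * ?U (Md x w) q)
        + pick r' (\<lambda>a q. parallel_sign a (Ed x w) * ?U (Md x w) q)
        + pick r' (\<lambda>a q. pick q (\<lambda>b s. parallel_sign a b * ?U (mark a) (Ed x w # s)))" for r'
      proof -
        have m: "parallel_sign a (Ed x w) * F (mark a # q) = parallel_sign a (Ed x w) * F (Md x w # q)" for a q
          using parallel_sign_mark[OF S, of a "Ed x w" q] by simp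
        show ?thesis
          by (simp add: mark_op_def parallel_sign_odd pick_zero pick_add pick_mult[symmetric] m)
      qed
      then have "split_vertex_cell w (mark_op F) d r
        = reattach_sum (branch x w) r (\<lambda>r'. pick r' (\<lambda>b q. parallel_sign (Ed x w) b * ?U (Md x w) q))
        + reattach_sum (branch x w) r (\<lambda>r'. pick r' (\<lambda>a q. parallel_sign a (Ed x w) * ?U (Md x w) q))
        + reattach_sum (branch x w) r (\<lambda>r'. pick r' (\<lambda>a q. pick q (\<lambda>b s. parallel_sign a b * ?U (mark a) (Ed x w # s))))"
        by (simp add: Vx reattach_sum_add)
      also have "reattach_sum (branch x w) r (\<lambda>r'. pick r' (\<lambda>b q. parallel_sign (Ed x w) b * ?U (Md x w) q)) = 0"
        unfolding reattach_sum_pick reattach_sum_mult sum_list_mult_const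
      proof (rule pick_zero)
        fix b q assume "mset (b # q) = mset r"
        then have "w \<notin> set (cell_ends b)"
          using names_mset[of "b # q" r] xw by (auto simp: names_def)
        from parallel_sign_choices(1)[OF this xw(1)[symmetric], where ?'k = 'k]
        show "(\<Sum>a'\<leftarrow>cell_choices (branch x w) b. parallel_sign (Ed x w) a')
            * reattach_sum (branch x w) q (?U (Md x w)) = 0"
          by simp
      qed
      also have "reattach_sum (branch x w) r (\<lambda>r'. pick r' (\<lambda>a q. parallel_sign a (Ed x w) * ?U (Md x w) q)) = 0"
        unfolding reattach_sum_pick reattach_sum_mult sum_list_mult_const
      proof (rule pick_zero)
        fix b q assume "mset (b # q) = mset r"
        then have "w \<notin> set (cell_ends b)"
          using names_mset[of "b # q" r] xw by (auto simp: names_def)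
        from parallel_sign_choices(2)[OF this xw(1)[symmetric], where ?'k = 'k]
        show "(\<Sum>a'\<leftarrow>cell_choices (branch x w) b. parallel_sign a' (Ed x w))
            * reattach_sum (branch x w) q (?U (Md x w)) = 0"
          by simp
      qed
      also have "reattach_sum (branch x w) r (\<lambda>r'. pick r' (\<lambda>a q. pick q (\<lambda>b s. parallel_sign a b * ?U (mark a) (Ed x w # s))))
        = pick r (\<lambda>a q. pick q (\<lambda>b s. \<Sum>a'\<leftarrow>cell_choices (branch x w) a. \<Sum>b'\<leftarrow>cell_choices (branch x w) b.
            parallel_sign a' b' * N d (mark a') s))"
        unfolding reattach_sum_pick pick_sum_list[symmetric] reattach_sum_mult by (simp add: N_def Vx)
      also have "\<dots> = pick r (\<lambda>a q. pick q (Q d a))"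
      proof (intro pick_cong)
        fix a q b s assume aq: "mset (a # q) = mset r" "mset (b # s) = mset q"
        then have "mset (a # b # s) = mset r" by simp
        from names_mset[OF this] have "w \<notin> set (cell_ends a)" "w \<notin> set (cell_ends b)"
          using xw by (auto simp: names_def)
        moreover have "N d (Md p q) s = N d (Md q p) s" for p q
          using cell_symmetric_reverse[OF S, of "Md p q"] by (simp add: N_def Vx)
        ultimately show "(\<Sum>a'\<leftarrow>cell_choices (branch x w) a. \<Sum>b'\<leftarrow>cell_choices (branch x w) b.
            parallel_sign a' b' * N d (mark a') s) = Q d a b s"
          using mark_choices[of w a b x "\<lambda>m. N d m s"] xw by (simp add: Q_def Vx)
      qed
      finally show ?thesis by simp
    qed (simp_all add: Q_def pick_zero)
  qed
  also have "\<dots> = - mark_op (split_op F) cs"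
  proof -
    have "parallel_sign a b * split_op F (mark a # q) = - pick q (\<lambda>d s. Q d a b s)"
      if m: "mset (a # b # q) = mset cs" for a b q
    proof (cases "parallel_sign a b = (0 :: 'k)")
      case False
      then obtain s t where a: "a = Ed s t"
        by (rule parallel_sign_nonzero)
      have "w \<notin> names (mark a # q)"
      proof -
        have "names (mark a # q) \<subseteq> names (a # b # q)"
          by (auto simp: a names_def vertices_def)
        then show ?thesis
          using w unfolding names_mset[OF m] by blast
      qed
      then have "split_op F (mark a # q) = pick q (\<lambda>d r. koszul (Md s t) d * split_vertex_cell w F d (Md s t # r))"
        by (simp add: split_op_eq[OF F] split_with_def a)
      also have "\<dots> = pick q (\<lambda>d s. - (\<Sum>m\<leftarrow>(case d of Vx x \<Rightarrow> cell_choices (branch x w) (mark a) | _ \<Rightarrow> []). N d m s))"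
      proof (rule pick_cong)
        fix d r
        have "F (Vx w # Vx x # Ed x w # m # r) = F (m # Vx w # Vx x # Ed x w # r)"
          if "m \<in> set (cell_choices f (Md s t))" for m x f r
          using graded_symmetric_front[OF G, of "[Vx w, Vx x, Ed x w]" m r] that by auto
        then show "koszul (Md s t) d * split_vertex_cell w F d (Md s t # r)
            = - (\<Sum>m\<leftarrow>(case d of Vx x \<Rightarrow> cell_choices (branch x w) (mark a) | _ \<Rightarrow> []). N d m r)"
          by (cases d) (simp_all add: N_def a del: cell_choices.simps cong: map_cong)
      qed
      finally show ?thesis
        unfolding Q_def pick_uminus by (simp add: pick_mult[symmetric] cell.case_distrib
            cong: cell.case_cong)
    qed (simp add: Q_def pick_zero split: cell.splits)
    then have "mark_op (split_op F) cs = pick cs (\<lambda>a r. pick r (\<lambda>b q. - pick q (\<lambda>d s. Q d a b s)))"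
      unfolding mark_op_def by (intro pick_cong) simp
    also have "\<dots> = - pick cs (\<lambda>a r. pick r (\<lambda>b q. pick q (\<lambda>d s. Q d a b s)))"
      by (simp add: pick_uminus)
    also have "pick cs (\<lambda>a r. pick r (\<lambda>b q. pick q (\<lambda>d s. Q d a b s)))
        = pick cs (\<lambda>a r. pick r (\<lambda>d q. pick q (\<lambda>b s. Q d a b s)))"
      by (rule pick_cong, rule pick_swap_even)
        (simp add: Q_def parallel_sign_odd split: cell.splits)
    also have "\<dots> = pick cs (\<lambda>d r. pick r (\<lambda>a q. pick q (Q d a)))"
      by (rule pick_swap_even) (simp add: Q_def parallel_sign_odd pick_zero split: cell.splits)
    finally show ?thesis by simp
  qed
  finally show ?thesis .
qed

section \<open>Opening double edges as a homotopy for marking\<close>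

lemma pick_diff: "pick cs (\<lambda>a r. K a r - K' a r) = pick cs K - pick cs K'"
  using pick_add[of cs K "\<lambda>a r. - K' a r"] by (simp add: pick_uminus)

definition parallel_cells :: "cell \<Rightarrow> cell \<Rightarrow> bool" where
  "parallel_cells a b \<longleftrightarrow> set (cell_ends a) = set (cell_ends b) \<and> card (set (cell_ends a)) = 2"

fun cell_multiplicity :: "cell \<Rightarrow> 'k::comm_ring_1" where
  "cell_multiplicity (Vx x) = 0"
| "cell_multiplicity (Ed a b) = 1"
| "cell_multiplicity (Md a b) = 2"

text \<open>The number of ordered pairs of distinct parallel edges, where a double edge counts as two
  edges.\<close>

definition pair_count :: "cell list \<Rightarrow> 'k::comm_ring_1" where
  "pair_count cs = (\<Sum>a\<leftarrow>cs. \<Sum>b\<leftarrow>cs. cell_multiplicity a * cell_multiplicity b * of_bool (parallel_cells a b))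
    - (\<Sum>a\<leftarrow>cs. cell_multiplicity a * of_bool (parallel_cells a a))"

lemma parallel_cells_simps [simp]:
  "\<not> parallel_cells (Vx x) b" "\<not> parallel_cells b (Vx x)"
  "parallel_cells (reverse_cell a) b = parallel_cells a b"
  "parallel_cells a (reverse_cell b) = parallel_cells a b"
  by (auto simp: parallel_cells_def)

lemma parallel_cells_commute: "parallel_cells a b = parallel_cells b a"
  by (auto simp: parallel_cells_def)

lemma parallel_cells_Ed: "parallel_cells (Ed p q) b \<longleftrightarrow> p \<noteq> q \<and> set (cell_ends b) = {p, q}"
  and parallel_cells_Md: "parallel_cells (Md p q) b \<longleftrightarrow> p \<noteq> q \<and> set (cell_ends b) = {p, q}"
  by (auto simp: parallel_cells_def card_insert_if)

lemma parallel_cells_rename: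
  "inj \<rho> \<Longrightarrow> parallel_cells (rename \<rho> a) (rename \<rho> b) = parallel_cells a b"
  by (simp add: parallel_cells_def card_image[OF inj_on_subset] inj_image_eq_iff)

lemma cell_multiplicity_simps [simp]:
  "cell_multiplicity (reverse_cell a) = cell_multiplicity a"
  "cell_multiplicity (rename \<rho> a) = cell_multiplicity a"
  by (cases a; simp)+

lemma graph_invariant_pair_count: "graph_invariant pair_count"
proof (rule graph_invariantI)
  fix cs cs' :: "cell list" assume m: "mset cs = mset cs'"
  show "pair_count cs = (pair_count cs' :: 'a)"
    unfolding pair_count_def sum_list_map_mset[OF m] ..
next
  fix c r
  show "pair_count (c # r) = (pair_count (reverse_cell c # r) :: 'a)"
    by (simp add: pair_count_def)
next
  fix \<rho> :: "nat \<Rightarrow> nat" and cs assume "inj \<rho>"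
  then show "pair_count (map (rename \<rho>) cs) = (pair_count cs :: 'a)"
    by (simp add: pair_count_def comp_def parallel_cells_rename)
qed

lemma parallel_Ed_cases:
  assumes "parallel_cells (Ed p q) (Ed s t)"
  obtains "p \<noteq> q" "s = p" "t = q" | "p \<noteq> q" "s = q" "t = p"
  using assms unfolding parallel_cells_Ed by (auto simp: doubleton_eq_iff)

text \<open>Turning a into the direction of b costs exactly the sign
  \<open>parallel_sign a b\<close>; what is left is a sign-free indicator, which can be
  counted.\<close>

lemma parallel_sign_times:
  assumes "cell_symmetric F"
  shows "parallel_sign a b * F (xs @ a # q) = of_bool (parallel_cells a b \<and> \<not> odd_cell a \<and> \<not> odd_cell b)
    * (F (xs @ b # q) :: 'k::comm_ring_1)"
proof (cases "parallel_cells a b \<and> \<not> odd_cell a \<and> \<not> odd_cell b")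
  case True
  then obtain p q s t where ab: "a = Ed p q" "b = Ed s t"
    by (cases a; cases b) auto
  then have "parallel_cells (Ed p q) (Ed s t)"
    using True by simp
  then show ?thesis
    using cell_symmetric_reverse[OF cell_symmetric_append[OF assms, of xs], of "Ed p q"] True
    unfolding ab by (cases rule: parallel_Ed_cases) simp_all
next
  case False
  then have "parallel_sign a b = (0 :: 'k)"
    by (cases a; cases b) (auto simp: parallel_cells_Ed)
  with False show ?thesis by auto
qed

text \<open>The factor 2 accounts for the distinguished edge being the first or the second member of
  the marked pair.\<close>

lemma mark_op_Ed:
  assumes F: "cell_symmetric F" and n: "n = Ed p q"
  shows "mark_op F (n # r)
    = 2 * pick r (\<lambda>b q. parallel_sign n b * F (mark n # q)) + mark_op (\<lambda>s. F (n # s)) r"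
proof -
  have "F (mark a # n # t) = F (n # mark a # t)" for a t
    using graded_symmetric_swap[OF cell_symmetric_graded[OF F], of n "mark a" t] n by simp
  moreover have "parallel_sign a n * F (mark a # q) = parallel_sign n a * F (mark n # q)" for a q
    using parallel_sign_mark[OF F, of a n q] by (simp add: parallel_sign_commute)
  ultimately show ?thesis
    by (simp add: mark_op_def n pick_add)
qed

text \<open>Marking one pair while opening an unrelated double edge cancels between the two
  compositions. The remaining terms count ordered pairs of parallel edges: two single edges, the two
  halves of one double edge, or a single edge and half of a double edge.\<close>

theorem mark_unmark_homotopy:
  fixes F :: "cell list \<Rightarrow> 'k::field_char_0"
  assumes F: "equivariant F"
  shows "mark_op (unmark_op F) cs + unmark_op (mark_op F) cs = pair_count cs * F cs"
proof -
  note S = equivariantD(1)[OF F] and G = equivariantD(2)[OF F]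
  define ee :: "cell \<Rightarrow> cell \<Rightarrow> 'k" where
    "ee a b = of_bool (parallel_cells a b \<and> \<not> odd_cell a \<and> \<not> odd_cell b)" for a b
  define md where "md c \<longleftrightarrow> (\<exists>p q. c = Md p q)" for c
  define m :: "cell \<Rightarrow> cell \<Rightarrow> 'k" where
    "m c b = 2 * of_bool (parallel_cells c b \<and> md c \<and> \<not> odd_cell b)" for c b
  define g :: "cell \<Rightarrow> cell \<Rightarrow> 'k" where
    "g a b = cell_multiplicity a * cell_multiplicity b * of_bool (parallel_cells a b)" for a b
  define h :: "cell \<Rightarrow> 'k" where "h c = 2 * of_bool (parallel_cells c c \<and> md c)" for c
  define T where "T a b c t = parallel_sign a b * unmark_cell F c (mark a # t)" for a b c t
  \<comment> \<open>The opened letter is the double edge just created, giving \<open>ee\<close>, or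
    an old one, giving \<open>T\<close>; in the latter case it passes the new odd letter, hence the
    minus sign.\<close>
  have A: "mark_op (unmark_op F) cs = pick cs (\<lambda>a r. pick r (\<lambda>b q. ee a b * F (a # b # q)))
      - pick cs (\<lambda>a r. pick r (\<lambda>b q. pick q (T a b)))"
  proof -
    have "parallel_sign a b * unmark_op F (mark a # q) = ee a b * F (a # b # q) + - pick q (T a b)" for a b q
    proof (cases "parallel_sign a b = (0 :: 'k)")
      case False
      then obtain s t where a: "a = Ed s t"
        by (rule parallel_sign_nonzero)
      have "koszul (Md s t) c * unmark_cell F c (Md s t # q) = - unmark_cell F c (Md s t # q)" for c q
        by (cases c) simp_all
      then have "unmark_op F (mark a # q) = F (a # a # q) - pick q (\<lambda>c t. unmark_cell F c (mark a # t))"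
        by (simp add: unmark_op_def a pick_uminus)
      moreover have "parallel_sign a b * F (a # a # q) = ee a b * F (a # b # q)"
        using parallel_sign_times[OF S, of a b "[a]" q] by (simp add: ee_def)
      ultimately show ?thesis
        by (simp add: T_def[abs_def] pick_mult right_diff_distrib)
    next
      case True
      then have "ee a b * F (a # b # q) = 0"
        using parallel_sign_times[OF S, of a b "[a]" q] by (simp add: ee_def)
      then show ?thesis
        using True by (simp add: T_def pick_zero)
    qed
    then show ?thesis
      by (simp add: mark_op_def pick_diff)
  qed
  \<comment> \<open>Opening c yields two edges. Marking them again gives \<open>h\<close>; marking
    one of them with an old edge gives \<open>m\<close>, doubled because either edge can be taken
    and the pair has two orders, so that \<open>2 * m\<close> is four times an indicator.\<close>
  have B: "unmark_op (mark_op F) cs = pick cs (\<lambda>c r. h c * F (c # r))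
      + pick cs (\<lambda>c r. pick r (\<lambda>b q. 2 * (m c b * F (c # b # q))))
      + pick cs (\<lambda>c r. pick r (\<lambda>a q. pick q (\<lambda>b. T a b c)))"
  proof -
    have "unmark_cell (mark_op F) c r = h c * F (c # r) + pick r (\<lambda>b q. 2 * (m c b * F (c # b # q)))
        + pick r (\<lambda>a q. pick q (\<lambda>b. T a b c))" for c r
    proof (cases c)
      case (Md p q)
      let ?n = "Ed p q"
      have "mark_op F (?n # ?n # r) = 2 * (parallel_sign ?n ?n * F (mark ?n # r)
          + pick r (\<lambda>b q. parallel_sign ?n b * F (mark ?n # ?n # q)))
          + (2 * pick r (\<lambda>b q. parallel_sign ?n b * F (?n # mark ?n # q)) + mark_op (\<lambda>s. F (?n # ?n # s)) r)"
        unfolding mark_op_Ed[OF S refl] mark_op_Ed[OF cell_symmetric_Cons[OF S] refl] by simp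
      moreover have "F (?n # mark ?n # q) = F (mark ?n # ?n # q)" for q
        using graded_symmetric_swap[OF G, of ?n "mark ?n" q] by simp
      moreover have "parallel_sign ?n b * F (mark ?n # ?n # q) = of_bool (parallel_cells c b \<and> \<not> odd_cell b) * F (c # b # q)" for b q
        using parallel_sign_times[OF S, of ?n b "[mark ?n]" q]
        by (simp add: Md parallel_cells_Ed parallel_cells_Md)
      moreover have "mark_op (\<lambda>s. F (?n # ?n # s)) r = pick r (\<lambda>a q. pick q (\<lambda>b. T a b c))"
        by (simp add: mark_op_def T_def[abs_def] Md)
      moreover have "2 * (m c b * F (c # b # q)) = 4 * (of_bool (parallel_cells c b \<and> \<not> odd_cell b) * F (c # b # q))" for b q
        by (simp add: m_def md_def Md)
      moreover have "h c * F (c # r) = 2 * (parallel_sign ?n ?n * F (mark ?n # r))"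
        by (simp add: h_def md_def Md parallel_cells_Md)
      ultimately show ?thesis
        by (simp only: Md unmark_cell.simps pick_mult) simp
    qed (simp_all add: h_def m_def md_def T_def pick_zero)
    then have "unmark_op (mark_op F) cs = pick cs (\<lambda>c r. h c * F (c # r)
        + pick r (\<lambda>b q. 2 * (m c b * F (c # b # q))) + pick r (\<lambda>a q. pick q (\<lambda>b. T a b c)))"
      unfolding unmark_op_def by (intro pick_cong)
    then show ?thesis
      unfolding pick_add .
  qed
  have "pick cs (\<lambda>a r. pick r (\<lambda>b q. pick q (T a b))) = pick cs (\<lambda>a r. pick r (\<lambda>c q. pick q (\<lambda>b. T a b c)))"
    by (rule pick_cong, rule pick_swap_even) (simp add: T_def parallel_sign_odd)
  also have "\<dots> = pick cs (\<lambda>c r. pick r (\<lambda>a q. pick q (\<lambda>b. T a b c)))"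
    by (rule pick_swap_even) (simp add: T_def parallel_sign_odd pick_zero)
  finally have C: "pick cs (\<lambda>a r. pick r (\<lambda>b q. pick q (T a b)))
    = pick cs (\<lambda>c r. pick r (\<lambda>a q. pick q (\<lambda>b. T a b c)))" .
  have "pick cs (\<lambda>a r. pick r (\<lambda>b q. g a b * F (a # b # q)))
      = pick cs (\<lambda>a r. pick r (\<lambda>b q. ee a b * F (a # b # q) + m a b * F (a # b # q) + m b a * F (b # a # q)))"
  proof (intro pick_cong)
    fix a b q
    \<comment> \<open>Two double edges between the same vertices are, up to reversal, equal odd
      letters, so F vanishes; otherwise pairs with one member in each would have to be
      counted.\<close>
    have MM: "F (Md s t # Md p u # q) = 0" if "parallel_cells (Md s t) (Md p u)" for s t p u
    proof -
      have "Md p u = Md s t \<or> Md p u = reverse_cell (Md s t)"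
        using that unfolding parallel_cells_Md by (auto simp: doubleton_eq_iff)
      then have "F (Md s t # Md p u # q) = F (Md s t # Md s t # q)"
        using cell_symmetric_reverse[OF cell_symmetric_Cons[OF S], of "Md s t" "Md s t" q] by auto
      moreover have "F (Md s t # Md s t # q) = - F (Md s t # Md s t # q)"
        using graded_symmetric_swap[OF G, of "Md s t" "Md s t" q] by simp
      ultimately show ?thesis
        using eq_uminus_imp_zero by metis
    qed
    have EM: "F (Ed s t # Md p u # q) = F (Md p u # Ed s t # q)" for s t p u
      using graded_symmetric_swap[OF G, of "Ed s t" "Md p u" q] by simp
    show "g a b * F (a # b # q) = ee a b * F (a # b # q) + m a b * F (a # b # q) + m b a * F (b # a # q)"
      by (cases a; cases b) (auto simp: g_def ee_def m_def md_def EM MM parallel_cells_commute)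
  qed
  also have "\<dots> = pick cs (\<lambda>a r. pick r (\<lambda>b q. ee a b * F (a # b # q)))
      + pick cs (\<lambda>a r. pick r (\<lambda>b q. m a b * F (a # b # q)))
      + pick cs (\<lambda>a r. pick r (\<lambda>b q. m b a * F (b # a # q)))"
    by (simp add: pick_add)
  also have "pick cs (\<lambda>a r. pick r (\<lambda>b q. m b a * F (b # a # q)))
      = pick cs (\<lambda>a r. pick r (\<lambda>b q. m a b * F (a # b # q)))"
    by (rule pick_swap_even) (simp add: m_def)
  finally have D: "pick cs (\<lambda>a r. pick r (\<lambda>b q. g a b * F (a # b # q)))
      = pick cs (\<lambda>a r. pick r (\<lambda>b q. ee a b * F (a # b # q)))
      + pick cs (\<lambda>c r. pick r (\<lambda>b q. 2 * (m c b * F (c # b # q))))"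
    by (simp add: pick_mult)
  have "g a a - cell_multiplicity a * of_bool (parallel_cells a a) = h a" for a
    by (cases a) (auto simp: g_def h_def md_def)
  then have "(\<Sum>a\<leftarrow>cs. g a a) - (\<Sum>a\<leftarrow>cs. cell_multiplicity a * of_bool (parallel_cells a a)) = (\<Sum>a\<leftarrow>cs. h a)"
    by (simp add: sum_list_subtractf[symmetric])
  then have "pair_count cs = ((\<Sum>a\<leftarrow>cs. \<Sum>b\<leftarrow>cs. g a b) - (\<Sum>a\<leftarrow>cs. g a a)) + (\<Sum>a\<leftarrow>cs. h a)"
    by (simp add: pair_count_def g_def algebra_simps)
  then have "pair_count cs * F cs = pick cs (\<lambda>a r. pick r (\<lambda>b q. g a b * F (a # b # q)))
      + pick cs (\<lambda>c r. h c * F (c # r))"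
    unfolding pick_pick_restore[OF G] pick_restore[OF G] by (simp add: distrib_right)
  then show ?thesis
    unfolding A B C D by simp
qed

section \<open>The contracting homotopies\<close>

text \<open>The factor of \<open>contract_coeff\<close> that involves only the double edge. It is
  isolated for the terms in which the contracted edge is the one created by the splitting.\<close>

fun hook_coeff :: "bool \<Rightarrow> nat \<Rightarrow> cell \<Rightarrow> 'k::comm_ring_1" where
  "hook_coeff l z (Md s t) = of_bool (if l then s = z \<and> t = z else (s = z) \<noteq> (t = z))"
| "hook_coeff l z (Vx x) = 0"
| "hook_coeff l z (Ed p q) = 0"

fun hook_cell :: "nat \<Rightarrow> nat \<Rightarrow> cell \<Rightarrow> cell" where
  "hook_cell z y (Md s t) = Md y (if s = z then (if t = z then y else t) else s)"
| "hook_cell z y (Vx x) = Vx x"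
| "hook_cell z y (Ed p q) = Ed p q"

text \<open>The multiplicity with which splitting x and contracting the new edge restores the word,
  for each choice of which end of the new edge is removed.\<close>

fun hook_weight :: "bool \<Rightarrow> cell \<Rightarrow> cell \<Rightarrow> 'k::comm_ring_1" where
  "hook_weight l (Vx x) (Md s t)
    = (if l then of_bool (s = x \<and> t = x) else of_bool (s = x) + of_bool (t = x))"
| "hook_weight l a b = 0"

fun is_loop :: "cell \<Rightarrow> bool" where
  "is_loop (Md s t) \<longleftrightarrow> s = t"
| "is_loop (Vx x) \<longleftrightarrow> False"
| "is_loop (Ed p q) \<longleftrightarrow> False"

fun is_marked :: "cell \<Rightarrow> bool" where
  "is_marked (Md s t) \<longleftrightarrow> True"
| "is_marked (Vx x) \<longleftrightarrow> False"
| "is_marked (Ed p q) \<longleftrightarrow> False"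

definition loop_count :: "cell list \<Rightarrow> nat" where
  "loop_count cs = (\<Sum>c\<leftarrow>cs. of_bool (is_loop c))"

definition mark_count :: "cell list \<Rightarrow> nat" where
  "mark_count cs = (\<Sum>c\<leftarrow>cs. of_bool (is_marked c))"

lemma count_simps [simp]:
  "loop_count [] = 0" "loop_count (c # cs) = of_bool (is_loop c) + loop_count cs"
  "mark_count [] = 0" "mark_count (c # cs) = of_bool (is_marked c) + mark_count cs"
  by (simp_all add: loop_count_def mark_count_def)

lemma contract_coeff_eq_hook:
  "contract_coeff l (Vx z) (Ed p q) c = (of_bool (q = z) - of_bool (p = z)) * hook_coeff l z c"
  "hook_coeff l z c \<noteq> (0 :: 'k::comm_ring_1) \<Longrightarrow>
    contract_cell (Vx z) (Ed p q) c = hook_cell z (if p = z then q else p) c"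
  by (cases c; simp)+

lemma wf_graph_split:
  assumes wf: "wf_graph (Vx x # r)" and w: "w \<notin> names (Vx x # r)"
    and r: "list_all2 (\<lambda>c c'. c' \<in> set (cell_choices (branch x w) c)) r r'"
  shows "wf_graph (Vx w # Vx x # Ed x w # r')"
proof -
  have v: "vertices r' = vertices r"
    by (rule choices_vertices[OF r])
  have "w \<noteq> x" "w \<notin> vertices r"
    using w by (auto simp: names_def)
  moreover have "names r' \<subseteq> insert w (insert x (vertices r))"
    using choices_branch_names[OF r] names_wf[OF wf] by auto
  moreover have "count (mset (Vx x # Ed x w # r')) (Vx y) \<le> 1" for y
  proof -
    have "count (mset (Vx x # r)) (Vx y) \<le> 1"
      using wf unfolding wf_graph_def by blast
    then show ?thesis
      using choices_count_Vx[OF r, of y] by (cases "x = y") simp_all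
  qed
  ultimately show ?thesis
    unfolding wf_graph_Cons(1) v by (auto simp: v names_def)
qed

text \<open>A splitting may tear a marked loop open, but it cannot bring the distinct ends of a
  double edge together.\<close>

lemma choices_loop_count:
  assumes "list_all2 (\<lambda>c c'. c' \<in> set (cell_choices (branch x w) c)) t t'" "w \<notin> names t"
  shows "loop_count t' \<le> loop_count t"
  using assms
proof (induction rule: list_all2_induct)
  case (Cons c t c' t')
  then show ?case
    by (cases c) (auto simp: branch_def split: if_splits)
qed simp

lemma loop_count_mset: "mset cs = mset cs' \<Longrightarrow> loop_count cs = loop_count cs'"
  unfolding loop_count_def by (rule sum_list_map_mset)

text \<open>A contraction at an old vertex z commutes with the splitting of x because z is not
  split. The exception occurs for \<open>l\<close>: a loop that has been moved from z to x can be
  torn open afterwards but not beforehand, and the assumption on \<Phi> removes these terms.\<close>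

lemma contract_choices:
  fixes \<Phi> :: "cell \<Rightarrow> 'k::comm_ring_1"
  assumes "w \<notin> set (cell_ends b)" "w \<notin> set (cell_ends c)" "w \<noteq> x" "a \<noteq> Vx x" "a \<noteq> Vx w"
    and \<Phi>: "l \<Longrightarrow> is_loop c \<Longrightarrow> \<Phi> (Md x w) = 0 \<and> \<Phi> (Md w x) = 0"
  shows "(\<Sum>a'\<leftarrow>cell_choices (branch x w) a. \<Sum>b'\<leftarrow>cell_choices (branch x w) b.
      \<Sum>c'\<leftarrow>cell_choices (branch x w) c. contract_coeff l a' b' c' * \<Phi> (contract_cell a' b' c'))
    = contract_coeff l a b c * (\<Sum>m\<leftarrow>cell_choices (branch x w) (contract_cell a b c). \<Phi> m)"
proof (cases "\<exists>z p q s t. a = Vx z \<and> b = Ed p q \<and> c = Md s t")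
  case True
  then obtain z p q s t where abc: "a = Vx z" "b = Ed p q" "c = Md s t" by blast
  have z: "z \<noteq> x" "z \<noteq> w" "branch x w z = [z]"
    using assms(4,5) by (auto simp: abc branch_def)
  have b: "(i' = z) = (i = z)" if "i' \<in> set (branch x w i)" for i i'
    using that z by (auto simp: branch_def split: if_splits)
  have "contract_coeff l (Vx z) (Ed p' q') (Md s' t') = (contract_coeff l (Vx z) (Ed p q) (Md s t) :: 'k)"
    if "p' \<in> set (branch x w p)" "q' \<in> set (branch x w q)" "s' \<in> set (branch x w s)" "t' \<in> set (branch x w t)"
    for p' q' s' t'
    by (simp add: b[OF that(1)] b[OF that(2)] b[OF that(3)] b[OF that(4)])
  then have "(\<Sum>a'\<leftarrow>cell_choices (branch x w) a. \<Sum>b'\<leftarrow>cell_choices (branch x w) b.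
      \<Sum>c'\<leftarrow>cell_choices (branch x w) c. contract_coeff l a' b' c' * \<Phi> (contract_cell a' b' c'))
    = (\<Sum>p'\<leftarrow>branch x w p. \<Sum>q'\<leftarrow>branch x w q. \<Sum>s'\<leftarrow>branch x w s. \<Sum>t'\<leftarrow>branch x w t.
        contract_coeff l a b c * \<Phi> (contract_cell a (Ed p' q') (Md s' t')))"
    unfolding abc sum_list_cell_choices_Ed sum_list_cell_choices_Md
    by (simp cong: map_cong del: contract_coeff.simps contract_cell.simps)
  also have "\<dots> = contract_coeff l a b c * (\<Sum>p'\<leftarrow>branch x w p. \<Sum>q'\<leftarrow>branch x w q. \<Sum>s'\<leftarrow>branch x w s.
      \<Sum>t'\<leftarrow>branch x w t. \<Phi> (contract_cell a (Ed p' q') (Md s' t')))"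
    by (simp only: sum_list_const_mult)
  also have "\<dots> = contract_coeff l a b c * (\<Sum>m\<leftarrow>cell_choices (branch x w) (contract_cell a b c). \<Phi> m)"
  proof (cases "contract_coeff l a b c = (0 :: 'k)")
    case False
    then have 1: "(p = z) \<noteq> (q = z)" "if l then s = z \<and> t = z else (s = z) \<noteq> (t = z)"
      unfolding abc by (auto simp: of_bool_def split: if_splits)
    have "(\<Sum>p'\<leftarrow>branch x w p. \<Sum>q'\<leftarrow>branch x w q. \<Sum>s'\<leftarrow>branch x w s.
      \<Sum>t'\<leftarrow>branch x w t. \<Phi> (contract_cell a (Ed p' q') (Md s' t')))
      = (\<Sum>m\<leftarrow>cell_choices (branch x w) (contract_cell a b c). \<Phi> m)"
    proof (cases l)
      case True
      then show ?thesis
        using 1 z(1,2) \<Phi> unfolding abc by (cases "p = z") (auto simp: z(3), auto simp: branch_def)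
    next
      case False
      then show ?thesis
        using 1 z(1,2) unfolding abc
        by (cases "p = z"; cases "s = z") (auto simp: z(3), auto simp: branch_def)
    qed
    then show ?thesis by simp
  qed simp
  finally show ?thesis .
next
  case False
  then show ?thesis
    by (cases a; cases b; cases c) (simp_all add: sum_list_cell_choices_Ed sum_list_cell_choices_Md
        del: cell_choices.simps(2,3))
qed

lemma sum_list_Vx_count:
  "(\<Sum>d\<leftarrow>cs. case d of Vx x \<Rightarrow> of_bool (s = x) | _ \<Rightarrow> 0) = (of_nat (count (mset cs) (Vx s)) :: 'k::comm_ring_1)"
  by (induction cs) (auto split: cell.splits)

text \<open>In a well-formed word each end of a double edge belongs to exactly one vertex letter, so
  summing over vertices counts ends, or loops.\<close>

lemma sum_hook_weight:
  assumes wf: "wf_graph cs"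
  shows "(\<Sum>d\<leftarrow>cs. \<Sum>c\<leftarrow>cs. hook_weight l d c)
    = (of_nat (if l then loop_count cs else 2 * mark_count cs) :: 'k::comm_ring_1)"
proof -
  have one: "(\<Sum>d\<leftarrow>cs. case d of Vx x \<Rightarrow> of_bool (s = x) | _ \<Rightarrow> 0) = (1 :: 'k)" if "s \<in> vertices cs" for s
  proof -
    have "count (mset cs) (Vx s) = 1"
      using wf that unfolding wf_graph_def vertices_def
      by (metis (mono_tags) mem_Collect_eq count_mset_0_iff le_antisym less_one not_less)
    then show ?thesis
      unfolding sum_list_Vx_count by simp
  qed
  have "(\<Sum>d\<leftarrow>cs. hook_weight l d c) = (of_nat (if l then of_bool (is_loop c) else 2 * of_bool (is_marked c)) :: 'k)"
    if c: "c \<in> set cs" for c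
  proof (cases c)
    case (Md s t)
    have st: "s \<in> vertices cs" "t \<in> vertices cs"
      using wf c Md unfolding wf_graph_def by fastforce+
    have "hook_weight l d c = (if l then of_bool (s = t) * (case d of Vx x \<Rightarrow> of_bool (s = x) | _ \<Rightarrow> 0)
      else (case d of Vx x \<Rightarrow> of_bool (s = x) | _ \<Rightarrow> 0) + (case d of Vx x \<Rightarrow> of_bool (t = x) | _ \<Rightarrow> 0) :: 'k)" for d
      by (cases d) (auto simp: Md)
    then show ?thesis
      using one[OF st(1)] one[OF st(2)]
      by (simp add: Md sum_list_const_mult sum_list_map_add)
  next
    case (Vx x)
    have "hook_weight l d c = (0 :: 'k)" for d by (cases d) (simp_all add: Vx)
    then show ?thesis by (simp add: Vx)
  next
    case (Ed p q)
    have "hook_weight l d c = (0 :: 'k)" for d by (cases d) (simp_all add: Ed)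
    then show ?thesis by (simp add: Ed)
  qed
  then have "(\<Sum>c\<leftarrow>cs. \<Sum>d\<leftarrow>cs. hook_weight l d c)
      = (\<Sum>c\<leftarrow>cs. of_nat (if l then of_bool (is_loop c) else 2 * of_bool (is_marked c)) :: 'k)"
    by (simp cong: map_cong)
  also have "\<dots> = of_nat (if l then loop_count cs else 2 * mark_count cs)"
    by (induction cs) simp_all
  finally show ?thesis
    by (subst sum_list_map_swap)
qed

text \<open>If the contracted edge is the one just created, either of its ends may be removed and
  both choices restore the word; this is the outer factor 2. Contractions at old vertices cancel
  between the two compositions. For \<open>l\<close> the terms with a torn loop are killed by the
  assumption on words with fewer loops.\<close>

theorem split_contract_homotopy:
  fixes F :: "cell list \<Rightarrow> 'k::field_char_0"
  assumes F: "equivariant F" and wf: "wf_graph cs"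
    and loops: "\<And>cs'. l \<Longrightarrow> loop_count cs' < loop_count cs \<Longrightarrow> F cs' = 0"
  shows "split_op (contract_op l F) cs + contract_op l (split_op F) cs
    = 2 * of_nat (if l then loop_count cs else 2 * mark_count cs) * F cs"
proof -
  note S = equivariantD(1)[OF F] and G = equivariantD(2)[OF F]
  define w where "w = fresh_vertex cs"
  have w: "w \<notin> names cs"
    by (simp add: w_def fresh_vertex)
  define KK where "KK a s = pick s (\<lambda>b r. pick r (\<lambda>c t. contract_coeff l a b c * F (contract_cell a b c # t)))"
    for a s
  define H where "H z y r = pick r (\<lambda>c t. hook_coeff l z c * F (hook_cell z y c # Vx y # t))" for z y r
  define N where "N d m s = (case d of Vx x \<Rightarrow> \<Sum>m'\<leftarrow>cell_choices (branch x w) m.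
      reattach_sum (branch x w) s (\<lambda>s'. F (Vx w # Vx x # Ed x w # m' # s')) | _ \<Rightarrow> 0)" for d m s
  define Q where "Q d a b c t = contract_coeff l a b c * N d (contract_cell a b c) t" for d a b c t
  have KK_end: "KK (Vx z) (Vx y # Ed p q # r') = - ((of_bool (q = z) - of_bool (p = z)) * H z y r')"
    if z: "z \<notin> vertices r'" "z \<noteq> y" "{p, q} = {y, z}" for z y p q r'
  proof -
    \<comment> \<open>Removing z while contracting a different edge leaves the new edge with a
      deleted end, so the word is ill-formed and F vanishes.\<close>
    have 0: "pick (Vx y # Ed p q # s) (\<lambda>c t. contract_coeff l (Vx z) b c * F (contract_cell (Vx z) b c # t)) = 0"
      if s: "mset (b # s) = mset r'" for b s
    proof (rule pick_zero)
      fix c t assume ct: "mset (c # t) = mset (Vx y # Ed p q # s)"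
      show "contract_coeff l (Vx z) b c * F (contract_cell (Vx z) b c # t) = 0"
      proof (cases "contract_coeff l (Vx z) b c = (0 :: 'k)")
        case False
        then obtain s' t' m m' where c: "c = Md s' t'" "contract_cell (Vx z) b c = Md m m'"
          by (cases b; cases c) (auto simp: Let_def)
        have "Ed p q \<in> set (c # t)"
          using ct by (metis list.set_intros(1,2) set_mset_mset)
        then have "Ed p q \<in> set t"
          using c by simp
        moreover have "vertices (c # t) = insert y (vertices s)"
          using vertices_mset[OF ct] by simp
        then have "z \<notin> vertices t"
          using z vertices_mset[OF s] c by (cases b) auto
        ultimately have "\<not> wf_graph (Md m m' # t)"
          using z(3) unfolding wf_graph_def by (force simp: doubleton_eq_iff)
        then show ?thesis
          using equivariantD(5)[OF F] c by simp
      qed simp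
    qed
    have "pick r' (\<lambda>b s. koszul (Vx y) b * (pick (Vx y # Ed p q # s)
        (\<lambda>c t. contract_coeff l (Vx z) b c * F (contract_cell (Vx z) b c # t)))) = 0"
      by (rule pick_zero) (simp only: 0 mult_zero_right)
    moreover have "koszul (Vx y) c * (contract_coeff l (Vx z) (Ed p q) c * F (contract_cell (Vx z) (Ed p q) c # Vx y # t))
        = - ((of_bool (q = z) - of_bool (p = z)) * (hook_coeff l z c * F (hook_cell z y c # Vx y # t)))" for c t
    proof (cases "hook_coeff l z c = (0 :: 'k)")
      case False
      have "(if p = z then q else p) = y"
        using z(2,3) by (auto simp: doubleton_eq_iff)
      then show ?thesis
        using contract_coeff_eq_hook(2)[OF False] False
        by (cases c) (simp_all add: contract_coeff_eq_hook(1) del: contract_coeff.simps contract_cell.simps)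
    qed (simp add: contract_coeff_eq_hook(1))
    then have "pick (Vx y # r') (\<lambda>c t. contract_coeff l (Vx z) (Ed p q) c * F (contract_cell (Vx z) (Ed p q) c # t))
        = - ((of_bool (q = z) - of_bool (p = z)) * H z y r')"
      by (simp add: H_def pick_mult pick_uminus del: contract_coeff.simps(1) contract_cell.simps(1))
    moreover have "pick (Vx y # Ed p q # r') K
        = K (Vx y) (Ed p q # r') + K (Ed p q) (Vx y # r') + pick r' (\<lambda>b s. koszul (Vx y) b * K b (Vx y # Ed p q # s))"
      for K :: "cell \<Rightarrow> cell list \<Rightarrow> 'k"
      by simp
    moreover have "pick (Ed p q # r') (\<lambda>c t. contract_coeff l (Vx z) (Vx y) c * F (contract_cell (Vx z) (Vx y) c # t)) = 0"
      by (rule pick_zero) simp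
    ultimately show ?thesis
      unfolding KK_def by (simp only:) simp
  qed
  have "split_op (contract_op l F) cs = pick cs (\<lambda>d r. pick r (\<lambda>c t. 2 * hook_weight l d c * F (d # c # t))
      + pick r (\<lambda>a q. pick q (\<lambda>b s. pick s (Q d a b))))"
    unfolding split_op_eq[OF equivariant_contract_op[OF F] w] split_with_def
  proof (rule pick_cong)
    fix d r assume dr: "mset (d # r) = mset cs"
    show "split_vertex_cell w (contract_op l F) d r = pick r (\<lambda>c t. 2 * hook_weight l d c * F (d # c # t))
      + pick r (\<lambda>a q. pick q (\<lambda>b s. pick s (Q d a b)))"
    proof (cases d)
      case (Vx x)
      have wfx: "wf_graph (Vx x # r)"
        using wf_graph_pick[OF wf dr] Vx by simp
      have wx: "w \<notin> names (Vx x # r)"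
        using w names_mset[OF dr] Vx by simp
      then have xw: "x \<noteq> w" "w \<notin> names r" "w \<notin> vertices r" "x \<notin> vertices r"
        using wfx by (auto simp: names_def wf_graph_Cons)
      let ?P = "\<lambda>a b c t. contract_coeff l a b c * F (Vx w # Vx x # Ed x w # contract_cell a b c # t)"
      have expand: "contract_op l F (Vx w # Vx x # Ed x w # r') = - H w x r' + - H x w r'
          + pick r' (\<lambda>a q. pick q (\<lambda>b s. pick s (?P a b)))"
        if r': "list_all2 (\<lambda>c c'. c' \<in> set (cell_choices (branch x w) c)) r r'" for r'
      proof -
        have v: "vertices r' = vertices r"
          by (rule choices_vertices[OF r'])
        have "koszul (Vx x) a * (koszul (Vx w) a * KK a (Vx w # Vx x # Ed x w # q))
            = pick q (\<lambda>b s. pick s (?P a b))" if aq: "mset (a # q) = mset r'" for a q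
        proof (cases a)
          case a: (Vx z)
          have z: "z \<noteq> x" "z \<noteq> w"
            using vertices_mset[OF aq] xw v a by auto
          have kk: "koszul (Vx x) b * (koszul (Vx w) b * y) = y" for b and y :: 'k
            by (simp add: koszul_def)
          have move: "contract_coeff l (Vx z) b c * F (contract_cell (Vx z) b c # Vx w # Vx x # Ed x w # t)
              = ?P (Vx z) b c t" for b c t
            using graded_symmetric_front[OF G, of "[Vx w, Vx x, Ed x w]" "contract_cell (Vx z) b c" t]
            by (cases b; cases c) (simp_all add: Let_def)
          have zero: "contract_coeff l (Vx z) b (Vx p) = (0 :: 'k)" "contract_coeff l (Vx z) (Ed x w) c = (0 :: 'k)"
            "contract_coeff l (Vx z) b (Ed x w) = (0 :: 'k)" for b c p
            using z by (cases b; cases c; simp)+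
          show ?thesis
            by (simp add: a KK_def pick_zero kk move zero)
        qed (simp_all add: KK_def pick_zero)
        then have "pick r' (\<lambda>a q. koszul (Vx x) a * (koszul (Vx w) a * KK a (Vx w # Vx x # Ed x w # q)))
            = pick r' (\<lambda>a q. pick q (\<lambda>b s. pick s (?P a b)))"
          by (rule pick_cong)
        moreover have "contract_op l F (Vx w # Vx x # Ed x w # r') = pick (Vx w # Vx x # Ed x w # r') KK"
          using wf_graph_split[OF wfx wx r'] by (simp add: contract_op_def KK_def)
        moreover have "KK (Vx w) (Vx x # Ed x w # r') = - H w x r'" "KK (Vx x) (Vx w # Ed x w # r') = H x w r'"
          using KK_end[of w r' x x w] KK_end[of x r' w x w] xw v by auto
        moreover have "KK (Ed x w) s = 0" for s
          by (simp add: KK_def pick_zero)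
        ultimately show ?thesis
          by simp
      qed
      \<comment> \<open>Removing w forces everything except the hooked ends of the double edge to
        stay at x. The minus sign comes from exchanging \<open>Vx x\<close> with the odd double
        edge.\<close>
      have H_weight: "reattach_sum (branch x w) r (H w x) = - pick r (\<lambda>c t. hook_weight l d c * F (d # c # t))"
      proof -
        have "reattach_sum (branch x w) r (H w x) = pick r (\<lambda>c t. \<Sum>c'\<leftarrow>cell_choices (branch x w) c.
            hook_coeff l w c' * reattach_sum (branch x w) t (\<lambda>t'. F (hook_cell w x c' # Vx x # t')))"
          unfolding H_def[abs_def] reattach_sum_pick reattach_sum_mult ..
        also have "\<dots> = pick r (\<lambda>c t. - (hook_weight l d c * F (d # c # t)))"
        proof (rule pick_cong)
          fix c t assume ct: "mset (c # t) = mset r"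
          then have wt: "w \<notin> names t" "w \<notin> set (cell_ends c)" "w \<notin> vertices t"
            using names_mset[OF ct] xw by (auto simp: names_def vertices_def)
          have const: "hook_coeff l w c' * reattach_sum (branch x w) t (\<lambda>t'. F (hook_cell w x c' # Vx x # t'))
            = hook_coeff l w c' * F (hook_cell w x c' # Vx x # t)" for c'
          proof (cases c')
            case (Md p q)
            have "reattach_sum (branch x w) t (\<lambda>t'. F (hook_cell w x c' # Vx x # t')) = F (hook_cell w x c' # Vx x # t)"
            proof (rule reattach_sum_branch_const[OF wt(1)])
              fix t' assume t': "list_all2 (\<lambda>c c'. c' \<in> set (cell_choices (branch x w) c)) t t'" "w \<in> names t'"
              have "w \<notin> vertices (hook_cell w x c' # Vx x # t')"
                using xw wt choices_vertices[OF t'(1)] by (simp add: Md)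
              moreover have "w \<in> names (hook_cell w x c' # Vx x # t')"
                using t'(2) by (simp add: Md)
              ultimately show "F (hook_cell w x c' # Vx x # t') = 0"
                using names_wf equivariantD(5)[OF F] by blast
            qed
            then show ?thesis by simp
          qed simp_all
          have weight: "(\<Sum>c'\<leftarrow>cell_choices (branch x w) c. hook_coeff l w c' * F (hook_cell w x c' # Vx x # t))
            = - (hook_weight l d c * F (d # c # t))"
          proof (cases c)
            case (Md p q)
            have 1: "F (d # c # t) = - F (c # Vx x # t)"
              using graded_symmetric_swap[OF G, of "Vx x" c t] by (simp add: Md Vx)
            have 2: "F (Md p x # Vx x # t) = F (Md x p # Vx x # t)"
              using cell_symmetric_reverse[OF S, of "Md p x"] by simp
            show ?thesis
              using 2 wt(2) xw(1) unfolding 1 unfolding Md Vx sum_list_cell_choices_Md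
              by (auto simp: branch_def)
          qed (simp_all add: Vx sum_list_cell_choices_Ed del: cell_choices.simps(2))
          show "(\<Sum>c'\<leftarrow>cell_choices (branch x w) c.
              hook_coeff l w c' * reattach_sum (branch x w) t (\<lambda>t'. F (hook_cell w x c' # Vx x # t')))
            = - (hook_weight l d c * F (d # c # t))"
            by (simp only: const weight)
        qed
        finally show ?thesis
          by (simp add: pick_uminus)
      qed
      \<comment> \<open>The sum over reattachments is invariant under exchanging x and w, so
        removing x contributes the same as removing w.\<close>
      have H_sym: "reattach_sum (branch x w) r (H x w) = reattach_sum (branch x w) r (H w x)"
      proof -
        let ?\<tau> = "transpose x w"
        have \<tau>: "inj ?\<tau>" by simp
        have "hook_coeff l (?\<tau> x) (rename ?\<tau> c) = (hook_coeff l x c :: 'k)" for c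
          by (cases c) (simp_all only: hook_coeff.simps rename.simps inj_eq[OF \<tau>])
        moreover have "hook_cell (?\<tau> x) (?\<tau> w) (rename ?\<tau> c) = rename ?\<tau> (hook_cell x w c)" for c
          by (cases c) (auto simp only: hook_cell.simps rename.simps inj_eq[OF \<tau>] split: if_splits)
        moreover have "F (map (rename ?\<tau>) (hook_cell x w c # Vx w # t)) = F (hook_cell x w c # Vx w # t)" for c t
          by (rule equivariantD(3)[OF F \<tau>])
        ultimately have "H x w r' = H w x (map (rename ?\<tau>) r')" for r'
          unfolding H_def pick_rename by simp
        then have "reattach_sum (branch x w) r (H x w)
            = reattach_sum (branch x w) r (\<lambda>r'. H w x (map (rename ?\<tau>) r'))"
          by (intro reattach_sum_cong) simp
        also have "\<dots> = reattach_sum (\<lambda>i. map ?\<tau> (branch x w i)) r (H w x)"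
          by (rule reattach_sum_rename_result) (use xw in \<open>auto simp: vertices_def transpose_def\<close>)
        also have "\<dots> = reattach_sum (branch x w) r (H w x)"
          by (rule reattach_sum_fun_cong)
            (use xw in \<open>auto simp: branch_def transpose_def names_def add_mset_commute\<close>)
        finally show ?thesis .
      qed
      have main: "reattach_sum (branch x w) r (\<lambda>r'. pick r' (\<lambda>a q. pick q (\<lambda>b s. pick s (?P a b))))
          = pick r (\<lambda>a q. pick q (\<lambda>b s. pick s (Q d a b)))"
      proof -
        have "reattach_sum (branch x w) r (\<lambda>r'. pick r' (\<lambda>a q. pick q (\<lambda>b s. pick s (?P a b))))
          = pick r (\<lambda>a q. pick q (\<lambda>b s. pick s (\<lambda>c t. \<Sum>a'\<leftarrow>cell_choices (branch x w) a.
              \<Sum>b'\<leftarrow>cell_choices (branch x w) b. \<Sum>c'\<leftarrow>cell_choices (branch x w) c.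
              contract_coeff l a' b' c' * reattach_sum (branch x w) t
                (\<lambda>t'. F (Vx w # Vx x # Ed x w # contract_cell a' b' c' # t')))))"
          unfolding reattach_sum_pick pick_sum_list[symmetric] reattach_sum_mult ..
        also have "\<dots> = pick r (\<lambda>a q. pick q (\<lambda>b s. pick s (Q d a b)))"
        proof (intro pick_cong)
          fix a q b s c t
          assume "mset (a # q) = mset r" "mset (b # s) = mset q" "mset (c # t) = mset s"
          then have m: "mset (a # b # c # t) = mset r" by simp
          let ?\<Phi> = "\<lambda>m. reattach_sum (branch x w) t (\<lambda>t'. F (Vx w # Vx x # Ed x w # m # t'))"
          have n: "w \<notin> set (cell_ends b)" "w \<notin> set (cell_ends c)" "a \<noteq> Vx x" "a \<noteq> Vx w" "w \<notin> names t"
            using names_mset[OF m] vertices_mset[OF m] xw by (auto simp: names_def vertices_def)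
          \<comment> \<open>A loop has been replaced by a double edge with distinct ends, which
            lowers the number of loops.\<close>
          have "?\<Phi> (Md p q) = 0" if l: l "is_loop c" "p \<noteq> q" for p q
          proof (rule reattach_sum_zero, rule loops[OF l(1)])
            fix t' assume "list_all2 (\<lambda>c c'. c' \<in> set (cell_choices (branch x w) c)) t t'"
            from choices_loop_count[OF this n(5)]
            have "loop_count (Vx w # Vx x # Ed x w # Md p q # t') < loop_count (a # b # c # t)"
              using l by simp
            also have "\<dots> \<le> loop_count cs"
              using loop_count_mset[OF m] loop_count_mset[OF dr] by simp
            finally show "loop_count (Vx w # Vx x # Ed x w # Md p q # t') < loop_count cs" .
          qed
          then show "(\<Sum>a'\<leftarrow>cell_choices (branch x w) a. \<Sum>b'\<leftarrow>cell_choices (branch x w) b.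
              \<Sum>c'\<leftarrow>cell_choices (branch x w) c. contract_coeff l a' b' c' * ?\<Phi> (contract_cell a' b' c'))
            = Q d a b c t"
            using contract_choices[of w b c x a l ?\<Phi>] n xw(1) by (simp add: Q_def N_def Vx)
        qed
        finally show ?thesis .
      qed
      have "split_vertex_cell w (contract_op l F) d r = reattach_sum (branch x w) r (\<lambda>r'. - H w x r' + - H x w r'
          + pick r' (\<lambda>a q. pick q (\<lambda>b s. pick s (?P a b))))"
        unfolding Vx split_vertex_cell.simps by (rule reattach_sum_cong) (rule expand)
      also have "\<dots> = 2 * pick r (\<lambda>c t. hook_weight l d c * F (d # c # t))
          + pick r (\<lambda>a q. pick q (\<lambda>b s. pick s (Q d a b)))"
        unfolding reattach_sum_add reattach_sum_uminus H_sym H_weight main by simp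
      finally show ?thesis
        by (simp add: pick_mult mult.assoc)
    next
      case (Ed p q)
      have "hook_weight l d c = (0 :: 'k)" for c by (simp add: Ed)
      then show ?thesis by (simp add: Ed Q_def N_def pick_zero)
    next
      case (Md p q)
      have "hook_weight l d c = (0 :: 'k)" for c by (simp add: Md)
      then show ?thesis by (simp add: Md Q_def N_def pick_zero)
    qed
  qed
  also have "\<dots> = pick cs (\<lambda>d r. pick r (\<lambda>c t. 2 * hook_weight l d c * F (d # c # t)))
      + pick cs (\<lambda>d r. pick r (\<lambda>a q. pick q (\<lambda>b s. pick s (Q d a b))))"
    by (rule pick_add)
  also have "pick cs (\<lambda>d r. pick r (\<lambda>c t. 2 * hook_weight l d c * F (d # c # t)))
      = 2 * of_nat (if l then loop_count cs else 2 * mark_count cs) * F cs"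
  proof -
    have "hook_weight l a a = (0 :: 'k)" for a by (cases a) simp_all
    then show ?thesis
      unfolding pick_pick_restore[OF G] sum_list_const_mult sum_hook_weight[OF wf] by simp
  qed
  also have "pick cs (\<lambda>d r. pick r (\<lambda>a q. pick q (\<lambda>b s. pick s (Q d a b)))) = - contract_op l (split_op F) cs"
  proof -
    have "contract_coeff l a b c * split_op F (contract_cell a b c # t) = - pick t (\<lambda>d s. Q d a b c s)"
      if m: "mset (a # b # c # t) = mset cs" for a b c t
    proof (cases "contract_coeff l a b c = (0 :: 'k)")
      case False
      then obtain z x y where z: "a = Vx z" "x \<noteq> z" "l \<longleftrightarrow> y = z"
        "b = Ed x z \<or> b = reverse_cell (Ed x z)" "c = Md y z \<or> c = reverse_cell (Md y z)"
        "contract_cell a b c = Md x (if l then x else y)"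
        by (rule contract_coeff_nonzero)
      let ?m = "Md x (if l then x else y)"
      have "names (?m # t) \<subseteq> names (a # b # c # t)"
        using z by auto
      then have "w \<notin> names (?m # t)"
        using w unfolding names_mset[OF m] by blast
      then have "split_op F (?m # t) = pick t (\<lambda>d s. koszul ?m d * split_vertex_cell w F d (?m # s))"
        by (simp add: split_op_eq[OF F] split_with_def)
      also have "\<dots> = pick t (\<lambda>d s. - N d ?m s)"
      proof (rule pick_cong)
        fix d s show "koszul ?m d * split_vertex_cell w F d (?m # s) = - N d ?m s"
          by (cases d) (simp_all add: N_def del: cell_choices.simps)
      qed
      finally show ?thesis
        by (simp add: Q_def z(6) pick_mult pick_uminus)
    qed (simp add: Q_def pick_zero)
    then have "contract_op l (split_op F) cs = pick cs (\<lambda>a r. pick r (\<lambda>b q. pick q (\<lambda>c t. - pick t (\<lambda>d s. Q d a b c s))))"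
      using wf unfolding contract_op_def by (simp, intro pick_cong) simp
    also have "\<dots> = - pick cs (\<lambda>a r. pick r (\<lambda>b q. pick q (\<lambda>c t. pick t (\<lambda>d s. Q d a b c s))))"
      by (simp add: pick_uminus)
    \<comment> \<open>On its way to the front the vertex d passes the odd letters c and a and the
      even letter b. These exchanges have no total sign; the minus sign of the claim is that of
      passing the contracted double edge.\<close>
    also have "pick cs (\<lambda>a r. pick r (\<lambda>b q. pick q (\<lambda>c t. pick t (\<lambda>d s. Q d a b c s))))
        = pick cs (\<lambda>a r. pick r (\<lambda>b q. - pick q (\<lambda>d t. pick t (\<lambda>c s. Q d a b c s))))"
    proof (rule pick_cong, rule pick_cong, rule pick_swap_odd)
      fix a b c d s assume "\<not> (odd_cell c \<and> odd_cell d)"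
      then show "Q d a b c s = 0"
        by (cases a; cases b; cases c; cases d) (simp_all add: Q_def N_def)
    qed
    also have "\<dots> = - pick cs (\<lambda>a r. pick r (\<lambda>b q. pick q (\<lambda>d t. pick t (\<lambda>c s. Q d a b c s))))"
      by (simp add: pick_uminus)
    also have "pick cs (\<lambda>a r. pick r (\<lambda>b q. pick q (\<lambda>d t. pick t (\<lambda>c s. Q d a b c s))))
        = pick cs (\<lambda>a r. pick r (\<lambda>d q. pick q (\<lambda>b t. pick t (\<lambda>c s. Q d a b c s))))"
    proof (rule pick_cong, rule pick_swap_even, rule pick_zero)
      fix a b c d s assume "odd_cell b" "odd_cell d"
      then show "Q d a b c s = 0"
        by (cases a; cases b; cases c; cases d) (simp_all add: Q_def N_def)
    qed
    also have "\<dots> = - pick cs (\<lambda>d r. pick r (\<lambda>a q. pick q (\<lambda>b t. pick t (\<lambda>c s. Q d a b c s))))"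
    proof (rule pick_swap_odd, rule pick_zero, rule pick_zero)
      fix a b c d s assume "\<not> (odd_cell a \<and> odd_cell d)"
      then show "Q d a b c s = 0"
        by (cases a; cases b; cases c; cases d) (simp_all add: Q_def N_def)
    qed
    finally show ?thesis by simp
  qed
  finally show ?thesis by simp
qed

section \<open>Supports\<close>

text \<open>Connectedness by cuts instead of paths: no letter crosses from A to its complement. A
  cut is easily transported through splittings and contractions.\<close>

definition connected_cells :: "cell list \<Rightarrow> bool" where
  "connected_cells cs \<longleftrightarrow> (\<forall>A. A \<inter> vertices cs \<noteq> {} \<longrightarrow>
    (\<forall>c\<in>set cs. set (cell_ends c) \<subseteq> A \<or> set (cell_ends c) \<inter> A = {}) \<longrightarrow> vertices cs \<subseteq> A)"

text \<open>With k = 2 this is the valence after opening all double edges; with k = 1 it is the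
  degree that contractions of an edge against a double edge preserve.\<close>

definition degree_with :: "nat \<Rightarrow> cell list \<Rightarrow> nat \<Rightarrow> nat" where
  "degree_with k cs i = (\<Sum>c\<leftarrow>cs. (if is_marked c then k else 1) * count_list (cell_ends c) i)"

definition min_degree :: "nat \<Rightarrow> nat \<Rightarrow> cell list \<Rightarrow> bool" where
  "min_degree k m cs \<longleftrightarrow> (\<forall>x\<in>vertices cs. m \<le> degree_with k cs x)"

lemma degree_with_simps [simp]:
  "degree_with k [] i = 0"
  "degree_with k (c # cs) i = (if is_marked c then k else 1) * count_list (cell_ends c) i + degree_with k cs i"
  by (simp_all add: degree_with_def)

lemma is_marked_simps [simp]:
  "is_marked (reverse_cell c) = is_marked c" "is_marked (rename \<rho> c) = is_marked c"
  by (cases c; simp)+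

lemma is_loop_simps [simp]:
  "is_loop (reverse_cell c) = is_loop c" "inj \<rho> \<Longrightarrow> is_loop (rename \<rho> c) = is_loop c"
  by (cases c; auto simp: inj_eq)+

lemma graph_invariant_connected: "graph_invariant connected_cells"
proof (rule graph_invariantI)
  fix cs cs' :: "cell list" assume m: "mset cs = mset cs'"
  show "connected_cells cs = connected_cells cs'"
    unfolding connected_cells_def vertices_mset[OF m] mset_eq_setD[OF m] ..
next
  fix c r
  show "connected_cells (c # r) = connected_cells (reverse_cell c # r)"
    by (simp add: connected_cells_def)
next
  fix \<rho> :: "nat \<Rightarrow> nat" and cs assume \<rho>: "inj \<rho>"
  show "connected_cells (map (rename \<rho>) cs) = connected_cells cs"
  proof
    assume L: "connected_cells (map (rename \<rho>) cs)"
    show "connected_cells cs"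
      unfolding connected_cells_def
    proof (intro allI impI)
      fix A assume A: "A \<inter> vertices cs \<noteq> {}"
        "\<forall>c\<in>set cs. set (cell_ends c) \<subseteq> A \<or> set (cell_ends c) \<inter> A = {}"
      have "\<rho> ` vertices cs \<subseteq> \<rho> ` A"
      proof (rule L[unfolded connected_cells_def vertices_rename, rule_format])
        show "\<rho> ` A \<inter> \<rho> ` vertices cs \<noteq> {}"
          using A(1) by auto
        fix c assume "c \<in> set (map (rename \<rho>) cs)"
        then obtain d where d: "d \<in> set cs" "c = rename \<rho> d" by auto
        have "set (cell_ends d) \<subseteq> A \<or> set (cell_ends d) \<inter> A = {}"
          using A(2) d(1) by blast
        then show "set (cell_ends c) \<subseteq> \<rho> ` A \<or> set (cell_ends c) \<inter> \<rho> ` A = {}"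
          using inj_image_mem_iff[OF \<rho>] d(2) by auto
      qed
      then show "vertices cs \<subseteq> A"
        by (simp add: inj_image_subset_iff[OF \<rho>])
    qed
  next
    assume R: "connected_cells cs"
    show "connected_cells (map (rename \<rho>) cs)"
      unfolding connected_cells_def vertices_rename
    proof (intro allI impI)
      fix A assume A: "A \<inter> \<rho> ` vertices cs \<noteq> {}"
        "\<forall>c\<in>set (map (rename \<rho>) cs). set (cell_ends c) \<subseteq> A \<or> set (cell_ends c) \<inter> A = {}"
      have "vertices cs \<subseteq> \<rho> -` A"
      proof (rule R[unfolded connected_cells_def, rule_format])
        show "\<rho> -` A \<inter> vertices cs \<noteq> {}"
          using A(1) by auto
        fix c assume "c \<in> set cs"
        then have "set (cell_ends (rename \<rho> c)) \<subseteq> A \<or> set (cell_ends (rename \<rho> c)) \<inter> A = {}"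
          using A(2) by auto
        then show "set (cell_ends c) \<subseteq> \<rho> -` A \<or> set (cell_ends c) \<inter> \<rho> -` A = {}"
          by auto
      qed
      then show "\<rho> ` vertices cs \<subseteq> A" by auto
    qed
  qed
qed

lemma count_list_map_inj: "inj \<rho> \<Longrightarrow> count_list (map \<rho> xs) (\<rho> i) = count_list xs i"
  by (induction xs) (simp_all add: inj_eq)

lemma graph_invariant_min_degree: "graph_invariant (min_degree k m)"
proof (rule graph_invariantI)
  fix cs cs' :: "cell list" assume e: "mset cs = mset cs'"
  show "min_degree k m cs = min_degree k m cs'"
    unfolding min_degree_def degree_with_def sum_list_map_mset[OF e] vertices_mset[OF e] ..
next
  fix c r
  have "count_list (cell_ends (reverse_cell c)) i = count_list (cell_ends c) i" for i
    by (cases c) simp_all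
  then show "min_degree k m (c # r) = min_degree k m (reverse_cell c # r)"
    by (simp add: min_degree_def)
next
  fix \<rho> :: "nat \<Rightarrow> nat" and cs assume \<rho>: "inj \<rho>"
  show "min_degree k m (map (rename \<rho>) cs) = min_degree k m cs"
    by (simp add: min_degree_def degree_with_def comp_def count_list_map_inj[OF \<rho>])
qed

lemma graph_invariant_mark_count: "graph_invariant mark_count"
  unfolding mark_count_def[abs_def] by (rule graph_invariant_sum_list) simp_all

lemma graph_invariant_loop_count: "graph_invariant loop_count"
  unfolding loop_count_def[abs_def] by (rule graph_invariant_sum_list) simp_all

lemma graph_invariant_length: "graph_invariant length"
  by (rule graph_invariantI) (auto dest: mset_eq_length)

lemma graph_invariant_card_vertices: "graph_invariant (\<lambda>cs. card (vertices cs))"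
  by (rule graph_invariantI) (auto simp: card_image inj_on_subset dest: vertices_mset)

lemma supported_conj:
  "supported P F \<Longrightarrow> supported Q F \<Longrightarrow> supported (\<lambda>cs. P cs \<and> Q cs) F"
  by (auto simp: supported_def)

lemma supported_mono: "supported P F \<Longrightarrow> (\<And>cs. P cs \<Longrightarrow> Q cs) \<Longrightarrow> supported Q F"
  by (auto simp: supported_def)

lemma choices_preimage:
  assumes "list_all2 (\<lambda>c c'. c' \<in> set (cell_choices f c)) r r'" "c' \<in> set r'"
  obtains c where "c \<in> set r" "c' \<in> set (cell_choices f c)"
  using assms by (induction rule: list_all2_induct) auto

lemma supported_connected_split_op:
  assumes "supported connected_cells F"
  shows "supported connected_cells (split_op F)"
proof (rule supported_split_op[OF graph_invariant_connected assms])
  fix x w r r'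
  assume w: "w \<notin> names (Vx x # r)"
    and r: "list_all2 (\<lambda>c c'. c' \<in> set (cell_choices (branch x w) c)) r r'"
    and con: "connected_cells (Vx w # Vx x # Ed x w # r')"
  have v: "vertices r' = vertices r"
    by (rule choices_vertices[OF r])
  show "connected_cells (Vx x # r)"
    unfolding connected_cells_def
  proof (intro allI impI)
    fix A assume A: "A \<inter> vertices (Vx x # r) \<noteq> {}"
      "\<forall>c\<in>set (Vx x # r). set (cell_ends c) \<subseteq> A \<or> set (cell_ends c) \<inter> A = {}"
    \<comment> \<open>The cut is extended to the split word by putting the new vertex on the side of
      x.\<close>
    define B where "B = (if x \<in> A then insert w A else A - {w})"
    have wx: "w \<noteq> x" "w \<notin> vertices r"
      using w by (auto simp: names_def)
    have "vertices (Vx w # Vx x # Ed x w # r') \<subseteq> B"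
    proof (rule con[unfolded connected_cells_def, rule_format])
      show "B \<inter> vertices (Vx w # Vx x # Ed x w # r') \<noteq> {}"
        using A(1) wx by (auto simp: B_def v)
      fix c' assume "c' \<in> set (Vx w # Vx x # Ed x w # r')"
      then consider "c' \<in> set r'" | "c' = Ed x w" | "set (cell_ends c') = {}"
        by auto
      then show "set (cell_ends c') \<subseteq> B \<or> set (cell_ends c') \<inter> B = {}"
      proof cases
        case 1
        then obtain c where c: "c \<in> set r" "c' \<in> set (cell_choices (branch x w) c)"
          by (rule choices_preimage[OF r])
        have "w \<notin> set (cell_ends c)"
          using w c(1) by (auto simp: names_def)
        moreover have "set (cell_ends c) \<subseteq> A \<or> set (cell_ends c) \<inter> A = {}"
          using A(2) c(1) by simp
        ultimately show ?thesis
          using c(2) by (cases c) (auto simp: B_def branch_def split: if_splits)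
      qed (auto simp: B_def wx)
    qed
    then show "vertices (Vx x # r) \<subseteq> A"
      using wx by (auto simp: B_def v split: if_splits)
  qed
qed

lemma connected_cells_same:
  assumes "vertices cs = vertices cs'"
    and "\<And>A. \<forall>c\<in>set cs'. set (cell_ends c) \<subseteq> A \<or> set (cell_ends c) \<inter> A = {} \<Longrightarrow>
      \<forall>c\<in>set cs. set (cell_ends c) \<subseteq> A \<or> set (cell_ends c) \<inter> A = {}"
    and "connected_cells cs"
  shows "connected_cells cs'"
  using assms unfolding connected_cells_def by simp

lemma supported_connected_mark_op:
  "supported connected_cells F \<Longrightarrow> supported connected_cells (mark_op F)"
  by (erule supported_mark_op[OF graph_invariant_connected])
    (rule connected_cells_same[rotated 2], assumption, auto)

lemma supported_connected_unmark_op: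
  "supported connected_cells F \<Longrightarrow> supported connected_cells (unmark_op F)"
  by (erule supported_unmark_op[OF graph_invariant_connected])
    (rule connected_cells_same[rotated 2], assumption, auto)

lemma connected_contract:
  assumes wf: "wf_graph (Vx z # Ed x z # Md y z # r)" and "x \<noteq> z" "l \<longleftrightarrow> y = z"
    and con: "connected_cells (Md x (if l then x else y) # r)"
  shows "connected_cells (Vx z # Ed x z # Md y z # r)"
  unfolding connected_cells_def
proof (intro allI impI)
  fix A assume A: "A \<inter> vertices (Vx z # Ed x z # Md y z # r) \<noteq> {}"
    "\<forall>c\<in>set (Vx z # Ed x z # Md y z # r). set (cell_ends c) \<subseteq> A \<or> set (cell_ends c) \<inter> A = {}"
  have x: "x \<in> vertices r"
    using wf \<open>x \<noteq> z\<close> by (auto simp: wf_graph_Cons)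
  have "x \<in> A \<longleftrightarrow> z \<in> A" "y \<in> A \<longleftrightarrow> z \<in> A"
    using A(2) by auto
  then have "vertices (Md x (if l then x else y) # r) \<subseteq> A"
    using A x by (intro con[unfolded connected_cells_def, rule_format]) (auto split: if_splits)
  with \<open>x \<in> A \<longleftrightarrow> z \<in> A\<close> x show "vertices (Vx z # Ed x z # Md y z # r) \<subseteq> A"
    by auto
qed

lemma choices_degree:
  assumes "list_all2 (\<lambda>c c'. c' \<in> set (cell_choices (branch x w) c)) r r'" "w \<notin> names r" "w \<noteq> x"
  shows "degree_with k r' x + degree_with k r' w = degree_with k r x"
    "i \<noteq> x \<Longrightarrow> i \<noteq> w \<Longrightarrow> degree_with k r' i = degree_with k r i"
proof -
  have "degree_with k r' x + degree_with k r' w = degree_with k r x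
    \<and> (i \<noteq> x \<longrightarrow> i \<noteq> w \<longrightarrow> degree_with k r' i = degree_with k r i)"
    using assms
  proof (induction rule: list_all2_induct)
    case (Cons c r c' r')
    then show ?case
      by (cases c) (auto simp: branch_def algebra_simps split: if_splits)
  qed simp
  then show "degree_with k r' x + degree_with k r' w = degree_with k r x"
    "i \<noteq> x \<Longrightarrow> i \<noteq> w \<Longrightarrow> degree_with k r' i = degree_with k r i"
    by blast+
qed

text \<open>Both vertices that replace x receive one end of the new edge, so the degree of x is at
  least 2 (m - 1), which is at least m for m \<ge> 2.\<close>

lemma supported_min_degree_split_op:
  assumes "supported (min_degree k m) F" "2 \<le> m"
  shows "supported (min_degree k m) (split_op F)"
proof (rule supported_split_op[OF graph_invariant_min_degree assms(1)])
  fix x w r r'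
  assume w: "w \<notin> names (Vx x # r)"
    and r: "list_all2 (\<lambda>c c'. c' \<in> set (cell_choices (branch x w) c)) r r'"
    and deg: "min_degree k m (Vx w # Vx x # Ed x w # r')"
  have wx: "w \<notin> names r" "w \<noteq> x" "w \<notin> vertices r"
    using w by (auto simp: names_def)
  note d = choices_degree[OF r wx(1,2), where k = k]
  have "m \<le> 1 + degree_with k r' w" "m \<le> 1 + degree_with k r' x"
    using deg wx(2) by (simp_all add: min_degree_def)
  then have "m \<le> degree_with k r x"
    using d(1) assms(2) by linarith
  moreover have "m \<le> degree_with k r i" if "i \<in> vertices r" "i \<noteq> x" for i
  proof -
    have i: "i \<noteq> w"
      using that(1) wx(3) by auto
    have "m \<le> degree_with k (Vx w # Vx x # Ed x w # r') i"
      using deg that(1) by (simp add: min_degree_def choices_vertices[OF r])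
    then show ?thesis
      using d(2)[OF that(2) i] that(2) i by simp
  qed
  ultimately show "min_degree k m (Vx x # r)"
    by (auto simp: min_degree_def)
qed

lemma supported_min_degree_mark_op:
  assumes "supported (min_degree k m) F" "k \<le> 2"
  shows "supported (min_degree k m) (mark_op F)"
proof (rule supported_mark_op[OF graph_invariant_min_degree assms(1)])
  fix p q r assume pq: "p \<noteq> q" "min_degree k m (Md p q # r)"
  have "k * count_list [p, q] i \<le> 2 * count_list [p, q] i" for i
    using assms(2) by (rule mult_right_mono) simp
  then have "degree_with k (Md p q # r) i \<le> degree_with k (Ed p q # Ed p q # r) i" for i
    by (simp add: numeral_2_eq_2)
  then show "min_degree k m (Ed p q # Ed p q # r)"
    using pq(2) le_trans unfolding min_degree_def vertices_simps by blast
qed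

text \<open>Weight 2 is what makes opening a double edge preserve degrees; the chase therefore uses
  this weight.\<close>

lemma supported_min_degree_unmark_op:
  assumes "supported (min_degree 2 m) F"
  shows "supported (min_degree 2 m) (unmark_op F)"
  by (rule supported_unmark_op[OF graph_invariant_min_degree assms])
    (auto simp: min_degree_def numeral_2_eq_2)

lemma min_degree_2_3_imp_1_2: "min_degree 2 3 cs \<Longrightarrow> min_degree 1 2 cs"
proof -
  have "degree_with 2 cs i \<le> 2 * degree_with 1 cs i" for i
    by (induction cs) auto
  note le = this
  assume "min_degree 2 3 cs"
  then have "3 \<le> 2 * degree_with 1 cs x" if "x \<in> vertices cs" for x
    using that le[of x] le_trans unfolding min_degree_def by blast
  then show "min_degree 1 2 cs"
    unfolding min_degree_def by force
qed

lemma choices_mark_count: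
  "list_all2 (\<lambda>c c'. c' \<in> set (cell_choices f c)) r r' \<Longrightarrow> mark_count r' = mark_count r"
proof (induction rule: list_all2_induct)
  case (Cons c r c' r')
  then show ?case by (cases c) auto
qed simp

lemma supported_mark_count_split_op:
  "supported (\<lambda>cs. mark_count cs = n) F \<Longrightarrow> supported (\<lambda>cs. mark_count cs = n) (split_op F)"
  by (erule supported_split_op[OF graph_invariant_comp[OF graph_invariant_mark_count]])
    (simp add: choices_mark_count)

lemma supported_mark_count_mark_op:
  "supported (\<lambda>cs. mark_count cs = Suc n) F \<Longrightarrow> supported (\<lambda>cs. mark_count cs = n) (mark_op F)"
  by (erule supported_mark_op[OF graph_invariant_comp[OF graph_invariant_mark_count]]) simp

lemma supported_mark_count_unmark_op:
  "supported (\<lambda>cs. mark_count cs = n) F \<Longrightarrow> supported (\<lambda>cs. mark_count cs = Suc n) (unmark_op F)"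
  by (erule supported_unmark_op[OF graph_invariant_comp[OF graph_invariant_mark_count]]) simp

lemma supported_card_vertices_split_op:
  assumes "supported (\<lambda>cs. card (vertices cs) = Suc n) F" "equivariant F"
  shows "supported (\<lambda>cs. card (vertices cs) = n) (split_op F)"
proof (rule supported_split_op[OF graph_invariant_comp[OF graph_invariant_card_vertices]
      supported_conj[OF assms(1) equivariantD(4)[OF assms(2)]]])
  fix x w r r'
  assume w: "w \<notin> names (Vx x # r)"
    and r: "list_all2 (\<lambda>c c'. c' \<in> set (cell_choices (branch x w) c)) r r'"
    and n: "card (vertices (Vx w # Vx x # Ed x w # r')) = Suc n \<and> wf_graph (Vx w # Vx x # Ed x w # r')"
  have "w \<notin> insert x (vertices r)"
    using w by (auto simp: names_def)
  then show "card (vertices (Vx x # r)) = n"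
    using n by (simp add: choices_vertices[OF r])
qed

lemma supported_card_vertices_unmark_op:
  "supported (\<lambda>cs. card (vertices cs) = n) F \<Longrightarrow> supported (\<lambda>cs. card (vertices cs) = n) (unmark_op F)"
  by (erule supported_unmark_op[OF graph_invariant_comp[OF graph_invariant_card_vertices]]) simp

lemma loop_count_le_mark_count: "loop_count cs \<le> mark_count cs"
proof (induction cs)
  case (Cons c cs)
  then show ?case by (cases c) auto
qed simp

text \<open>A contraction trades the edge end at x for a double edge end and removes z, which meets
  one edge and one double edge. With weight 1 the degree of x is unchanged and z has degree two, so
  the bound 2 passes from the contracted word to the original one. With weight 2 the original word
  may have a smaller degree at x, and the bound 3 would be lost.\<close>

definition good :: "nat \<Rightarrow> cell list \<Rightarrow> bool" where
  "good r cs \<longleftrightarrow> connected_cells cs \<and> min_degree 1 2 cs \<and> mark_count cs = r"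

lemma graph_invariant_good: "graph_invariant (good r)"
  unfolding good_def[abs_def]
  by (rule graph_invariant_comp2[OF graph_invariant_connected graph_invariant_comp2[OF
          graph_invariant_min_degree graph_invariant_mark_count, of "\<lambda>a b. a \<and> b = r"], of "(\<and>)"])

lemma supported_goodD:
  assumes "supported (good r) F"
  shows "supported connected_cells F" "supported (min_degree 1 2) F" "supported (\<lambda>cs. mark_count cs = r) F"
  by (rule supported_mono[OF assms]; simp add: good_def)+

lemma supported_goodI:
  assumes "supported connected_cells F" "supported (min_degree 1 2) F" "supported (\<lambda>cs. mark_count cs = r) F"
  shows "supported (good r) F"
  using assms by (auto simp: supported_def good_def)

lemma supported_good_split_op: "supported (good r) F \<Longrightarrow> supported (good r) (split_op F)"
  by (intro supported_goodI supported_connected_split_op supported_min_degree_split_op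
      supported_mark_count_split_op) (auto dest: supported_goodD)

lemma supported_good_mark_op: "supported (good (Suc r)) F \<Longrightarrow> supported (good r) (mark_op F)"
  by (intro supported_goodI supported_connected_mark_op supported_min_degree_mark_op
      supported_mark_count_mark_op) (auto dest: supported_goodD)

lemma supported_good_contract_False:
  assumes "supported (good r) F"
  shows "supported (good r) (contract_op False F)"
proof (rule supported_contract_op[OF graph_invariant_good assms])
  fix z x y q
  assume *: "x \<noteq> z" "False \<longleftrightarrow> y = z" "wf_graph (Vx z # Ed x z # Md y z # q)"
    "good r (Md x (if False then x else y) # q)"
  have "z \<notin> vertices q"
    using *(3) by (simp add: wf_graph_Cons)
  then have "min_degree 1 2 (Vx z # Ed x z # Md y z # q)"
    using *(1,2,4) unfolding good_def min_degree_def by auto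
  moreover have "connected_cells (Vx z # Ed x z # Md y z # q)"
    using connected_contract[OF *(3,1,2)] *(4) by (simp add: good_def)
  ultimately show "good r (Vx z # Ed x z # Md y z # q)"
    using *(4) by (simp add: good_def)
qed

text \<open>If contracting a loop creates a vertex of degree one, then the contracted graph consists
  of a single vertex with a loop.\<close>

lemma supported_good_contract_True:
  assumes "supported (\<lambda>cs. good r cs \<and> length cs \<noteq> 2) F" "equivariant F"
  shows "supported (good r) (contract_op True F)"
proof (rule supported_contract_op[OF graph_invariant_good supported_conj[OF assms(1) equivariantD(4)[OF assms(2)]]])
  fix z x y q
  assume *: "x \<noteq> z" "True \<longleftrightarrow> y = z" "wf_graph (Vx z # Ed x z # Md y z # q)"
    "(good r (Md x (if True then x else y) # q) \<and> length (Md x (if True then x else y) # q) \<noteq> 2)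
      \<and> wf_graph (Md x (if True then x else y) # q)"
  have wf: "wf_graph q"
    using *(4) by (simp add: wf_graph_Cons(2))
  have q: "z \<notin> vertices q" "x \<in> vertices q"
    using *(1,3) by (auto simp: wf_graph_Cons)
  have one: "count (mset q) (Vx y) \<le> 1" and ends: "c \<in> set q \<Longrightarrow> set (cell_ends c) \<subseteq> vertices q" for y c
    using wf unfolding wf_graph_def by blast+
  have con: "connected_cells (Md x x # q)"
    using *(4) by (simp add: good_def)
  have "degree_with 1 q x \<noteq> 0"
  proof
    assume 0: "degree_with 1 q x = 0"
    have none: "x \<notin> set (cell_ends c)" if "c \<in> set q" for c
      using 0 that by (induction q) (auto simp: count_list_0_iff split: if_splits)
    have "vertices (Md x x # q) \<subseteq> {x}"
      by (rule con[unfolded connected_cells_def, rule_format]) (use q(2) none in auto)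
    then have v: "vertices q = {x}"
      using q(2) by auto
    have "c = Vx x" if c: "c \<in> set q" for c
      using none[OF c] ends[OF c] c unfolding v by (cases c) (use v in \<open>auto simp: vertices_def\<close>)
    then have "q = replicate (length q) (Vx x)"
      by (simp add: replicate_length_same)
    moreover have "count (mset (replicate n (Vx x))) (Vx x) = n" for n
      by simp
    ultimately have "length q \<le> 1"
      using one[of x] by metis
    moreover have "length q \<noteq> 0"
      using q(2) by auto
    ultimately show False
      using *(4) by (cases q) auto
  qed
  then have "min_degree 1 2 (Vx z # Ed x z # Md y z # q)"
    using *(1,2,4) q(1) unfolding good_def min_degree_def by auto
  moreover have "connected_cells (Vx z # Ed x z # Md y z # q)"
    using connected_contract[OF *(3,1), of True] *(2,4) by (simp add: good_def)
  ultimately show "good r (Vx z # Ed x z # Md y z # q)"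
    using *(4) by (simp add: good_def)
qed

section \<open>Exactness of the dual complexes\<close>

lemma reattach_sum_diff:
  "reattach_sum f cs (\<lambda>r. K r - K' r) = reattach_sum f cs K - reattach_sum f cs K'"
  using reattach_sum_add[of f cs K "\<lambda>r. - K' r"] by (simp add: reattach_sum_uminus)

lemma split_op_diff: "split_op (\<lambda>cs. F cs - G cs) cs = split_op F cs - split_op G cs"
proof -
  have "split_vertex_cell w (\<lambda>cs. F cs - G cs) a r = split_vertex_cell w F a r - split_vertex_cell w G a r"
    for w a r by (cases a) (simp_all add: reattach_sum_diff)
  then have "split_vertex_cell w (\<lambda>cs. F cs - G cs)
      = (\<lambda>a r. split_vertex_cell w F a r - split_vertex_cell w G a r)" for w
    by (intro ext)
  then show ?thesis
    unfolding split_op_def split_with_def by (simp only: pick_diff)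
qed

lemma split_op_scale: "split_op (\<lambda>cs. c * F cs) cs = c * split_op F cs"
proof -
  have "split_vertex_cell w (\<lambda>cs. c * F cs) a r = c * split_vertex_cell w F a r"
    for w a r by (cases a) (simp_all add: reattach_sum_mult)
  then have "split_vertex_cell w (\<lambda>cs. c * F cs) = (\<lambda>a r. c * split_vertex_cell w F a r)" for w
    by (intro ext)
  then show ?thesis
    unfolding split_op_def split_with_def by (simp only: pick_mult)
qed

text \<open>The value at a word depends only on words with at most as many loops. Thus loop numbers
  filter the complex, and the loop-free level can be treated on its own.\<close>

lemma split_op_cong:
  assumes "\<And>cs'. loop_count cs' \<le> loop_count cs \<Longrightarrow> F cs' = F' cs'"
  shows "split_op F cs = split_op F' cs"
  unfolding split_op_def split_with_def
proof (rule pick_cong)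
  fix a r assume ar: "mset (a # r) = mset cs"
  let ?w = "fresh_vertex cs"
  have w: "?w \<notin> names r"
    using fresh_vertex[of cs] names_mset[OF ar] by (cases a) auto
  show "split_vertex_cell ?w F a r = split_vertex_cell ?w F' a r"
  proof (cases a)
    case (Vx x)
    show ?thesis
      unfolding Vx split_vertex_cell.simps
    proof (rule reattach_sum_cong, rule assms)
      fix r' assume "list_all2 (\<lambda>c c'. c' \<in> set (cell_choices (branch x ?w) c)) r r'"
      from choices_loop_count[OF this w] show "loop_count (Vx ?w # Vx x # Ed x ?w # r') \<le> loop_count cs"
        using loop_count_mset[OF ar] by (simp add: Vx)
    qed
  qed simp_all
qed

lemma split_op_zero:
  assumes "\<And>cs'. loop_count cs' \<le> loop_count cs \<Longrightarrow> F cs' = 0"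
  shows "split_op F cs = 0"
proof -
  have "split_op F cs = split_op (\<lambda>cs. 0 * F cs) cs"
    by (rule split_op_cong) (simp add: assms)
  then show ?thesis
    unfolding split_op_scale by simp
qed

lemma mark_op_cong:
  fixes F F' :: "cell list \<Rightarrow> 'k::comm_ring_1"
  assumes "\<And>cs'. loop_count cs' = 0 \<Longrightarrow> F cs' = F' cs'" and cs: "loop_count cs = 0"
  shows "mark_op F cs = mark_op F' cs"
  unfolding mark_op_def
proof (intro pick_cong)
  fix a r b q assume "mset (a # r) = mset cs" "mset (b # q) = mset r"
  then have m: "mset (a # b # q) = mset cs" by simp
  show "parallel_sign a b * F (mark a # q) = parallel_sign a b * F' (mark a # q)"
  proof (cases "parallel_sign a b = (0 :: 'k)")
    case False
    then obtain s t where "s \<noteq> t" "a = Ed s t"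
      by (rule parallel_sign_nonzero)
    then have "loop_count (mark a # q) = 0"
      using loop_count_mset[OF m] cs by simp
    then show ?thesis
      by (simp only: assms(1))
  qed simp
qed

lemma mark_op_add: "mark_op (\<lambda>cs. F cs + G cs) cs = mark_op F cs + mark_op G cs"
  by (simp add: mark_op_def distrib_left pick_add)

lemma mark_op_scale: "mark_op (\<lambda>cs. c * F cs) cs = c * mark_op F cs"
  by (simp add: mark_op_def mult.left_commute[of _ c] pick_mult)

text \<open>The word is the theta graph with two of its three edges replaced by a double
  edge.\<close>

definition vanishes_on_theta :: "(cell list \<Rightarrow> 'k::comm_ring_1) \<Rightarrow> bool" where
  "vanishes_on_theta F \<longleftrightarrow> (\<forall>x w. x \<noteq> w \<longrightarrow> F [Vx w, Vx x, Ed x w, Md x w] = 0)"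

text \<open>If the two ends of the loop are separated, the splitting is a theta word; otherwise one
  of the two vertices has degree one.\<close>

lemma split_op_single_loop:
  assumes F: "supported (good r) F" "vanishes_on_theta F" "equivariant F"
  shows "split_op F [Vx x, Md x x] = 0"
proof -
  define w where "w = fresh_vertex [Vx x, Md x x]"
  have wx: "w \<noteq> x"
    using fresh_vertex[of "[Vx x, Md x x]"] by (simp add: w_def)
  have "F [Vx w, Vx x, Ed x w, Md x x] = 0" "F [Vx w, Vx x, Ed x w, Md w w] = 0"
    by (rule supportedD[OF F(1)]; use wx in \<open>simp add: good_def min_degree_def\<close>)+
  moreover have "F [Vx w, Vx x, Ed x w, Md x w] = 0"
    using F(2) wx by (simp add: vanishes_on_theta_def)
  moreover have "F [Vx w, Vx x, Ed x w, Md w x] = 0"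
    using calculation(3) cell_symmetric_reverse[OF cell_symmetric_append[OF equivariantD(1)[OF F(3)],
        of "[Vx w, Vx x, Ed x w]"], of "Md w x" "[]"] by simp
  ultimately show ?thesis
    by (simp add: split_op_def split_with_def branch_def flip: w_def)
qed

lemma wf_graph_two_cells:
  assumes wf: "wf_graph cs" and "length cs = 2" "loop_count cs \<noteq> 0"
  obtains x where "mset cs = mset [Vx x, Md x x]"
proof -
  obtain a b where cs: "cs = [a, b]"
    using assms(2) by (auto simp: numeral_2_eq_2 length_Suc_conv)
  have "\<exists>x. {#a, b#} = {#Vx x, Md x x#}"
    using wf assms(3) unfolding cs
    by (cases a; cases b) (auto simp: wf_graph_def vertices_def add_mset_commute split: if_splits)
  then show thesis
    using that cs by auto
qed

text \<open>The defect of closedness at the next number of loops is itself closed there. Hence the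
  loop-sliding homotopy, divided by its factor \<open>2 * of_nat (Suc k)\<close>, provides a
  correction that leaves words with fewer loops untouched.\<close>

lemma extend_over_loops:
  fixes F :: "cell list \<Rightarrow> 'k::field_char_0"
  assumes F: "equivariant F" "supported (good r) F" "vanishes_on_theta F"
    and closed: "\<And>cs. loop_count cs = 0 \<Longrightarrow> split_op F cs = 0"
  shows "\<exists>G. equivariant G \<and> supported (good r) G \<and> (\<forall>cs. loop_count cs = 0 \<longrightarrow> G cs = F cs)
    \<and> (\<forall>cs. loop_count cs \<le> k \<longrightarrow> split_op G cs = 0) \<and> (\<forall>cs. k < loop_count cs \<longrightarrow> G cs = 0)"
proof (induction k)
  case 0
  have L: "graph_invariant (\<lambda>cs. loop_count cs = 0)"
    by (rule graph_invariant_comp[OF graph_invariant_loop_count])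
  let ?G = "\<lambda>cs. if loop_count cs = 0 then F cs else 0"
  have "split_op ?G cs = 0" if "loop_count cs = 0" for cs
    using split_op_cong[of cs ?G F] closed[OF that] that by simp
  then show ?case
    using equivariant_restrict[OF L F(1)] F(2) by (intro exI[of _ ?G]) (auto simp: supported_def)
next
  case (Suc k)
  then obtain G where G: "equivariant G" "supported (good r) G" "\<And>cs. loop_count cs = 0 \<Longrightarrow> G cs = F cs"
    "\<And>cs. loop_count cs \<le> k \<Longrightarrow> split_op G cs = 0" "\<And>cs. k < loop_count cs \<Longrightarrow> G cs = 0"
    by blast
  \<comment> \<open>The defect of closedness, restricted to the first number of loops where it can
    be nonzero.\<close>
  define E where "E cs = (if loop_count cs = Suc k then split_op G cs else 0)" for cs
  have E: "equivariant E"
    unfolding E_def[abs_def]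
    by (rule equivariant_restrict[OF graph_invariant_comp[OF graph_invariant_loop_count]
          equivariant_split_op[OF G(1)]])
  have theta: "vanishes_on_theta G"
    using F(3) G(3) by (simp add: vanishes_on_theta_def)
  \<comment> \<open>On a single vertex with a loop, sliding the loop would start from a vertex of
    degree one. The defect must vanish there, and this is where the theta condition enters.\<close>
  have E0: "E cs = 0" if len: "length cs = 2" for cs
  proof (rule ccontr)
    assume n: "E cs \<noteq> 0"
    have "wf_graph cs"
      using equivariantD(5)[OF E] n by blast
    moreover have "loop_count cs \<noteq> 0"
      using n by (auto simp: E_def split: if_splits)
    ultimately obtain x where x: "mset cs = mset [Vx x, Md x x]"
      using wf_graph_two_cells[OF _ len] by metis
    have "E [Vx x, Md x x] = 0"
      using split_op_single_loop[OF G(2) theta G(1)] by (simp add: E_def)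
    then show False
      using graded_symmetric_mset[OF equivariantD(2)[OF E] x[symmetric]] n by blast
  qed
  have "supported (good r) E"
    using supported_good_split_op[OF G(2)] by (auto simp: supported_def E_def)
  then have "supported (\<lambda>cs. good r cs \<and> length cs \<noteq> 2) E"
    using E0 by (auto simp: supported_def)
  from supported_good_contract_True[OF this E]
  have CE: "supported (good r) (contract_op True E)" .
  have loops: "supported (\<lambda>cs. P (loop_count cs)) (contract_op True H)"
    if "supported (\<lambda>cs. P (loop_count cs)) H" for P and H :: "cell list \<Rightarrow> 'k"
    by (rule supported_contract_op[OF graph_invariant_comp[OF graph_invariant_loop_count] that]) auto
  have "supported (\<lambda>cs. loop_count cs = Suc k) E"
    by (simp add: supported_def E_def)
  from loops[OF this] have CE': "contract_op True E cs = 0" if "loop_count cs \<noteq> Suc k" for cs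
    using that by (simp add: supported_def)
  \<comment> \<open>On words with at most \<open>Suc k\<close> loops the defect agrees with
    \<open>split_op G\<close>, because G is closed below; so the claim is that splitting squares to
    zero.\<close>
  have split_E: "split_op E cs = 0" if "loop_count cs = Suc k" for cs
  proof -
    have "split_op E cs = split_op (split_op G) cs"
      by (rule split_op_cong) (use that G(4) in \<open>auto simp: E_def le_Suc_eq\<close>)
    then show ?thesis
      using split_op_split_op[OF G(1)] by simp
  qed
  have "supported (\<lambda>cs. loop_count cs \<noteq> Suc k) (split_op E)"
    using split_E by (simp add: supported_def)
  from loops[OF this] have CSE: "contract_op True (split_op E) cs = 0" if "loop_count cs = Suc k" for cs
    using that by (simp add: supported_def)
  have split_CE: "split_op (contract_op True E) cs = 2 * of_nat (Suc k) * split_op G cs"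
    if cs: "loop_count cs = Suc k" for cs
  proof (cases "wf_graph cs")
    case True
    have "split_op (contract_op True E) cs + contract_op True (split_op E) cs
        = 2 * of_nat (if True then loop_count cs else 2 * mark_count cs) * E cs"
      by (rule split_contract_homotopy[OF E True]) (simp add: E_def cs)
    then show ?thesis
      unfolding CSE[OF cs] E_def using cs by simp
  next
    case False
    then show ?thesis
      using equivariantD(5)[OF equivariant_split_op[OF equivariant_contract_op[OF E]] False]
        equivariantD(5)[OF equivariant_split_op[OF G(1)] False] by simp
  qed
  let ?c = "1 / (2 * of_nat (Suc k)) :: 'k"
  let ?G = "\<lambda>cs. G cs - ?c * contract_op True E cs"
  have split: "split_op ?G cs = split_op G cs - ?c * split_op (contract_op True E) cs" for cs
    by (simp only: split_op_diff split_op_scale)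
  have "split_op ?G cs = 0" if cs: "loop_count cs \<le> Suc k" for cs
  proof (cases "loop_count cs = Suc k")
    case True
    have "(of_nat (Suc k) :: 'k) \<noteq> 0"
      by (simp only: of_nat_eq_0_iff)
    then show ?thesis
      unfolding split split_CE[OF True] by (simp del: of_nat_Suc)
  next
    case False
    then have "split_op (contract_op True E) cs = 0"
      using cs by (intro split_op_zero CE') auto
    then show ?thesis
      unfolding split using G(4) cs False by simp
  qed
  moreover have "?G cs = 0" if "Suc k < loop_count cs" for cs
    using G(5) CE' that by simp
  moreover have "?G cs = F cs" if "loop_count cs = 0" for cs
    using G(3) CE' that by simp
  moreover have "equivariant ?G"
    by (intro equivariant_diff equivariant_scale equivariant_contract_op G(1) E)
  moreover have "supported (good r) ?G"
    using G(2) CE by (simp add: supported_def)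
  ultimately show ?case
    by blast
qed

text \<open>The contraction may evaluate a function on words with loops even when the argument is
  loop-free, so F is first replaced by a function closed on all words. A word with r double edges
  has at most r loops, so r extension steps suffice.\<close>

theorem loop_free_exact:
  fixes F :: "cell list \<Rightarrow> 'k::field_char_0"
  assumes F: "equivariant F" "supported (good r) F" "vanishes_on_theta F"
    and closed: "\<And>cs. loop_count cs = 0 \<Longrightarrow> split_op F cs = 0" and r: "r \<noteq> 0"
  obtains G where "equivariant G" "supported (good r) G" "\<And>cs. loop_count cs = 0 \<Longrightarrow> split_op G cs = F cs"
proof -
  obtain H where H: "equivariant H" "supported (good r) H" "\<And>cs. loop_count cs = 0 \<Longrightarrow> H cs = F cs"
    "\<And>cs. loop_count cs \<le> r \<Longrightarrow> split_op H cs = 0"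
    using extend_over_loops[OF F closed, of r] by blast
  have marks: "supported (\<lambda>cs. mark_count cs = r) K" if "supported (good r) K" for K :: "cell list \<Rightarrow> 'k"
    by (rule supported_goodD(3)[OF that])
  have H0: "split_op H cs = 0" for cs
  proof (cases "mark_count cs = r")
    case True
    then show ?thesis
      using H(4) loop_count_le_mark_count[of cs] by simp
  next
    case False
    then show ?thesis
      using marks[OF supported_good_split_op[OF H(2)]] by (simp add: supported_def)
  qed
  \<comment> \<open>Inverse of the homotopy factor: r double edges have 2 r ends, each counted
    twice.\<close>
  define c :: 'k where "c = 1 / (4 * of_nat r)"
  have split: "split_op (contract_op False H) cs = 4 * of_nat r * H cs" for cs
  proof (cases "wf_graph cs")
    case True
    have "split_op (contract_op False H) cs + contract_op False (split_op H) cs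
        = 2 * of_nat (if False then loop_count cs else 2 * mark_count cs) * H cs"
      by (rule split_contract_homotopy[OF H(1) True]) simp
    moreover have "contract_op False (split_op H) cs = 0"
      by (simp add: contract_op_def H0 pick_zero)
    moreover have "of_nat (mark_count cs) * H cs = of_nat r * H cs"
      using marks[OF H(2)] by (cases "mark_count cs = r") (simp_all add: supported_def)
    ultimately show ?thesis by (simp add: mult.assoc)
  next
    case False
    then show ?thesis
      using equivariantD(5)[OF equivariant_split_op[OF equivariant_contract_op[OF H(1)]]]
        equivariantD(5)[OF H(1)] by simp
  qed
  show thesis
  proof (rule that[of "\<lambda>cs. c * contract_op False H cs"])
    show "equivariant (\<lambda>cs. c * contract_op False H cs)"
      by (intro equivariant_scale equivariant_contract_op H(1))
    show "supported (good r) (\<lambda>cs. c * contract_op False H cs)"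
      using supported_good_contract_False[OF H(2)] by (simp add: supported_def)
    show "split_op (\<lambda>cs. c * contract_op False H cs) cs = F cs" if "loop_count cs = 0" for cs
      unfolding split_op_scale split using r H(3)[OF that] by (simp add: c_def)
  qed
qed

section \<open>Division by the number of parallel pairs\<close>

definition parallel_weight :: "cell \<Rightarrow> cell list \<Rightarrow> 'k::comm_ring_1" where
  "parallel_weight a r = (\<Sum>c\<leftarrow>r. cell_multiplicity c * of_bool (parallel_cells a c))"

lemma parallel_weight_simps [simp]:
  "parallel_weight a [] = 0"
  "parallel_weight a (c # r) = cell_multiplicity c * of_bool (parallel_cells a c) + parallel_weight a r"
  by (simp_all add: parallel_weight_def)

lemma pair_count_Nil [simp]: "pair_count [] = 0"
  by (simp add: pair_count_def)

lemma pair_count_Cons: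
  "pair_count (a # r) = (cell_multiplicity a * cell_multiplicity a - cell_multiplicity a) * of_bool (parallel_cells a a)
    + 2 * (cell_multiplicity a * parallel_weight a r) + (pair_count r :: 'k::comm_ring_1)"
proof -
  have "(\<Sum>c\<leftarrow>r. cell_multiplicity c * cell_multiplicity a * of_bool (parallel_cells c a))
      = cell_multiplicity a * (parallel_weight a r :: 'k)"
    "(\<Sum>c\<leftarrow>r. cell_multiplicity a * cell_multiplicity c * of_bool (parallel_cells a c))
      = cell_multiplicity a * (parallel_weight a r :: 'k)"
    unfolding parallel_weight_def sum_list_const_mult[symmetric]
    by (simp_all add: parallel_cells_commute[of _ a] ac_simps)
  then show ?thesis
    by (simp add: pair_count_def sum_list_map_add algebra_simps)
qed

lemma parallel_weight_int:
  "(0 :: int) \<le> parallel_weight a r" "parallel_weight a r = (of_int (parallel_weight a r) :: 'k::comm_ring_1)"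
proof -
  have "(0 :: int) \<le> cell_multiplicity c" "cell_multiplicity c = (of_int (cell_multiplicity c) :: 'k)" for c
    by (cases c; simp)+
  then show "(0 :: int) \<le> parallel_weight a r" "parallel_weight a r = (of_int (parallel_weight a r) :: 'k)"
    by (induction r) (auto simp: algebra_simps)
qed

text \<open>Positivity is available over the integers; characteristic zero then transfers it to
  nonvanishing in the field.\<close>

lemma pair_count_int:
  "(0 :: int) \<le> pair_count cs" "pair_count cs = (of_int (pair_count cs) :: 'k::comm_ring_1)"
proof -
  show "(0 :: int) \<le> pair_count cs"
  proof (induction cs)
    case (Cons c cs)
    then show ?case
      using parallel_weight_int(1)[of c cs] by (cases c) (simp_all add: pair_count_Cons)
  qed simp
  show "pair_count cs = (of_int (pair_count cs) :: 'k)"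
  proof (induction cs)
    case (Cons c cs)
    then show ?case
      using parallel_weight_int(2)[of c cs, where ?'k = 'k] by (cases c) (simp_all add: pair_count_Cons)
  qed simp
qed

lemma pair_count_nonzero_Md:
  assumes "p \<noteq> q"
  shows "pair_count (Md p q # r) \<noteq> (0 :: 'k::field_char_0)"
proof -
  have "(0 :: int) < pair_count (Md p q # r)"
    using assms parallel_weight_int(1)[of "Md p q" r] pair_count_int(1)[of r]
    by (simp add: pair_count_Cons parallel_cells_Md)
  then show ?thesis
    by (subst pair_count_int(2)) simp
qed

lemma pair_count_nonzero_Ed:
  assumes "parallel_cells a b" "\<not> odd_cell a" "\<not> odd_cell b"
  shows "pair_count (a # b # r) \<noteq> (0 :: 'k::field_char_0)"
proof -
  have "cell_multiplicity a = (1 :: int)" "cell_multiplicity b = (1 :: int)"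
    using assms by (cases a; cases b; simp)+
  then have "(0 :: int) < pair_count (a # b # r)"
    using assms parallel_weight_int(1)[of a r] parallel_weight_int(1)[of b r] pair_count_int(1)[of r]
    by (simp add: pair_count_Cons)
  then show ?thesis
    by (subst pair_count_int(2)) simp
qed

lemma mark_count_nonzero: "mark_count cs \<noteq> 0 \<Longrightarrow> \<exists>c\<in>set cs. is_marked c"
  by (induction cs) auto

text \<open>A double edge that is not a loop already contains two parallel edges, so division by the
  number of pairs is possible on loop-free words with a mark.\<close>

lemma pair_count_nonzero_loop_free:
  assumes "loop_count cs = 0" "mark_count cs \<noteq> 0"
  shows "pair_count cs \<noteq> (0 :: 'k::field_char_0)"
proof -
  obtain c where c: "c \<in> set cs" "is_marked c"
    using mark_count_nonzero[OF assms(2)] by blast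
  have "\<not> is_loop c"
    using assms(1) c(1) by (induction cs) auto
  then obtain p q where pq: "c = Md p q" "p \<noteq> q"
    using c(2) by (cases c) auto
  obtain xs ys where cs: "cs = xs @ c # ys"
    using c(1) by (meson split_list)
  have "pair_count cs = (pair_count (c # xs @ ys) :: 'k)"
    by (rule graph_invariant_mset[OF graph_invariant_pair_count]) (simp add: cs)
  then show ?thesis
    using pair_count_nonzero_Md pq by simp
qed

text \<open>Since a double edge counts as two edges, marking does not change the number of pairs;
  hence division by it commutes with \<open>mark_op\<close>.\<close>

lemma pair_count_mark:
  assumes "parallel_sign a b \<noteq> (0 :: 'k::comm_ring_1)"
  shows "pair_count (mark a # q) = (pair_count (a # b # q) :: 'k)"
proof -
  obtain s t where st: "s \<noteq> t" "a = Ed s t" "b = a \<or> b = reverse_cell a"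
    using assms by (rule parallel_sign_nonzero)
  have "parallel_weight (Md s t) q = (parallel_weight (Ed s t) q :: 'k)"
    "parallel_weight (Ed t s) q = (parallel_weight (Ed s t) q :: 'k)"
    by (simp_all add: parallel_weight_def parallel_cells_Md parallel_cells_Ed insert_commute eq_commute)
  then show ?thesis
    using st by (auto simp: pair_count_Cons parallel_cells_Md parallel_cells_Ed)
qed

text \<open>As \<open>inverse 0 = 0\<close>, the quotient is 0 on words without parallel
  edges.\<close>

definition divide_pairs :: "(cell list \<Rightarrow> 'k::field_char_0) \<Rightarrow> cell list \<Rightarrow> 'k" where
  "divide_pairs F cs = inverse (pair_count cs) * F cs"

lemma equivariant_divide_pairs: "equivariant F \<Longrightarrow> equivariant (divide_pairs F)"
  unfolding divide_pairs_def[abs_def]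
  by (rule equivariant_mult[OF graph_invariant_comp[OF graph_invariant_pair_count]])

lemma supported_divide_pairs: "supported P F \<Longrightarrow> supported P (divide_pairs F)"
  by (simp add: supported_def divide_pairs_def)

lemma mark_op_divide_pairs:
  fixes F :: "cell list \<Rightarrow> 'k::field_char_0"
  shows "mark_op (divide_pairs F) cs = inverse (pair_count cs) * mark_op F cs"
proof -
  have "mark_op (divide_pairs F) cs
      = pick cs (\<lambda>a r. pick r (\<lambda>b q. inverse (pair_count cs) * (parallel_sign a b * F (mark a # q))))"
    unfolding mark_op_def
  proof (intro pick_cong)
    fix a r b q assume "mset (a # r) = mset cs" "mset (b # q) = mset r"
    then have m: "mset (a # b # q) = mset cs" by simp
    show "parallel_sign a b * divide_pairs F (mark a # q)
        = inverse (pair_count cs) * (parallel_sign a b * F (mark a # q))"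
    proof (cases "parallel_sign a b = (0 :: 'k)")
      case False
      have "pair_count (a # b # q) = (pair_count cs :: 'k)"
        by (rule graph_invariant_mset[OF graph_invariant_pair_count m])
      then show ?thesis
        using pair_count_mark[OF False, of q] by (simp add: divide_pairs_def)
    qed simp
  qed
  then show ?thesis
    by (simp add: mark_op_def pick_mult)
qed

lemma unmark_op_zero:
  assumes "\<And>cs'. loop_count cs' = 0 \<Longrightarrow> F cs' = 0" and "loop_count cs = 0"
  shows "unmark_op F cs = 0"
  unfolding unmark_op_def
proof (rule pick_zero)
  fix a r assume "mset (a # r) = mset cs"
  from loop_count_mset[OF this] show "unmark_cell F a r = 0"
    using assms by (cases a) auto
qed

section \<open>The diagram chase\<close>

text \<open>Degrees are those of the opened graph. The number of vertices is fixed because it is the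
  induction parameter: splitting lowers it by one on the level of functions.\<close>

definition trivalent_support :: "nat \<Rightarrow> nat \<Rightarrow> cell list \<Rightarrow> bool" where
  "trivalent_support r n cs \<longleftrightarrow> connected_cells cs \<and> min_degree 2 3 cs \<and> mark_count cs = r
    \<and> card (vertices cs) = n"

lemma supported_trivalentD:
  assumes "supported (trivalent_support r n) F"
  shows "supported connected_cells F" "supported (min_degree 2 3) F" "supported (\<lambda>cs. mark_count cs = r) F"
    "supported (\<lambda>cs. card (vertices cs) = n) F"
  by (rule supported_mono[OF assms]; simp add: trivalent_support_def)+

lemma supported_trivalentI:
  assumes "supported connected_cells F" "supported (min_degree 2 3) F" "supported (\<lambda>cs. mark_count cs = r) F"
    "supported (\<lambda>cs. card (vertices cs) = n) F"
  shows "supported (trivalent_support r n) F"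
  using assms by (auto simp: supported_def trivalent_support_def)

lemma supported_trivalent_good: "supported (trivalent_support r n) F \<Longrightarrow> supported (good r) F"
  by (erule supported_mono) (unfold trivalent_support_def good_def, blast dest: min_degree_2_3_imp_1_2)

lemma supported_trivalent_unmark_op:
  "supported (trivalent_support r n) F \<Longrightarrow> supported (trivalent_support (Suc r) n) (unmark_op F)"
  by (intro supported_trivalentI supported_connected_unmark_op supported_min_degree_unmark_op
      supported_mark_count_unmark_op supported_card_vertices_unmark_op)
    (auto dest: supported_trivalentD)

lemma supported_trivalent_split_op:
  assumes F: "supported (trivalent_support r (Suc n)) F" "equivariant F"
  shows "supported (trivalent_support r n) (split_op F)"
  by (intro supported_trivalentI supported_connected_split_op supported_min_degree_split_op
      supported_mark_count_split_op supported_card_vertices_split_op F(2))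
    (auto intro: supported_trivalentD[OF F(1)])

text \<open>The theta word has a single double edge, so the obstruction concerns only functions of
  words with exactly one mark.\<close>

lemma supported_mark_theta:
  assumes "supported (\<lambda>cs. mark_count cs = Suc (Suc r)) F"
  shows "vanishes_on_theta F"
  using assms by (auto simp: vanishes_on_theta_def supported_def)

text \<open>The induction goes from a function \<open>F\<close> on graphs with \<open>n + 1\<close> vertices to a function \<open>F'\<close> on
  graphs with \<open>n\<close> vertices that satisfies \<open>mark_op F' = split_op F\<close>.\<close>

lemma closed_modulo_marking:
  fixes F :: "cell list \<Rightarrow> 'k::field_char_0"
  assumes "equivariant F" "supported (trivalent_support (Suc r) n) F" "vanishes_on_theta F"
    and "\<And>cs. loop_count cs = 0 \<Longrightarrow> mark_op (split_op F) cs = 0"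
  shows "\<exists>G G'. equivariant G \<and> equivariant G' \<and> supported (good (Suc r)) G \<and> supported (good (Suc (Suc r))) G'
    \<and> (\<forall>cs. loop_count cs = 0 \<longrightarrow> F cs = split_op G cs + mark_op G' cs)"
  using assms
proof (induction n arbitrary: F r)
  case 0
  \<comment> \<open>A double edge has ends, so a well-formed word with a mark has a vertex.\<close>
  have "F cs = 0" for cs
  proof (rule ccontr)
    assume n: "F cs \<noteq> 0"
    then have wf: "wf_graph cs"
      using equivariantD(5)[OF 0(1)] by blast
    have t: "trivalent_support (Suc r) 0 cs"
      using n 0(2) by (auto simp: supported_def)
    then obtain c where c: "c \<in> set cs" "is_marked c"
      using mark_count_nonzero[of cs] unfolding trivalent_support_def by auto
    have "set (cell_ends c) \<noteq> {}"
      using c(2) by (cases c) auto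
    moreover have "set (cell_ends c) \<subseteq> vertices cs"
      using wf c(1) unfolding wf_graph_def by blast
    ultimately show False
      using t by (auto simp: trivalent_support_def)
  qed
  then have F0: "F = (\<lambda>cs. 0)" by blast
  have e: "equivariant (\<lambda>cs. 0 :: 'k)"
    using 0(1) unfolding F0 .
  have "split_op (\<lambda>cs. 0 :: 'k) cs = 0" "mark_op (\<lambda>cs. 0 :: 'k) cs = 0" for cs
    using split_op_scale[of 0 "\<lambda>cs. 0 :: 'k" cs] mark_op_scale[of 0 "\<lambda>cs. 0 :: 'k" cs] by simp_all
  then show ?case
    using e by (intro exI[of _ "\<lambda>cs. 0"]) (simp add: F0 supported_def)
next
  case (Suc n)
  note F = Suc.prems
  \<comment> \<open>\<open>split_op F\<close> is killed by \<open>mark_op\<close> on loop-free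
    words, so opening double edges after division by the number of pairs gives a preimage
    \<open>F'\<close> under \<open>mark_op\<close>.\<close>
  define H where "H = divide_pairs (split_op F)"
  define F' where "F' = unmark_op H"
  have H: "equivariant H" "supported (trivalent_support (Suc r) n) H"
    unfolding H_def
    by (intro equivariant_divide_pairs equivariant_split_op F(1))
      (intro supported_divide_pairs supported_trivalent_split_op F(1,2))
  have F': "equivariant F'" "supported (trivalent_support (Suc (Suc r)) n) F'"
    unfolding F'_def using equivariant_unmark_op[OF H(1)] supported_trivalent_unmark_op[OF H(2)] .
  have "mark_op H cs = 0" if "loop_count cs = 0" for cs
    using F(4)[OF that] by (simp add: H_def mark_op_divide_pairs)
  then have um: "unmark_op (mark_op H) cs = 0" if "loop_count cs = 0" for cs
    using that by (rule unmark_op_zero)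
  have mF': "mark_op F' cs = split_op F cs" if "loop_count cs = 0" for cs
  proof (cases "mark_count cs = Suc r")
    case True
    have "mark_op F' cs = pair_count cs * H cs"
      using mark_unmark_homotopy[OF H(1), of cs] um[OF that] by (simp add: F'_def)
    then show ?thesis
      using pair_count_nonzero_loop_free[OF that, where ?'k = 'k] True by (simp add: H_def divide_pairs_def)
  next
    case False
    have "supported (\<lambda>cs. mark_count cs = Suc r) (mark_op F')"
      by (rule supported_mark_count_mark_op[OF supported_trivalentD(3)[OF F'(2)]])
    moreover have "supported (\<lambda>cs. mark_count cs = Suc r) (split_op F)"
      by (rule supported_mark_count_split_op[OF supported_trivalentD(3)[OF F(2)]])
    ultimately show ?thesis
      using False by (simp add: supported_def)
  qed
  have "mark_op (split_op F') cs = 0" if "loop_count cs = 0" for cs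
  proof -
    have "split_op (mark_op F') cs = split_op (split_op F) cs"
      by (rule split_op_cong) (simp add: that mF')
    then show ?thesis
      using split_op_mark_op[OF F'(1), of cs] split_op_split_op[OF F(1), of cs] by simp
  qed
  then obtain G G' where G: "equivariant G" "equivariant G'" "supported (good (Suc (Suc r))) G"
    "\<And>cs. loop_count cs = 0 \<Longrightarrow> F' cs = split_op G cs + mark_op G' cs"
    using Suc.IH[OF F'(1,2) supported_mark_theta[OF supported_trivalentD(3)[OF F'(2)]]] by blast
  \<comment> \<open>On loop-free words \<open>split_op F\<close> equals \<open>mark_op F'\<close>,
    hence \<open>mark_op (split_op G)\<close>, hence \<open>- split_op (mark_op G)\<close>; adding
    \<open>mark_op G\<close> to F makes it closed there.\<close>
  define P where "P cs = F cs + mark_op G cs" for cs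
  have "split_op P cs = 0" if cs: "loop_count cs = 0" for cs
  proof -
    have "split_op F cs = mark_op (\<lambda>cs. split_op G cs + mark_op G' cs) cs"
      using mF'[OF cs] mark_op_cong[OF G(4) cs] by simp
    also have "\<dots> = - split_op (mark_op G) cs"
      using mark_op_mark_op[OF G(2)] split_op_mark_op[OF G(1), of cs] by (simp add: mark_op_add)
    finally show ?thesis
      using split_op_diff[of F "\<lambda>cs. (- 1) * mark_op G cs" cs] split_op_scale[of "- 1" "mark_op G" cs]
      by (simp add: P_def[abs_def])
  qed
  moreover have "equivariant P"
    unfolding P_def[abs_def] by (intro equivariant_add equivariant_mark_op F(1) G(1))
  moreover have "supported (good (Suc r)) P"
    using supported_trivalent_good[OF F(2)] supported_good_mark_op[OF G(3)]
    by (simp add: supported_def P_def)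
  \<comment> \<open>The theta word has only one unmarked edge, so no pair can be marked and
    \<open>mark_op G\<close> is 0 on it.\<close>
  moreover have "vanishes_on_theta P"
    using F(3) by (simp add: vanishes_on_theta_def P_def mark_op_def)
  ultimately obtain Q where Q: "equivariant Q" "supported (good (Suc r)) Q"
    "\<And>cs. loop_count cs = 0 \<Longrightarrow> split_op Q cs = P cs"
    using loop_free_exact[of P "Suc r"] by blast
  let ?G' = "\<lambda>cs. (- 1) * G cs"
  have "F cs = split_op Q cs + mark_op ?G' cs" if "loop_count cs = 0" for cs
    unfolding Q(3)[OF that] mark_op_scale by (simp add: P_def)
  moreover have "equivariant ?G'"
    by (rule equivariant_scale[OF G(1)])
  moreover have "supported (good (Suc (Suc r))) ?G'"
    using G(3) by (simp add: supported_def)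
  ultimately show ?case
    using Q(1,2) by blast
qed

text \<open>The multiset equation says that a and b occupy two different positions, in any
  order.\<close>

definition simple_cells :: "cell list \<Rightarrow> bool" where
  "simple_cells cs \<longleftrightarrow> (\<forall>a b r. mset (a # b # r) = mset cs \<longrightarrow> \<not> odd_cell a \<longrightarrow> \<not> odd_cell b
    \<longrightarrow> \<not> parallel_cells a b)"

text \<open>Opening double edges writes f as \<open>mark_op F\<close>. Anticommutation makes F
  closed up to marking, so F is \<open>split_op G\<close> plus something marked twice, and f becomes
  \<open>- split_op (mark_op G)\<close>. A value of \<open>mark_op\<close> involves a parallel pair,
  hence the vanishing on simple words.\<close>

theorem dual_exactness:
  fixes f :: "cell list \<Rightarrow> 'k::field_char_0"
  assumes f: "equivariant f" "supported (trivalent_support 0 n) f"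
    and closed: "\<And>cs. split_op f cs = 0"
    and simple: "\<And>cs. pair_count cs = (0 :: 'k) \<Longrightarrow> f cs = 0"
    and theta: "\<And>x w. x \<noteq> w \<Longrightarrow> f [Vx w, Vx x, Ed x w, Ed x w, Ed x w] = 0"
  obtains g where "equivariant g" "supported (min_degree 1 2) g" "\<And>cs. simple_cells cs \<Longrightarrow> g cs = 0"
    "\<And>cs. mark_count cs = 0 \<Longrightarrow> f cs = split_op g cs"
proof -
  define H where "H = divide_pairs f"
  define F where "F = unmark_op H"
  have H: "equivariant H" "supported (trivalent_support 0 n) H"
    unfolding H_def by (intro equivariant_divide_pairs f(1)) (intro supported_divide_pairs f(2))
  have F: "equivariant F" "supported (trivalent_support (Suc 0) n) F"
    unfolding F_def using equivariant_unmark_op[OF H(1)] supported_trivalent_unmark_op[OF H(2)] .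
  have no_mark: "mark_op H cs = 0" for cs
    unfolding mark_op_def
  proof (intro pick_zero)
    fix a b q
    show "parallel_sign a b * H (mark a # q) = 0"
    proof (cases "parallel_sign a b = (0 :: 'k)")
      case False
      then obtain s t where "a = Ed s t"
        by (rule parallel_sign_nonzero)
      then show ?thesis
        using supported_trivalentD(3)[OF H(2)] by (simp add: supported_def)
    qed simp
  qed
  have mF: "mark_op F cs = f cs" for cs
  proof -
    have "unmark_op (mark_op H) cs = 0"
      using no_mark unmark_cell.simps unfolding unmark_op_def
      by (intro pick_zero) (case_tac a; simp)
    then have "mark_op F cs = pair_count cs * H cs"
      using mark_unmark_homotopy[OF H(1), of cs] by (simp add: F_def)
    then show ?thesis
      using simple[of cs] by (cases "pair_count cs = (0 :: 'k)") (simp_all add: H_def divide_pairs_def)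
  qed
  have "vanishes_on_theta F"
    unfolding vanishes_on_theta_def
  proof (intro allI impI)
    fix x w :: nat assume "x \<noteq> w"
    then have "f [Vx w, Vx x, Ed x w, Ed x w, Ed x w] = 0"
      by (rule theta)
    then have "f [Ed x w, Ed x w, Vx w, Vx x, Ed x w] = 0"
      by (rule graded_symmetric_mset[OF equivariantD(2)[OF f(1)], rotated]) simp
    then show "F [Vx w, Vx x, Ed x w, Md x w] = 0"
      by (simp add: F_def unmark_op_def H_def divide_pairs_def)
  qed
  moreover have "mark_op (split_op F) cs = 0" for cs
  proof -
    have "mark_op F = f"
      using mF by blast
    then show ?thesis
      using split_op_mark_op[OF F(1), of cs] closed by simp
  qed
  ultimately obtain G G' where G: "equivariant G" "equivariant G'" "supported (good (Suc 0)) G"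
    "\<And>cs. loop_count cs = 0 \<Longrightarrow> F cs = split_op G cs + mark_op G' cs"
    using closed_modulo_marking[OF F] by blast
  show thesis
  proof (rule that[of "\<lambda>cs. (- 1) * mark_op G cs"])
    show "equivariant (\<lambda>cs. (- 1) * mark_op G cs)"
      by (intro equivariant_scale equivariant_mark_op G(1))
    show "supported (min_degree 1 2) (\<lambda>cs. (- 1) * mark_op G cs)"
      using supported_goodD(2)[OF supported_good_mark_op[OF G(3)]] by (simp add: supported_def)
    show "(- 1) * mark_op G cs = 0" if "simple_cells cs" for cs
    proof -
      have "mark_op G cs = 0"
        unfolding mark_op_def
      proof (intro pick_zero)
        fix a r b q assume "mset (a # r) = mset cs" "mset (b # q) = mset r"
        then have m: "mset (a # b # q) = mset cs" by simp
        have "parallel_sign a b = (0 :: 'k)"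
        proof (rule ccontr)
          assume "parallel_sign a b \<noteq> (0 :: 'k)"
          then obtain s t where "s \<noteq> t" "a = Ed s t" "b = a \<or> b = reverse_cell a"
            by (rule parallel_sign_nonzero)
          then have "\<not> odd_cell a" "\<not> odd_cell b" "parallel_cells a b"
            by (auto simp: parallel_cells_Ed)
          then show False
            using that m unfolding simple_cells_def by blast
        qed
        then show "parallel_sign a b * G (mark a # q) = 0"
          by simp
      qed
      then show ?thesis by simp
    qed
    show "f cs = split_op (\<lambda>cs. (- 1) * mark_op G cs) cs" if "mark_count cs = 0" for cs
    proof -
      have l: "loop_count cs = 0"
        using that loop_count_le_mark_count[of cs] by simp
      have "f cs = mark_op (\<lambda>cs. split_op G cs + mark_op G' cs) cs"
        using mF[of cs] mark_op_cong[OF G(4) l] by simp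
      also have "\<dots> = - split_op (mark_op G) cs"
        using mark_op_mark_op[OF G(2)] split_op_mark_op[OF G(1), of cs] by (simp add: mark_op_add)
      finally show ?thesis
        using split_op_scale[of "- 1" "mark_op G" cs] by simp
    qed
  qed
qed

section \<open>Functionals on the space of odd graphs\<close>

declare upt_Suc [simp del]

definition edge_cell :: "graph \<Rightarrow> nat \<Rightarrow> cell" where
  "edge_cell \<Gamma> a = Ed (fst (ends \<Gamma> a)) (snd (ends \<Gamma> a))"

definition cells_of :: "graph \<Rightarrow> cell list" where
  "cells_of \<Gamma> = map Vx [1..<Suc (nverts \<Gamma>)] @ map (edge_cell \<Gamma>) [1..<Suc (nedges \<Gamma>)]"

lemma class_reverse_edge:
  assumes "\<Gamma> \<in> labelled_graphs" "a \<in> edges \<Gamma>"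
  shows "graph_class (reverse_edge a \<Gamma>) = - (graph_class \<Gamma> :: 'k::field odd_graphs)"
proof -
  have "gen \<Gamma> + gen (reverse_edge a \<Gamma>) \<in> (odd_relations :: (graph \<Rightarrow>\<^sub>0 'k) set)"
    using assms unfolding odd_relations_def by blast
  from free.span_base[OF this] have "gen (reverse_edge a \<Gamma>) - - gen \<Gamma> \<in> free.span (odd_relations :: (graph \<Rightarrow>\<^sub>0 'k) set)"
    by (simp add: add.commute)
  then show ?thesis
    by transfer
qed

lemma class_relabel_edges:
  assumes "\<Gamma> \<in> labelled_graphs" "\<pi> permutes edges \<Gamma>"
  shows "graph_class (relabel_edges \<pi> \<Gamma>) = (graph_class \<Gamma> :: 'k::field odd_graphs)"
proof -
  have "gen \<Gamma> - gen (relabel_edges \<pi> \<Gamma>) \<in> (odd_relations :: (graph \<Rightarrow>\<^sub>0 'k) set)"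
    using assms unfolding odd_relations_def by blast
  from free.span_base[OF this] have "(graph_class \<Gamma> :: 'k odd_graphs) = graph_class (relabel_edges \<pi> \<Gamma>)"
    by transfer
  then show ?thesis by simp
qed

lemma class_relabel_verts:
  assumes "\<Gamma> \<in> labelled_graphs" "\<sigma> permutes verts \<Gamma>"
  shows "graph_class \<Gamma> = oscale (of_int (sign \<sigma>)) (graph_class (relabel_verts \<sigma> \<Gamma>) :: 'k::field odd_graphs)"
proof -
  have "gen \<Gamma> - fscale (of_int (sign \<sigma>)) (gen (relabel_verts \<sigma> \<Gamma>)) \<in> (odd_relations :: (graph \<Rightarrow>\<^sub>0 'k) set)"
    using assms unfolding odd_relations_def by blast
  from free.span_base[OF this] show ?thesis
    by transfer
qed

lemma graded_symmetric_even:
  assumes "graded_symmetric F" "mset cs = mset cs'" "\<And>c. c \<in> set cs \<Longrightarrow> \<not> odd_cell c"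
  shows "F cs = F cs'"
  using assms
proof (induction cs arbitrary: cs' F)
  case (Cons a cs)
  have "a \<in> set cs'"
    using Cons.prems(2) by (metis list.set_intros(1) set_mset_mset)
  then obtain xs ys where cs': "cs' = xs @ a # ys"
    by (meson split_list)
  have "(\<Prod>x\<leftarrow>xs. koszul x a) = (1 :: 'a)"
    using Cons.prems(3)[of a] by (induction xs) (simp_all add: koszul_def)
  then have "F cs' = F (a # xs @ ys)"
    unfolding cs' graded_symmetric_front[OF Cons.prems(1), of xs] by simp
  moreover have "F (a # cs) = F (a # xs @ ys)"
    by (rule Cons.IH[OF graded_symmetric_Cons[OF Cons.prems(1)]]) (use Cons.prems(2,3) cs' in simp_all)
  ultimately show ?case by simp
qed simp

text \<open>Both letters cross everything between them, which cancels, and they cross each other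
  once.\<close>

lemma graded_symmetric_exchange:
  assumes F: "graded_symmetric F" and "\<And>c. c \<in> set (a # b # vs) \<Longrightarrow> odd_cell c"
  shows "F (us @ a # vs @ b # ws) = - (F (us @ b # vs @ a # ws) :: 'k::comm_ring_1)"
proof -
  define G where "G r = F (us @ r)" for r
  have G: "graded_symmetric G"
    unfolding G_def by (rule graded_symmetric_append[OF F])
  have k: "(\<Prod>x\<leftarrow>vs. koszul x b) = (\<Prod>x\<leftarrow>vs. koszul x a :: 'k)"
    using assms(2) by (intro arg_cong[where f = prod_list] map_cong refl) (simp add: koszul_def)
  have "G (a # vs @ b # ws) = (\<Prod>x\<leftarrow>a # vs. koszul x b) * G (b # a # vs @ ws)"
    using graded_symmetric_front[OF G, of "a # vs" b ws] by simp
  moreover have "G (b # vs @ a # ws) = (\<Prod>x\<leftarrow>vs. koszul x a) * G (b # a # vs @ ws)"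
    using graded_symmetric_front[OF graded_symmetric_Cons[OF G, of b], of vs a ws] .
  ultimately show ?thesis
    using assms(2) by (simp add: k G_def koszul_def[of a b])
qed

lemma permute_vertices:
  assumes F: "graded_symmetric F" and p: "p permutes S" "finite S" and xs: "distinct xs" "set xs = S"
  shows "F (map Vx (map p xs) @ ys) = of_int (sign p) * (F (map Vx xs @ ys) :: 'k::comm_ring_1)"
proof -
  have "p permutes S \<and> F (map Vx (map p xs) @ ys) = of_int (sign p) * F (map Vx xs @ ys)"
    using p
  proof (induction rule: permutes_induct)
    case id
    then show ?case by (simp add: permutes_id[unfolded id_def] id_def)
  next
    case (swap a b p)
    have pS: "p permutes S" using swap by blast
    define zs where "zs = map p xs"
    have zs: "distinct zs" "set zs = S"
      using xs permutes_inj_on[OF pS] permutes_image[OF pS] by (auto simp: zs_def distinct_map)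
    have "F (map Vx (map (transpose a b) zs) @ ys) = - F (map Vx zs @ ys)"
    proof -
      have main: "F (map Vx (map (transpose a b) zs) @ ys) = - F (map Vx zs @ ys)"
        if z: "zs = us @ a # vs @ b # ws" for a b us vs ws
      proof -
        have "map (transpose a b) us = us" "map (transpose a b) vs = vs" "map (transpose a b) ws = ws"
          using zs(1) unfolding z by (intro map_idI; auto simp: transpose_def)+
        then have "map (transpose a b) zs = us @ b # vs @ a # ws"
          unfolding z by simp
        moreover have "F (map Vx us @ Vx b # map Vx vs @ Vx a # (map Vx ws @ ys))
            = - F (map Vx us @ Vx a # map Vx vs @ Vx b # (map Vx ws @ ys))"
          by (rule graded_symmetric_exchange[OF F]) auto
        ultimately show ?thesis
          unfolding z by simp
      qed
      obtain us r where r: "zs = us @ a # r"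
        using swap(1) zs(2) by (meson split_list)
      have "b \<in> set us \<or> b \<in> set r"
        using swap(2,3) zs(2) r by auto
      then show ?thesis
      proof
        assume "b \<in> set r"
        then obtain vs ws where "r = vs @ b # ws" by (meson split_list)
        then show ?thesis using main r by simp
      next
        assume "b \<in> set us"
        then obtain vs ws where "us = vs @ b # ws" by (meson split_list)
        then have "zs = vs @ b # ws @ a # r" using r by simp
        from main[OF this] show ?thesis by (simp add: transpose_commute)
      qed
    qed
    moreover have "map (transpose a b \<circ> p) xs = map (transpose a b) zs"
      by (simp add: zs_def)
    moreover have "sign (transpose a b \<circ> p) = - sign p"
      using swap(3) permutation_permutes[of p] pS p(2)
      by (subst sign_compose) (auto simp: sign_swap_id permutation_swap_id)
    moreover have "transpose a b \<circ> p permutes S"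
      by (rule permutes_compose[OF pS permutes_swap_id[OF swap(1,2)]])
    moreover have "F (map Vx zs @ ys) = of_int (sign p) * F (map Vx xs @ ys)"
      using swap unfolding zs_def by blast
    ultimately show ?case
      by (simp only: of_int_minus mult_minus_left simp_thms)
  qed
  then show ?thesis by blast
qed

lemma labelled_ends:
  assumes "\<Gamma> \<in> labelled_graphs" "a \<in> edges \<Gamma>"
  shows "fst (ends \<Gamma> a) \<in> verts \<Gamma>" "snd (ends \<Gamma> a) \<in> verts \<Gamma>"
proof -
  have "ends \<Gamma> a \<in> verts \<Gamma> \<times> verts \<Gamma>"
    using assms unfolding labelled_graphs_def by (blast intro: PiE_mem)
  then show "fst (ends \<Gamma> a) \<in> verts \<Gamma>" "snd (ends \<Gamma> a) \<in> verts \<Gamma>"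
    by (auto simp: mem_Times_iff)
qed

lemma set_edge_list [simp]: "set [1..<Suc n] = {1..n}"
  by auto

lemma vertices_cells_of [simp]: "vertices (cells_of \<Gamma>) = verts \<Gamma>"
  by (auto simp: vertices_def cells_of_def edge_cell_def)

lemma cells_of_reverse_edge:
  assumes g: "equivariant g" and a: "a \<in> edges \<Gamma>"
  shows "g (cells_of (reverse_edge a \<Gamma>)) = - (g (cells_of \<Gamma>) :: 'k::comm_ring_1)"
proof -
  have l: "[1..<Suc (nedges \<Gamma>)] = [1..<a] @ a # [Suc a..<Suc (nedges \<Gamma>)]"
    using a by (metis One_nat_def atLeastAtMost_iff le_imp_less_Suc upt_conv_Cons upt_add_eq_append le_Suc_ex less_Suc_eq_le le_SucI)
  have "map (edge_cell (reverse_edge a \<Gamma>)) [1..<a] = map (edge_cell \<Gamma>) [1..<a]"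
    "map (edge_cell (reverse_edge a \<Gamma>)) [Suc a..<Suc (nedges \<Gamma>)] = map (edge_cell \<Gamma>) [Suc a..<Suc (nedges \<Gamma>)]"
    by (auto simp: edge_cell_def reverse_edge_def)
  moreover have "edge_cell (reverse_edge a \<Gamma>) a = reverse_cell (edge_cell \<Gamma> a)"
    by (simp add: edge_cell_def reverse_edge_def)
  moreover have "nverts (reverse_edge a \<Gamma>) = nverts \<Gamma>" "nedges (reverse_edge a \<Gamma>) = nedges \<Gamma>"
    by (simp_all add: reverse_edge_def)
  ultimately have "cells_of (reverse_edge a \<Gamma>) = (map Vx [1..<Suc (nverts \<Gamma>)] @ map (edge_cell \<Gamma>) [1..<a])
      @ reverse_cell (edge_cell \<Gamma> a) # map (edge_cell \<Gamma>) [Suc a..<Suc (nedges \<Gamma>)]"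
    by (simp only: cells_of_def l map_append list.map append.assoc)
  moreover have "cells_of \<Gamma> = (map Vx [1..<Suc (nverts \<Gamma>)] @ map (edge_cell \<Gamma>) [1..<a])
      @ edge_cell \<Gamma> a # map (edge_cell \<Gamma>) [Suc a..<Suc (nedges \<Gamma>)]"
    by (simp only: cells_of_def l map_append list.map append.assoc)
  ultimately show ?thesis
    using cell_symmetric_reverse[OF cell_symmetric_append[OF equivariantD(1)[OF g]],
        of "map Vx [1..<Suc (nverts \<Gamma>)] @ map (edge_cell \<Gamma>) [1..<a]" "edge_cell \<Gamma> a"
        "map (edge_cell \<Gamma>) [Suc a..<Suc (nedges \<Gamma>)]"]
    by (simp only: edge_cell_def reverse_sign.simps) simp
qed

lemma cells_of_relabel_edges:
  assumes g: "equivariant g" and \<pi>: "\<pi> permutes edges \<Gamma>"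
  shows "g (cells_of (relabel_edges \<pi> \<Gamma>)) = (g (cells_of \<Gamma>) :: 'k::comm_ring_1)"
proof -
  have "edge_cell (relabel_edges \<pi> \<Gamma>) = edge_cell \<Gamma> \<circ> \<pi>"
    by (auto simp: edge_cell_def relabel_edges_def)
  then have "mset (map (edge_cell (relabel_edges \<pi> \<Gamma>)) [1..<Suc (nedges \<Gamma>)])
      = image_mset (edge_cell \<Gamma>) (image_mset \<pi> (mset_set (edges \<Gamma>)))"
    by (simp add: multiset.map_comp atLeastLessThanSuc_atLeastAtMost)
  also have "image_mset \<pi> (mset_set (edges \<Gamma>)) = mset_set (edges \<Gamma>)"
    using image_mset_mset_set[OF permutes_inj_on[OF \<pi>], of "edges \<Gamma>"] permutes_image[OF \<pi>] by simp
  finally have m: "mset (map (edge_cell (relabel_edges \<pi> \<Gamma>)) [1..<Suc (nedges \<Gamma>)])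
      = mset (map (edge_cell \<Gamma>) [1..<Suc (nedges \<Gamma>)])"
    by (simp add: atLeastLessThanSuc_atLeastAtMost)
  have "nverts (relabel_edges \<pi> \<Gamma>) = nverts \<Gamma>" "nedges (relabel_edges \<pi> \<Gamma>) = nedges \<Gamma>"
    by (simp_all add: relabel_edges_def)
  moreover have "g (map Vx [1..<Suc (nverts \<Gamma>)] @ map (edge_cell (relabel_edges \<pi> \<Gamma>)) [1..<Suc (nedges \<Gamma>)])
      = g (map Vx [1..<Suc (nverts \<Gamma>)] @ map (edge_cell \<Gamma>) [1..<Suc (nedges \<Gamma>)])"
    by (rule graded_symmetric_even[OF graded_symmetric_append[OF equivariantD(2)[OF g]] m])
      (auto simp: edge_cell_def)
  ultimately show ?thesis
    by (simp add: cells_of_def)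
qed

text \<open>Renaming the vertices costs nothing; bringing the renamed vertex letters back into
  increasing order costs \<open>sign \<sigma>\<close>.\<close>

lemma cells_of_relabel_verts:
  assumes g: "equivariant g" and \<sigma>: "\<sigma> permutes verts \<Gamma>"
  shows "g (cells_of \<Gamma>) = of_int (sign \<sigma>) * (g (cells_of (relabel_verts \<sigma> \<Gamma>)) :: 'k::comm_ring_1)"
proof -
  let ?V = "[1..<Suc (nverts \<Gamma>)]" and ?E = "map (edge_cell \<Gamma>) [1..<Suc (nedges \<Gamma>)]"
  have inv: "inv \<sigma> permutes verts \<Gamma>"
    by (rule permutes_inv[OF \<sigma>])
  have inj: "inj \<sigma>"
    by (rule permutes_inj[OF \<sigma>])
  have "map (edge_cell (relabel_verts \<sigma> \<Gamma>)) [1..<Suc (nedges \<Gamma>)] = map (rename \<sigma>) ?E"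
    by (auto simp: edge_cell_def relabel_verts_def)
  moreover have "map (rename \<sigma>) (map Vx (map (inv \<sigma>) ?V)) = map Vx ?V"
    using permutes_inverses(1)[OF \<sigma>] by (simp add: comp_def)
  ultimately have "cells_of (relabel_verts \<sigma> \<Gamma>) = map (rename \<sigma>) (map Vx (map (inv \<sigma>) ?V) @ ?E)"
    by (simp add: cells_of_def relabel_verts_def)
  then have "g (cells_of (relabel_verts \<sigma> \<Gamma>)) = g (map Vx (map (inv \<sigma>) ?V) @ ?E)"
    by (simp only: equivariantD(3)[OF g inj])
  also have "\<dots> = of_int (sign (inv \<sigma>)) * g (cells_of \<Gamma>)"
    unfolding cells_of_def by (rule permute_vertices[OF equivariantD(2)[OF g] inv]) auto
  also have "sign (inv \<sigma>) = sign \<sigma>"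
    using sign_inverse[of \<sigma>] permutation_permutes \<sigma> by blast
  finally have "g (cells_of (relabel_verts \<sigma> \<Gamma>)) = of_int (sign \<sigma>) * g (cells_of \<Gamma>)" .
  moreover have "of_int (sign \<sigma>) * (of_int (sign \<sigma>) * z) = (z :: 'k)" for z
    by (simp add: sign_def)
  ultimately show ?thesis by simp
qed

definition formal_value :: "(cell list \<Rightarrow> 'k) \<Rightarrow> (graph \<Rightarrow>\<^sub>0 'k::field) \<Rightarrow> 'k" where
  "formal_value g p = (\<Sum>\<Gamma>\<in>Poly_Mapping.keys p. Poly_Mapping.lookup p \<Gamma> * g (cells_of \<Gamma>))"

lemma formal_value_superset:
  "finite A \<Longrightarrow> Poly_Mapping.keys p \<subseteq> A \<Longrightarrow>
    formal_value g p = (\<Sum>\<Gamma>\<in>A. Poly_Mapping.lookup p \<Gamma> * g (cells_of \<Gamma>))"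
  unfolding formal_value_def by (rule sum.mono_neutral_left) (auto simp: in_keys_iff)

lemma formal_value_add: "formal_value g (p + q) = formal_value g p + formal_value g q"
proof -
  let ?A = "Poly_Mapping.keys p \<union> Poly_Mapping.keys q"
  have "finite ?A" by simp
  then show ?thesis
    using Poly_Mapping.keys_add[of p q]
    by (simp add: formal_value_superset[of ?A] lookup_add distrib_right sum.distrib)
qed

lemma formal_value_scale: "formal_value g (fscale c p) = c * formal_value g p"
proof -
  have "Poly_Mapping.keys (fscale c p) \<subseteq> Poly_Mapping.keys p"
    by (auto simp: in_keys_iff)
  then have "formal_value g (fscale c p) = (\<Sum>\<Gamma>\<in>Poly_Mapping.keys p. c * (Poly_Mapping.lookup p \<Gamma> * g (cells_of \<Gamma>)))"
    by (subst formal_value_superset[of "Poly_Mapping.keys p"]) (simp_all add: mult.assoc)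
  then show ?thesis
    by (simp add: formal_value_def sum_distrib_left)
qed

lemma formal_value_gen: "formal_value g (gen \<Gamma>) = g (cells_of \<Gamma>)"
  by (simp add: formal_value_def)

lemma formal_value_diff: "formal_value g (p - q) = formal_value g p - formal_value g q"
  using formal_value_add[of g "p - q" q] by simp

lemma formal_value_relations:
  assumes g: "equivariant g" and "p \<in> free.span (odd_relations :: (graph \<Rightarrow>\<^sub>0 'k::field) set)"
  shows "formal_value g p = 0"
  using assms(2)
proof (induction rule: free.span_induct_alt)
  case base
  show ?case by (simp add: formal_value_def)
next
  case (step c r p)
  have "formal_value g r = 0"
    using step.hyps(1) unfolding odd_relations_def
    by (elim UnE CollectE exE conjE)
      (simp_all add: formal_value_add formal_value_diff formal_value_scale formal_value_gen
        cells_of_reverse_edge[OF g] cells_of_relabel_edges[OF g] cells_of_relabel_verts[OF g, symmetric]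
        del: atLeastAtMost_iff)
  then show ?case
    using step.IH by (simp add: formal_value_add formal_value_scale)
qed

text \<open>The conditional makes the map well defined on classes for every g; functions that are
  not equivariant give the zero functional.\<close>

lift_definition cell_value :: "(cell list \<Rightarrow> 'k) \<Rightarrow> 'k::field odd_graphs \<Rightarrow> 'k"
  is "\<lambda>g p. if equivariant g then formal_value g p else 0"
proof -
  fix g and p q :: "graph \<Rightarrow>\<^sub>0 'k"
  assume "p - q \<in> free.span odd_relations"
  then show "(if equivariant g then formal_value g p else 0) = (if equivariant g then formal_value g q else 0)"
    using formal_value_relations[of g "p - q"] by (simp add: formal_value_diff)
qed

definition odd_functional :: "('k::field odd_graphs \<Rightarrow> 'k) \<Rightarrow> bool" where
  "odd_functional \<phi> \<longleftrightarrow> (\<forall>X Y. \<phi> (X + Y) = \<phi> X + \<phi> Y) \<and> (\<forall>c X. \<phi> (oscale c X) = c * \<phi> X)"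

lemma odd_functionalD:
  assumes "odd_functional \<phi>"
  shows "\<phi> (X + Y) = \<phi> X + \<phi> Y" "\<phi> (oscale c X) = c * \<phi> X" "\<phi> 0 = 0" "\<phi> (- X) = - \<phi> X"
    "\<phi> (X - Y) = \<phi> X - \<phi> Y" "\<phi> (sum f A) = (\<Sum>a\<in>A. \<phi> (f a))"
proof -
  show add: "\<phi> (X + Y) = \<phi> X + \<phi> Y" and sc: "\<phi> (oscale c X) = c * \<phi> X" for X Y c
    using assms by (simp_all add: odd_functional_def)
  show z: "\<phi> 0 = 0"
    using sc[of 0 0] by simp
  show m: "\<phi> (- X) = - \<phi> X" for X
    using sc[of "-1" X] by simp
  show "\<phi> (X - Y) = \<phi> X - \<phi> Y"
    using add[of X "- Y"] m by simp
  show "\<phi> (sum f A) = (\<Sum>a\<in>A. \<phi> (f a))"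
    by (induction A rule: infinite_finite_induct) (simp_all add: add z)
qed

lemma odd_functional_cell_value: "odd_functional (cell_value g)"
  unfolding odd_functional_def
  by (intro conjI allI; transfer; simp add: formal_value_add formal_value_scale)

lemma cell_value_class: "equivariant g \<Longrightarrow> cell_value g (graph_class \<Gamma>) = g (cells_of \<Gamma>)"
  by transfer (simp add: formal_value_gen)

text \<open>A maximal independent subset of S remains independent when x is added, so there is a
  linear map that is 0 on it and 1 at x. No finiteness is involved.\<close>

lemma separating_functional:
  assumes "x \<notin> odd.span S"
  obtains \<phi> :: "'k::field odd_graphs \<Rightarrow> 'k" where "odd_functional \<phi>" "\<And>s. s \<in> S \<Longrightarrow> \<phi> s = 0" "\<phi> x = 1"
proof -
  interpret pair: vector_space_pair oscale "(*) :: 'k \<Rightarrow> 'k \<Rightarrow> 'k"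
    by unfold_locales (simp_all add: algebra_simps)
  obtain B where B: "B \<subseteq> S" "odd.independent B" "S \<subseteq> odd.span B"
    using odd.maximal_independent_subset[of S] by blast
  have "odd.span S \<subseteq> odd.span B"
    by (rule odd.span_minimal[OF B(3) odd.subspace_span])
  then have sp: "odd.span B = odd.span S"
    using odd.span_mono[OF B(1)] by blast
  have "odd.independent (insert x B)"
    using odd.independent_insertI[of x B] B(2) assms sp by simp
  from pair.linear_independent_extend[OF this, of "\<lambda>y. if y = x then 1 else 0"]
  obtain \<phi> where \<phi>: "Vector_Spaces.linear oscale (*) \<phi>" "\<And>y. y \<in> insert x B \<Longrightarrow> \<phi> y = (if y = x then 1 else 0)"
    by blast
  interpret \<phi>: Vector_Spaces.linear oscale "(*)" \<phi> by (rule \<phi>(1))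
  have "\<phi> b = 0" if "b \<in> B" for b
    using \<phi>(2)[of b] that assms B(1) odd.span_base by auto
  then have "\<phi> s = 0" if "s \<in> S" for s
    using \<phi>.eq_0_on_span[of B s] B(3) that by blast
  then show thesis
    using that[of \<phi>] \<phi>(2)[of x] by (auto simp: odd_functional_def \<phi>.add \<phi>.scale)
qed

section \<open>From words back to labelled graphs\<close>

primrec vertex_list :: "cell list \<Rightarrow> nat list" where
  "vertex_list [] = []"
| "vertex_list (c # cs) = (case c of Vx x \<Rightarrow> x # vertex_list cs | _ \<Rightarrow> vertex_list cs)"

primrec edge_list :: "cell list \<Rightarrow> (nat \<times> nat) list" where
  "edge_list [] = []"
| "edge_list (c # cs) = (case c of Ed a b \<Rightarrow> (a, b) # edge_list cs | _ \<Rightarrow> edge_list cs)"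

text \<open>Positions are counted from one.\<close>

primrec position :: "nat \<Rightarrow> nat list \<Rightarrow> nat" where
  "position x [] = 0"
| "position x (y # ys) = (if x = y then 1 else Suc (position x ys))"

text \<open>Labels are given by order of occurrence, starting from 1. Double edges leave no trace
  here, so \<open>functional_cells\<close> vanishes on words containing them.\<close>

definition graph_of :: "cell list \<Rightarrow> graph" where
  "graph_of cs = Graph (length (vertex_list cs)) (length (edge_list cs))
    (\<lambda>a\<in>{1..length (edge_list cs)}. map_prod (\<lambda>x. position x (vertex_list cs))
      (\<lambda>x. position x (vertex_list cs)) (edge_list cs ! (a - 1)))"

definition functional_cells :: "('k::field odd_graphs \<Rightarrow> 'k) \<Rightarrow> cell list \<Rightarrow> 'k" where
  "functional_cells \<phi> cs = (if wf_graph cs \<and> mark_count cs = 0 then \<phi> (graph_class (graph_of cs)) else 0)"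

lemma vertex_list_append [simp]: "vertex_list (xs @ ys) = vertex_list xs @ vertex_list ys"
  by (induction xs) (simp_all split: cell.split)

lemma edge_list_append [simp]: "edge_list (xs @ ys) = edge_list xs @ edge_list ys"
  by (induction xs) (simp_all split: cell.split)

lemma set_vertex_list [simp]: "set (vertex_list cs) = vertices cs"
proof (induction cs)
  case (Cons c cs)
  then show ?case by (cases c) simp_all
qed simp

lemma set_edge_list_ends: "(a, b) \<in> set (edge_list cs) \<Longrightarrow> Ed a b \<in> set cs"
proof (induction cs)
  case (Cons c cs)
  then show ?case by (cases c) auto
qed simp

lemma edge_list_vertices:
  assumes "wf_graph cs" "(a, b) \<in> set (edge_list cs)"
  shows "a \<in> vertices cs" "b \<in> vertices cs"
proof -
  have "set (cell_ends (Ed a b)) \<subseteq> vertices cs"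
    using assms(1) set_edge_list_ends[OF assms(2)] unfolding wf_graph_def by blast
  then show "a \<in> vertices cs" "b \<in> vertices cs" by simp_all
qed

lemma distinct_vertex_list:
  assumes "wf_graph cs"
  shows "distinct (vertex_list cs)"
proof -
  have "count (mset (vertex_list cs)) x = count (mset cs) (Vx x)" for x
  proof (induction cs)
    case (Cons c cs)
    then show ?case by (cases c) auto
  qed simp
  then have "count (mset (vertex_list cs)) x \<le> 1" for x
    using assms by (simp add: wf_graph_def)
  then show ?thesis
    unfolding distinct_count_atmost_1
    by (metis count_mset_0_iff le_antisym less_one linorder_not_le)
qed

lemma mset_split_cells:
  "mark_count cs = 0 \<Longrightarrow> mset cs = mset (map Vx (vertex_list cs) @ map (\<lambda>(a, b). Ed a b) (edge_list cs))"
proof (induction cs)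
  case (Cons c cs)
  then show ?case by (cases c) simp_all
qed simp

lemma position_bounds: "x \<in> set ys \<Longrightarrow> 1 \<le> position x ys \<and> position x ys \<le> length ys"
  by (induction ys) auto

lemma position_inj: "x \<in> set ys \<Longrightarrow> y \<in> set ys \<Longrightarrow> position x ys = position y ys \<longleftrightarrow> x = y"
proof (induction ys)
  case (Cons z zs)
  then show ?case
    using position_bounds[of x zs] position_bounds[of y zs] by auto
qed simp

lemma map_position: "distinct ys \<Longrightarrow> map (\<lambda>x. position x ys) ys = [1..<Suc (length ys)]"
proof (induction ys)
  case (Cons y ys)
  have "map (\<lambda>x. position x (y # ys)) ys = map Suc (map (\<lambda>x. position x ys) ys)"
    using Cons.prems by auto
  also have "\<dots> = [Suc 1..<Suc (Suc (length ys))]"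
    using Cons by (simp add: map_Suc_upt)
  finally show ?case
    by (simp add: upt_conv_Cons)
qed simp

lemma position_map: "inj \<rho> \<Longrightarrow> position (\<rho> x) (map \<rho> ys) = position x ys"
  by (induction ys) (auto simp: inj_eq)

lemma position_upt: "k \<le> x \<Longrightarrow> x < n \<Longrightarrow> position x [k..<n] = Suc (x - k)"
proof (induction "n - k" arbitrary: k)
  case (Suc d)
  then have "[k..<n] = k # [Suc k..<n]"
    by (simp add: upt_conv_Cons)
  then show ?case
    using Suc by (cases "x = k") auto
qed simp

lemma position_swap:
  "a \<noteq> b \<Longrightarrow> x \<in> set (xs @ a # b # ys) \<Longrightarrow>
    position x (xs @ b # a # ys)
      = transpose (Suc (length xs)) (Suc (Suc (length xs))) (position x (xs @ a # b # ys))"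
proof (induction xs)
  case Nil
  then show ?case
    using position_bounds[of x ys] by (auto simp: transpose_def)
next
  case (Cons y xs)
  show ?case
  proof (cases "x = y")
    case False
    then have "x \<in> set (xs @ a # b # ys)"
      using Cons.prems(2) by simp
    from Cons.IH[OF Cons.prems(1) this] False show ?thesis
      by (simp add: transpose_def)
  qed (simp add: transpose_def)
qed

lemma graph_of_labelled:
  assumes "wf_graph cs" "vertices cs \<noteq> {}"
  shows "graph_of cs \<in> labelled_graphs"
proof -
  let ?p = "\<lambda>x. position x (vertex_list cs)"
  have "map_prod ?p ?p (edge_list cs ! (a - 1)) \<in> {1..length (vertex_list cs)} \<times> {1..length (vertex_list cs)}"
    if "a \<in> {1..length (edge_list cs)}" for a
  proof -
    obtain s t where st: "edge_list cs ! (a - 1) = (s, t)"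
      by fastforce
    then have "(s, t) \<in> set (edge_list cs)"
      using that nth_mem[of "a - 1" "edge_list cs"] by auto
    from edge_list_vertices[OF assms(1) this] show ?thesis
      using position_bounds[of s "vertex_list cs"] position_bounds[of t "vertex_list cs"] st by simp
  qed
  moreover have "vertex_list cs \<noteq> []"
    using assms(2) set_vertex_list[of cs] by force
  ultimately show ?thesis
    unfolding labelled_graphs_def graph_of_def by (auto simp: Suc_le_eq simp del: set_vertex_list)
qed

lemma graph_of_reverse:
  "graph_of (Ed b a # r) = reverse_edge 1 (graph_of (Ed a b # r))"
  unfolding graph_of_def reverse_edge_def by (auto simp: fun_eq_iff restrict_def)

lemma graph_of_swap_edges:
  "graph_of (xs @ Ed s t # Ed p q # ys)
    = relabel_edges (transpose (Suc (length (edge_list xs))) (Suc (Suc (length (edge_list xs)))))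
        (graph_of (xs @ Ed p q # Ed s t # ys))"
proof -
  let ?n = "length (edge_list xs)" and ?u = "edge_list xs" and ?w = "edge_list ys"
  let ?\<tau> = "transpose (Suc ?n) (Suc (Suc ?n))"
  have "(?u @ (s, t) # (p, q) # ?w) ! (i - 1) = (?u @ (p, q) # (s, t) # ?w) ! (?\<tau> i - 1)"
    if "i \<ge> 1" for i
    using that by (auto simp: transpose_def nth_append nth_Cons split: nat.splits)
  moreover have "?\<tau> i \<in> {1..Suc (Suc (?n + length ?w))} \<longleftrightarrow> i \<in> {1..Suc (Suc (?n + length ?w))}" for i
    by (auto simp: transpose_def)
  ultimately show ?thesis
    unfolding graph_of_def relabel_edges_def by (auto simp: fun_eq_iff restrict_def)
qed

lemma graph_of_swap_verts:
  assumes "wf_graph (xs @ Vx x # Vx y # ys)"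
  shows "graph_of (xs @ Vx y # Vx x # ys)
    = relabel_verts (transpose (Suc (length (vertex_list xs))) (Suc (Suc (length (vertex_list xs)))))
        (graph_of (xs @ Vx x # Vx y # ys))"
proof -
  let ?c = "xs @ Vx x # Vx y # ys"
  have xy: "x \<noteq> y"
    using distinct_vertex_list[OF assms] by auto
  have p: "position i (vertex_list xs @ y # x # vertex_list ys)
    = transpose (Suc (length (vertex_list xs))) (Suc (Suc (length (vertex_list xs))))
        (position i (vertex_list xs @ x # y # vertex_list ys))" if "i \<in> vertices ?c" for i
    by (rule position_swap[OF xy]) (use that in auto)
  have "s \<in> vertices ?c \<and> t \<in> vertices ?c"
    if "(edge_list xs @ edge_list ys) ! (a - Suc 0) = (s, t)" "Suc 0 \<le> a" "a \<le> length (edge_list xs) + length (edge_list ys)"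
    for a s t
  proof -
    have "(s, t) \<in> set (edge_list ?c)"
      using that nth_mem[of "a - 1" "edge_list xs @ edge_list ys"] by auto
    then show ?thesis
      using edge_list_vertices[OF assms] by blast
  qed
  then have "map_prod (\<lambda>i. position i (vertex_list xs @ y # x # vertex_list ys))
      (\<lambda>i. position i (vertex_list xs @ y # x # vertex_list ys)) ((edge_list xs @ edge_list ys) ! (a - Suc 0))
    = map_prod (transpose (Suc (length (vertex_list xs))) (Suc (Suc (length (vertex_list xs)))))
      (transpose (Suc (length (vertex_list xs))) (Suc (Suc (length (vertex_list xs)))))
      (map_prod (\<lambda>i. position i (vertex_list xs @ x # y # vertex_list ys))
      (\<lambda>i. position i (vertex_list xs @ x # y # vertex_list ys)) ((edge_list xs @ edge_list ys) ! (a - Suc 0)))"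
    if "Suc 0 \<le> a" "a \<le> length (edge_list xs) + length (edge_list ys)" for a
    using that p by (cases "(edge_list xs @ edge_list ys) ! (a - Suc 0)") (metis map_prod_simp)
  then show ?thesis
    unfolding graph_of_def relabel_verts_def by (auto simp: fun_eq_iff restrict_def)
qed

text \<open>Each symmetry of words is one of the relations between graphs: exchanging adjacent
  vertex or edge letters is a relabelling by a transposition, and reversing the front edge reverses
  edge 1. Renaming does not change the graph, because labels record positions only.\<close>

lemma equivariant_functional_cells:
  fixes \<phi> :: "'k::field odd_graphs \<Rightarrow> 'k"
  assumes \<phi>: "odd_functional \<phi>"
  shows "equivariant (functional_cells \<phi>)"
proof (rule equivariantI[OF cell_symmetricI])
  show "graded_symmetric (functional_cells \<phi>)"
    unfolding graded_symmetric_def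
  proof (intro allI)
    fix xs ys :: "cell list" and a b :: cell
    let ?c1 = "xs @ a # b # ys" and ?c2 = "xs @ b # a # ys"
    have m: "mset ?c1 = mset ?c2" by simp
    show "functional_cells \<phi> ?c1 = koszul a b * functional_cells \<phi> ?c2"
    proof (cases "wf_graph ?c1 \<and> mark_count ?c1 = 0")
      case False
      then show ?thesis
        using wf_graph_mset[OF m] graph_invariant_mset[OF graph_invariant_mark_count m]
        unfolding functional_cells_def by auto
    next
      case True
      then have wf: "wf_graph ?c1" "mark_count ?c1 = 0" "wf_graph ?c2" "mark_count ?c2 = 0"
        using wf_graph_mset[OF m] graph_invariant_mset[OF graph_invariant_mark_count m] by auto
      have v: "functional_cells \<phi> ?c1 = \<phi> (graph_class (graph_of ?c1))"
        "functional_cells \<phi> ?c2 = \<phi> (graph_class (graph_of ?c2))"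
        using wf by (simp_all add: functional_cells_def)
      have nm: "\<not> is_marked a" "\<not> is_marked b"
        using wf(2) by (auto simp: mark_count_def split: if_splits)
      \<comment> \<open>Labelled graphs have at least one vertex, and the relations are imposed on
        labelled graphs only.\<close>
      have "vertices ?c1 \<noteq> {}"
      proof (cases a)
        case (Ed s t)
        have "s \<in> vertices ?c1"
          by (rule edge_list_vertices(1)[OF wf(1), of s t]) (simp add: Ed)
        then show ?thesis by blast
      qed (use nm in auto)
      note lab = graph_of_labelled[OF wf(1) this]
      consider x y where "a = Vx x" "b = Vx y" | s t p q where "a = Ed s t" "b = Ed p q"
        | x s t where "a = Vx x" "b = Ed s t" | x s t where "a = Ed s t" "b = Vx x"
        using nm by (cases a; cases b) auto
      then show ?thesis
      proof cases
        case 1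
        let ?\<tau> = "transpose (Suc (length (vertex_list xs))) (Suc (Suc (length (vertex_list xs))))"
        have \<tau>: "?\<tau> permutes verts (graph_of ?c1)"
          by (rule permutes_swap_id) (auto simp: graph_of_def 1)
        have g: "graph_of ?c2 = relabel_verts ?\<tau> (graph_of ?c1)"
          using graph_of_swap_verts wf(1) unfolding 1 by blast
        have "sign ?\<tau> = -1"
          by (simp add: sign_swap_id)
        then show ?thesis
          unfolding v g using class_relabel_verts[OF lab \<tau>, where ?'k = 'k] odd_functionalD(2,4)[OF \<phi>]
          by (simp add: 1)
      next
        case 2
        let ?\<tau> = "transpose (Suc (length (edge_list xs))) (Suc (Suc (length (edge_list xs))))"
        have \<tau>: "?\<tau> permutes edges (graph_of ?c1)"
          by (rule permutes_swap_id) (auto simp: graph_of_def 2)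
        have g: "graph_of ?c2 = relabel_edges ?\<tau> (graph_of ?c1)"
          unfolding 2 by (rule graph_of_swap_edges)
        show ?thesis
          unfolding v g class_relabel_edges[OF lab \<tau>] by (simp add: 2)
      next
        case 3
        then show ?thesis
          unfolding v by (simp add: graph_of_def)
      next
        case 4
        then show ?thesis
          unfolding v by (simp add: graph_of_def)
      qed
    qed
  qed
  show "functional_cells \<phi> (c # r) = reverse_sign c * functional_cells \<phi> (reverse_cell c # r)" for c r
  proof (cases "wf_graph (c # r) \<and> mark_count (c # r) = 0")
    case False
    then show ?thesis
      using graph_invariant_reverse[OF graph_invariant_wf, of c r]
        graph_invariant_reverse[OF graph_invariant_mark_count, of c r]
      unfolding functional_cells_def by auto
  next
    case True
    show ?thesis
    proof (cases c)
      case (Ed a b)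
      have "a \<in> vertices (c # r)"
        using True Ed by (auto simp: wf_graph_def)
      then have lab: "graph_of (Ed a b # r) \<in> labelled_graphs"
        using graph_of_labelled[of "c # r"] True Ed by auto
      have wf': "wf_graph (Ed b a # r)"
        using graph_invariant_reverse[OF graph_invariant_wf, of c r] True Ed by simp
      have e: "1 \<in> edges (graph_of (Ed a b # r))"
        by (simp add: graph_of_def)
      have "\<phi> (graph_class (graph_of (Ed b a # r))) = - \<phi> (graph_class (graph_of (Ed a b # r)))"
        by (simp only: graph_of_reverse[of b a r] class_reverse_edge[OF lab e] odd_functionalD(4)[OF \<phi>])
      then show ?thesis
        using True wf' by (simp add: functional_cells_def Ed)
    next
      case (Md a b)
      then show ?thesis using True by simp
    qed simp
  qed
  show "functional_cells \<phi> (map (rename \<rho>) cs) = functional_cells \<phi> cs" if \<rho>: "inj \<rho>" for \<rho> cs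
  proof -
    have vl: "vertex_list (map (rename \<rho>) cs) = map \<rho> (vertex_list cs)"
      by (induction cs) (auto split: cell.split)
    have el: "edge_list (map (rename \<rho>) cs) = map (map_prod \<rho> \<rho>) (edge_list cs)"
      by (induction cs) (auto split: cell.split)
    have "graph_of (map (rename \<rho>) cs) = graph_of cs"
      unfolding graph_of_def vl el
      by (auto simp: fun_eq_iff restrict_def map_prod.comp position_map[OF \<rho>] comp_def
          prod.map_comp nth_map)
    then show ?thesis
      by (simp add: functional_cells_def graph_invariant_rename[OF graph_invariant_wf \<rho>]
          graph_invariant_rename[OF graph_invariant_mark_count \<rho>])
  qed
  show "supported wf_graph (functional_cells \<phi>)"
    by (simp add: supported_def functional_cells_def)
qed

lemma mark_count_cells_of [simp]: "mark_count (cells_of \<Gamma>) = 0"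
proof -
  have "mark_count (map Vx xs @ map (edge_cell \<Gamma>) ys) = 0" for xs ys
    by (induction xs; induction ys) (simp_all add: edge_cell_def)
  then show ?thesis by (simp add: cells_of_def)
qed

lemma set_cells_of: "set (cells_of \<Gamma>) = Vx ` verts \<Gamma> \<union> edge_cell \<Gamma> ` edges \<Gamma>"
  by (simp only: cells_of_def set_append set_map set_edge_list)

lemma wf_graph_cells_of:
  assumes "\<Gamma> \<in> labelled_graphs"
  shows "wf_graph (cells_of \<Gamma>)"
proof -
  have "count (mset (cells_of \<Gamma>)) (Vx x) \<le> 1" for x
  proof -
    have "Vx x \<notin># mset (map (edge_cell \<Gamma>) [1..<Suc (nedges \<Gamma>)])"
      by (auto simp: edge_cell_def)
    then have "count (mset (cells_of \<Gamma>)) (Vx x) = count (mset (map Vx [1..<Suc (nverts \<Gamma>)])) (Vx x)"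
      unfolding cells_of_def mset_append count_union by (simp only: not_in_iff)
    also have "\<dots> \<le> 1"
    proof -
      have "distinct (map Vx [1..<Suc (nverts \<Gamma>)])"
        by (simp add: distinct_map inj_on_def)
      then show ?thesis
        unfolding distinct_count_atmost_1 by auto
    qed
    finally show ?thesis .
  qed
  moreover have "set (cell_ends c) \<subseteq> verts \<Gamma>" if c: "c \<in> set (cells_of \<Gamma>)" for c
  proof -
    consider x where "c = Vx x" | a where "a \<in> edges \<Gamma>" "c = edge_cell \<Gamma> a"
      using c unfolding set_cells_of by blast
    then show ?thesis
      by cases (use labelled_ends[OF assms] in \<open>auto simp: edge_cell_def\<close>)
  qed
  ultimately show ?thesis
    unfolding wf_graph_def vertices_cells_of by blast
qed

lemma graph_of_cells_of:
  assumes "\<Gamma> \<in> labelled_graphs"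
  shows "graph_of (cells_of \<Gamma>) = \<Gamma>"
proof -
  have "vertex_list (map Vx xs) = xs" "edge_list (map Vx xs) = []" for xs
    by (induction xs) simp_all
  moreover have "vertex_list (map (edge_cell \<Gamma>) xs) = []" "edge_list (map (edge_cell \<Gamma>) xs) = map (ends \<Gamma>) xs" for xs
    by (induction xs) (simp_all add: edge_cell_def)
  ultimately have l: "vertex_list (cells_of \<Gamma>) = [1..<Suc (nverts \<Gamma>)]"
    "edge_list (cells_of \<Gamma>) = map (ends \<Gamma>) [1..<Suc (nedges \<Gamma>)]"
    by (simp_all add: cells_of_def)
  have "ends (graph_of (cells_of \<Gamma>)) a = ends \<Gamma> a" for a
  proof (cases "a \<in> edges \<Gamma>")
    case True
    then have "map (ends \<Gamma>) [1..<Suc (nedges \<Gamma>)] ! (a - 1) = ends \<Gamma> a"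
      by (cases a) simp_all
    moreover have "position x [1..<Suc (nverts \<Gamma>)] = x" if "x \<in> verts \<Gamma>" for x
      using that by (simp add: position_upt)
    ultimately show ?thesis
      using True labelled_ends[OF assms True] unfolding graph_of_def l
      by (cases "ends \<Gamma> a") simp
  next
    case False
    have "ends \<Gamma> a = undefined"
      using assms False unfolding labelled_graphs_def by (blast intro: PiE_arb)
    then show ?thesis
      using False by (auto simp: graph_of_def l)
  qed
  then show ?thesis
    by (intro graph.expand) (simp add: graph_of_def l fun_eq_iff)
qed

lemma functional_cells_cells_of:
  "\<Gamma> \<in> labelled_graphs \<Longrightarrow> functional_cells \<phi> (cells_of \<Gamma>) = \<phi> (graph_class \<Gamma>)"
  by (simp add: functional_cells_def wf_graph_cells_of graph_of_cells_of)

text \<open>Up to renaming and reordering, a well-formed nonempty word without double edges is the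
  word of a labelled graph.\<close>

lemma equivariant_zero_by_graphs:
  fixes D :: "cell list \<Rightarrow> 'k::comm_ring_1"
  assumes D: "equivariant D" and 0: "\<And>\<Gamma>. \<Gamma> \<in> labelled_graphs \<Longrightarrow> D (cells_of \<Gamma>) = 0"
    and cs: "mark_count cs = 0" "vertices cs \<noteq> {}"
  shows "D cs = 0"
proof (cases "wf_graph cs")
  case False
  then show ?thesis by (rule equivariantD(5)[OF D])
next
  case True
  define n where "n = length (vertex_list cs)"
  \<comment> \<open>Vertices receive the labels 1 to n; all other names are shifted beyond n to keep
    the renaming injective on all naturals.\<close>
  define \<rho> where "\<rho> x = (if x \<in> vertices cs then position x (vertex_list cs) else x + n + 1)" for x
  have "inj \<rho>"
  proof (rule injI)
    fix x y assume e: "\<rho> x = \<rho> y"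
    show "x = y"
      using e position_inj[of x "vertex_list cs" y] position_bounds[of x "vertex_list cs"]
        position_bounds[of y "vertex_list cs"]
      by (auto simp: \<rho>_def n_def split: if_splits)
  qed
  let ?cs = "map Vx (vertex_list cs) @ map (\<lambda>(a, b). Ed a b) (edge_list cs)"
  have "map \<rho> (vertex_list cs) = map (\<lambda>x. position x (vertex_list cs)) (vertex_list cs)"
    by (rule map_cong) (simp_all add: \<rho>_def)
  also have "\<dots> = [1..<Suc n]"
    unfolding n_def by (rule map_position[OF distinct_vertex_list[OF True]])
  finally have v: "map (rename \<rho>) (map Vx (vertex_list cs)) = map Vx [1..<Suc n]"
    by (simp add: comp_def flip: map_map[of Vx \<rho>, unfolded comp_def])
  have "rename \<rho> (case edge_list cs ! i of (a, b) \<Rightarrow> Ed a b) = edge_cell (graph_of cs) (Suc i)"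
    if i: "i < length (edge_list cs)" for i
  proof -
    obtain a b where ab: "edge_list cs ! i = (a, b)" by fastforce
    then have "(a, b) \<in> set (edge_list cs)"
      using nth_mem[OF i] by simp
    from edge_list_vertices[OF True this] show ?thesis
      using i by (simp add: ab edge_cell_def graph_of_def \<rho>_def)
  qed
  then have e: "map (rename \<rho>) (map (\<lambda>(a, b). Ed a b) (edge_list cs))
      = map (edge_cell (graph_of cs)) [1..<Suc (nedges (graph_of cs))]"
    by (intro nth_equalityI) (simp_all add: graph_of_def)
  have "map (rename \<rho>) ?cs = cells_of (graph_of cs)"
    unfolding map_append v e cells_of_def by (simp add: graph_of_def n_def)
  then have "D ?cs = 0"
    using equivariantD(3)[OF D \<open>inj \<rho>\<close>, of ?cs] 0[OF graph_of_labelled[OF True cs(2)]] by simp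
  then show ?thesis
    by (rule graded_symmetric_mset[OF equivariantD(2)[OF D] mset_split_cells[OF cs(1), symmetric]])
qed

section \<open>The differential on classes of graphs\<close>

lemma sum_list_upt: "(\<Sum>a\<leftarrow>[1..<Suc n]. f a) = (\<Sum>a\<in>{1..n}. f a)"
  using sum_list_distinct_conv_sum_set[of "[1..<Suc n]" f] by (simp only: distinct_upt set_edge_list)

text \<open>The weight k is arbitrary because the word of a graph contains no double edge.\<close>

lemma degree_cells_of: "degree_with k (cells_of \<Gamma>) x = valence \<Gamma> x"
proof -
  have 1: "degree_with k (map Vx xs @ ys) x = degree_with k ys x" for xs ys
    by (induction xs) simp_all
  have "degree_with k (map (edge_cell \<Gamma>) ys) x
      = (\<Sum>a\<leftarrow>ys. of_bool (fst (ends \<Gamma> a) = x) + of_bool (snd (ends \<Gamma> a) = x))" for ys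
    by (induction ys) (auto simp: edge_cell_def)
  then have "degree_with k (cells_of \<Gamma>) x
      = (\<Sum>a\<in>edges \<Gamma>. of_bool (fst (ends \<Gamma> a) = x) + of_bool (snd (ends \<Gamma> a) = x))"
    unfolding cells_of_def 1 by (simp only: sum_list_upt)
  also have "\<dots> = (\<Sum>a\<in>edges \<Gamma>. card {j \<in> {1, 2}. half_edge_vertex \<Gamma> (a, j) = x})"
  proof (rule sum.cong[OF refl])
    fix a
    have "{j \<in> {1, 2}. half_edge_vertex \<Gamma> (a, j) = x} = (if fst (ends \<Gamma> a) = x then {1} else {})
        \<union> (if snd (ends \<Gamma> a) = x then {2} else {})"
      by (auto simp: half_edge_vertex_def)
    then show "of_bool (fst (ends \<Gamma> a) = x) + of_bool (snd (ends \<Gamma> a) = x)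
        = card {j \<in> {1, 2}. half_edge_vertex \<Gamma> (a, j) = x}"
      by simp
  qed
  also have "\<dots> = card (SIGMA a:edges \<Gamma>. {j \<in> {1, 2}. half_edge_vertex \<Gamma> (a, j) = x})"
    by (rule card_SigmaI[symmetric]) simp_all
  also have "(SIGMA a:edges \<Gamma>. {j \<in> {1, 2}. half_edge_vertex \<Gamma> (a, j) = x}) = half_edges_at \<Gamma> x"
    by (auto simp: half_edges_at_def)
  finally show ?thesis
    by (simp add: valence_def)
qed

lemma min_degree_cells_of: "min_degree k m (cells_of \<Gamma>) \<longleftrightarrow> (\<forall>x\<in>verts \<Gamma>. m \<le> valence \<Gamma> x)"
  by (simp add: min_degree_def degree_cells_of)

lemma connected_graph_iff_cut:
  "connected_graph \<Gamma> \<longleftrightarrow> (\<forall>A. A \<inter> verts \<Gamma> \<noteq> {} \<longrightarrow>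
    (\<forall>a\<in>edges \<Gamma>. fst (ends \<Gamma> a) \<in> A \<longleftrightarrow> snd (ends \<Gamma> a) \<in> A) \<longrightarrow> verts \<Gamma> \<subseteq> A)" (is "?L \<longleftrightarrow> ?R")
proof
  assume L: ?L
  show ?R
  proof (intro allI impI subsetI)
    fix A y assume A: "A \<inter> verts \<Gamma> \<noteq> {}"
      "\<forall>a\<in>edges \<Gamma>. fst (ends \<Gamma> a) \<in> A \<longleftrightarrow> snd (ends \<Gamma> a) \<in> A" and y: "y \<in> verts \<Gamma>"
    obtain x where x: "x \<in> A" "x \<in> verts \<Gamma>"
      using A(1) by blast
    have "(x, y) \<in> (adjacency \<Gamma>)\<^sup>*"
      using L x(2) y unfolding connected_graph_def by blast
    then show "y \<in> A"
    proof (induction rule: rtrancl_induct)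
      case base
      show ?case by (rule x(1))
    next
      case (step u v)
      from step.hyps(2) obtain a where "a \<in> edges \<Gamma>" "ends \<Gamma> a = (u, v) \<or> ends \<Gamma> a = (v, u)"
        unfolding adjacency_def by fastforce
      then show ?case
        using A(2) step.IH by fastforce
    qed
  qed
next
  assume R: ?R
  show ?L
    unfolding connected_graph_def
  proof (intro ballI)
    fix x y assume x: "x \<in> verts \<Gamma>" and y: "y \<in> verts \<Gamma>"
    let ?A = "{y. (x, y) \<in> (adjacency \<Gamma>)\<^sup>*}"
    have "verts \<Gamma> \<subseteq> ?A"
    proof (rule R[rule_format])
      show "?A \<inter> verts \<Gamma> \<noteq> {}"
        using x by blast
      fix a assume a: "a \<in> edges \<Gamma>"
      have "(fst (ends \<Gamma> a), snd (ends \<Gamma> a)) \<in> adjacency \<Gamma>" "(snd (ends \<Gamma> a), fst (ends \<Gamma> a)) \<in> adjacency \<Gamma>"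
        using a by (auto simp: adjacency_def)
      then show "fst (ends \<Gamma> a) \<in> ?A \<longleftrightarrow> snd (ends \<Gamma> a) \<in> ?A"
        by (auto intro: rtrancl_into_rtrancl)
    qed
    then show "(x, y) \<in> (adjacency \<Gamma>)\<^sup>*"
      using y by blast
  qed
qed

lemma connected_cells_of: "connected_cells (cells_of \<Gamma>) \<longleftrightarrow> connected_graph \<Gamma>"
proof -
  have "(\<forall>c\<in>set (cells_of \<Gamma>). set (cell_ends c) \<subseteq> A \<or> set (cell_ends c) \<inter> A = {})
    \<longleftrightarrow> (\<forall>a\<in>edges \<Gamma>. fst (ends \<Gamma> a) \<in> A \<longleftrightarrow> snd (ends \<Gamma> a) \<in> A)" for A
    unfolding set_cells_of ball_Un by (auto simp: edge_cell_def)
  then show ?thesis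
    unfolding connected_cells_def connected_graph_iff_cut vertices_cells_of by simp
qed

text \<open>Letters with a given pair of ends are counted twice: the word would contain at least two
  of them, while at most one edge label produces them.\<close>

lemma simple_cells_of:
  assumes "no_multiple_edges \<Gamma>"
  shows "simple_cells (cells_of \<Gamma>)"
  unfolding simple_cells_def
proof (intro allI impI notI)
  fix a b r
  assume m: "mset (a # b # r) = mset (cells_of \<Gamma>)" and ab: "\<not> odd_cell a" "\<not> odd_cell b" "parallel_cells a b"
  let ?P = "\<lambda>c. \<not> odd_cell c \<and> set (cell_ends c) = set (cell_ends a)"
  let ?Q = "\<lambda>i. {fst (ends \<Gamma> i), snd (ends \<Gamma> i)} = set (cell_ends a)"
  have "length (filter P xs) = size (filter_mset P (mset xs))" for P and xs :: "cell list"
    by (induction xs) auto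
  then have "length (filter ?P (a # b # r)) = length (filter ?P (cells_of \<Gamma>))"
    by (simp only: m)
  also have "\<dots> = length (filter ?Q [1..<Suc (nedges \<Gamma>)])"
    by (simp add: cells_of_def filter_map comp_def edge_cell_def)
  also have "\<dots> = card ({i. ?Q i} \<inter> edges \<Gamma>)"
    using distinct_length_filter[of "[1..<Suc (nedges \<Gamma>)]" ?Q] by (simp only: distinct_upt set_edge_list)
  also have "\<dots> \<le> Suc 0"
  proof -
    have fin: "finite ({i. ?Q i} \<inter> edges \<Gamma>)" by simp
    show ?thesis
      unfolding card_le_Suc0_iff_eq[OF fin]
    proof (intro ballI)
      fix i j assume "i \<in> {i. ?Q i} \<inter> edges \<Gamma>" "j \<in> {i. ?Q i} \<inter> edges \<Gamma>"
      then have ij: "i \<in> edges \<Gamma>" "j \<in> edges \<Gamma>"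
        and eq: "{fst (ends \<Gamma> i), snd (ends \<Gamma> i)} = {fst (ends \<Gamma> j), snd (ends \<Gamma> j)}"
        by simp_all
      show "i = j"
        by (rule ccontr) (use assms[unfolded no_multiple_edges_def, rule_format, OF ij] eq in simp)
    qed
  qed
  finally show False
    using ab by (simp add: parallel_cells_def)
qed

lemma length_cells_of [simp]: "length (cells_of \<Gamma>) = nverts \<Gamma> + nedges \<Gamma>"
  by (simp add: cells_of_def)

section \<open>Splitting a graph and splitting its word\<close>

lemma pick_restore_family:
  assumes "\<And>a. graded_symmetric (H a)"
  shows "pick cs (\<lambda>a r. H a (a # r)) = (\<Sum>a\<leftarrow>cs. H a cs)"
  using assms
proof (induction cs arbitrary: H)
  case (Cons x cs)
  have "pick cs (\<lambda>b r. koszul x b * H b (b # x # r)) = pick cs (\<lambda>b r. H b (x # b # r))"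
    by (rule pick_cong) (simp add: graded_symmetric_swap[OF Cons.prems, of _ x])
  also have "\<dots> = (\<Sum>b\<leftarrow>cs. H b (x # cs))"
    by (rule Cons.IH[of "\<lambda>b r. H b (x # r)"]) (rule graded_symmetric_Cons[OF Cons.prems])
  finally show ?case by simp
qed simp

fun split_term :: "nat \<Rightarrow> (cell list \<Rightarrow> 'k::comm_ring_1) \<Rightarrow> cell \<Rightarrow> cell list \<Rightarrow> 'k" where
  "split_term w F (Vx x) s = reattach_sum (branch x w) s (\<lambda>s'. F (Vx w # Ed x w # s'))"
| "split_term w F (Ed a b) s = 0"
| "split_term w F (Md a b) s = 0"

text \<open>The letter to be split is returned to its place. With the word in its original order the
  sum can be compared with sums over sets of half-edges.\<close>

lemma split_op_sum:
  assumes F: "equivariant F" and w: "w \<notin> names cs"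
  shows "split_op F cs = (\<Sum>a\<leftarrow>cs. split_term w F a cs)"
proof -
  have "graded_symmetric (split_term w F a)" for a
  proof (cases a)
    case (Vx x)
    have "split_term w F a = (\<lambda>s. reattach_sum (branch x w) s (\<lambda>s'. F ([Vx w, Ed x w] @ s')))"
      by (simp add: Vx fun_eq_iff)
    then show ?thesis
      by (simp only: graded_symmetric_reattach_sum[OF graded_symmetric_append[OF equivariantD(2)[OF F]]])
  qed (simp_all add: graded_symmetric_def)
  then have "(\<Sum>a\<leftarrow>cs. split_term w F a cs) = pick cs (\<lambda>a r. split_term w F a (a # r))"
    by (rule pick_restore_family[symmetric])
  also have "\<dots> = pick cs (split_vertex_cell w F)"
  proof (rule pick_cong)
    fix a r
    have "F (Vx w # Ed x w # Vx x # s) = F (Vx w # Vx x # Ed x w # s)" for x s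
      using graded_symmetricD[OF equivariantD(2)[OF F], of "[Vx w]" "Ed x w" "Vx x" s] by simp
    then show "split_term w F a (a # r) = split_vertex_cell w F a r"
      by (cases a) simp_all
  qed
  finally show ?thesis
    by (simp add: split_op_eq[OF F w] split_with_def)
qed

definition split_edge :: "graph \<Rightarrow> nat \<Rightarrow> (nat \<times> nat) set \<Rightarrow> nat \<Rightarrow> cell" where
  "split_edge \<Gamma> w S a = Ed (if (a, 1) \<in> S then w else fst (ends \<Gamma> a)) (if (a, 2) \<in> S then w else snd (ends \<Gamma> a))"

definition half_edges_among :: "graph \<Rightarrow> nat \<Rightarrow> nat list \<Rightarrow> (nat \<times> nat) set" where
  "half_edges_among \<Gamma> x as = {h \<in> set as \<times> {1, 2}. half_edge_vertex \<Gamma> h = x}"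

lemma sum_Pow_insert:
  assumes "finite B" "h \<notin> B"
  shows "(\<Sum>S\<in>Pow (insert h B). f S) = (\<Sum>S\<in>Pow B. f S) + (\<Sum>S\<in>Pow B. f (insert h S) :: 'b::comm_monoid_add)"
proof -
  have "inj_on (insert h) (Pow B)"
    using assms(2) by (auto simp: inj_on_def)
  moreover have "Pow B \<inter> insert h ` Pow B = {}"
    using assms(2) by auto
  ultimately show ?thesis
    using assms(1) by (simp add: Pow_insert sum.union_disjoint sum.reindex)
qed

text \<open>A reattachment amounts to the set of half-edges that move to w. The induction
  distinguishes which ends of the first edge lie at x; a loop contributes two half-edges and four
  choices.\<close>

lemma reattach_sum_Pow:
  assumes "distinct as"
  shows "reattach_sum (branch x w) (map (edge_cell \<Gamma>) as) K
    = (\<Sum>S\<in>Pow (half_edges_among \<Gamma> x as). K (map (split_edge \<Gamma> w S) as))"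
  using assms
proof (induction as arbitrary: K)
  case Nil
  show ?case by (simp add: half_edges_among_def)
next
  case (Cons a as)
  let ?B = "half_edges_among \<Gamma> x as" and ?p = "fst (ends \<Gamma> a)" and ?q = "snd (ends \<Gamma> a)"
  have fin: "finite ?B"
    by (auto simp: half_edges_among_def)
  have aB: "(a, j) \<notin> ?B" for j
    using Cons.prems by (auto simp: half_edges_among_def)
  let ?k = "\<lambda>p q S. K (Ed p q # map (split_edge \<Gamma> w S) as)"
  have IH: "reattach_sum (branch x w) (map (edge_cell \<Gamma>) as) K
      = (\<Sum>S\<in>Pow ?B. K (map (split_edge \<Gamma> w S) as))" for K :: "cell list \<Rightarrow> 'a"
    by (rule Cons.IH) (use Cons.prems in simp)
  have L: "reattach_sum (branch x w) (map (edge_cell \<Gamma>) (a # as)) K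
      = (\<Sum>p\<leftarrow>branch x w ?p. \<Sum>q\<leftarrow>branch x w ?q. \<Sum>S\<in>Pow ?B. ?k p q S)"
    by (simp add: edge_cell_def[of \<Gamma> a] sum_list_cell_choices_Ed IH del: cell_choices.simps)
  have H: "half_edges_among \<Gamma> x (a # as) = (if ?p = x then {(a, 1)} else {}) \<union> (if ?q = x then {(a, 2)} else {}) \<union> ?B"
    by (auto simp: half_edges_among_def half_edge_vertex_def)
  have m: "map (split_edge \<Gamma> w (insert (a, j) S)) as = map (split_edge \<Gamma> w S) as" for j S
    using Cons.prems by (auto simp: split_edge_def)
  have S: "(a, j) \<notin> S" if "S \<in> Pow ?B" for S j
    using aB that by blast
  have e: "split_edge \<Gamma> w S a = Ed ?p ?q" "split_edge \<Gamma> w (insert (a, 1) S) a = Ed w ?q"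
    "split_edge \<Gamma> w (insert (a, 2) S) a = Ed ?p w"
    "split_edge \<Gamma> w (insert (a, 1) (insert (a, 2) S)) a = Ed w w" if "S \<in> Pow ?B" for S
    using S[OF that] by (simp_all add: split_edge_def)
  let ?f = "\<lambda>S. K (map (split_edge \<Gamma> w S) (a # as))"
  have f: "?f S = ?k ?p ?q S" "?f (insert (a, 1) S) = ?k w ?q S" "?f (insert (a, 2) S) = ?k ?p w S"
    "?f (insert (a, 1) (insert (a, 2) S)) = ?k w w S" if "S \<in> Pow ?B" for S
    by (simp_all only: list.map e[OF that] m)
  consider "?p = x" "?q = x" | "?p = x" "?q \<noteq> x" | "?p \<noteq> x" "?q = x" | "?p \<noteq> x" "?q \<noteq> x" by blast
  then show ?case
  proof cases
    case 1
    have "(\<Sum>S\<in>Pow (half_edges_among \<Gamma> x (a # as)). ?f S) = (\<Sum>S\<in>Pow (insert (a, 1) (insert (a, 2) ?B)). ?f S)"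
      unfolding H using 1 by (simp add: insert_commute)
    also have "\<dots> = (\<Sum>S\<in>Pow ?B. ?f S) + (\<Sum>S\<in>Pow ?B. ?f (insert (a, 2) S))
        + ((\<Sum>S\<in>Pow ?B. ?f (insert (a, 1) S)) + (\<Sum>S\<in>Pow ?B. ?f (insert (a, 1) (insert (a, 2) S))))"
      using fin aB by (subst sum_Pow_insert, simp, simp, subst (1 2) sum_Pow_insert) simp_all
    also have "\<dots> = (\<Sum>S\<in>Pow ?B. ?k ?p ?q S) + (\<Sum>S\<in>Pow ?B. ?k ?p w S)
        + ((\<Sum>S\<in>Pow ?B. ?k w ?q S) + (\<Sum>S\<in>Pow ?B. ?k w w S))"
      by (simp only: f cong: sum.cong)
    finally show ?thesis
      unfolding L using 1 by (simp add: branch_def)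
  next
    case 2
    have "(\<Sum>S\<in>Pow (half_edges_among \<Gamma> x (a # as)). ?f S) = (\<Sum>S\<in>Pow (insert (a, 1) ?B). ?f S)"
      unfolding H using 2 by simp
    also have "\<dots> = (\<Sum>S\<in>Pow ?B. ?k ?p ?q S) + (\<Sum>S\<in>Pow ?B. ?k w ?q S)"
      unfolding sum_Pow_insert[OF fin aB] by (simp only: f cong: sum.cong)
    finally show ?thesis
      unfolding L using 2 by (simp add: branch_def)
  next
    case 3
    have "(\<Sum>S\<in>Pow (half_edges_among \<Gamma> x (a # as)). ?f S) = (\<Sum>S\<in>Pow (insert (a, 2) ?B). ?f S)"
      unfolding H using 3 by simp
    also have "\<dots> = (\<Sum>S\<in>Pow ?B. ?k ?p ?q S) + (\<Sum>S\<in>Pow ?B. ?k ?p w S)"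
      unfolding sum_Pow_insert[OF fin aB] by (simp only: f cong: sum.cong)
    finally show ?thesis
      unfolding L using 3 by (simp add: branch_def)
  next
    case 4
    have "(\<Sum>S\<in>Pow (half_edges_among \<Gamma> x (a # as)). ?f S) = (\<Sum>S\<in>Pow ?B. ?f S)"
      unfolding H using 4 by simp
    also have "\<dots> = (\<Sum>S\<in>Pow ?B. ?k ?p ?q S)"
      by (simp only: f cong: sum.cong)
    finally show ?thesis
      unfolding L using 4 by (simp add: branch_def)
  qed
qed

text \<open>The new vertex is last among the vertices and passes all of them on its way to the
  front; the new edge is even and moves freely.\<close>

lemma cells_of_split_vertex:
  fixes F :: "cell list \<Rightarrow> 'k::comm_ring_1"
  assumes F: "equivariant F"
  shows "F (cells_of (split_vertex \<Gamma> x S)) = (-1) ^ nverts \<Gamma> * F (Vx (Suc (nverts \<Gamma>)) # Ed x (Suc (nverts \<Gamma>))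
    # map Vx [1..<Suc (nverts \<Gamma>)] @ map (split_edge \<Gamma> (Suc (nverts \<Gamma>)) S) [1..<Suc (nedges \<Gamma>)])"
proof -
  let ?v = "nverts \<Gamma>" and ?e = "nedges \<Gamma>" and ?w = "Suc (nverts \<Gamma>)"
  let ?V = "map Vx [1..<Suc ?v]" and ?E = "map (split_edge \<Gamma> ?w S) [1..<Suc ?e]"
  note G = equivariantD(2)[OF F]
  have "map (edge_cell (split_vertex \<Gamma> x S)) [1..<Suc ?e] = ?E"
    by (auto simp: edge_cell_def split_edge_def split_simps)
  moreover have "edge_cell (split_vertex \<Gamma> x S) (Suc ?e) = Ed x ?w"
    by (simp add: edge_cell_def split_simps)
  moreover have "[1..<Suc (Suc n)] = [1..<Suc n] @ [Suc n]" for n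
    by (simp add: upt_Suc)
  ultimately have "cells_of (split_vertex \<Gamma> x S) = ?V @ Vx ?w # (?E @ [Ed x ?w])"
    by (simp add: cells_of_def split_vertex_def add_edge_at_def reattach_def)
  moreover have "(\<Prod>c\<leftarrow>?V. koszul c (Vx ?w)) = ((-1) ^ ?v :: 'k)"
  proof -
    have "(\<Prod>c\<leftarrow>map Vx xs. koszul c (Vx ?w)) = ((-1) ^ length xs :: 'k)" for xs
      by (induction xs) simp_all
    from this[of "[1..<Suc ?v]"] show ?thesis by simp
  qed
  ultimately have "F (cells_of (split_vertex \<Gamma> x S)) = (-1) ^ ?v * F (Vx ?w # (?V @ ?E) @ Ed x ?w # [])"
    using graded_symmetric_front[OF G, of ?V "Vx ?w" "?E @ [Ed x ?w]"] by simp
  moreover have "F (Vx ?w # (?V @ ?E) @ Ed x ?w # []) = F (Vx ?w # Ed x ?w # ?V @ ?E)"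
  proof -
    have "(\<Prod>c\<leftarrow>xs. koszul c (Ed x ?w)) = (1 :: 'k)" for xs
      by (induction xs) simp_all
    then show ?thesis
      using graded_symmetric_front[OF graded_symmetric_Cons[OF G, of "Vx ?w"], of "?V @ ?E" "Ed x ?w" "[]"]
      by (simp only: mult_1 append_Nil2)
  qed
  ultimately show ?thesis by simp
qed

theorem sum_split_vertex:
  fixes F :: "cell list \<Rightarrow> 'k::comm_ring_1"
  assumes F: "equivariant F" and \<Gamma>: "\<Gamma> \<in> labelled_graphs"
  shows "(\<Sum>x\<in>verts \<Gamma>. \<Sum>S\<in>Pow (half_edges_at \<Gamma> x). F (cells_of (split_vertex \<Gamma> x S)))
    = (-1) ^ nverts \<Gamma> * split_op F (cells_of \<Gamma>)"
proof -
  let ?w = "Suc (nverts \<Gamma>)" and ?V = "map Vx [1..<Suc (nverts \<Gamma>)]"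
  have "?w \<notin> names (cells_of \<Gamma>)"
    unfolding names_wf[OF wf_graph_cells_of[OF \<Gamma>]] by simp
  from split_op_sum[OF F this] have "split_op F (cells_of \<Gamma>)
      = (\<Sum>a\<leftarrow>?V. split_term ?w F a (cells_of \<Gamma>))
      + (\<Sum>a\<leftarrow>map (edge_cell \<Gamma>) [1..<Suc (nedges \<Gamma>)]. split_term ?w F a (cells_of \<Gamma>))"
    by (simp add: cells_of_def)
  also have "(\<Sum>a\<leftarrow>map (edge_cell \<Gamma>) [1..<Suc (nedges \<Gamma>)]. split_term ?w F a (cells_of \<Gamma>)) = 0"
    by (simp add: edge_cell_def comp_def)
  also have "(\<Sum>a\<leftarrow>?V. split_term ?w F a (cells_of \<Gamma>)) = (\<Sum>x\<in>verts \<Gamma>. split_term ?w F (Vx x) (cells_of \<Gamma>))"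
    unfolding map_map comp_def by (rule sum_list_upt)
  finally have "(-1) ^ nverts \<Gamma> * split_op F (cells_of \<Gamma>)
      = (\<Sum>x\<in>verts \<Gamma>. (-1) ^ nverts \<Gamma> * split_term ?w F (Vx x) (cells_of \<Gamma>))"
    by (simp add: sum_distrib_left)
  also have "\<dots> = (\<Sum>x\<in>verts \<Gamma>. \<Sum>S\<in>Pow (half_edges_at \<Gamma> x). F (cells_of (split_vertex \<Gamma> x S)))"
  proof (rule sum.cong[OF refl])
    fix x
    have V: "reattach_sum f (map Vx xs @ ys) K = reattach_sum f ys (\<lambda>r. K (map Vx xs @ r))"
      for f xs ys and K :: "cell list \<Rightarrow> 'k"
      by (induction xs arbitrary: K) simp_all
    have "half_edges_among \<Gamma> x [1..<Suc (nedges \<Gamma>)] = half_edges_at \<Gamma> x"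
      unfolding half_edges_among_def half_edges_at_def set_edge_list ..
    then have "split_term ?w F (Vx x) (cells_of \<Gamma>) = (\<Sum>S\<in>Pow (half_edges_at \<Gamma> x).
        F (Vx ?w # Ed x ?w # ?V @ map (split_edge \<Gamma> ?w S) [1..<Suc (nedges \<Gamma>)]))"
      using reattach_sum_Pow[OF distinct_upt, of x ?w \<Gamma> 1 "Suc (nedges \<Gamma>)"]
      unfolding cells_of_def split_term.simps V by simp
    then show "(-1) ^ nverts \<Gamma> * split_term ?w F (Vx x) (cells_of \<Gamma>)
        = (\<Sum>S\<in>Pow (half_edges_at \<Gamma> x). F (cells_of (split_vertex \<Gamma> x S)))"
      unfolding cells_of_split_vertex[OF F] by (simp add: sum_distrib_left)
  qed
  finally show ?thesis ..
qed

section \<open>Cancellation of vertices of valence one and two\<close>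

lemma nverts_split [simp]: "nverts (split_vertex \<Gamma> x S) = Suc (nverts \<Gamma>)"
  and nedges_split [simp]: "nedges (split_vertex \<Gamma> x S) = Suc (nedges \<Gamma>)"
  by (simp_all add: split_simps)

lemma ends_split:
  "ends (split_vertex \<Gamma> x S) a = (if a = Suc (nedges \<Gamma>) then (x, Suc (nverts \<Gamma>))
    else (if (a, 1) \<in> S then Suc (nverts \<Gamma>) else fst (ends \<Gamma> a),
          if (a, 2) \<in> S then Suc (nverts \<Gamma>) else snd (ends \<Gamma> a)))"
  by (simp add: split_simps)

lemma half_edges_at_iff:
  "(a, j) \<in> half_edges_at \<Gamma> x \<longleftrightarrow> a \<in> edges \<Gamma> \<and> (j = 1 \<and> fst (ends \<Gamma> a) = x \<or> j = 2 \<and> snd (ends \<Gamma> a) = x)"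
  by (auto simp: half_edges_at_def half_edge_vertex_def)

lemma finite_half_edges_at [simp]: "finite (half_edges_at \<Gamma> x)"
  unfolding half_edges_at_def by (rule finite_subset[of _ "edges \<Gamma> \<times> {1, 2}"]) auto

text \<open>The two graphs differ by exchanging x with the new vertex and reversing the new edge.
  Each operation costs a sign, and the two signs cancel.\<close>

lemma class_split_complement:
  assumes \<Gamma>: "\<Gamma> \<in> labelled_graphs" and x: "x \<in> verts \<Gamma>" and S: "S \<subseteq> half_edges_at \<Gamma> x"
  shows "graph_class (split_vertex \<Gamma> x (half_edges_at \<Gamma> x - S)) = (graph_class (split_vertex \<Gamma> x S) :: 'k::field odd_graphs)"
proof -
  let ?w = "Suc (nverts \<Gamma>)" and ?n = "Suc (nedges \<Gamma>)"
  let ?\<tau> = "transpose x ?w"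
  let ?\<Gamma>1 = "split_vertex \<Gamma> x S"
  let ?\<Gamma>2 = "reverse_edge ?n ?\<Gamma>1"
  have xw: "x \<noteq> ?w" using x by auto
  have g: "fst (ends \<Gamma> a) \<noteq> ?w \<and> snd (ends \<Gamma> a) \<noteq> ?w" if "a \<in> edges \<Gamma>" for a
    using labelled_ends[OF \<Gamma> that] by auto
  have out: "ends \<Gamma> a = undefined" if "a \<notin> edges \<Gamma>" for a
    using \<Gamma> that unfolding labelled_graphs_def by (blast intro: PiE_arb)
  have "ends (split_vertex \<Gamma> x (half_edges_at \<Gamma> x - S)) a = ends (relabel_verts ?\<tau> ?\<Gamma>2) a" for a
  proof -
    consider "a \<in> edges \<Gamma>" | "a = ?n" | "a \<notin> edges \<Gamma>" "a \<noteq> ?n" by blast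
    then show ?thesis
    proof cases
      case 1
      then have a: "a \<noteq> ?n" "a \<in> edges ?\<Gamma>2" by (auto simp: reverse_edge_def)
      have Sx: "(a, 1) \<in> S \<Longrightarrow> fst (ends \<Gamma> a) = x" "(a, 2) \<in> S \<Longrightarrow> snd (ends \<Gamma> a) = x"
        using S half_edges_at_iff[of a 1 \<Gamma> x] half_edges_at_iff[of a 2 \<Gamma> x] by auto
      have H: "(a, 1) \<in> half_edges_at \<Gamma> x \<longleftrightarrow> fst (ends \<Gamma> a) = x" "(a, 2) \<in> half_edges_at \<Gamma> x \<longleftrightarrow> snd (ends \<Gamma> a) = x"
        using 1 by (simp_all add: half_edges_at_iff)
      show ?thesis
        using a g[OF 1] Sx xw H by (auto simp: ends_split relabel_verts_def reverse_edge_def transpose_def)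
    next
      case 2
      then show ?thesis
        using xw by (simp add: ends_split relabel_verts_def reverse_edge_def)
    next
      case 3
      then have "(a, j) \<notin> half_edges_at \<Gamma> x - S" for j
        by (auto simp: half_edges_at_iff)
      moreover have "a \<notin> edges ?\<Gamma>2"
        using 3 by (auto simp: reverse_edge_def)
      ultimately show ?thesis
        using 3 out[OF 3(1)] by (auto simp: ends_split relabel_verts_def)
    qed
  qed
  then have eq: "split_vertex \<Gamma> x (half_edges_at \<Gamma> x - S) = relabel_verts ?\<tau> ?\<Gamma>2"
    by (intro graph.expand) (simp add: fun_eq_iff relabel_verts_def reverse_edge_def)
  have lab1: "?\<Gamma>1 \<in> labelled_graphs"
    by (rule split_vertex_labelled[OF \<Gamma> x S])
  have n: "?n \<in> edges ?\<Gamma>1" by simp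
  have lab2: "?\<Gamma>2 \<in> labelled_graphs"
  proof -
    have "ends ?\<Gamma>1 \<in> edges ?\<Gamma>1 \<rightarrow>\<^sub>E verts ?\<Gamma>1 \<times> verts ?\<Gamma>1"
      using lab1 by (simp add: labelled_graphs_def)
    moreover have "prod.swap (ends ?\<Gamma>1 ?n) \<in> verts ?\<Gamma>1 \<times> verts ?\<Gamma>1"
      using labelled_ends[OF lab1 n] by (auto simp: prod.swap_def)
    ultimately have "(ends ?\<Gamma>1)(?n := prod.swap (ends ?\<Gamma>1 ?n)) \<in> insert ?n (edges ?\<Gamma>1) \<rightarrow>\<^sub>E verts ?\<Gamma>1 \<times> verts ?\<Gamma>1"
      by (intro PiE_fun_upd)
    moreover have "insert ?n (edges ?\<Gamma>1) = edges ?\<Gamma>1" by auto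
    ultimately show ?thesis
      by (simp add: labelled_graphs_def reverse_edge_def)
  qed
  have \<tau>: "?\<tau> permutes verts ?\<Gamma>2"
    by (rule permutes_swap_id) (use x in \<open>auto simp: reverse_edge_def\<close>)
  have "sign ?\<tau> = -1"
    using xw by (simp add: sign_swap_id)
  with class_relabel_verts[OF lab2 \<tau>, where ?'k = 'k]
  have "graph_class ?\<Gamma>2 = - (graph_class (relabel_verts ?\<tau> ?\<Gamma>2) :: 'k odd_graphs)"
    by simp
  then show ?thesis
    unfolding eq class_reverse_edge[OF lab1 n] by simp
qed

text \<open>Both graphs subdivide the edge a. Exchanging the labels of its two halves and reversing
  one of them turns one graph into the other, and only the reversal costs a sign.\<close>

lemma class_bivalent_cancel:
  assumes \<Gamma>: "\<Gamma> \<in> labelled_graphs" and a: "a \<in> edges \<Gamma>"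
  shows "graph_class (split_vertex \<Gamma> (fst (ends \<Gamma> a)) {(a, 1)})
    + graph_class (split_vertex \<Gamma> (snd (ends \<Gamma> a)) {(a, 2)}) = (0 :: 'k::field odd_graphs)"
proof -
  let ?n = "Suc (nedges \<Gamma>)" and ?p = "fst (ends \<Gamma> a)" and ?q = "snd (ends \<Gamma> a)"
  let ?\<tau> = "transpose a ?n"
  let ?\<Gamma>2 = "split_vertex \<Gamma> ?q {(a, 2)}"
  have an: "a \<noteq> ?n" using a by auto
  have lab2: "?\<Gamma>2 \<in> labelled_graphs"
    by (rule split_vertex_labelled[OF \<Gamma> labelled_ends(2)[OF \<Gamma> a]]) (use a in \<open>simp add: half_edges_at_iff\<close>)
  have \<tau>: "?\<tau> permutes edges ?\<Gamma>2"
    by (rule permutes_swap_id) (use a in auto)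
  have "ends (relabel_edges ?\<tau> ?\<Gamma>2) b \<in> verts ?\<Gamma>2 \<times> verts ?\<Gamma>2" if "b \<in> edges ?\<Gamma>2" for b
  proof -
    have "?\<tau> b \<in> edges ?\<Gamma>2"
      using permutes_in_image[OF \<tau>] that by blast
    then show ?thesis
      using labelled_ends[OF lab2] by (simp add: relabel_edges_def mem_Times_iff)
  qed
  moreover have "ends (relabel_edges ?\<tau> ?\<Gamma>2) b = undefined" if "b \<notin> edges ?\<Gamma>2" for b
  proof -
    have "?\<tau> b \<notin> edges ?\<Gamma>2"
      using permutes_in_image[OF \<tau>] that by blast
    then have "ends ?\<Gamma>2 (?\<tau> b) = undefined"
      using lab2 unfolding labelled_graphs_def by (blast intro: PiE_arb)
    then show ?thesis
      by (simp add: relabel_edges_def)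
  qed
  ultimately have lab3: "relabel_edges ?\<tau> ?\<Gamma>2 \<in> labelled_graphs"
    using lab2 unfolding labelled_graphs_def by (auto simp: relabel_edges_def PiE_iff extensional_def)
  have "ends (split_vertex \<Gamma> ?p {(a, 1)}) b = ends (reverse_edge a (relabel_edges ?\<tau> ?\<Gamma>2)) b" for b
    using an by (cases "b = a"; cases "b = ?n") (auto simp: ends_split reverse_edge_def relabel_edges_def transpose_def)
  then have eq: "split_vertex \<Gamma> ?p {(a, 1)} = reverse_edge a (relabel_edges ?\<tau> ?\<Gamma>2)"
    by (intro graph.expand) (simp add: fun_eq_iff reverse_edge_def relabel_edges_def)
  have "a \<in> edges (relabel_edges ?\<tau> ?\<Gamma>2)"
    using a by (auto simp: relabel_edges_def)
  from class_reverse_edge[OF lab3 this, where ?'k = 'k] show ?thesis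
    unfolding eq class_relabel_edges[OF lab2 \<tau>] by simp
qed

lemma abs_odd_graphs_sum: "abs_odd_graphs (sum f A) = (\<Sum>a\<in>A. abs_odd_graphs (f a) :: 'k::field odd_graphs)"
proof (induction A rule: infinite_finite_induct)
  case (insert a A)
  then show ?case
    by (simp flip: plus_odd_graphs.abs_eq)
qed (simp_all add: zero_odd_graphs_def)

lemma odd_differential_class:
  "odd_differential (graph_class \<Gamma>) = (\<Sum>x\<in>verts \<Gamma>.
    oscale (1 / 2) (\<Sum>S\<in>Pow (half_edges_at \<Gamma> x). graph_class (split_vertex \<Gamma> x S))
    - (graph_class (split_vertex \<Gamma> x {}) :: 'k::field odd_graphs))"
proof -
  have "odd_differential (graph_class \<Gamma>) = (abs_odd_graphs (graph_differential \<Gamma>) :: 'k odd_graphs)"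
    by (simp add: graph_class.abs_eq odd_differential.abs_eq)
  then show ?thesis
    unfolding graph_differential_def add_edge_at_eq_split
    by (simp add: abs_odd_graphs_sum graph_class.abs_eq flip: minus_odd_graphs.abs_eq oscale.abs_eq)
qed

definition stable_subsets :: "graph \<Rightarrow> nat \<Rightarrow> (nat \<times> nat) set set" where
  "stable_subsets \<Gamma> x = {S \<in> Pow (half_edges_at \<Gamma> x). 2 \<le> card S \<and> 2 \<le> card (half_edges_at \<Gamma> x - S)}"

text \<open>The splittings in which one of the two vertices has valence one cancel against the added
  edges; those in which it has valence two cancel in pairs, since the new vertex then lies on an
  edge and arises from either end of that edge.\<close>

theorem odd_differential_trivalent:
  assumes \<Gamma>: "\<Gamma> \<in> labelled_graphs" and val: "\<And>x. x \<in> verts \<Gamma> \<Longrightarrow> 3 \<le> valence \<Gamma> x"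
  shows "odd_differential (graph_class \<Gamma>) = oscale (1 / 2)
    (\<Sum>x\<in>verts \<Gamma>. \<Sum>S\<in>stable_subsets \<Gamma> x. graph_class (split_vertex \<Gamma> x S) :: 'k::field_char_0 odd_graphs)"
proof -
  let ?c = "\<lambda>x S. graph_class (split_vertex \<Gamma> x S) :: 'k odd_graphs"
  have half: "oscale (1 / 2) (X + X) = X" for X :: "'k odd_graphs"
    by (simp add: odd.scale_right_distrib flip: odd.scale_left_distrib)
  have vertex: "oscale (1 / 2) (\<Sum>S\<in>Pow (half_edges_at \<Gamma> x). ?c x S) - ?c x {}
      = (\<Sum>h\<in>half_edges_at \<Gamma> x. ?c x {h}) + oscale (1 / 2) (\<Sum>S\<in>stable_subsets \<Gamma> x. ?c x S)"
    if x: "x \<in> verts \<Gamma>" for x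
  proof -
    let ?H = "half_edges_at \<Gamma> x"
    \<comment> \<open>In \<open>?A\<close> the new vertex has valence at most two, in
      \<open>?B\<close> the old one; valence at least three makes the two families disjoint.\<close>
    let ?A = "{S \<in> Pow ?H. card S \<le> 1}" and ?B = "{S \<in> Pow ?H. card (?H - S) \<le> 1}"
    have cardH: "3 \<le> card ?H"
      using val[OF x] by (simp add: valence_def)
    have sub: "card S + card (?H - S) = card ?H" if "S \<in> Pow ?H" for S
    proof -
      have "finite S" using that finite_subset[OF _ finite_half_edges_at] by blast
      then show ?thesis
        using that card_Diff_subset[of S ?H] card_mono[OF finite_half_edges_at, of S \<Gamma> x] by auto
    qed
    have fin: "finite (Pow ?H)" by simp
    have P: "Pow ?H = ?A \<union> ?B \<union> stable_subsets \<Gamma> x"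
      by (auto simp: stable_subsets_def)
    have dis: "?A \<inter> ?B = {}" "(?A \<union> ?B) \<inter> stable_subsets \<Gamma> x = {}"
    proof -
      have "False" if "S \<in> ?A" "S \<in> ?B" for S
        using that sub[of S] cardH by auto
      then show "?A \<inter> ?B = {}" by blast
      have "False" if "S \<in> ?A \<union> ?B" "S \<in> stable_subsets \<Gamma> x" for S
        using that by (auto simp: stable_subsets_def)
      then show "(?A \<union> ?B) \<inter> stable_subsets \<Gamma> x = {}" by blast
    qed
    have finT: "finite (stable_subsets \<Gamma> x)"
      unfolding stable_subsets_def by (rule finite_subset[OF _ fin]) blast
    have split: "(\<Sum>S\<in>Pow ?H. ?c x S) = (\<Sum>S\<in>?A. ?c x S) + (\<Sum>S\<in>?B. ?c x S) + (\<Sum>S\<in>stable_subsets \<Gamma> x. ?c x S)"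
    proof -
      have finA: "finite ?A" and finB: "finite ?B"
        by (rule finite_subset[OF _ fin], blast)+
      have "(\<Sum>S\<in>Pow ?H. ?c x S) = (\<Sum>S\<in>(?A \<union> ?B) \<union> stable_subsets \<Gamma> x. ?c x S)"
        by (rule sum.cong[OF P refl])
      also have "\<dots> = (\<Sum>S\<in>?A \<union> ?B. ?c x S) + (\<Sum>S\<in>stable_subsets \<Gamma> x. ?c x S)"
        by (rule sum.union_disjoint[OF finite_UnI[OF finA finB] finT dis(2)])
      also have "(\<Sum>S\<in>?A \<union> ?B. ?c x S) = (\<Sum>S\<in>?A. ?c x S) + (\<Sum>S\<in>?B. ?c x S)"
        by (rule sum.union_disjoint[OF finA finB dis(1)])
      finally show ?thesis .
    qed
    have dd: "?H - (?H - S) = S" if "S \<in> Pow ?H" for S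
      using that by blast
    \<comment> \<open>Complementation exchanges the two families without changing classes, so each
      contributes the same and the factor 1/2 disappears.\<close>
    have "(\<Sum>S\<in>?B. ?c x S) = (\<Sum>S\<in>?A. ?c x (?H - S))"
    proof (rule sum.reindex_bij_witness[of _ "\<lambda>S. ?H - S" "\<lambda>S. ?H - S"])
      fix S assume S: "S \<in> ?B"
      then have "S \<in> Pow ?H" by blast
      note e = dd[OF this]
      show "?H - (?H - S) = S" "?c x (?H - (?H - S)) = ?c x S"
        by (simp_all only: e)
      show "?H - S \<in> ?A"
        using S by blast
    next
      fix S assume S: "S \<in> ?A"
      then have "S \<in> Pow ?H" by blast
      note e = dd[OF this]
      show "?H - (?H - S) = S"
        by (rule e)
      show "?H - S \<in> ?B"
        using S by (simp only: mem_Collect_eq e) blast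
    qed
    also have "\<dots> = (\<Sum>S\<in>?A. ?c x S)"
      by (rule sum.cong[OF refl], rule class_split_complement[OF \<Gamma> x]) auto
    finally have B: "(\<Sum>S\<in>?B. ?c x S) = (\<Sum>S\<in>?A. ?c x S)" .
    have "?A = insert {} ((\<lambda>h. {h}) ` ?H)"
    proof (intro set_eqI iffI)
      fix S assume S: "S \<in> ?A"
      then have "finite S" using finite_subset[OF _ finite_half_edges_at] by blast
      then consider "S = {}" | "card S = Suc 0"
        using S by (cases "card S") auto
      then show "S \<in> insert {} ((\<lambda>h. {h}) ` ?H)"
        using S by cases (auto simp: card_1_singleton_iff)
    qed auto
    moreover have "inj_on (\<lambda>h. {h}) ?H" by simp
    moreover have "{} \<notin> (\<lambda>h. {h}) ` ?H" by auto
    ultimately have A: "(\<Sum>S\<in>?A. ?c x S) = ?c x {} + (\<Sum>h\<in>?H. ?c x {h})"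
      by (simp add: sum.reindex)
    have "oscale (1 / 2) (\<Sum>S\<in>Pow ?H. ?c x S) = oscale (1 / 2) ((\<Sum>S\<in>?A. ?c x S) + (\<Sum>S\<in>?A. ?c x S))
        + oscale (1 / 2) (\<Sum>S\<in>stable_subsets \<Gamma> x. ?c x S)"
      unfolding split B by (rule odd.scale_right_distrib)
    then show ?thesis
      unfolding half A by simp
  qed
  \<comment> \<open>The terms are regrouped by edges instead of vertices; the two half-edges of one
    edge then cancel.\<close>
  have singles: "(\<Sum>x\<in>verts \<Gamma>. \<Sum>h\<in>half_edges_at \<Gamma> x. ?c x {h}) = 0"
  proof -
    let ?h = "\<lambda>h. ?c (half_edge_vertex \<Gamma> h) {h}"
    have "(\<Sum>x\<in>verts \<Gamma>. \<Sum>h\<in>half_edges_at \<Gamma> x. ?c x {h})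
        = (\<Sum>x\<in>verts \<Gamma>. \<Sum>h\<in>{h \<in> edges \<Gamma> \<times> {1, 2}. half_edge_vertex \<Gamma> h = x}. ?h h)"
      unfolding half_edges_at_def by (intro sum.cong refl) auto
    also have "\<dots> = (\<Sum>h\<in>edges \<Gamma> \<times> {1, 2}. ?h h)"
      by (rule sum.group) (use labelled_ends[OF \<Gamma>] in \<open>auto simp: half_edge_vertex_def\<close>)
    also have "\<dots> = (\<Sum>a\<in>edges \<Gamma>. \<Sum>j\<in>{1, 2}. ?h (a, j))"
      by (simp only: sum.cartesian_product split_def prod.collapse)
    also have "\<dots> = 0"
    proof (rule sum.neutral, rule ballI)
      fix a assume "a \<in> edges \<Gamma>"
      from class_bivalent_cancel[OF \<Gamma> this, where ?'k = 'k] show "(\<Sum>j\<in>{1, 2}. ?h (a, j)) = 0"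
        by (simp add: half_edge_vertex_def)
    qed
    finally show ?thesis .
  qed
  have "odd_differential (graph_class \<Gamma>) = (\<Sum>x\<in>verts \<Gamma>. (\<Sum>h\<in>half_edges_at \<Gamma> x. ?c x {h})
      + oscale (1 / 2) (\<Sum>S\<in>stable_subsets \<Gamma> x. ?c x S))"
    unfolding odd_differential_class by (rule sum.cong[OF refl vertex])
  also have "\<dots> = (\<Sum>x\<in>verts \<Gamma>. \<Sum>h\<in>half_edges_at \<Gamma> x. ?c x {h})
      + (\<Sum>x\<in>verts \<Gamma>. oscale (1 / 2) (\<Sum>S\<in>stable_subsets \<Gamma> x. ?c x S))"
    by (rule sum.distrib)
  finally show ?thesis
    by (simp only: singles add_0_left odd.scale_sum_right)
qed

section \<open>Splittings preserve valence bounds, connectedness and simplicity\<close>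

lemma valence_split:
  assumes \<Gamma>: "\<Gamma> \<in> labelled_graphs" and x: "x \<in> verts \<Gamma>" and S: "S \<subseteq> half_edges_at \<Gamma> x"
  shows "valence (split_vertex \<Gamma> x S) (Suc (nverts \<Gamma>)) = Suc (card S)"
    "valence (split_vertex \<Gamma> x S) x = Suc (card (half_edges_at \<Gamma> x - S))"
    "y \<in> verts \<Gamma> \<Longrightarrow> y \<noteq> x \<Longrightarrow> valence (split_vertex \<Gamma> x S) y = valence \<Gamma> y"
proof -
  let ?w = "Suc (nverts \<Gamma>)" and ?n = "Suc (nedges \<Gamma>)" and ?\<Gamma> = "split_vertex \<Gamma> x S"
  have xw: "x \<noteq> ?w" using x by auto
  have g: "fst (ends \<Gamma> a) \<noteq> ?w \<and> snd (ends \<Gamma> a) \<noteq> ?w" if "a \<in> edges \<Gamma>" for a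
    using labelled_ends[OF \<Gamma> that] by auto
  have Sx: "(a, j) \<in> S \<Longrightarrow> a \<in> edges \<Gamma> \<and> (j = 1 \<and> fst (ends \<Gamma> a) = x \<or> j = 2 \<and> snd (ends \<Gamma> a) = x)" for a j
    using S half_edges_at_iff[of a j \<Gamma> x] by blast
  have e: "a \<in> edges ?\<Gamma> \<longleftrightarrow> a \<in> edges \<Gamma> \<or> a = ?n" for a by auto
  have nS: "(?n, j) \<notin> S" "(?n, j) \<notin> half_edges_at \<Gamma> y" for j y
    using Sx[of ?n j] by (auto simp: half_edges_at_iff)
  have fS: "finite S"
    using S finite_subset[OF _ finite_half_edges_at] by blast
  have "half_edges_at ?\<Gamma> ?w = insert (?n, 2) S"
  proof (rule set_eqI)
    fix h :: "nat \<times> nat"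
    obtain a j where h: "h = (a, j)" by fastforce
    show "h \<in> half_edges_at ?\<Gamma> ?w \<longleftrightarrow> h \<in> insert (?n, 2) S"
      unfolding h half_edges_at_iff e using xw g[of a] Sx[of a j] nS(1)[of j]
      by (cases "a = ?n") (auto simp: ends_split split: if_splits)
  qed
  then show "valence ?\<Gamma> ?w = Suc (card S)"
    unfolding valence_def using fS nS(1) by simp
  have "half_edges_at ?\<Gamma> x = insert (?n, 1) (half_edges_at \<Gamma> x - S)"
  proof (rule set_eqI)
    fix h :: "nat \<times> nat"
    obtain a j where h: "h = (a, j)" by fastforce
    show "h \<in> half_edges_at ?\<Gamma> x \<longleftrightarrow> h \<in> insert (?n, 1) (half_edges_at \<Gamma> x - S)"
      unfolding h insert_iff Diff_iff half_edges_at_iff e using xw g[of a] Sx[of a j] nS(1)[of j]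
      by (cases "a = ?n") (auto simp: ends_split split: if_splits)
  qed
  then show "valence ?\<Gamma> x = Suc (card (half_edges_at \<Gamma> x - S))"
    unfolding valence_def using nS(2) by simp
  assume y: "y \<in> verts \<Gamma>" "y \<noteq> x"
  have "half_edges_at ?\<Gamma> y = half_edges_at \<Gamma> y"
  proof (rule set_eqI)
    fix h :: "nat \<times> nat"
    obtain a j where h: "h = (a, j)" by fastforce
    have "y \<noteq> ?w" using y by auto
    then show "h \<in> half_edges_at ?\<Gamma> y \<longleftrightarrow> h \<in> half_edges_at \<Gamma> y"
      unfolding h half_edges_at_iff e using y(2) Sx[of a 1] Sx[of a 2]
      by (cases "a = ?n") (auto simp: ends_split split: if_splits)
  qed
  then show "valence ?\<Gamma> y = valence \<Gamma> y"
    by (simp add: valence_def)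
qed

lemma split_trivalent:
  assumes "\<Gamma> \<in> trivalent_graphs v e" "x \<in> verts \<Gamma>" "S \<in> stable_subsets \<Gamma> x"
  shows "split_vertex \<Gamma> x S \<in> trivalent_graphs (Suc v) (Suc e)"
proof -
  have \<Gamma>: "\<Gamma> \<in> labelled_graphs" "nverts \<Gamma> = v" "nedges \<Gamma> = e" and val: "\<And>y. y \<in> verts \<Gamma> \<Longrightarrow> 3 \<le> valence \<Gamma> y"
    using assms(1) by (auto simp: trivalent_graphs_def)
  have S: "S \<subseteq> half_edges_at \<Gamma> x" "2 \<le> card S" "2 \<le> card (half_edges_at \<Gamma> x - S)"
    using assms(3) by (auto simp: stable_subsets_def)
  note v = valence_split[OF \<Gamma>(1) assms(2) S(1)]
  have "3 \<le> valence (split_vertex \<Gamma> x S) y" if "y \<in> verts (split_vertex \<Gamma> x S)" for y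
  proof -
    consider "y = Suc (nverts \<Gamma>)" | "y = x" | "y \<in> verts \<Gamma>" "y \<noteq> x"
      using \<open>y \<in> verts (split_vertex \<Gamma> x S)\<close> by fastforce
    then show ?thesis
      by cases (use v S val in auto)
  qed
  then show ?thesis
    using split_vertex_labelled[OF \<Gamma>(1) assms(2) S(1)] \<Gamma> by (simp add: trivalent_graphs_def)
qed

lemma split_connected:
  assumes \<Gamma>: "\<Gamma> \<in> labelled_graphs" and con: "connected_graph \<Gamma>" and x: "x \<in> verts \<Gamma>"
    and S: "S \<subseteq> half_edges_at \<Gamma> x"
  shows "connected_graph (split_vertex \<Gamma> x S)"
  unfolding connected_graph_iff_cut
proof (intro allI impI)
  let ?w = "Suc (nverts \<Gamma>)" and ?n = "Suc (nedges \<Gamma>)" and ?\<Gamma> = "split_vertex \<Gamma> x S"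
  fix A assume A: "A \<inter> verts ?\<Gamma> \<noteq> {}" "\<forall>a\<in>edges ?\<Gamma>. fst (ends ?\<Gamma> a) \<in> A \<longleftrightarrow> snd (ends ?\<Gamma> a) \<in> A"
  have V: "verts ?\<Gamma> = insert ?w (verts \<Gamma>)" by auto
  have "?n \<in> edges ?\<Gamma>" by simp
  then have xw: "x \<in> A \<longleftrightarrow> ?w \<in> A"
    using A(2) by (force simp: ends_split)
  have Sx: "(a, 1) \<in> S \<Longrightarrow> fst (ends \<Gamma> a) = x" "(a, 2) \<in> S \<Longrightarrow> snd (ends \<Gamma> a) = x" for a
    using S half_edges_at_iff[of a 1 \<Gamma> x] half_edges_at_iff[of a 2 \<Gamma> x] by auto
  have "verts \<Gamma> \<subseteq> A"
  proof (rule con[unfolded connected_graph_iff_cut, rule_format])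
    show "A \<inter> verts \<Gamma> \<noteq> {}"
      using A(1) x xw unfolding V by blast
    fix a assume a: "a \<in> edges \<Gamma>"
    then have "a \<in> edges ?\<Gamma>" "a \<noteq> ?n" by auto
    then have "fst (ends ?\<Gamma> a) \<in> A \<longleftrightarrow> snd (ends ?\<Gamma> a) \<in> A"
      using A(2) by blast
    then show "fst (ends \<Gamma> a) \<in> A \<longleftrightarrow> snd (ends \<Gamma> a) \<in> A"
      using \<open>a \<noteq> ?n\<close> Sx[of a] xw by (auto simp: ends_split split: if_splits)
  qed
  then show "verts ?\<Gamma> \<subseteq> A"
    using x xw unfolding V by blast
qed

text \<open>Contracting the new edge by \<pi> recovers the ends in the old graph, so parallel old
  edges were parallel before; an edge parallel to the new one would come from a tadpole.\<close>

lemma split_no_multiple_edges: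
  assumes \<Gamma>: "\<Gamma> \<in> labelled_graphs" and nm: "no_multiple_edges \<Gamma>" and x: "x \<in> verts \<Gamma>"
    and S: "S \<subseteq> half_edges_at \<Gamma> x" and nt: "\<And>a. a \<in> edges \<Gamma> \<Longrightarrow> fst (ends \<Gamma> a) \<noteq> snd (ends \<Gamma> a)"
  shows "no_multiple_edges (split_vertex \<Gamma> x S)"
proof -
  let ?w = "Suc (nverts \<Gamma>)" and ?n = "Suc (nedges \<Gamma>)" and ?\<Gamma> = "split_vertex \<Gamma> x S"
  define \<pi> where "\<pi> y = (if y = ?w then x else y)" for y
  let ?E = "\<lambda>\<Gamma> a. {fst (ends \<Gamma> a), snd (ends \<Gamma> a)}"
  have Sx: "(a, 1) \<in> S \<Longrightarrow> fst (ends \<Gamma> a) = x" "(a, 2) \<in> S \<Longrightarrow> snd (ends \<Gamma> a) = x" for a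
    using S half_edges_at_iff[of a 1 \<Gamma> x] half_edges_at_iff[of a 2 \<Gamma> x] by auto
  have old: "\<pi> ` ?E ?\<Gamma> a = ?E \<Gamma> a" if "a \<in> edges \<Gamma>" for a
  proof -
    have "a \<noteq> ?n" "fst (ends \<Gamma> a) \<noteq> ?w" "snd (ends \<Gamma> a) \<noteq> ?w"
      using that labelled_ends[OF \<Gamma> that] by auto
    then show ?thesis
      using Sx[of a] by (auto simp: ends_split \<pi>_def)
  qed
  have new: "\<pi> ` ?E ?\<Gamma> ?n = {x}"
    by (auto simp: ends_split \<pi>_def)
  have e: "a \<in> edges \<Gamma> \<or> a = ?n" if "a \<in> edges ?\<Gamma>" for a
    using that by auto
  have loop: False if "a \<in> edges \<Gamma>" "?E ?\<Gamma> a = ?E ?\<Gamma> ?n" for a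
    using old[OF that(1)] new nt[OF that(1)] unfolding that(2) by (metis insertI1 insertCI singletonD)
  show ?thesis
    unfolding no_multiple_edges_def
  proof (intro ballI impI notI)
    fix a b assume ab: "a \<in> edges ?\<Gamma>" "b \<in> edges ?\<Gamma>" "a \<noteq> b" and eq: "?E ?\<Gamma> a = ?E ?\<Gamma> b"
    consider "a \<in> edges \<Gamma>" "b \<in> edges \<Gamma>" | "a \<in> edges \<Gamma>" "b = ?n" | "a = ?n" "b \<in> edges \<Gamma>"
      using e[OF ab(1)] e[OF ab(2)] ab(3) by blast
    then show False
    proof cases
      case 1
      have "?E \<Gamma> a = ?E \<Gamma> b"
        using old[OF 1(1)] old[OF 1(2)] eq by simp
      then show False
        using nm 1 ab(3) unfolding no_multiple_edges_def by blast
    next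
      case 2
      then show False using loop[OF 2(1)] eq by simp
    next
      case 3
      then show False using loop[OF 3(2)] eq by simp
    qed
  qed
qed

lemma class_tadpole:
  assumes \<Gamma>: "\<Gamma> \<in> labelled_graphs" "a \<in> edges \<Gamma>" "fst (ends \<Gamma> a) = snd (ends \<Gamma> a)"
  shows "graph_class \<Gamma> = (0 :: 'k::field_char_0 odd_graphs)"
proof -
  have "prod.swap (ends \<Gamma> a) = ends \<Gamma> a"
    using assms(3) by (simp add: prod_eq_iff)
  then have "reverse_edge a \<Gamma> = \<Gamma>"
    by (simp add: reverse_edge_def)
  then have "graph_class \<Gamma> = - (graph_class \<Gamma> :: 'k odd_graphs)"
    using class_reverse_edge[OF \<Gamma>(1,2), where ?'k = 'k] by simp
  then have "graph_class \<Gamma> + graph_class \<Gamma> = (0 :: 'k odd_graphs)"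
    by (metis add.right_inverse)
  then have "oscale (1 + 1) (graph_class \<Gamma>) = (0 :: 'k odd_graphs)"
    by (simp only: odd.scale_left_distrib odd.scale_one)
  then show ?thesis
    by (simp add: odd.scale_eq_0_iff)
qed

section \<open>The odd graph complex in a fixed number of vertices and edges\<close>

lemma linear_odd_differential:
  "Vector_Spaces.linear oscale oscale (odd_differential :: 'k::field odd_graphs \<Rightarrow> 'k odd_graphs)"
proof (unfold module_hom_iff_linear[symmetric], intro module_hom.intro module_hom_axioms.intro odd.module_axioms)
  show "odd_differential (X + Y) = odd_differential X + odd_differential Y" for X Y :: "'k odd_graphs"
    by transfer (simp add: lindiff.add free.span_zero)
  show "odd_differential (oscale c X) = oscale c (odd_differential X)" for c and X :: "'k odd_graphs"
    by transfer (simp add: lindiff.scale free.span_zero)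
qed

interpretation odd_d: Vector_Spaces.linear oscale oscale odd_differential
  by (rule linear_odd_differential)

lemma trivalent_labelled:
  assumes "\<Gamma> \<in> trivalent_graphs v e"
  shows "\<Gamma> \<in> labelled_graphs" "nverts \<Gamma> = v" "nedges \<Gamma> = e" "\<And>x. x \<in> verts \<Gamma> \<Longrightarrow> 3 \<le> valence \<Gamma> x"
  using assms by (auto simp: trivalent_graphs_def)

lemma odd_differential_trivalent_class:
  assumes "\<Gamma> \<in> trivalent_graphs v e"
  shows "odd_differential (graph_class \<Gamma>) = oscale (1 / 2)
    (\<Sum>x\<in>verts \<Gamma>. \<Sum>S\<in>stable_subsets \<Gamma> x. graph_class (split_vertex \<Gamma> x S) :: 'k::field_char_0 odd_graphs)"
  by (rule odd_differential_trivalent) (use trivalent_labelled[OF assms] in auto)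

lemma differential_span:
  assumes "\<And>\<Gamma>. \<Gamma> \<in> A \<Longrightarrow> odd_differential (graph_class \<Gamma>) \<in> odd.span W"
    and "X \<in> odd.span (graph_class ` A)"
  shows "odd_differential X \<in> odd.span W"
  using assms(2)
proof (induction rule: odd.span_induct_alt)
  case base
  show ?case by (simp only: odd_d.zero odd.span_zero)
next
  case (step c Y Z)
  then show ?case
    using assms(1) by (auto simp only: odd_d.add odd_d.scale intro!: odd.span_add odd.span_scale)
qed

lemma odd_differential_connected:
  fixes X :: "'k::field_char_0 odd_graphs"
  assumes "X \<in> odd_connected v e"
  shows "odd_differential X \<in> odd_connected (Suc v) (Suc e)"
  unfolding odd_connected_def
proof (rule differential_span[OF _ assms[unfolded odd_connected_def]])
  fix \<Gamma> assume "\<Gamma> \<in> {\<Gamma> \<in> trivalent_graphs v e. connected_graph \<Gamma>}"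
  then have \<Gamma>: "\<Gamma> \<in> trivalent_graphs v e" "connected_graph \<Gamma>" by auto
  note lab = trivalent_labelled[OF \<Gamma>(1)]
  have "split_vertex \<Gamma> x S \<in> {\<Gamma> \<in> trivalent_graphs (Suc v) (Suc e). connected_graph \<Gamma>}"
    if "x \<in> verts \<Gamma>" "S \<in> stable_subsets \<Gamma> x" for x S
    using split_trivalent[OF \<Gamma>(1) that] split_connected[OF lab(1) \<Gamma>(2) that(1)] that(2)
    unfolding stable_subsets_def by blast
  then show "odd_differential (graph_class \<Gamma> :: 'k odd_graphs)
      \<in> odd.span (graph_class ` {\<Gamma> \<in> trivalent_graphs (Suc v) (Suc e). connected_graph \<Gamma>})"
    unfolding odd_differential_trivalent_class[OF \<Gamma>(1)]
    by (intro odd.span_scale odd.span_sum odd.span_base imageI)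
qed

lemma odd_differential_connected_nm:
  fixes X :: "'k::field_char_0 odd_graphs"
  assumes "X \<in> odd_connected_nm v e"
  shows "odd_differential X \<in> odd_connected_nm (Suc v) (Suc e)"
  unfolding odd_connected_nm_def
proof (rule differential_span[OF _ assms[unfolded odd_connected_nm_def]])
  fix \<Gamma> assume "\<Gamma> \<in> {\<Gamma> \<in> trivalent_graphs v e. connected_graph \<Gamma> \<and> no_multiple_edges \<Gamma>}"
  then have \<Gamma>: "\<Gamma> \<in> trivalent_graphs v e" "connected_graph \<Gamma>" "no_multiple_edges \<Gamma>" by auto
  note lab = trivalent_labelled[OF \<Gamma>(1)]
  let ?W = "{\<Gamma> \<in> trivalent_graphs (Suc v) (Suc e). connected_graph \<Gamma> \<and> no_multiple_edges \<Gamma>}"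
  show "odd_differential (graph_class \<Gamma> :: 'k odd_graphs) \<in> odd.span (graph_class ` ?W)"
  \<comment> \<open>Splitting could turn a tadpole into an edge parallel to the new one, but then
    the class is already zero.\<close>
  proof (cases "\<exists>a\<in>edges \<Gamma>. fst (ends \<Gamma> a) = snd (ends \<Gamma> a)")
    case True
    then have "graph_class \<Gamma> = (0 :: 'k odd_graphs)"
      using class_tadpole[OF lab(1)] by blast
    then show ?thesis
      by (simp only: odd_d.zero odd.span_zero)
  next
    case False
    have "split_vertex \<Gamma> x S \<in> ?W" if "x \<in> verts \<Gamma>" "S \<in> stable_subsets \<Gamma> x" for x S
    proof -
      have "S \<subseteq> half_edges_at \<Gamma> x"
        using that(2) by (simp add: stable_subsets_def)
      then show ?thesis
        using split_trivalent[OF \<Gamma>(1) that] split_connected[OF lab(1) \<Gamma>(2) that(1)]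
          split_no_multiple_edges[OF lab(1) \<Gamma>(3) that(1)] False by blast
    qed
    then show ?thesis
      unfolding odd_differential_trivalent_class[OF \<Gamma>(1)]
      by (intro odd.span_scale odd.span_sum odd.span_base imageI)
  qed
qed

lemma span_zero_classes:
  assumes "\<And>\<Gamma>. \<Gamma> \<in> A \<Longrightarrow> graph_class \<Gamma> = (0 :: 'k::field odd_graphs)"
  shows "odd.span (graph_class ` A) = {0 :: 'k odd_graphs}"
proof -
  have "odd.span (graph_class ` A) \<subseteq> {0 :: 'k odd_graphs}"
    by (rule odd.span_minimal) (use assms odd.subspace_0 in \<open>auto simp: odd.subspace_def\<close>)
  then show ?thesis
    using odd.span_zero by blast
qed

lemma trivalent_edge:
  assumes "\<Gamma> \<in> trivalent_graphs v e"
  shows "1 \<in> edges \<Gamma>"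
proof -
  note lab = trivalent_labelled[OF assms]
  have "1 \<in> verts \<Gamma>"
    using lab(1) by (simp add: labelled_graphs_def)
  then have "half_edges_at \<Gamma> 1 \<noteq> {}"
    using lab(4)[of 1] by (auto simp: valence_def)
  then show ?thesis
    by (auto simp: half_edges_at_def)
qed

text \<open>On one vertex every edge is a tadpole, and the valence condition forces an edge to
  exist.\<close>

lemma odd_connected_trivial:
  fixes v e :: nat
  assumes "v \<le> 1 \<or> e = 0"
  shows "odd_connected v e = {0 :: 'k::field_char_0 odd_graphs}"
  unfolding odd_connected_def
proof (rule span_zero_classes)
  fix \<Gamma> assume "\<Gamma> \<in> {\<Gamma> \<in> trivalent_graphs v e. connected_graph \<Gamma>}"
  then have \<Gamma>: "\<Gamma> \<in> trivalent_graphs v e" by simp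
  note lab = trivalent_labelled[OF \<Gamma>] and e = trivalent_edge[OF \<Gamma>]
  have "fst (ends \<Gamma> 1) = snd (ends \<Gamma> 1)"
    using assms e labelled_ends[OF lab(1) e] lab(2,3) by auto
  then show "graph_class \<Gamma> = (0 :: 'k odd_graphs)"
    by (rule class_tadpole[OF lab(1) e])
qed

lemma odd_connected_nm_subset: "odd_connected_nm v e \<subseteq> odd_connected v e"
  unfolding odd_connected_def odd_connected_nm_def by (rule odd.span_mono) blast

text \<open>Two vertices joined by three edges without tadpoles have only parallel edges. This
  separates \<Theta> from the graphs without multiple edges in the proof of injectivity.\<close>

lemma odd_connected_nm_2_3: "odd_connected_nm 2 3 = {0 :: 'k::field_char_0 odd_graphs}"
  unfolding odd_connected_nm_def
proof (rule span_zero_classes)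
  fix \<Gamma> assume "\<Gamma> \<in> {\<Gamma> \<in> trivalent_graphs 2 3. connected_graph \<Gamma> \<and> no_multiple_edges \<Gamma>}"
  then have \<Gamma>: "\<Gamma> \<in> trivalent_graphs 2 3" "no_multiple_edges \<Gamma>" by auto
  note lab = trivalent_labelled[OF \<Gamma>(1)]
  show "graph_class \<Gamma> = (0 :: 'k odd_graphs)"
  proof (rule ccontr)
    assume n: "graph_class \<Gamma> \<noteq> (0 :: 'k odd_graphs)"
    have e: "{fst (ends \<Gamma> a), snd (ends \<Gamma> a)} = {1, 2}" if a: "a \<in> edges \<Gamma>" for a
    proof -
      have "fst (ends \<Gamma> a) \<noteq> snd (ends \<Gamma> a)"
        using n class_tadpole[OF lab(1) a] by blast
      moreover have "fst (ends \<Gamma> a) = 1 \<or> fst (ends \<Gamma> a) = 2" "snd (ends \<Gamma> a) = 1 \<or> snd (ends \<Gamma> a) = 2"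
        using labelled_ends[OF lab(1) a] unfolding lab(2) by auto
      ultimately show ?thesis
        by (elim disjE) (simp_all add: insert_commute)
    qed
    have "(1::nat) \<in> edges \<Gamma>" "2 \<in> edges \<Gamma>"
      using lab(3) by auto
    then show False
      using \<Gamma>(2) e unfolding no_multiple_edges_def by (metis one_eq_numeral_iff semiring_norm(85))
  qed
qed

lemma valence_Theta: "x \<in> {1, 2} \<Longrightarrow> valence \<Theta>_graph x = 3"
proof -
  assume x: "x \<in> {1, 2}"
  have "half_edges_at \<Theta>_graph x = (\<lambda>a. (a, x)) ` {1..3}"
    using x by (auto simp: half_edges_at_def half_edge_vertex_def \<Theta>_graph_def)
  then show ?thesis
    by (simp add: valence_def card_image inj_on_def)
qed

lemma Theta_graph: "\<Theta>_graph \<in> trivalent_graphs 2 3" "connected_graph \<Theta>_graph"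
proof -
  have v: "verts \<Theta>_graph = {1, 2}"
    by (auto simp: \<Theta>_graph_def)
  have "\<Theta>_graph \<in> labelled_graphs"
    by (auto simp: labelled_graphs_def \<Theta>_graph_def)
  moreover have "\<forall>x\<in>verts \<Theta>_graph. 3 \<le> valence \<Theta>_graph x"
    unfolding v using valence_Theta by (metis order_refl)
  ultimately show "\<Theta>_graph \<in> trivalent_graphs 2 3"
    by (simp add: trivalent_graphs_def \<Theta>_graph_def)
  show "connected_graph \<Theta>_graph"
    unfolding connected_graph_iff_cut v
  proof (intro allI impI)
    fix A assume "A \<inter> {1, 2} \<noteq> {}" and "\<forall>a\<in>edges \<Theta>_graph. fst (ends \<Theta>_graph a) \<in> A \<longleftrightarrow> snd (ends \<Theta>_graph a) \<in> A"
    moreover have "1 \<in> edges \<Theta>_graph" "ends \<Theta>_graph 1 = (1, 2)"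
      by (simp_all add: \<Theta>_graph_def)
    ultimately show "{1, 2} \<subseteq> A"
      by fastforce
  qed
qed

text \<open>Three half-edges cannot be divided into two sets of at least two, so a trivalent vertex
  has no stable splitting.\<close>

lemma odd_differential_Theta: "odd_differential (graph_class \<Theta>_graph) = (0 :: 'k::field_char_0 odd_graphs)"
proof -
  note lab = trivalent_labelled[OF Theta_graph(1)]
  have "stable_subsets \<Theta>_graph x = {}" if x: "x \<in> verts \<Theta>_graph" for x
  proof -
    have "x \<in> {1, 2}"
      using x lab(2) by auto
    then have c: "card (half_edges_at \<Theta>_graph x) = 3"
      using valence_Theta unfolding valence_def by blast
    have "False" if "S \<subseteq> half_edges_at \<Theta>_graph x" "2 \<le> card S" "2 \<le> card (half_edges_at \<Theta>_graph x - S)" for S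
      using that c card_Diff_subset[OF finite_subset[OF that(1) finite_half_edges_at] that(1)] by simp
    then show ?thesis
      by (auto simp: stable_subsets_def)
  qed
  then have "(\<Sum>x\<in>verts \<Theta>_graph. \<Sum>S\<in>stable_subsets \<Theta>_graph x. graph_class (split_vertex \<Theta>_graph x S))
      = (0 :: 'k odd_graphs)"
    by (intro sum.neutral ballI) (simp only: empty_iff)
  then show ?thesis
    unfolding odd_differential_trivalent_class[OF Theta_graph(1)] by (simp only: odd.scale_zero_right)
qed


section \<open>Functionals on the differential\<close>

text \<open>An unstable splitting has a vertex of valence at most two, where F vanishes; so the sum
  may be extended to all subsets, where it is the dual operator.\<close>

lemma sum_stable_split:
  fixes F :: "cell list \<Rightarrow> 'k::comm_ring_1"
  assumes F: "equivariant F" "supported (min_degree k 3) F" and \<Gamma>: "\<Gamma> \<in> labelled_graphs"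
  shows "(\<Sum>x\<in>verts \<Gamma>. \<Sum>S\<in>stable_subsets \<Gamma> x. F (cells_of (split_vertex \<Gamma> x S)))
    = (-1) ^ nverts \<Gamma> * split_op F (cells_of \<Gamma>)"
proof -
  have "(\<Sum>S\<in>stable_subsets \<Gamma> x. F (cells_of (split_vertex \<Gamma> x S)))
      = (\<Sum>S\<in>Pow (half_edges_at \<Gamma> x). F (cells_of (split_vertex \<Gamma> x S)))" if x: "x \<in> verts \<Gamma>" for x
  proof (rule sum.mono_neutral_left)
    show "\<forall>S\<in>Pow (half_edges_at \<Gamma> x) - stable_subsets \<Gamma> x. F (cells_of (split_vertex \<Gamma> x S)) = 0"
    proof
      fix S assume S: "S \<in> Pow (half_edges_at \<Gamma> x) - stable_subsets \<Gamma> x"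
      then have sub: "S \<subseteq> half_edges_at \<Gamma> x" by blast
      note v = valence_split[OF \<Gamma> x sub]
      have "\<not> (2 \<le> card S \<and> 2 \<le> card (half_edges_at \<Gamma> x - S))"
        using S by (auto simp: stable_subsets_def)
      then have "valence (split_vertex \<Gamma> x S) (Suc (nverts \<Gamma>)) < 3 \<or> valence (split_vertex \<Gamma> x S) x < 3"
        unfolding v(1,2) by linarith
      moreover have "Suc (nverts \<Gamma>) \<in> verts (split_vertex \<Gamma> x S)" "x \<in> verts (split_vertex \<Gamma> x S)"
        using x by auto
      ultimately have "\<not> min_degree k 3 (cells_of (split_vertex \<Gamma> x S))"
        unfolding min_degree_cells_of by (metis not_less)
      then show "F (cells_of (split_vertex \<Gamma> x S)) = 0"
        by (rule supportedD[OF F(2)])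
    qed
  qed (auto simp: stable_subsets_def)
  then have "(\<Sum>x\<in>verts \<Gamma>. \<Sum>S\<in>stable_subsets \<Gamma> x. F (cells_of (split_vertex \<Gamma> x S)))
      = (\<Sum>x\<in>verts \<Gamma>. \<Sum>S\<in>Pow (half_edges_at \<Gamma> x). F (cells_of (split_vertex \<Gamma> x S)))"
    by (rule sum.cong[OF refl])
  then show ?thesis
    using sum_split_vertex[OF F(1) \<Gamma>] by (rule trans)
qed

lemma functional_differential:
  fixes F :: "cell list \<Rightarrow> 'k::field_char_0"
  assumes \<phi>: "odd_functional \<phi>" and F: "equivariant F" "supported (min_degree k 3) F"
    and \<Gamma>: "\<Gamma> \<in> trivalent_graphs v e"
    and eq: "\<And>x S. x \<in> verts \<Gamma> \<Longrightarrow> S \<in> stable_subsets \<Gamma> x \<Longrightarrow>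
      \<phi> (graph_class (split_vertex \<Gamma> x S)) = F (cells_of (split_vertex \<Gamma> x S))"
  shows "\<phi> (odd_differential (graph_class \<Gamma>)) = 1 / 2 * ((-1) ^ v * split_op F (cells_of \<Gamma>))"
proof -
  note lab = trivalent_labelled[OF \<Gamma>]
  have "\<phi> (odd_differential (graph_class \<Gamma>))
      = 1 / 2 * (\<Sum>x\<in>verts \<Gamma>. \<Sum>S\<in>stable_subsets \<Gamma> x. \<phi> (graph_class (split_vertex \<Gamma> x S)))"
    by (simp only: odd_differential_trivalent_class[OF \<Gamma>] odd_functionalD(2,6)[OF \<phi>])
  also have "(\<Sum>x\<in>verts \<Gamma>. \<Sum>S\<in>stable_subsets \<Gamma> x. \<phi> (graph_class (split_vertex \<Gamma> x S)))
      = (\<Sum>x\<in>verts \<Gamma>. \<Sum>S\<in>stable_subsets \<Gamma> x. F (cells_of (split_vertex \<Gamma> x S)))"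
    by (intro sum.cong refl eq)
  also have "\<dots> = (-1) ^ v * split_op F (cells_of \<Gamma>)"
    using sum_stable_split[OF F lab(1)] unfolding lab(2) .
  finally show ?thesis .
qed

text \<open>The functions produced by contraction may be nonzero on graphs with bivalent vertices,
  so all splittings are kept here. The terms for added edges have a univalent vertex and
  vanish.\<close>

lemma cell_value_differential:
  fixes g :: "cell list \<Rightarrow> 'k::field_char_0"
  assumes g: "equivariant g" "supported (min_degree k 2) g" and \<Gamma>: "\<Gamma> \<in> labelled_graphs"
  shows "cell_value g (odd_differential (graph_class \<Gamma>)) = 1 / 2 * ((-1) ^ nverts \<Gamma> * split_op g (cells_of \<Gamma>))"
proof -
  note \<phi> = odd_functional_cell_value[of g]
  have z: "g (cells_of (split_vertex \<Gamma> x {})) = 0" if x: "x \<in> verts \<Gamma>" for x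
  proof (rule supportedD[OF g(2)])
    have "valence (split_vertex \<Gamma> x {}) (Suc (nverts \<Gamma>)) = 1"
      using valence_split(1)[OF \<Gamma> x, of "{}"] by simp
    moreover have "Suc (nverts \<Gamma>) \<in> verts (split_vertex \<Gamma> x {})" by simp
    ultimately show "\<not> min_degree k 2 (cells_of (split_vertex \<Gamma> x {}))"
      unfolding min_degree_cells_of by (metis not_less one_less_numeral_iff semiring_norm(76))
  qed
  have "cell_value g (odd_differential (graph_class \<Gamma>)) = (\<Sum>x\<in>verts \<Gamma>.
      1 / 2 * (\<Sum>S\<in>Pow (half_edges_at \<Gamma> x). g (cells_of (split_vertex \<Gamma> x S))) - g (cells_of (split_vertex \<Gamma> x {})))"
    by (simp only: odd_differential_class odd_functionalD(2,5,6)[OF \<phi>] cell_value_class[OF g(1)])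
  also have "\<dots> = (\<Sum>x\<in>verts \<Gamma>. 1 / 2 * (\<Sum>S\<in>Pow (half_edges_at \<Gamma> x). g (cells_of (split_vertex \<Gamma> x S))))"
    by (intro sum.cong refl) (simp only: z diff_0_right)
  also have "\<dots> = 1 / 2 * ((-1) ^ nverts \<Gamma> * split_op g (cells_of \<Gamma>))"
    by (simp only: sum_split_vertex[OF g(1) \<Gamma>] flip: sum_distrib_left)
  finally show ?thesis .
qed

lemma supported_restrict: "supported P (\<lambda>cs. if P cs then F cs else 0)"
  by (simp add: supported_def)

text \<open>A functional detecting the square of the differential would, as a function of words,
  give a nonzero value of \<open>split_op (split_op f)\<close>.\<close>

lemma odd_differential_square_class:
  assumes \<Gamma>: "\<Gamma> \<in> trivalent_graphs v e"
  shows "odd_differential (odd_differential (graph_class \<Gamma>)) = (0 :: 'k::field_char_0 odd_graphs)"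
proof (rule ccontr)
  let ?X = "odd_differential (graph_class \<Gamma>) :: 'k odd_graphs"
  note lab = trivalent_labelled[OF \<Gamma>]
  assume "odd_differential ?X \<noteq> 0"
  then have "odd_differential ?X \<notin> odd.span {}" by simp
  then obtain \<phi> :: "'k odd_graphs \<Rightarrow> 'k" where \<phi>: "odd_functional \<phi>" "\<phi> (odd_differential ?X) = 1"
    by (rule separating_functional)
  define f where "f cs = (if min_degree 2 3 cs then functional_cells \<phi> cs else 0)" for cs
  have f: "equivariant f" "supported (min_degree 2 3) f"
    unfolding f_def by (intro equivariant_restrict graph_invariant_min_degree equivariant_functional_cells \<phi>(1))
      (rule supported_restrict)
  have sf: "equivariant (split_op f)" "supported (min_degree 2 3) (split_op f)"
    using equivariant_split_op[OF f(1)] supported_min_degree_split_op[OF f(2)] by auto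
  have fval: "\<phi> (graph_class \<Gamma>') = f (cells_of \<Gamma>')" if "\<Gamma>' \<in> trivalent_graphs v' e'" for \<Gamma>' v' e'
    using trivalent_labelled[OF that] by (simp add: f_def min_degree_cells_of functional_cells_cells_of)
  have d: "\<phi> (odd_differential (graph_class \<Gamma>')) = 1 / 2 * ((-1) ^ v' * split_op f (cells_of \<Gamma>'))"
    if \<Gamma>': "\<Gamma>' \<in> trivalent_graphs v' e'" for \<Gamma>' v' e'
    by (rule functional_differential[OF \<phi>(1) f \<Gamma>'], rule fval, rule split_trivalent[OF \<Gamma>'])
  have "\<phi> (odd_differential ?X) = 1 / 2 * (\<Sum>x\<in>verts \<Gamma>. \<Sum>S\<in>stable_subsets \<Gamma> x.
      \<phi> (odd_differential (graph_class (split_vertex \<Gamma> x S))))"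
    by (simp only: odd_differential_trivalent_class[OF \<Gamma>] odd_d.scale odd_d.sum odd_functionalD(2,6)[OF \<phi>(1)])
  also have "(\<Sum>x\<in>verts \<Gamma>. \<Sum>S\<in>stable_subsets \<Gamma> x. \<phi> (odd_differential (graph_class (split_vertex \<Gamma> x S))))
      = (\<Sum>x\<in>verts \<Gamma>. \<Sum>S\<in>stable_subsets \<Gamma> x. 1 / 2 * ((-1) ^ Suc v * split_op f (cells_of (split_vertex \<Gamma> x S))))"
    by (intro sum.cong refl, rule d[OF split_trivalent[OF \<Gamma>]])
  also have "\<dots> = 1 / 2 * ((-1) ^ Suc v * ((-1) ^ v * split_op (split_op f) (cells_of \<Gamma>)))"
    using sum_stable_split[OF sf lab(1)] by (simp only: lab(2) flip: sum_distrib_left)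
  finally show False
    using \<phi>(2) split_op_split_op[OF f(1)] by simp
qed

lemma odd_differential_square:
  fixes X :: "'k::field_char_0 odd_graphs"
  assumes "X \<in> odd_connected v e"
  shows "odd_differential (odd_differential X) = 0"
  using assms[unfolded odd_connected_def]
proof (induction rule: odd.span_induct_alt)
  case base
  show ?case by (simp only: odd_d.zero)
next
  case (step c Y Z)
  then obtain \<Gamma> where "\<Gamma> \<in> trivalent_graphs v e" "Y = graph_class \<Gamma>" by blast
  then have "odd_differential (odd_differential Y) = 0"
    using odd_differential_square_class by blast
  then show ?case
    by (simp only: odd_d.add odd_d.scale step.IH odd.scale_zero_right add_0_left)
qed

section \<open>Exactness in fixed numbers of vertices and edges\<close>

lemma mset_Cons_remove1: "a \<in> set xs \<Longrightarrow> mset (a # remove1 a xs) = mset xs"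
  by simp

lemma pair_count_cells_of:
  assumes "pair_count (cells_of \<Gamma>) = (0 :: 'k::field_char_0)" "graph_class \<Gamma> \<noteq> (0 :: 'k odd_graphs)"
    and \<Gamma>: "\<Gamma> \<in> labelled_graphs"
  shows "no_multiple_edges \<Gamma>"
  unfolding no_multiple_edges_def
proof (intro ballI impI notI)
  fix a b assume ab: "a \<in> edges \<Gamma>" "b \<in> edges \<Gamma>" "a \<noteq> b"
    and eq: "{fst (ends \<Gamma> a), snd (ends \<Gamma> a)} = {fst (ends \<Gamma> b), snd (ends \<Gamma> b)}"
  have "fst (ends \<Gamma> a) \<noteq> snd (ends \<Gamma> a)"
    using assms(2) class_tadpole[OF \<Gamma> ab(1)] by blast
  then have "card {fst (ends \<Gamma> a), snd (ends \<Gamma> a)} = 2" by simp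
  then have p: "parallel_cells (edge_cell \<Gamma> a) (edge_cell \<Gamma> b)"
    unfolding eq by (simp add: parallel_cells_def edge_cell_def eq)
  let ?l = "[1..<Suc (nedges \<Gamma>)]"
  have "a \<in> set ?l" "b \<in> set (remove1 a ?l)"
    using ab by (simp_all only: set_edge_list set_remove1_eq[OF distinct_upt] Diff_iff) auto
  then have "mset ?l = mset (a # remove1 a ?l)" "mset (remove1 a ?l) = mset (b # remove1 b (remove1 a ?l))"
    by (simp_all only: mset_Cons_remove1)
  then have "mset ?l = mset (a # b # remove1 b (remove1 a ?l))"
    by (simp only: mset.simps)
  then have "mset (map (edge_cell \<Gamma>) ?l) = mset (map (edge_cell \<Gamma>) (a # b # remove1 b (remove1 a ?l)))"
    by (simp only: mset_map)
  then have m: "mset (cells_of \<Gamma>)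
      = mset (edge_cell \<Gamma> a # edge_cell \<Gamma> b # map Vx [1..<Suc (nverts \<Gamma>)] @ map (edge_cell \<Gamma>) (remove1 b (remove1 a ?l)))"
    unfolding cells_of_def mset_append by (simp only: list.map mset.simps mset_append union_mset_add_mset_right)
  have "\<not> odd_cell (edge_cell \<Gamma> c)" for c
    by (simp add: edge_cell_def)
  note pair_count_nonzero_Ed[OF p this this, where ?'k = 'k]
  then have "pair_count (cells_of \<Gamma>) \<noteq> (0 :: 'k)"
    unfolding graph_invariant_mset[OF graph_invariant_pair_count m] .
  then show False
    using assms(1) by simp
qed

text \<open>Suppose that a functional kills the right-hand side but not z. Killing boundaries makes
  its function on words closed, and killing the other two kinds of generators makes it vanish on
  simple graphs and on theta. By \<open>dual_exactness\<close> its value at z is then a multiple of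
  the value of some g at the differential of z, which is 0 because g vanishes on simple
  graphs.\<close>

theorem component_exactness:
  fixes z :: "'k::field_char_0 odd_graphs"
  assumes z: "z \<in> odd_connected v e" and dz: "odd_differential z \<in> odd_connected_nm (Suc v) (Suc e)"
  shows "z \<in> odd.span (odd_differential ` odd_connected (v - 1) (e - 1) \<union> odd_connected_nm v e
    \<union> (if (v, e) = (2, 3) then {graph_class \<Theta>_graph} else {}))" (is "z \<in> odd.span ?S")
proof (cases "v \<le> 1 \<or> e = 0")
  case True
  then have "z = 0"
    using z odd_connected_trivial by blast
  then show ?thesis
    by (simp only: odd.span_zero)
next
  case False
  then obtain v' e' where ve: "v = Suc v'" "e = Suc e'" and v': "1 \<le> v'"
    by (cases v; cases e) auto
  show ?thesis
  proof (rule ccontr)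
    assume "z \<notin> odd.span ?S"
    then obtain \<phi> :: "'k odd_graphs \<Rightarrow> 'k" where \<phi>: "odd_functional \<phi>" "\<And>s. s \<in> ?S \<Longrightarrow> \<phi> s = 0" "\<phi> z = 1"
      by (rule separating_functional) blast
    let ?P = "\<lambda>cs. trivalent_support 0 v cs \<and> length cs = v + e"
    \<comment> \<open>For well-formed words without double edges and with v vertices, the length
      determines the number of edges, so f sees only the component (v, e).\<close>
    define f where "f cs = (if ?P cs then functional_cells \<phi> cs else 0)" for cs
    have "graph_invariant ?P"
      unfolding trivalent_support_def
      by (intro graph_invariant_comp2[of _ _ "(\<and>)"] graph_invariant_connected graph_invariant_min_degree
          graph_invariant_comp[OF graph_invariant_mark_count] graph_invariant_comp[OF graph_invariant_length]
          graph_invariant_comp[OF graph_invariant_card_vertices])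
    then have f: "equivariant f"
      unfolding f_def by (intro equivariant_restrict equivariant_functional_cells \<phi>(1))
    have fP: "f cs = 0" if "\<not> ?P cs" for cs
      using that by (auto simp: f_def)
    have fs: "supported (trivalent_support 0 v) f"
      using fP by (auto simp: supported_def)
    note fsD = supported_trivalentD[OF fs]
    have P: "?P (cells_of \<Gamma>) \<longleftrightarrow> \<Gamma> \<in> trivalent_graphs v e \<and> connected_graph \<Gamma>" if "\<Gamma> \<in> labelled_graphs" for \<Gamma>
      using that by (auto simp: trivalent_support_def connected_cells_of min_degree_cells_of trivalent_graphs_def)
    have fval: "f (cells_of \<Gamma>) = \<phi> (graph_class \<Gamma>)" if "\<Gamma> \<in> trivalent_graphs v e" "connected_graph \<Gamma>" for \<Gamma>
      using that P[OF trivalent_labelled(1)[OF that(1)]]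
      by (simp add: f_def functional_cells_cells_of[OF trivalent_labelled(1)[OF that(1)]])
    have D: "equivariant (split_op f)" "supported connected_cells (split_op f)" "supported (min_degree 2 3) (split_op f)"
      "supported (\<lambda>cs. mark_count cs = 0) (split_op f)" "supported (\<lambda>cs. card (vertices cs) = v') (split_op f)"
      using equivariant_split_op[OF f] supported_connected_split_op[OF fsD(1)]
        supported_min_degree_split_op[OF fsD(2)] supported_mark_count_split_op[OF fsD(3)]
        supported_card_vertices_split_op[OF fsD(4)[unfolded ve] f] by auto
    have graphs: "split_op f (cells_of \<Gamma>) = 0" if \<Gamma>: "\<Gamma> \<in> labelled_graphs" for \<Gamma>
    proof (cases "\<Gamma> \<in> trivalent_graphs v' e' \<and> connected_graph \<Gamma>")
      case True
      have "graph_class \<Gamma> \<in> (odd_connected v' e' :: 'k odd_graphs set)"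
        unfolding odd_connected_def using True by (intro odd.span_base imageI) simp
      then have "odd_differential (graph_class \<Gamma>) \<in> ?S"
        unfolding ve by simp
      then have "\<phi> (odd_differential (graph_class \<Gamma>)) = 0"
        by (rule \<phi>(2))
      moreover have "\<phi> (odd_differential (graph_class \<Gamma>)) = 1 / 2 * ((-1) ^ v' * split_op f (cells_of \<Gamma>))"
      proof (rule functional_differential[OF \<phi>(1) f fsD(2)])
        show "\<Gamma> \<in> trivalent_graphs v' e'" using True by simp
        fix x S assume x: "x \<in> verts \<Gamma>" and S: "S \<in> stable_subsets \<Gamma> x"
        have "S \<subseteq> half_edges_at \<Gamma> x"
          using S by (simp add: stable_subsets_def)
        then show "\<phi> (graph_class (split_vertex \<Gamma> x S)) = f (cells_of (split_vertex \<Gamma> x S))"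
          using fval[of "split_vertex \<Gamma> x S"] split_trivalent[OF _ x S] split_connected[OF \<Gamma> _ x] True
          unfolding ve by simp
      qed
      ultimately show ?thesis by simp
    next
      case False
      show ?thesis
      proof (cases "nedges \<Gamma> = e'")
        case True
        then have "\<not> (connected_cells (cells_of \<Gamma>) \<and> min_degree 2 3 (cells_of \<Gamma>) \<and> card (vertices (cells_of \<Gamma>)) = v')"
          using False \<Gamma> by (auto simp: connected_cells_of min_degree_cells_of trivalent_graphs_def)
        then show ?thesis
          using supportedD[OF D(2)] supportedD[OF D(3)] supportedD[OF D(5)] by blast
      next
        case len: False
        show ?thesis
        proof (cases "nverts \<Gamma> = v'")
          case True
          \<comment> \<open>With v' vertices but not e' edges, every splitting has the wrong
            length.\<close>
          have "f (cells_of (split_vertex \<Gamma> x S)) = 0" for x S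
            by (rule fP) (use True len in \<open>simp add: ve\<close>)
          then have "(-1) ^ nverts \<Gamma> * split_op f (cells_of \<Gamma>) = 0"
            by (simp flip: sum_split_vertex[OF f \<Gamma>])
          then show ?thesis by simp
        next
          case False
          then show ?thesis
            by (intro supportedD[OF D(5)]) simp
        qed
      qed
    qed
    \<comment> \<open>The words not covered by labelled graphs contain a mark or have no vertex; the
      latter are excluded by \<open>1 \<le> v'\<close>.\<close>
    have closed: "split_op f cs = 0" for cs
    proof (cases "mark_count cs = 0 \<and> vertices cs \<noteq> {}")
      case True
      then show ?thesis
        using equivariant_zero_by_graphs[OF D(1) graphs] by blast
    next
      case False
      then consider "mark_count cs \<noteq> 0" | "card (vertices cs) \<noteq> v'"
        using v' by auto
      then show ?thesis
        by cases (rule supportedD[OF D(4)], simp, rule supportedD[OF D(5)], simp)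
    qed
    \<comment> \<open>A graph without parallel pairs may still have several tadpoles at a vertex and
      so violate \<open>no_multiple_edges\<close>, but then its class is zero.\<close>
    have simple: "f cs = 0" if pc: "pair_count cs = (0 :: 'k)" for cs
    proof (cases "mark_count cs = 0 \<and> vertices cs \<noteq> {}")
      case True
      define h where "h cs = (if pair_count cs = (0 :: 'k) then f cs else 0)" for cs
      have h: "equivariant h"
        unfolding h_def by (intro equivariant_restrict f graph_invariant_comp[OF graph_invariant_pair_count])
      have "h (cells_of \<Gamma>) = 0" if \<Gamma>: "\<Gamma> \<in> labelled_graphs" for \<Gamma>
      proof (rule ccontr)
        assume n: "h (cells_of \<Gamma>) \<noteq> 0"
        then have pc: "pair_count (cells_of \<Gamma>) = (0 :: 'k)" and "f (cells_of \<Gamma>) \<noteq> 0"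
          by (auto simp: h_def split: if_splits)
        then have T: "\<Gamma> \<in> trivalent_graphs v e" "connected_graph \<Gamma>"
          using fP[of "cells_of \<Gamma>"] P[OF \<Gamma>] by blast+
        then have ph: "\<phi> (graph_class \<Gamma>) \<noteq> 0"
          using fval \<open>f (cells_of \<Gamma>) \<noteq> 0\<close> by simp
        then have "graph_class \<Gamma> \<noteq> (0 :: 'k odd_graphs)"
          using odd_functionalD(3)[OF \<phi>(1)] by metis
        then have "no_multiple_edges \<Gamma>"
          by (rule pair_count_cells_of[OF pc _ \<Gamma>])
        then have "graph_class \<Gamma> \<in> (odd_connected_nm v e :: 'k odd_graphs set)"
          unfolding odd_connected_nm_def using T by (intro odd.span_base imageI) simp
        then show False
          using ph \<phi>(2) by blast
      qed
      then have "h cs = 0"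
        using equivariant_zero_by_graphs[OF h] True by blast
      then show ?thesis
        using pc by (simp add: h_def)
    next
      case False
      then consider "mark_count cs \<noteq> 0" | "card (vertices cs) \<noteq> v"
        using ve by auto
      then show ?thesis
        by cases (rule supportedD[OF fsD(3)], simp, rule supportedD[OF fsD(4)], simp)
    qed
    have theta: "f [Vx w, Vx x, Ed x w, Ed x w, Ed x w] = 0" if xw: "x \<noteq> w" for x w
    proof -
      \<comment> \<open>The first transposition sends x to 1 and w to u; a second one sends u to 2
        and fixes 1.\<close>
      define u where "u = Transposition.transpose x 1 w"
      define \<rho> where "\<rho> = Transposition.transpose 2 u \<circ> Transposition.transpose x (1 :: nat)"
      have "u \<noteq> 1"
        using xw unfolding u_def by (metis transpose_apply_first transpose_involutory)
      then have \<rho>: "\<rho> x = 1" "\<rho> w = 2"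
        unfolding \<rho>_def comp_apply transpose_apply_first u_def[symmetric] by (simp_all add: transpose_apply_other)
      have inj: "inj \<rho>"
        unfolding \<rho>_def by (intro inj_compose) simp_all
      have c: "cells_of \<Theta>_graph = [Vx 1, Vx 2, Ed 1 2, Ed 1 2, Ed 1 2]"
        by (simp add: cells_of_def \<Theta>_graph_def edge_cell_def upt_rec numeral_eq_Suc)
      have "f (cells_of \<Theta>_graph) = 0"
      proof (cases "(v, e) = (2, 3)")
        case True
        then have "\<phi> (graph_class \<Theta>_graph) = 0"
          by (intro \<phi>(2)) simp
        then show ?thesis
          using fval[of \<Theta>_graph] Theta_graph True by simp
      next
        case False
        then show ?thesis
          using fP[of "cells_of \<Theta>_graph"] P[OF trivalent_labelled(1)[OF Theta_graph(1)]]
            trivalent_labelled(2,3)[OF Theta_graph(1)] trivalent_labelled(2,3)[of \<Theta>_graph v e] by auto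
      qed
      then have "f [Vx 2, Vx 1, Ed 1 2, Ed 1 2, Ed 1 2] = 0"
        using graded_symmetricD[OF equivariantD(2)[OF f], of "[]" "Vx 2" "Vx 1" "[Ed 1 2, Ed 1 2, Ed 1 2]"]
        unfolding c by (simp only: append_Nil mult_zero_right)
      then show ?thesis
        using equivariantD(3)[OF f inj, of "[Vx w, Vx x, Ed x w, Ed x w, Ed x w]"] by (simp add: \<rho>)
    qed
    obtain g where g: "equivariant g" "supported (min_degree 1 2) g" "\<And>cs. simple_cells cs \<Longrightarrow> g cs = 0"
        "\<And>cs. mark_count cs = 0 \<Longrightarrow> f cs = split_op g cs"
      using dual_exactness[OF f fs closed simple theta] by blast
    \<comment> \<open>The factor inverts the \<open>1 / 2 * (-1) ^ v\<close> of
      \<open>cell_value_differential\<close>.\<close>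
    have "\<phi> (graph_class \<Gamma>) = 2 * (-1) ^ v * cell_value g (odd_differential (graph_class \<Gamma>))"
      if "\<Gamma> \<in> trivalent_graphs v e" "connected_graph \<Gamma>" for \<Gamma>
    proof -
      note lab = trivalent_labelled[OF that(1)]
      have "\<phi> (graph_class \<Gamma>) = split_op g (cells_of \<Gamma>)"
        using fval[OF that] g(4)[of "cells_of \<Gamma>"] by simp
      moreover have "y = 2 * (-1) ^ v * (1 / 2 * ((-1) ^ v * y))" for y :: 'k
      proof -
        have "y = (-1) ^ v * ((-1) ^ v * y)" by simp
        also have "\<dots> = 2 * (-1) ^ v * (1 / 2 * ((-1) ^ v * y))"
          by (simp only: mult.assoc mult.left_commute[of "(-1) ^ v" "1 / 2"]) simp
        finally show ?thesis .
      qed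
      ultimately show ?thesis
        unfolding cell_value_differential[OF g(1,2) lab(1)] lab(2) by metis
    qed
    note cls = this
    note \<psi> = odd_functional_cell_value[of g]
    have "\<phi> z = 2 * (-1) ^ v * cell_value g (odd_differential z)"
      using z[unfolded odd_connected_def]
    proof (induction rule: odd.span_induct_alt)
      case base
      show ?case by (simp add: odd_d.zero odd_functionalD(3)[OF \<phi>(1)] odd_functionalD(3)[OF \<psi>])
    next
      case (step c Y Z)
      then obtain \<Gamma> where "\<Gamma> \<in> trivalent_graphs v e" "connected_graph \<Gamma>" "Y = graph_class \<Gamma>" by blast
      then have "\<phi> Y = 2 * (-1) ^ v * cell_value g (odd_differential Y)"
        using cls by blast
      then show ?case
        by (simp only: odd_d.add odd_d.scale odd_functionalD(1,2)[OF \<phi>(1)] odd_functionalD(1,2)[OF \<psi>] step.IH)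
          (simp add: algebra_simps)
    qed
    moreover have "cell_value g (odd_differential z) = 0"
      using dz[unfolded odd_connected_nm_def]
    proof (induction rule: odd.span_induct_alt)
      case base
      show ?case by (rule odd_functionalD(3)[OF \<psi>])
    next
      case (step c Y Z)
      then obtain \<Gamma> where "no_multiple_edges \<Gamma>" "Y = graph_class \<Gamma>" by blast
      then have "cell_value g Y = 0"
        using cell_value_class[OF g(1)] g(3)[OF simple_cells_of] by simp
      then show ?case
        by (simp add: odd_functionalD(1,2)[OF \<psi>] step.IH)
    qed
    ultimately show False
      using \<phi>(3) by simp
  qed
qed

section \<open>Quasi-isomorphisms\<close>

context cochain_complex
begin

lemma subspace_coboundaries: "subspace (coboundaries C d k)"
proof -
  interpret d: Vector_Spaces.linear scale scale d by (rule linear_d)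
  show ?thesis
    unfolding coboundaries_def by (rule d.subspace_image[OF subspace_C])
qed

lemma subspace_cocycles: "subspace (cocycles C d k)"
proof -
  interpret d: Vector_Spaces.linear scale scale d by (rule linear_d)
  show ?thesis
    using subspace_C[of k] by (simp add: subspace_def cocycles_def d.add d.scale d.zero)
qed

lemma equiv_cohomologous: "equiv (cocycles C d k) (cohomologous C d k)"
proof (rule equivI)
  note B = subspace_coboundaries[of k]
  show "cohomologous C d k \<subseteq> cocycles C d k \<times> cocycles C d k"
    by (auto simp: cohomologous_def)
  show "refl_on (cocycles C d k) (cohomologous C d k)"
    using subspace_0[OF B] by (auto simp: refl_on_def cohomologous_def)
  show "sym (cohomologous C d k)"
    using subspace_neg[OF B] by (force simp: sym_def cohomologous_def)
  show "trans (cohomologous C d k)"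
  proof (rule transI)
    fix x y z assume "(x, y) \<in> cohomologous C d k" "(y, z) \<in> cohomologous C d k"
    then show "(x, z) \<in> cohomologous C d k"
      using subspace_add[OF B, of "x - y" "y - z"] by (simp add: cohomologous_def)
  qed
qed

end

lemma bij_cohomology_mapI:
  assumes "cochain_complex sC C dC" "cochain_complex sD D dD" "Vector_Spaces.linear sC sD f"
    and map_in: "\<And>x k. x \<in> C k \<Longrightarrow> f x \<in> D k" and map_d: "\<And>x k. x \<in> C k \<Longrightarrow> f (dC x) = dD (f x)"
    and surj: "\<And>z. z \<in> cocycles D dD k \<Longrightarrow> \<exists>x\<in>cocycles C dC k. z - f x \<in> coboundaries D dD k"
    and inj: "\<And>x. x \<in> cocycles C dC k \<Longrightarrow> f x \<in> coboundaries D dD k \<Longrightarrow> x \<in> coboundaries C dC k"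
  shows "bij_betw (cohomology_map D dD f k) (cohomology C dC k) (cohomology D dD k)"
proof -
  interpret C: cochain_complex sC C dC by (rule assms(1))
  interpret D: cochain_complex sD D dD by (rule assms(2))
  interpret f: Vector_Spaces.linear sC sD f by (rule assms(3))
  let ?R = "cohomologous C dC k" and ?S = "cohomologous D dD k"
  note R = C.equiv_cohomologous[of k] and S = D.equiv_cohomologous[of k]
  have cocycle: "f x \<in> cocycles D dD k" if "x \<in> cocycles C dC k" for x
    using that map_in[of x k] map_d[of x k] f.zero by (simp add: cocycles_def)
  have rel: "(f x, f y) \<in> ?S" if "(x, y) \<in> ?R" for x y
  proof -
    obtain u where "u \<in> C (k - 1)" "x - y = dC u"
      using \<open>(x, y) \<in> ?R\<close> by (auto simp: cohomologous_def coboundaries_def)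
    then have "f x - f y = dD (f u)" "f u \<in> D (k - 1)"
      using map_d[of u "k - 1"] map_in[of u "k - 1"] by (simp_all flip: f.diff)
    then show ?thesis
      using that cocycle by (auto simp: cohomologous_def coboundaries_def)
  qed
  have map: "cohomology_map D dD f k (?R `` {x}) = ?S `` {f x}" if "x \<in> cocycles C dC k" for x
  proof
    show "cohomology_map D dD f k (?R `` {x}) \<subseteq> ?S `` {f x}"
      using rel S unfolding cohomology_map_def equiv_def trans_def by blast
    have "x \<in> ?R `` {x}"
      by (rule equiv_class_self[OF R that])
    then show "?S `` {f x} \<subseteq> cohomology_map D dD f k (?R `` {x})"
      unfolding cohomology_map_def by blast
  qed
  show ?thesis
    unfolding bij_betw_def cohomology_def
  proof (rule conjI, rule inj_onI)
    fix X Y assume X: "X \<in> cocycles C dC k // ?R" and Y: "Y \<in> cocycles C dC k // ?R"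
      and eq: "cohomology_map D dD f k X = cohomology_map D dD f k Y"
    from X obtain x where x: "x \<in> cocycles C dC k" "X = ?R `` {x}" by (rule quotientE)
    from Y obtain y where y: "y \<in> cocycles C dC k" "Y = ?R `` {y}" by (rule quotientE)
    have "?S `` {f x} = ?S `` {f y}"
      using eq unfolding x(2) y(2) map[OF x(1)] map[OF y(1)] .
    then have "(f x, f y) \<in> ?S"
      by (rule eq_equiv_class[OF _ S cocycle[OF y(1)]])
    then have "f (x - y) \<in> coboundaries D dD k"
      by (simp add: cohomologous_def f.diff)
    then have "x - y \<in> coboundaries C dC k"
      by (rule inj[OF C.subspace_diff[OF C.subspace_cocycles x(1) y(1)]])
    then have "(x, y) \<in> ?R"
      using x(1) y(1) by (simp add: cohomologous_def)
    then show "X = Y"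
      unfolding x(2) y(2) by (rule equiv_class_eq[OF R])
  next
    show "cohomology_map D dD f k ` (cocycles C dC k // ?R) = cocycles D dD k // ?S"
    proof (intro subset_antisym subsetI)
      fix Z assume "Z \<in> cohomology_map D dD f k ` (cocycles C dC k // ?R)"
      then obtain X where X: "X \<in> cocycles C dC k // ?R" and Z: "Z = cohomology_map D dD f k X" by blast
      from X obtain x where x: "x \<in> cocycles C dC k" "X = ?R `` {x}" by (rule quotientE)
      show "Z \<in> cocycles D dD k // ?S"
        unfolding Z x(2) map[OF x(1)] by (rule quotientI[OF cocycle[OF x(1)]])
    next
      fix Z assume "Z \<in> cocycles D dD k // ?S"
      then obtain z where z: "z \<in> cocycles D dD k" "Z = ?S `` {z}" by (rule quotientE)
      from surj[OF z(1)] obtain x where x: "x \<in> cocycles C dC k" "z - f x \<in> coboundaries D dD k" by blast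
      have "(z, f x) \<in> ?S"
        using z(1) x cocycle by (simp add: cohomologous_def)
      then have "Z = cohomology_map D dD f k (?R `` {x})"
        unfolding z(2) map[OF x(1)] by (rule equiv_class_eq[OF S])
      then show "Z \<in> cohomology_map D dD f k ` (cocycles C dC k // ?R)"
        using quotientI[OF x(1)] by blast
    qed
  qed
qed


section \<open>The complexes of graph series\<close>

lemma gc_differential_simps [simp]:
  "gc_differential X (0, e) = 0" "gc_differential X (v, 0) = 0"
  "gc_differential X (Suc v, Suc e) = odd_differential (X (v, e))"
  by (simp_all add: gc_differential_def)

lemma linear_gc_differential:
  "Vector_Spaces.linear gc_scale gc_scale (gc_differential :: 'k::field graph_series \<Rightarrow> 'k graph_series)"
  unfolding Vector_Spaces.linear_iff
proof (intro conjI allI gc.vector_space_axioms)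
  show "gc_differential (X + Y) = gc_differential X + gc_differential Y" for X Y :: "'k graph_series"
    by (auto simp: fun_eq_iff gc_differential_def odd_d.add)
  show "gc_differential (gc_scale c X) = gc_scale c (gc_differential X)" for c and X :: "'k graph_series"
    by (auto simp: fun_eq_iff gc_differential_def gc_scale_def odd_d.scale)
qed

interpretation gc_d: Vector_Spaces.linear gc_scale gc_scale gc_differential
  by (rule linear_gc_differential)

lemma graph_degree_Suc: "graph_degree m (Suc v) (Suc e) = graph_degree m v e + 1"
  by (simp add: graph_degree_def algebra_simps)

lemma graded_productD:
  assumes "X \<in> graded_product m W k"
  shows "X (v, e) \<noteq> 0 \<Longrightarrow> 1 \<le> v" "X (v, e) \<noteq> 0 \<Longrightarrow> graph_degree m v e = k" "X (v, e) \<noteq> 0 \<Longrightarrow> X (v, e) \<in> W v e"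
proof -
  have "X (v, e) \<in> (if 1 \<le> v \<and> graph_degree m v e = k then W v e else {0})"
    using assms unfolding graded_product_def by blast
  then show "X (v, e) \<noteq> 0 \<Longrightarrow> 1 \<le> v" "X (v, e) \<noteq> 0 \<Longrightarrow> graph_degree m v e = k"
    "X (v, e) \<noteq> 0 \<Longrightarrow> X (v, e) \<in> W v e"
    by (auto split: if_splits)
qed

lemma graded_productI:
  assumes "\<And>v e. 0 \<in> W v e"
    and "\<And>v e. X (v, e) \<noteq> 0 \<Longrightarrow> 1 \<le> v \<and> graph_degree m v e = k \<and> X (v, e) \<in> W v e"
  shows "X \<in> graded_product m W k"
  unfolding graded_product_def
proof (intro CollectI allI)
  show "X (v, e) \<in> (if 1 \<le> v \<and> graph_degree m v e = k then W v e else {0})" for v e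
    by (cases "X (v, e) = 0") (use assms in auto)
qed

lemma graded_product_component:
  "X \<in> graded_product m W k \<Longrightarrow> (\<And>v e. 0 \<in> W v e) \<Longrightarrow> X (v, e) \<in> W v e"
  using graded_productD(3) by metis

lemma subspace_graded_product:
  assumes "\<And>v e. odd.subspace (W v e)"
  shows "gc.subspace (graded_product m W k)"
  using assms by (auto simp: gc.subspace_def odd.subspace_def graded_product_def gc_scale_def)

lemma subspace_odd_connected: "odd.subspace (odd_connected v e)" "odd.subspace (odd_connected_nm v e)"
  unfolding odd_connected_def odd_connected_nm_def by (rule odd.subspace_span)+

lemma zero_in_odd_connected [simp]: "0 \<in> odd_connected v e" "0 \<in> odd_connected_nm v e"
  by (rule odd.subspace_0, rule subspace_odd_connected)+

lemma gc_differential_graded_product: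
  assumes W: "\<And>v e X. X \<in> W v e \<Longrightarrow> odd_differential X \<in> W (Suc v) (Suc e)" "\<And>v e. 0 \<in> W v e"
    and X: "X \<in> graded_product m W k"
  shows "gc_differential X \<in> graded_product m W (k + 1)"
proof (rule graded_productI[OF W(2)])
  fix v e assume n: "gc_differential X (v, e) \<noteq> 0"
  then obtain v' e' where ve: "v = Suc v'" "e = Suc e'"
    by (cases v; cases e) auto
  with n have d: "odd_differential (X (v', e')) \<noteq> 0" by simp
  then have "X (v', e') \<noteq> 0"
    using odd_d.zero by metis
  then show "1 \<le> v \<and> graph_degree m v e = k + 1 \<and> gc_differential X (v, e) \<in> W v e"
    unfolding ve graph_degree_Suc using graded_productD[OF X, of v' e'] W(1) by simp
qed

lemma gc_differential_square:
  fixes X :: "'k::field_char_0 graph_series"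
  assumes X: "X \<in> GC m k"
  shows "gc_differential (gc_differential X) = 0"
proof
  fix i :: "nat \<times> nat"
  obtain v e where i: "i = (v, e)" by fastforce
  have "odd_differential (odd_differential (X (v', e'))) = 0" for v' e'
    by (rule odd_differential_square, rule graded_product_component[OF X[unfolded GC_def]]) simp
  then show "gc_differential (gc_differential X) i = 0 i"
    unfolding i by (cases v; cases e; cases "v - 1"; cases "e - 1") (simp_all add: odd_d.zero)
qed

lemma GC_nm_subset: "GC_nm m k \<subseteq> (GC m k :: 'k::field graph_series set)"
proof
  fix X :: "'k graph_series" assume "X \<in> GC_nm m k"
  then have X: "X \<in> graded_product m odd_connected_nm k"
    by (simp add: GC_nm_def)
  show "X \<in> GC m k"
    unfolding GC_def
  proof (rule graded_productI[OF zero_in_odd_connected(1)])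
    fix v e assume "X (v, e) \<noteq> 0"
    then show "1 \<le> v \<and> graph_degree m v e = k \<and> X (v, e) \<in> odd_connected v e"
      using graded_productD[OF X, of v e] subsetD[OF odd_connected_nm_subset[of v e, where ?'a = 'k]] by blast
  qed
qed

lemma Theta_line_cases:
  assumes "X \<in> \<Theta>_line m k"
  obtains c where "X = gc_scale c \<Theta>" "c = 0 \<or> k = graph_degree m 2 3"
proof (cases "k = graph_degree m 2 3")
  case True
  then obtain c where "X = gc_scale c \<Theta>"
    using assms by (auto simp: \<Theta>_line_def gc.span_singleton)
  then show ?thesis
    using that True by blast
next
  case False
  then have "X = gc_scale 0 \<Theta>"
    using assms by (simp add: \<Theta>_line_def)
  then show ?thesis
    using that by blast
qed

lemma scale_Theta_in: "c = 0 \<or> k = graph_degree m 2 3 \<Longrightarrow> gc_scale c \<Theta> \<in> \<Theta>_line m k"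
  by (cases "c = 0") (auto simp: \<Theta>_line_def gc.span_singleton gc.span_zero)

lemma subspace_Theta_line: "gc.subspace (\<Theta>_line m k)"
  by (simp add: \<Theta>_line_def gc.subspace_span gc.subspace_single_0)

lemma Theta_line_subset: "\<Theta>_line m k \<subseteq> GC m k"
proof
  fix X assume "X \<in> \<Theta>_line m k"
  then obtain c where c: "X = gc_scale c \<Theta>" "c = 0 \<or> k = graph_degree m 2 3"
    by (rule Theta_line_cases) blast
  have "graph_class \<Theta>_graph \<in> odd_connected 2 3"
    unfolding odd_connected_def using Theta_graph by (intro odd.span_base imageI) simp
  then show "X \<in> GC m k"
    unfolding GC_def using c
    by (intro graded_productI) (auto simp: gc_scale_def \<Theta>_def split: if_splits
        intro: odd.subspace_scale[OF subspace_odd_connected(1)])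
qed

lemma gc_differential_Theta_line:
  fixes X :: "'k::field_char_0 graph_series"
  assumes "X \<in> \<Theta>_line m k"
  shows "gc_differential X = 0"
proof -
  have "gc_differential (\<Theta> :: 'k graph_series) (v, e) = 0" for v e
    by (cases v; cases e) (simp_all add: \<Theta>_def odd_differential_Theta odd_d.zero)
  then have "gc_differential \<Theta> = (0 :: 'k graph_series)"
    by (simp add: fun_eq_iff)
  then show ?thesis
    using assms by (elim Theta_line_cases) (simp add: gc_d.scale)
qed

section \<open>From components to series\<close>

lemma component_exactness_obtains:
  fixes z :: "'k::field_char_0 odd_graphs"
  assumes "z \<in> odd_connected v e" "odd_differential z \<in> odd_connected_nm (Suc v) (Suc e)"
  obtains y n c where "y \<in> odd_connected (v - 1) (e - 1)" "n \<in> odd_connected_nm v e" "c = 0 \<or> (v, e) = (2, 3)"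
    "z = odd_differential y + n + oscale c (graph_class \<Theta>_graph)"
proof -
  let ?T = "if (v, e) = (2, 3) then {graph_class \<Theta>_graph :: 'k odd_graphs} else {}"
  have eq: "odd.span (odd_differential ` odd_connected (v - 1) (e - 1)) = odd_differential ` odd_connected (v - 1) (e - 1)"
    "odd.span (odd_connected_nm v e) = odd_connected_nm v e"
    by (rule odd.span_eq_iff[THEN iffD2], (rule odd_d.subspace_image)?, rule subspace_odd_connected)+
  then obtain y n t where "y \<in> odd_connected (v - 1) (e - 1)" "n \<in> odd_connected_nm v e" and t: "t \<in> odd.span ?T"
    and "z = odd_differential y + n + t"
    using component_exactness[OF assms, unfolded odd.span_Un eq] by blast
  moreover obtain c where "t = oscale c (graph_class \<Theta>_graph)" "c = 0 \<or> (v, e) = (2, 3)"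
  proof (cases "(v, e) = (2, 3)")
    case True
    then show ?thesis
      using t that by (auto simp: odd.span_singleton)
  next
    case False
    then have "t = oscale 0 (graph_class \<Theta>_graph)"
      using t unfolding if_not_P[OF False] by simp
    then show ?thesis
      using that by blast
  qed
  ultimately show ?thesis
    using that by blast
qed

text \<open>The components are decomposed independently and the choices are assembled into series;
  the product needs no compatibility between them beyond the grading.\<close>

theorem series_exactness:
  fixes z :: "'k::field_char_0 graph_series"
  assumes z: "z \<in> GC m k" and dz: "gc_differential z = t + n" "t \<in> \<Theta>_line m (k + 1)" "n \<in> GC_nm m (k + 1)"
  obtains y c n' where "y \<in> GC m (k - 1)" "c \<in> \<Theta>_line m k" "n' \<in> GC_nm m k" "z = gc_differential y + c + n'"
proof -
  \<comment> \<open>The last conjunct chooses zero wherever z is zero, so that the assembled series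
    are concentrated in the degrees where z is.\<close>
  define Q where "Q v e y n c \<longleftrightarrow> y \<in> odd_connected (v - 1) (e - 1) \<and> n \<in> odd_connected_nm v e
    \<and> (c = 0 \<or> (v, e) = (2, 3)) \<and> z (v, e) = odd_differential y + n + oscale c (graph_class \<Theta>_graph)
    \<and> (z (v, e) = 0 \<longrightarrow> y = 0 \<and> n = 0 \<and> c = 0)" for v e y n and c :: 'k
  have "\<exists>y n c. Q v e y n c" for v e
  proof (cases "z (v, e) = 0")
    case True
    then have "Q v e 0 0 0"
      by (simp add: Q_def odd_d.zero)
    then show ?thesis by blast
  next
    case False
    have zve: "z (v, e) \<in> odd_connected v e"
      by (rule graded_product_component[OF z[unfolded GC_def]]) simp
    have "odd_differential (z (v, e)) \<in> odd_connected_nm (Suc v) (Suc e)"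
    proof (cases "v \<le> 1")
      case True
      then show ?thesis
        using zve odd_connected_trivial[of v e, where ?'k = 'k] False by simp
    next
      case v: False
      obtain c where "t = gc_scale c \<Theta>"
        using dz(2) by (rule Theta_line_cases) blast
      \<comment> \<open>\<Theta> has two vertices, so it cannot occur in the differential of a graph
        with at least two.\<close>
      then have "t (Suc v, Suc e) = 0"
        using v by (simp add: gc_scale_def \<Theta>_def)
      moreover have "odd_differential (z (v, e)) = t (Suc v, Suc e) + n (Suc v, Suc e)"
        using fun_cong[OF dz(1), of "(Suc v, Suc e)"] by simp
      moreover have "n (Suc v, Suc e) \<in> odd_connected_nm (Suc v) (Suc e)"
        by (rule graded_product_component[OF dz(3)[unfolded GC_nm_def]]) simp
      ultimately show ?thesis by simp
    qed
    from component_exactness_obtains[OF zve this] show ?thesis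
      using False unfolding Q_def by metis
  qed
  then obtain y n c where Q: "\<And>v e. Q v e (y v e) (n v e) (c v e)"
    by metis
  \<comment> \<open>The summand \<open>y v e\<close> lives one vertex and one edge lower, hence the
    shift of indices.\<close>
  define Y where "Y = (\<lambda>(v, e). y (Suc v) (Suc e))"
  define N where "N = (\<lambda>(v, e). n v e)"
  have q: "y v e \<in> odd_connected (v - 1) (e - 1)" "n v e \<in> odd_connected_nm v e" "c v e = 0 \<or> (v, e) = (2, 3)"
    "z (v, e) = odd_differential (y v e) + n v e + oscale (c v e) (graph_class \<Theta>_graph)"
    "z (v, e) = 0 \<Longrightarrow> y v e = 0 \<and> n v e = 0 \<and> c v e = 0" for v e
    using Q[of v e] unfolding Q_def by blast+
  have z0: "z (v, e) = 0" if "v \<le> 1 \<or> e = 0" for v e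
    using graded_product_component[OF z[unfolded GC_def], of v e] odd_connected_trivial[OF that, where ?'k = 'k] by simp
  have "Y \<in> GC m (k - 1)"
    unfolding GC_def
  proof (rule graded_productI[OF zero_in_odd_connected(1)])
    fix v e assume "Y (v, e) \<noteq> 0"
    then have Y: "y (Suc v) (Suc e) \<noteq> 0" by (simp add: Y_def)
    then have zn: "z (Suc v, Suc e) \<noteq> 0"
      using q(5)[of "Suc v" "Suc e"] by blast
    then have "graph_degree m (Suc v) (Suc e) = k"
      by (rule graded_productD(2)[OF z[unfolded GC_def]])
    moreover have "1 \<le> v"
      using z0[of "Suc v" "Suc e"] zn by (cases v) auto
    moreover have "Y (v, e) \<in> odd_connected v e"
      using q(1)[of "Suc v" "Suc e"] by (simp add: Y_def)
    ultimately show "1 \<le> v \<and> graph_degree m v e = k - 1 \<and> Y (v, e) \<in> odd_connected v e"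
      unfolding graph_degree_Suc by simp
  qed
  moreover have "gc_scale (c 2 3) \<Theta> \<in> \<Theta>_line m k"
  proof (rule scale_Theta_in)
    show "c 2 3 = 0 \<or> k = graph_degree m 2 3"
      using q(5)[of 2 3] graded_productD(2)[OF z[unfolded GC_def], of 2 3] by blast
  qed
  moreover have "N \<in> GC_nm m k"
    unfolding GC_nm_def
  proof (rule graded_productI[OF zero_in_odd_connected(2)])
    fix v e assume "N (v, e) \<noteq> 0"
    then have zn: "z (v, e) \<noteq> 0"
      using q(5)[of v e] by (auto simp: N_def)
    show "1 \<le> v \<and> graph_degree m v e = k \<and> N (v, e) \<in> odd_connected_nm v e"
      using graded_productD(1,2)[OF z[unfolded GC_def] zn] q(2)[of v e] by (simp add: N_def)
  qed
  moreover have "z = gc_differential Y + gc_scale (c 2 3) \<Theta> + N"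
  proof
    fix i :: "nat \<times> nat"
    obtain v e where i: "i = (v, e)" by fastforce
    have "gc_differential Y (v, e) = odd_differential (y v e)"
    proof (cases "v = 0 \<or> e = 0")
      case True
      then have "y v e = 0"
        using z0[of v e] q(5)[of v e] by auto
      then show ?thesis
        using True by (auto simp: odd_d.zero)
    next
      case False
      then show ?thesis
        by (cases v; cases e) (simp_all add: Y_def)
    qed
    moreover have "gc_scale (c 2 3) \<Theta> (v, e) = oscale (c v e) (graph_class \<Theta>_graph)"
      using q(3)[of v e] by (cases "(v, e) = (2, 3)") (auto simp: gc_scale_def \<Theta>_def)
    ultimately show "z i = (gc_differential Y + gc_scale (c 2 3) \<Theta> + N) i"
      using q(4)[of v e] unfolding i by (simp add: N_def algebra_simps)
  qed
  ultimately show ?thesis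
    using that by blast
qed

section \<open>The two complexes and the quasi-isomorphism\<close>

interpretation gc_prod: vector_space_prod gc_scale gc_scale
  by unfold_locales

lemma cochain_complex_GC: "cochain_complex (gc_scale :: 'k::field_char_0 \<Rightarrow> _) (GC m) gc_differential"
proof (intro cochain_complex.intro cochain_complex_axioms.intro gc.vector_space_axioms linear_gc_differential)
  show "gc.subspace (GC m k :: 'k graph_series set)" for k
    unfolding GC_def by (intro subspace_graded_product subspace_odd_connected)
  fix X :: "'k graph_series" and k
  assume X: "X \<in> GC m k"
  then show "gc_differential X \<in> GC m (k + 1)"
    unfolding GC_def by (intro gc_differential_graded_product odd_differential_connected zero_in_odd_connected)
  show "gc_differential (gc_differential X) = 0"
    by (rule gc_differential_square[OF X])
qed

lemma cochain_complex_source: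
  "cochain_complex (module_prod.scale gc_scale (gc_scale :: 'k::field_char_0 \<Rightarrow> _))
    (\<lambda>k. \<Theta>_line m k \<times> GC_nm m k) (map_prod gc_differential gc_differential)"
proof (intro cochain_complex.intro cochain_complex_axioms.intro gc_prod.p.vector_space_axioms)
  show "module.subspace (module_prod.scale gc_scale gc_scale) (\<Theta>_line m k \<times> GC_nm m k :: ('k graph_series \<times> 'k graph_series) set)" for k
    unfolding GC_nm_def by (intro gc_prod.subspace_Times subspace_Theta_line subspace_graded_product subspace_odd_connected)
  show "Vector_Spaces.linear (module_prod.scale gc_scale gc_scale) (module_prod.scale gc_scale gc_scale)
      (map_prod gc_differential (gc_differential :: 'k graph_series \<Rightarrow> _))"
    unfolding Vector_Spaces.linear_iff
    by (intro conjI allI gc_prod.p.vector_space_axioms)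
      (auto simp: gc_prod.scale_def gc_d.add gc_d.scale)
  fix X :: "'k graph_series \<times> 'k graph_series" and k
  assume "X \<in> \<Theta>_line m k \<times> GC_nm m k"
  then obtain t n where X: "X = (t, n)" "t \<in> \<Theta>_line m k" "n \<in> GC_nm m k" by blast
  have "gc_differential n \<in> GC_nm m (k + 1)"
    using X(3) unfolding GC_nm_def
    by (intro gc_differential_graded_product odd_differential_connected_nm zero_in_odd_connected)
  then show "map_prod gc_differential gc_differential X \<in> \<Theta>_line m (k + 1) \<times> GC_nm m (k + 1)"
    using gc.subspace_0[OF subspace_Theta_line] by (simp add: X(1) gc_differential_Theta_line[OF X(2)])
  show "map_prod gc_differential gc_differential (map_prod gc_differential gc_differential X) = 0"
    using gc_differential_square[of n m k] X(3) GC_nm_subset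
    by (auto simp: X(1) gc_differential_Theta_line[OF X(2)] gc_d.zero zero_prod_def)
qed

theorem theorem2:
  fixes n :: int
  shows "quasi_isomorphism
    (module_prod.scale gc_scale gc_scale)
    (\<lambda>k. \<Theta>_line (2 * n + 1) k \<times> GC_nm (2 * n + 1) k)
    (map_prod gc_differential gc_differential)
    (gc_scale :: 'k::field_char_0 \<Rightarrow> 'k graph_series \<Rightarrow> 'k graph_series)
    (GC (2 * n + 1))
    gc_differential
    (\<lambda>(x, y). x + y)"
proof -
  define m where "m = 2 * n + 1"
  let ?C = "\<lambda>k. \<Theta>_line m k \<times> GC_nm m k :: ('k graph_series \<times> 'k graph_series) set"
  let ?dC = "map_prod gc_differential (gc_differential :: 'k graph_series \<Rightarrow> _)"
  let ?f = "\<lambda>(x, y). x + y :: 'k graph_series"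
  interpret GC: cochain_complex "gc_scale :: 'k \<Rightarrow> _" "GC m" gc_differential
    by (rule cochain_complex_GC)
  have lin: "Vector_Spaces.linear (module_prod.scale gc_scale gc_scale) gc_scale ?f"
    unfolding Vector_Spaces.linear_iff
    by (intro conjI allI gc_prod.p.vector_space_axioms gc.vector_space_axioms)
      (auto simp: gc_prod.scale_def gc.scale_right_distrib)
  have map_in: "?f x \<in> GC m k" if "x \<in> ?C k" for x k
  proof -
    obtain t u where x: "x = (t, u)" "t \<in> \<Theta>_line m k" "u \<in> GC_nm m k"
      using \<open>x \<in> ?C k\<close> by blast
    show ?thesis
      using gc.subspace_add[OF GC.subspace_C subsetD[OF Theta_line_subset x(2)] subsetD[OF GC_nm_subset x(3)]]
      by (simp add: x(1))
  qed
  have map_d: "?f (?dC x) = gc_differential (?f x)" for x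
    by (cases x) (simp add: gc_d.add)
  have surj: "\<exists>x\<in>cocycles ?C ?dC k. z - ?f x \<in> coboundaries (GC m) gc_differential k"
    if "z \<in> cocycles (GC m) gc_differential k" for z k
  proof -
    from that have z: "z \<in> GC m k" "gc_differential z = 0 + 0"
      by (auto simp: cocycles_def)
    have "0 \<in> \<Theta>_line m (k + 1)" "0 \<in> (GC_nm m (k + 1) :: 'k graph_series set)"
      unfolding GC_nm_def
      by (intro gc.subspace_0 subspace_Theta_line subspace_graded_product subspace_odd_connected)+
    from series_exactness[OF z this] obtain y c n' where
      y: "y \<in> GC m (k - 1)" "c \<in> \<Theta>_line m k" "n' \<in> GC_nm m k" "z = gc_differential y + c + n'" .
    have "gc_differential n' = 0"
      using z(2) GC.d_d[OF y(1)] gc_differential_Theta_line[OF y(2)] unfolding y(4) by (simp add: gc_d.add)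
    then have "(c, n') \<in> cocycles ?C ?dC k"
      using y(2,3) gc_differential_Theta_line[OF y(2)] by (simp add: cocycles_def zero_prod_def)
    moreover have "z - ?f (c, n') \<in> coboundaries (GC m) gc_differential k"
      using y(1,4) by (simp add: coboundaries_def)
    ultimately show ?thesis by blast
  qed
  have inj: "x \<in> coboundaries ?C ?dC k"
    if "x \<in> cocycles ?C ?dC k" "?f x \<in> coboundaries (GC m) gc_differential k" for x k
  proof -
    from that(1) obtain t n where x: "x = (t, n)" "t \<in> \<Theta>_line m k" "n \<in> GC_nm m k"
      by (auto simp: cocycles_def)
    from that(2) obtain z where z: "z \<in> GC m (k - 1)" "gc_differential z = t + n"
      by (auto simp: x(1) coboundaries_def)
    have tn: "t \<in> \<Theta>_line m (k - 1 + 1)" "n \<in> GC_nm m (k - 1 + 1)"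
      using x by simp_all
    from series_exactness[OF z tn] obtain y c n' where
      y: "y \<in> GC m (k - 1 - 1)" "c \<in> \<Theta>_line m (k - 1)" "n' \<in> GC_nm m (k - 1)" "z = gc_differential y + c + n'" .
    have eq: "t + n = gc_differential n'"
      using z(2) GC.d_d[OF y(1)] gc_differential_Theta_line[OF y(2)] unfolding y(4) by (simp add: gc_d.add)
    \<comment> \<open>It remains to show that t vanishes. In the component (2, 3) neither n nor the
      differential of n' contributes, so the coefficient of \<Theta> in t is tested there; then n
      alone is the differential of n'.\<close>
    have "n' (1, 2) \<in> odd_connected 1 2"
      using graded_product_component[OF y(3)[unfolded GC_nm_def] zero_in_odd_connected(2)] odd_connected_nm_subset by blast
    then have "n' (1, 2) = 0"
      using odd_connected_trivial[of 1 2, where ?'k = 'k] by simp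
    moreover have "n (2, 3) = 0"
      using graded_product_component[OF x(3)[unfolded GC_nm_def] zero_in_odd_connected(2), of 2 3] odd_connected_nm_2_3 by blast
    moreover have "gc_differential n' (2, 3) = odd_differential (n' (1, 2))"
      using gc_differential_simps(3)[of n' 1 2] by (simp add: numeral_eq_Suc)
    ultimately have t23: "t (2, 3) = 0"
      using fun_cong[OF eq, of "(2, 3)"] by (simp add: odd_d.zero)
    obtain a where a: "t = gc_scale a \<Theta>"
      using x(2) by (rule Theta_line_cases) blast
    have "t i = 0" for i
      using t23 by (cases "i = (2, 3)") (simp_all add: a gc_scale_def \<Theta>_def)
    then have t: "t = 0"
      by (simp add: fun_eq_iff)
    have "x = ?dC (0, n')"
      using eq by (simp add: x(1) t gc_d.zero)
    moreover have "(0, n') \<in> ?C (k - 1)"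
      using y(3) gc.subspace_0[OF subspace_Theta_line] by simp
    ultimately show ?thesis
      unfolding coboundaries_def by blast
  qed
  have bij: "bij_betw (cohomology_map (GC m) gc_differential ?f k) (cohomology ?C ?dC k)
      (cohomology (GC m) gc_differential k)" for k
    by (rule bij_cohomology_mapI[OF cochain_complex_source cochain_complex_GC lin])
      (erule map_in, rule map_d, erule surj, erule inj, assumption)
  have "quasi_isomorphism (module_prod.scale gc_scale gc_scale) ?C ?dC gc_scale (GC m) gc_differential ?f"
    by (intro quasi_isomorphism.intro quasi_isomorphism_axioms.intro cochain_complex_source cochain_complex_GC lin bij)
      (erule map_in, rule map_d)
  then show ?thesis
    unfolding m_def .
qed

end
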